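(* Let $n\ge 2$ and consider the renewal risk model with $n$-order phase-type interclaim times and exponential claim sizes described in the context. Let $\{b_i^*\}_{i=1}^n$ be optimal phase-wise barriers and let $f_i^*$, $i=1,\dots,n$, be the corresponding value functions. Then for every $i\in\{1,\dots,n\}$: (1) ${f_i^*}'(x)>1$ for all $x\in(0,b_i^* )$; (2) ${f_i^*}''(b_i^* )=0$.
   Context: **Model.** Fix $n\ge 2$, $c>0$, $\beta>0$, $\delta>0$, and $\pi_1,\dots,\pi_n\ge0$ with $\sum_{i=1}^n\pi_i=1$. For $i\in\{1,\dots,n\}$ and $j\in\{1,\dots,n+1\}$, $j\ne i$, let $\lambda_{ij}\ge 0$ be transition intensities, and put $\lambda_i=\sum_{j=1,j\ne i}^{n+1}\lambda_{ij}>0$. A continuous-time Markov process $\bar J$ on $\{1,\dots,n+1\}$ has these intensities; $n+1$ is absorbing and all states $1,\dots,n$ (the phases) are transient. The observed phase process $J$ moves like $\bar J$ on $\{1,\dots,n\}$; each time $n+1$ is entered a claim occurs and the process immediately restarts in phase $i$ with probability $\pi_i$, independently of the past. $N_t$ is the number of claims up to time $t$. Claim sizes $Y_1,Y_2,\dots$ are i.i.d. with distribution function $1-e^{-\beta y}$, $y\ge 0$, and independent of $J$. With cumulative dividends $D_t$ and initial capital $x\ge 0$ the surplus is $X_t^D=x+ct-\sum_{k=1}^{N_t}Y_k-D_t$, with ruin time $\tau=\inf\{t: X_t^D<0\}$. **Phase-wise barrier strategy.** For $b=(b_1,\dots,b_n)\in[0,\infty)^n$, the phase-wise barrier strategy with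 barriers $b$ is: whenever the current phase is $i$, all capital above $b_i$ is immediately paid as dividend; while the surplus equals $b_i$ in phase $i$ all incoming premium is paid as dividend (at rate $c$) until the next jump of the phase process; while the surplus is below $b_i$ no dividend is paid. Its value is $$f_i^b(x)=\mathbb E\Big[\int_{0-}^{\tau-}e^{-\delta t}\,\mathrm dD_t\,\Big|\,J_0=i,\ X_{0-}^D=x\Big],\quad x\ge 0,$$ where the integral includes an immediate lump sum at time $0$. **Optimal phase-wise barriers.** A vector $b^*=(b_1^*,\dots,b_n^* )\in[0,\infty)^n$ is called a vector of optimal phase-wise barriers if it is chosen among all barrier vectors so that the values become maximal below the barriers: for every $i$ and every $x\ge 0$ with $x<b_i^*$, $f_i^{b^*}(x)=\sup_{b\in[0,\infty)^n}f_i^{b}(x)$. Put $f_i^*:=f_i^{b^*}$. *)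

theory Defs
  imports "HOL-Probability.Probability"
begin

section \<open>Markov jump processes with finite state space\<close>

definition path_events :: "'a measure \<Rightarrow> (real \<Rightarrow> 'a \<Rightarrow> nat) \<Rightarrow> real set \<Rightarrow> 'a set set" where
  "path_events M Z I =
     sigma_sets (space M) {Z s -` {k} \<inter> space M |s k. s \<in> I}"

text \<open>
  Only the off-diagonal entries of \<open>q\<close> are used: \<open>q i j\<close> is the intensity of a
  transition from \<open>i\<close> to \<open>j \<noteq> i\<close>.  The matrices \<open>p h\<close> are the transition
  probabilities; they are determined by the process only in the rows of states that it visits
  with positive probability, hence the existential quantifier.
\<close>
definition markov_jump_process ::
  "'a measure \<Rightarrow> nat set \<Rightarrow> (nat \<Rightarrow> nat \<Rightarrow> real) \<Rightarrow> (real \<Rightarrow> 'a \<Rightarrow> nat) \<Rightarrow> bool" where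
  "markov_jump_process M S q Z \<longleftrightarrow>
     (\<forall>t\<ge>0. Z t \<in> measurable M (count_space S)) \<and>
     (\<forall>\<omega>\<in>space M. \<forall>t\<ge>0. \<forall>\<^sub>F s in at_right t. Z s \<omega> = Z t \<omega>) \<and>
     (\<forall>\<omega>\<in>space M. \<forall>t>0. \<exists>k. \<forall>\<^sub>F s in at_left t. Z s \<omega> = k) \<and>
     (\<exists>p :: real \<Rightarrow> nat \<Rightarrow> nat \<Rightarrow> real.
        (\<forall>h>0. \<forall>i\<in>S. (\<forall>j\<in>S. 0 \<le> p h i j) \<and> (\<Sum>j\<in>S. p h i j) = 1) \<and>
        (\<forall>i\<in>S. \<forall>j\<in>S. j \<noteq> i \<longrightarrow> ((\<lambda>h. p h i j / h) \<longlongrightarrow> q i j) (at_right 0)) \<and>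
        (\<forall>t\<ge>0. \<forall>h>0. \<forall>i\<in>S. \<forall>j\<in>S. \<forall>A\<in>path_events M Z {0..t}.
           measure M (A \<inter> {\<omega>\<in>space M. Z t \<omega> = i \<and> Z (t + h) \<omega> = j}) =
           measure M (A \<inter> {\<omega>\<in>space M. Z t \<omega> = i}) * p h i j))"

section \<open>The risk model\<close>

text \<open>
  \<open>P i\<close> is the law of the model given that the initial phase is \<open>i\<close>.  The observed phase
  process is glued together from independent cycles: \<open>Z 0\<close> is the absorbing process started in
  the initial phase, and \<open>Z k\<close> (\<open>k \<ge> 1\<close>) is the copy, with initial distribution \<open>\<pi>\<close>, that
  is started at the \<open>k\<close>-th claim.  \<open>Y k\<close> (\<open>k \<ge> 1\<close>) is the size of the \<open>k\<close>-th claim.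
  A phase is transient if, started in it, the absorbing process almost surely visits it only
  at a bounded set of times.
\<close>
locale phase_type_risk_model =
  fixes n :: nat and c \<beta> :: real and \<pi> :: "nat \<Rightarrow> real" and lam :: "nat \<Rightarrow> nat \<Rightarrow> real"
    and P :: "nat \<Rightarrow> 'a measure"
    and Z :: "nat \<Rightarrow> real \<Rightarrow> 'a \<Rightarrow> nat"
    and Y :: "nat \<Rightarrow> 'a \<Rightarrow> real"
  assumes premium: "c > 0"
    and claim_parameter: "\<beta> > 0"
    and initial_nonneg: "\<And>i. i \<in> {1..n} \<Longrightarrow> \<pi> i \<ge> 0"
    and initial_sum: "(\<Sum>i=1..n. \<pi> i) = 1"
    and intensity_nonneg:
      "\<And>i j. i \<in> {1..n} \<Longrightarrow> j \<in> {1..n+1} \<Longrightarrow> j \<noteq> i \<Longrightarrow> lam i j \<ge> 0"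
    and total_intensity_pos: "\<And>i. i \<in> {1..n} \<Longrightarrow> (\<Sum>j\<in>{1..n+1} - {i}. lam i j) > 0"
    and prob: "\<And>i. i \<in> {1..n} \<Longrightarrow> prob_space (P i)"
    and cycles: "\<And>i k. i \<in> {1..n} \<Longrightarrow>
      markov_jump_process (P i) {1..n+1} (\<lambda>l j. if l = n + 1 then 0 else lam l j) (Z k)"
    and initial_phase: "\<And>i. i \<in> {1..n} \<Longrightarrow> AE \<omega> in P i. Z 0 0 \<omega> = i"
    and restart_phase: "\<And>i k j. i \<in> {1..n} \<Longrightarrow> k \<ge> 1 \<Longrightarrow> j \<in> {1..n} \<Longrightarrow>
      measure (P i) {\<omega>\<in>space (P i). Z k 0 \<omega> = j} = \<pi> j"
    and transient: "\<And>i. i \<in> {1..n} \<Longrightarrow> AE \<omega> in P i. bounded {t. 0 \<le> t \<and> Z 0 t \<omega> = i}"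
    and claim_size: "\<And>i k. i \<in> {1..n} \<Longrightarrow> k \<ge> 1 \<Longrightarrow>
      distributed (P i) lborel (Y k) (exponential_density \<beta>)"
    and independence: "\<And>i. i \<in> {1..n} \<Longrightarrow>
      prob_space.indep_sets (P i)
        (case_sum (\<lambda>k. path_events (P i) (Z k) {0..})
                  (\<lambda>k. {Y k -` B \<inter> space (P i) |B. B \<in> sets borel}))
        (UNIV <+> {1..})"

text \<open>
  The following path functionals are meaningful on the almost sure event that every cycle is
  absorbed and the claim times tend to infinity.
\<close>

definition interclaim_time :: "nat \<Rightarrow> (nat \<Rightarrow> real \<Rightarrow> 'a \<Rightarrow> nat) \<Rightarrow> nat \<Rightarrow> 'a \<Rightarrow> real" where
  "interclaim_time n Z k \<omega> = Inf {t. 0 \<le> t \<and> Z k t \<omega> = n + 1}"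

definition claim_time :: "nat \<Rightarrow> (nat \<Rightarrow> real \<Rightarrow> 'a \<Rightarrow> nat) \<Rightarrow> nat \<Rightarrow> 'a \<Rightarrow> real" where
  "claim_time n Z k \<omega> = (\<Sum>m<k. interclaim_time n Z m \<omega>)"

definition claim_number :: "nat \<Rightarrow> (nat \<Rightarrow> real \<Rightarrow> 'a \<Rightarrow> nat) \<Rightarrow> real \<Rightarrow> 'a \<Rightarrow> nat" where
  "claim_number n Z t \<omega> = card {k. 1 \<le> k \<and> claim_time n Z k \<omega> \<le> t}"

definition phase :: "nat \<Rightarrow> (nat \<Rightarrow> real \<Rightarrow> 'a \<Rightarrow> nat) \<Rightarrow> real \<Rightarrow> 'a \<Rightarrow> nat" where
  "phase n Z t \<omega> =
     (let k = claim_number n Z t \<omega> in Z k (t - claim_time n Z k \<omega>) \<omega>)"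

definition free_surplus ::
  "nat \<Rightarrow> real \<Rightarrow> (nat \<Rightarrow> real \<Rightarrow> 'a \<Rightarrow> nat) \<Rightarrow> (nat \<Rightarrow> 'a \<Rightarrow> real) \<Rightarrow> real \<Rightarrow> real \<Rightarrow> 'a \<Rightarrow> real"
where
  "free_surplus n c Z Y x t \<omega> = x + c * t - (\<Sum>k=1..claim_number n Z t \<omega>. Y k \<omega>)"

section \<open>Phase-wise barrier strategies\<close>

definition barrier_vectors :: "nat \<Rightarrow> (nat \<Rightarrow> real) set" where
  "barrier_vectors n = (\<Pi>\<^sub>E i\<in>{1..n}. {0..})"

text \<open>
  Pathwise description, for a phase path \<open>J\<close>, a path \<open>U\<close> of the surplus before dividends and
  a path \<open>D\<close> of cumulative dividends: the surplus \<open>U - D\<close> never exceeds the barrier of the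
  current phase (anything above is paid out at once), and the random measure \<open>dD\<close> charges
  only times at which the surplus (after payment) is at that barrier, so nothing is paid below
  it and a lump sum leads exactly to it.  While the surplus stays at the barrier this forces
  \<open>dD = c dt\<close>.  Since \<open>D\<close> vanishes on the negative half-line, a lump sum at time \<open>0\<close> is an
  atom of \<open>dD\<close> at \<open>0\<close>.  The conditions determine \<open>D\<close> uniquely.
\<close>
definition follows_phasewise_barriers ::
  "(nat \<Rightarrow> real) \<Rightarrow> (real \<Rightarrow> nat) \<Rightarrow> (real \<Rightarrow> real) \<Rightarrow> (real \<Rightarrow> real) \<Rightarrow> bool" where
  "follows_phasewise_barriers b J U D \<longleftrightarrow>
     (\<forall>t<0. D t = 0) \<and> mono D \<and> (\<forall>t. continuous (at_right t) D) \<and>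
     (\<forall>t\<ge>0. U t - D t \<le> b (J t)) \<and>
     (AE t in interval_measure D. 0 \<le> t \<longrightarrow> U t - D t = b (J t))"

definition ruin_time :: "(real \<Rightarrow> real) \<Rightarrow> ereal" where
  "ruin_time X = Inf (ereal ` {t. 0 \<le> t \<and> X t < 0})"

text \<open>
  \<open>D b x\<close> is the cumulative dividend process of the strategy with barriers \<open>b\<close> and initial
  capital \<open>x\<close>.
\<close>
definition barrier_value ::
  "nat \<Rightarrow> real \<Rightarrow> real \<Rightarrow> (nat \<Rightarrow> 'a measure) \<Rightarrow> (nat \<Rightarrow> real \<Rightarrow> 'a \<Rightarrow> nat) \<Rightarrow> (nat \<Rightarrow> 'a \<Rightarrow> real)
    \<Rightarrow> ((nat \<Rightarrow> real) \<Rightarrow> real \<Rightarrow> real \<Rightarrow> 'a \<Rightarrow> real) \<Rightarrow> (nat \<Rightarrow> real) \<Rightarrow> nat \<Rightarrow> real \<Rightarrow> real"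
where
  "barrier_value n c \<delta> P Z Y D b i x = enn2real
     (\<integral>\<^sup>+ \<omega>. (\<integral>\<^sup>+ t. ennreal (exp (- \<delta> * t)) *
          indicator {t. 0 \<le> t \<and>
            ereal t < ruin_time (\<lambda>s. free_surplus n c Z Y x s \<omega> - D b x s \<omega>)} t
        \<partial>interval_measure (\<lambda>t. D b x t \<omega>)) \<partial>P i)"

definition optimal_phasewise_barriers ::
  "nat \<Rightarrow> ((nat \<Rightarrow> real) \<Rightarrow> nat \<Rightarrow> real \<Rightarrow> real) \<Rightarrow> (nat \<Rightarrow> real) \<Rightarrow> bool" where
  "optimal_phasewise_barriers n f bs \<longleftrightarrow>
     bs \<in> barrier_vectors n \<and>
     (\<forall>i\<in>{1..n}. \<forall>x. 0 \<le> x \<and> x < bs i \<longrightarrow>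
        f bs i x = (SUP b\<in>barrier_vectors n. f b i x))"

section \<open>Second derivatives\<close>

text \<open>
  Derivatives are relative to the domain \<open>S\<close>, so they are one-sided at its boundary.
\<close>
definition has_second_derivative_within ::
  "(real \<Rightarrow> real) \<Rightarrow> real \<Rightarrow> real \<Rightarrow> real set \<Rightarrow> bool" where
  "has_second_derivative_within f d x S \<longleftrightarrow>
     (\<exists>g. (\<forall>\<^sub>F y in nhds x. y \<in> S \<longrightarrow> (f has_real_derivative g y) (at y within S)) \<and>
          (g has_real_derivative d) (at x within S))"

end

theory Submission
  imports Defs
begin

text \<open>
  The optimal values solve a Hamilton--Jacobi--Bellman system.  It is solved by monotone iteration
  on the slopes of the values and their values at zero: one step turns concave values into concave
  values, and in phase \<open>i\<close> the slope of the limit is the discounted future average of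
  \<open>max 1 g\<close>, where the nonincreasing \<open>g\<close> is the weighted slope after the next phase change or
  claim.  Hence the slope exceeds \<open>1\<close> up to the level at which \<open>g\<close> reaches \<open>1\<close>, equals \<open>1\<close>
  beyond, and has derivative \<open>0\<close> at that level.

  Verification uses the independence of the interclaim periods.  Within a period the dividends are
  given by Skorokhod's reflection formula, and a generator inequality for a candidate is
  transferred to expected rewards along dyadic time grids; only the infinitesimal description of
  the Markov process is needed for this.  Summing over the periods bounds the value of every
  strategy by the solution of the system, with equality for the barriers at its levels.

  An optimal barrier \<open>b > 0\<close> in phase \<open>i\<close> must be such a level: a wrong barrier in phase
  \<open>i\<close> alone, followed by the optimal continuation, gives a supersolution that is strictly smaller
  at \<open>b\<close>.  If \<open>b = 0\<close>, the value is \<open>x\<close> plus a constant.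
\<close>

section \<open>Calculus on the half-line\<close>

text \<open>The form of the solution comes from a differentiation: below the barrier the
  Hamilton--Jacobi--Bellman equation in phase i, differentiated in x, reads c v' = (total i +
  \<delta>) (v - g), whose only bounded solution is an exponential mean of g. Exponential claims
  keep the claim term local: the convolution w of a value F with the claim density satisfies w' =
  \<beta> (F - w), so all estimates are first-order comparisons. Three obstacles shape the rest. If
  g were equal to one on an interval, several barriers would be equally good and the level could not
  be recovered; discounting excludes this. The process is given only through one-step conditional
  probabilities and right-continuous paths, so instead of a Dynkin formula the rewards are computed
  by recursion on grids, and the dividend measure is traded for the cumulative dividends at an
  exponential time, which converge path by path. Optimality is assumed strictly below the barrier
  only, so the value at and above the barrier is recovered from monotonicity in the capital and from
  the lump sum paid at time zero.\<close>

lemma mvt_half_line: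
  fixes f :: "real \<Rightarrow> real"
  assumes "0 \<le> a" "a < b"
    and "\<And>x. 0 \<le> x \<Longrightarrow> (f has_real_derivative f' x) (at x within {0..})"
  shows "\<exists>z. a < z \<and> z < b \<and> f b - f a = f' z * (b - a)"
proof -
  have "\<exists>x\<in>{a<..<b}. f b - f a = f' x * (b - a)"
  proof (rule mvt_simple[OF \<open>a < b\<close>, of f "\<lambda>x y. f' x * y"])
    fix x assume "a \<le> x" "x \<le> b"
    then have "(f has_real_derivative f' x) (at x within {a..b})"
      using assms by (intro has_field_derivative_subset[OF assms(3)]) auto
    then show "(f has_derivative (\<lambda>y. f' x * y)) (at x within {a..b})"
      by (simp add: has_field_derivative_def)
  qed
  then show ?thesis by auto
qed

lemma half_line_mono:
  fixes f :: "real \<Rightarrow> real"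
  assumes "\<And>x. 0 \<le> x \<Longrightarrow> (f has_real_derivative f' x) (at x within {0..})"
    and "0 \<le> a" "a \<le> b" and "\<And>x. a < x \<Longrightarrow> x < b \<Longrightarrow> 0 \<le> f' x"
  shows "f a \<le> f b"
proof (cases "a < b")
  case True
  from mvt_half_line[OF assms(2) True assms(1)] obtain z
    where "a < z" "z < b" "f b - f a = f' z * (b - a)" by blast
  with assms(4)[of z] True show ?thesis
    by (metis diff_ge_0_iff_ge less_imp_le zero_le_mult_iff)
qed (use assms in auto)

lemma half_line_antimono:
  fixes f :: "real \<Rightarrow> real"
  assumes "\<And>x. 0 \<le> x \<Longrightarrow> (f has_real_derivative f' x) (at x within {0..})"
    and "0 \<le> a" "a \<le> b" and "\<And>x. a < x \<Longrightarrow> x < b \<Longrightarrow> f' x \<le> 0"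
  shows "f b \<le> f a"
proof -
  have "- f a \<le> - f b"
    by (rule half_line_mono[of "\<lambda>x. - f x" "\<lambda>x. - f' x"])
       (use assms in \<open>auto intro: derivative_eq_intros\<close>)
  then show ?thesis by simp
qed

lemma half_line_constant:
  fixes f :: "real \<Rightarrow> real"
  assumes "\<And>x. 0 \<le> x \<Longrightarrow> (f has_real_derivative f' x) (at x within {0..})"
    and "0 \<le> a" "a \<le> b" and "\<And>x. a < x \<Longrightarrow> x < b \<Longrightarrow> f' x = 0"
  shows "f b = f a"
  using half_line_mono[OF assms(1-3)] half_line_antimono[OF assms(1-3)] assms(4)
  by (simp add: antisym)

lemma half_line_continuous:
  fixes f :: "real \<Rightarrow> real"
  assumes "\<And>x. 0 \<le> x \<Longrightarrow> (f has_real_derivative f' x) (at x within {0..})"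
  shows "continuous_on {0..} f"
  unfolding continuous_on_eq_continuous_within
  using assms by (auto intro: DERIV_continuous)

lemma half_line_antiderivative:
  fixes f :: "real \<Rightarrow> real"
  assumes "continuous_on {0..} f" "0 \<le> x"
  shows "((\<lambda>x. integral {0..x} f) has_real_derivative f x) (at x within {0..})"
proof -
  have "((\<lambda>x. integral {0..x} f) has_real_derivative f x) (at x within {0..x+1})"
    using assms by (intro integral_has_real_derivative continuous_on_subset[OF assms(1)]) auto
  moreover have "at x within {0..x+1} = at x within {0..}"
    by (rule at_within_nhd[where S="{..<x+1}"]) (use assms in auto)
  ultimately show ?thesis by simp
qed

text \<open>
  \<open>resolvent \<theta> m x\<close> is the mean of \<open>m (x + T)\<close> for an exponential time \<open>T\<close> with rate \<open>\<theta>\<close>;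
  it is the only bounded solution of \<open>v' = \<theta> (v - m)\<close>.
\<close>

definition resolvent :: "real \<Rightarrow> (real \<Rightarrow> real) \<Rightarrow> real \<Rightarrow> real" where
  "resolvent \<theta> m x = \<theta> * exp (\<theta> * x) * integral {x..} (\<lambda>u. exp (- \<theta> * u) * m u)"

lemma resolvent_integrable:
  fixes m :: "real \<Rightarrow> real"
  assumes "\<theta> > 0" "continuous_on {0..} m" "\<And>u. 0 \<le> u \<Longrightarrow> \<bar>m u\<bar> \<le> K" "0 \<le> x"
  shows "(\<lambda>u. exp (- \<theta> * u) * m u) integrable_on {x..}"
proof (rule measurable_bounded_by_integrable_imp_integrable)
  show "(\<lambda>u. exp (- \<theta> * u) * m u) \<in> borel_measurable (lebesgue_on {x..})"
  proof (rule continuous_imp_measurable_on_sets_lebesgue)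
    have "continuous_on {x..} (\<lambda>u. exp (- \<theta> * u))" by (intro continuous_intros)
    moreover have "continuous_on {x..} m" by (rule continuous_on_subset[OF assms(2)]) (use assms(4) in auto)
    ultimately show "continuous_on {x..} (\<lambda>u. exp (- \<theta> * u) * m u)" by (rule continuous_on_mult)
    show "{x..} \<in> sets lebesgue" by (rule sets_completionI_sets) simp
  qed
  show "(\<lambda>u. K * exp (- \<theta> * u)) integrable_on {x..}"
    using integrable_on_exp_minus_to_infinity[OF assms(1)] by (intro integrable_on_mult_right)
  show "norm (exp (- \<theta> * u) * m u) \<le> K * exp (- \<theta> * u)" if "u \<in> {x..}" for u
    using that assms(3)[of u] \<open>0 \<le> x\<close> by (simp add: abs_mult)
qed auto

lemma resolvent_const:
  assumes "\<theta> > 0"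
  shows "resolvent \<theta> (\<lambda>_. k) x = k"
proof -
  have "integral {x..} (\<lambda>u. exp (- \<theta> * u) * k) = exp (- \<theta> * x) / \<theta> * k"
    by (rule integral_unique) (intro has_integral_mult_left has_integral_exp_minus_to_infinity assms)
  then show ?thesis using assms by (simp add: resolvent_def exp_minus field_simps)
qed

lemma resolvent_mono:
  assumes "\<theta> > 0" "0 \<le> x"
    "continuous_on {0..} m" "\<And>u. 0 \<le> u \<Longrightarrow> \<bar>m u\<bar> \<le> K"
    "continuous_on {0..} m'" "\<And>u. 0 \<le> u \<Longrightarrow> \<bar>m' u\<bar> \<le> K'"
    "\<And>u. x \<le> u \<Longrightarrow> m u \<le> m' u"
  shows "resolvent \<theta> m x \<le> resolvent \<theta> m' x"
  unfolding resolvent_def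
  using assms by (intro mult_left_mono integral_le resolvent_integrable) auto

lemma resolvent_deriv:
  assumes "\<theta> > 0" "continuous_on {0..} m" "\<And>u. 0 \<le> u \<Longrightarrow> \<bar>m u\<bar> \<le> K" "0 \<le> x"
  shows "(resolvent \<theta> m has_real_derivative \<theta> * (resolvent \<theta> m x - m x)) (at x within {0..})"
proof -
  let ?f = "\<lambda>u. exp (- \<theta> * u) * m u"
  \<comment> \<open>The tail integral becomes a constant minus an integral from zero, to which the
    fundamental theorem on the half-line applies.\<close>
  have split: "integral {y..} ?f = integral {0..} ?f - integral {0..y} ?f" if "0 \<le> y" for y
  proof -
    have "{0..y} \<union> {y..} = {0..}" using that by auto
    moreover have "integral ({0..y} \<union> {y..}) ?f = integral {0..y} ?f + integral {y..} ?f"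
    proof (rule integral_Un)
      show "?f integrable_on {0..y}"
        by (rule integrable_on_subinterval[OF resolvent_integrable[OF assms(1-3), of 0]]) auto
      show "?f integrable_on {y..}" by (rule resolvent_integrable[OF assms(1-3) that])
      have "{0..y} \<inter> {y..} = {y}" using that by auto
      then show "negligible ({0..y} \<inter> {y..})" by simp
    qed
    ultimately show ?thesis by simp
  qed
  have "((\<lambda>y. \<theta> * exp (\<theta> * y) * (integral {0..} ?f - integral {0..y} ?f)) has_real_derivative
      \<theta> * (\<theta> * exp (\<theta> * x)) * (integral {0..} ?f - integral {0..x} ?f) - \<theta> * exp (\<theta> * x) * ?f x)
      (at x within {0..})"
    by (rule derivative_eq_intros half_line_antiderivative continuous_intros assms refl | simp)+
  then have d: "((\<lambda>y. \<theta> * exp (\<theta> * y) * (integral {0..} ?f - integral {0..y} ?f)) has_real_derivative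
      \<theta> * (resolvent \<theta> m x - m x)) (at x within {0..})"
    unfolding resolvent_def split[OF assms(4)] by (rule DERIV_cong) (simp add: algebra_simps flip: exp_add)
  have eq: "\<theta> * exp (\<theta> * y) * (integral {0..} ?f - integral {0..y} ?f) = resolvent \<theta> m y" if "0 \<le> y" for y
    by (simp only: resolvent_def split[OF that])
  show ?thesis
    by (rule has_field_derivative_transform_within[OF d zero_less_one]) (use assms eq in auto)
qed

text \<open>
  The solution of \<open>w' = \<beta> (f - w)\<close> with \<open>w 0 = k\<close>.
\<close>

definition claim_average :: "real \<Rightarrow> real \<Rightarrow> (real \<Rightarrow> real) \<Rightarrow> real \<Rightarrow> real" where
  "claim_average \<beta> k f x = exp (- \<beta> * x) * (k + integral {0..x} (\<lambda>u. \<beta> * exp (\<beta> * u) * f u))"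

lemma claim_average_0 [simp]: "claim_average \<beta> k f 0 = k"
  by (simp add: claim_average_def)

lemma claim_average_deriv:
  assumes "continuous_on {0..} f" "0 \<le> x"
  shows "(claim_average \<beta> k f has_real_derivative \<beta> * (f x - claim_average \<beta> k f x)) (at x within {0..})"
proof -
  have "(claim_average \<beta> k f has_real_derivative
     (- \<beta>) * exp (- \<beta> * x) * (k + integral {0..x} (\<lambda>u. \<beta> * exp (\<beta> * u) * f u))
      + exp (- \<beta> * x) * (\<beta> * exp (\<beta> * x) * f x)) (at x within {0..})"
    unfolding claim_average_def
    by (rule derivative_eq_intros half_line_antiderivative continuous_intros assms refl | simp)+
  then show ?thesis by (simp add: claim_average_def algebra_simps flip: exp_add)
qed

lemma claim_average_mono:
  assumes "continuous_on {0..} f" "continuous_on {0..} f'" "0 \<le> x" "\<beta> > 0" "k \<le> k'"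
    "\<And>u. 0 \<le> u \<Longrightarrow> u \<le> x \<Longrightarrow> f u \<le> f' u"
  shows "claim_average \<beta> k f x \<le> claim_average \<beta> k' f' x"
  unfolding claim_average_def
  by (intro mult_left_mono add_mono integral_le integrable_continuous_interval continuous_intros
      continuous_on_subset[OF assms(1)] continuous_on_subset[OF assms(2)]) (use assms in auto)

lemma claim_average_const:
  assumes "\<beta> > 0" "0 \<le> x"
  shows "claim_average \<beta> k (\<lambda>_. k') x = k' + (k - k') * exp (- \<beta> * x)"
proof -
  have "((\<lambda>u. \<beta> * exp (\<beta> * u) * k') has_integral (exp (\<beta> * x) * k' - exp (\<beta> * 0) * k')) {0..x}"
    by (rule fundamental_theorem_of_calculus)
       (auto simp: assms simp flip: has_real_derivative_iff_has_vector_derivative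
         intro!: derivative_eq_intros)
  then show ?thesis
    unfolding claim_average_def by (subst integral_unique) (auto simp: algebra_simps simp flip: exp_add)
qed

text \<open>Monotonicity is inherited only if the value \<open>k\<close>, which stands for \<open>f\<close> on the negative
  half-line, lies above \<open>f\<close>.\<close>

lemma claim_average_ge:
  assumes "continuous_on {0..} f" "0 \<le> x" "\<beta> > 0" "\<And>u. 0 \<le> u \<Longrightarrow> u \<le> x \<Longrightarrow> l \<le> f u" "l \<le> k"
  shows "l \<le> claim_average \<beta> k f x"
proof -
  have "l = claim_average \<beta> l (\<lambda>_. l) x" using assms by (simp add: claim_average_const)
  also have "\<dots> \<le> claim_average \<beta> k f x" by (rule claim_average_mono) (use assms in auto)
  finally show ?thesis .
qed

lemma claim_average_le:
  assumes "continuous_on {0..} f" "0 \<le> x" "\<beta> > 0" "\<And>u. 0 \<le> u \<Longrightarrow> u \<le> x \<Longrightarrow> f u \<le> l" "k \<le> l"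
  shows "claim_average \<beta> k f x \<le> l"
proof -
  have "claim_average \<beta> k f x \<le> claim_average \<beta> l (\<lambda>_. l) x" by (rule claim_average_mono) (use assms in auto)
  also have "\<dots> = l" using assms by (simp add: claim_average_const)
  finally show ?thesis .
qed

text \<open>The average at z is taken over \<open>k\<close> and values of \<open>f\<close> at points
  up to z, all at least \<open>f z\<close>; hence \<open>f z\<close> lies below it and the equation
  \<open>w' = \<beta> * (f - w)\<close> forces a decrease.\<close>

lemma claim_average_antimono:
  assumes "continuous_on {0..} f" "\<beta> > 0" "\<And>x y. 0 \<le> x \<Longrightarrow> x \<le> y \<Longrightarrow> f y \<le> f x" "f 0 \<le> k" "0 \<le> x" "x \<le> y"
  shows "claim_average \<beta> k f y \<le> claim_average \<beta> k f x"
proof (rule half_line_antimono[OF claim_average_deriv])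
  fix z assume z: "x < z" "z < y"
  have "f z \<le> claim_average \<beta> k f z"
    using z assms order_trans[OF assms(3)[of 0 z] assms(4)] by (intro claim_average_ge) auto
  then show "\<beta> * (f z - claim_average \<beta> k f z) \<le> 0"
    using assms by (simp add: mult_nonneg_nonpos)
qed (use assms in auto)

section \<open>The Hamilton--Jacobi--Bellman system\<close>

locale hjb_system =
  fixes n :: nat and c \<beta> \<delta> :: real and \<pi> :: "nat \<Rightarrow> real" and lam :: "nat \<Rightarrow> nat \<Rightarrow> real"
  assumes c_pos: "c > 0" and \<beta>_pos: "\<beta> > 0" and \<delta>_pos: "\<delta> > 0"
    and \<pi>_nonneg: "\<And>i. i \<in> {1..n} \<Longrightarrow> \<pi> i \<ge> 0"
    and \<pi>_sum: "(\<Sum>i=1..n. \<pi> i) = 1"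
    and lam_nonneg: "\<And>i j. i \<in> {1..n} \<Longrightarrow> j \<in> {1..n+1} \<Longrightarrow> j \<noteq> i \<Longrightarrow> lam i j \<ge> 0"
begin

definition total :: "nat \<Rightarrow> real" where "total i = (\<Sum>j\<in>{1..n} - {i}. lam i j) + lam i (n+1)"
text \<open>Discounting at rate \<delta> is the same as an additional exit at rate \<delta>. The
  ratio of \<open>total i\<close> to \<open>killing i\<close> is therefore below one, which makes
  the levels finite and the inequalities above them strict.\<close>

definition killing :: "nat \<Rightarrow> real" where "killing i = total i + \<delta>"

lemma lam_nonneg': "i \<in> {1..n} \<Longrightarrow> 0 \<le> lam i (n+1)" "i \<in> {1..n} \<Longrightarrow> j \<in> {1..n} - {i} \<Longrightarrow> 0 \<le> lam i j"
  by (auto intro: lam_nonneg)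

lemma total_nonneg: "i \<in> {1..n} \<Longrightarrow> 0 \<le> total i"
  unfolding total_def by (intro add_nonneg_nonneg sum_nonneg lam_nonneg')

lemma killing_pos: "i \<in> {1..n} \<Longrightarrow> 0 < killing i"
  using total_nonneg \<delta>_pos by (force simp: killing_def)

definition mix :: "(nat \<Rightarrow> real) \<Rightarrow> real" where "mix u = (\<Sum>j=1..n. \<pi> j * u j)"

lemma mix_mono: "(\<And>j. j \<in> {1..n} \<Longrightarrow> u j \<le> u' j) \<Longrightarrow> mix u \<le> mix u'"
  unfolding mix_def by (intro sum_mono mult_left_mono \<pi>_nonneg)

lemma mix_const: "mix (\<lambda>_. k) = k"
  using \<pi>_sum by (simp add: mix_def flip: sum_distrib_right)

lemma mix_le: "(\<And>j. j \<in> {1..n} \<Longrightarrow> u j \<le> k) \<Longrightarrow> mix u \<le> k"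
  using mix_mono[of u "\<lambda>_. k"] mix_const by simp

lemma mix_ge: "(\<And>j. j \<in> {1..n} \<Longrightarrow> k \<le> u j) \<Longrightarrow> k \<le> mix u"
  using mix_mono[of "\<lambda>_. k" u] mix_const by simp

text \<open>
  A candidate for the value functions is represented by the slopes \<open>v\<close> and the values \<open>a\<close>
  at zero.  \<open>claim_slope\<close> is the slope of the expected value just after a claim; the maximum
  with \<open>1\<close> makes it nonincreasing also in the degenerate case in which immediate payment of
  everything is optimal in every phase.
\<close>

definition claim_slope :: "(nat \<Rightarrow> real \<Rightarrow> real) \<Rightarrow> (nat \<Rightarrow> real) \<Rightarrow> real \<Rightarrow> real" where
  "claim_slope v a = claim_average \<beta> (max 1 (\<beta> * mix a)) (\<lambda>x. mix (\<lambda>j. v j x))"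

definition inflow :: "(nat \<Rightarrow> real \<Rightarrow> real) \<Rightarrow> (nat \<Rightarrow> real) \<Rightarrow> nat \<Rightarrow> real \<Rightarrow> real" where
  "inflow v a i x =
     ((\<Sum>j\<in>{1..n} - {i}. lam i j * v j x) + lam i (n+1) * claim_slope v a x) / killing i"

text \<open>With target \<open>g\<close> the equation \<open>c * v' = killing i * (v - g)\<close> is
  the differentiated Hamilton--Jacobi--Bellman equation below the barrier; cutting the target at
  \<open>1\<close> gives the constant slope \<open>1\<close> from the point on where
  \<open>g\<close> stays below \<open>1\<close>.\<close>

definition next_slope :: "(nat \<Rightarrow> real \<Rightarrow> real) \<Rightarrow> (nat \<Rightarrow> real) \<Rightarrow> nat \<Rightarrow> real \<Rightarrow> real" where
  "next_slope v a i = resolvent (killing i / c) (\<lambda>x. max 1 (inflow v a i x))"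

text \<open>The undifferentiated equation at surplus zero, solved for the value in phase
  \<open>i\<close>. There is no claim term because a claim at surplus zero is almost surely
  ruin.\<close>

definition next_base :: "(nat \<Rightarrow> real \<Rightarrow> real) \<Rightarrow> (nat \<Rightarrow> real) \<Rightarrow> nat \<Rightarrow> real" where
  "next_base v a i = (c * next_slope v a i 0 + (\<Sum>j\<in>{1..n} - {i}. lam i j * a j)) / killing i"

definition val :: "(nat \<Rightarrow> real \<Rightarrow> real) \<Rightarrow> (nat \<Rightarrow> real) \<Rightarrow> nat \<Rightarrow> real \<Rightarrow> real" where
  "val v a i x = a i + integral {0..x} (v i)"

text \<open>The upper bound on the slopes is the starting value of \<open>claim_slope\<close>, which
  makes that function nonincreasing. The growth bound is the capital plus all premiums, discounted
  forever; it keeps the iterates bounded and forces the slopes towards one.\<close>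

definition admissible :: "(nat \<Rightarrow> real \<Rightarrow> real) \<Rightarrow> (nat \<Rightarrow> real) \<Rightarrow> bool" where
  "admissible v a \<longleftrightarrow> (\<forall>i\<in>{1..n}. continuous_on {0..} (v i) \<and>
     (\<forall>x\<ge>0. 1 \<le> v i x \<and> v i x \<le> max 1 (\<beta> * mix a)) \<and>
     (\<forall>x y. 0 \<le> x \<longrightarrow> x \<le> y \<longrightarrow> v i y \<le> v i x) \<and>
     0 \<le> a i \<and> (\<forall>x\<ge>0. val v a i x \<le> x + c / \<delta>))"

definition level :: "(nat \<Rightarrow> real \<Rightarrow> real) \<Rightarrow> (nat \<Rightarrow> real) \<Rightarrow> nat \<Rightarrow> real" where
  "level v a i = Inf {x. 0 \<le> x \<and> inflow v a i x \<le> 1}"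

context
  fixes v a assumes adm: "admissible v a"
begin

lemma adm_cont: "i \<in> {1..n} \<Longrightarrow> continuous_on {0..} (v i)"
  and adm_ge1: "i \<in> {1..n} \<Longrightarrow> 0 \<le> x \<Longrightarrow> 1 \<le> v i x"
  and adm_le: "i \<in> {1..n} \<Longrightarrow> 0 \<le> x \<Longrightarrow> v i x \<le> max 1 (\<beta> * mix a)"
  and adm_anti: "i \<in> {1..n} \<Longrightarrow> 0 \<le> x \<Longrightarrow> x \<le> y \<Longrightarrow> v i y \<le> v i x"
  and adm_base: "i \<in> {1..n} \<Longrightarrow> 0 \<le> a i"
  and adm_val: "i \<in> {1..n} \<Longrightarrow> 0 \<le> x \<Longrightarrow> val v a i x \<le> x + c / \<delta>"
  using adm by (auto simp: admissible_def)

lemma mix_slope_cont: "continuous_on {0..} (\<lambda>x. mix (\<lambda>j. v j x))"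
  unfolding mix_def by (intro continuous_intros adm_cont)

lemma mix_slope_bounds:
  assumes "0 \<le> x" shows "1 \<le> mix (\<lambda>j. v j x)" "mix (\<lambda>j. v j x) \<le> max 1 (\<beta> * mix a)"
  using assms by (auto intro!: mix_ge mix_le adm_ge1 adm_le simp del: max.bounded_iff)

lemma mix_slope_anti: "0 \<le> x \<Longrightarrow> x \<le> y \<Longrightarrow> mix (\<lambda>j. v j y) \<le> mix (\<lambda>j. v j x)"
  by (intro mix_mono adm_anti)

lemma claim_slope_deriv: "0 \<le> x \<Longrightarrow>
   (claim_slope v a has_real_derivative \<beta> * (mix (\<lambda>j. v j x) - claim_slope v a x)) (at x within {0..})"
  unfolding claim_slope_def by (rule claim_average_deriv[OF mix_slope_cont])

lemma claim_slope_cont: "continuous_on {0..} (claim_slope v a)"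
  by (rule half_line_continuous[OF claim_slope_deriv])

lemma claim_slope_bounds:
  assumes "0 \<le> x" shows "1 \<le> claim_slope v a x" "claim_slope v a x \<le> max 1 (\<beta> * mix a)"
  unfolding claim_slope_def
  using assms mix_slope_cont mix_slope_bounds \<beta>_pos
  by (auto intro!: claim_average_ge claim_average_le simp del: max.bounded_iff)

lemma claim_slope_anti: "0 \<le> x \<Longrightarrow> x \<le> y \<Longrightarrow> claim_slope v a y \<le> claim_slope v a x"
  unfolding claim_slope_def
  by (rule claim_average_antimono[OF mix_slope_cont \<beta>_pos])
     (auto intro: mix_slope_anti mix_slope_bounds)

context
  fixes i assumes i: "i \<in> {1..n}"
begin

lemma inflow_cont: "continuous_on {0..} (inflow v a i)"
  unfolding inflow_def using killing_pos[OF i]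
  by (intro continuous_intros adm_cont claim_slope_cont) auto

lemma inflow_anti: "0 \<le> x \<Longrightarrow> x \<le> y \<Longrightarrow> inflow v a i y \<le> inflow v a i x"
  unfolding inflow_def using killing_pos[OF i] lam_nonneg'[OF i]
  by (intro divide_right_mono add_mono sum_mono mult_left_mono adm_anti claim_slope_anti) auto

text \<open>The coefficients of the inflow are nonnegative and add up to
  \<open>total i / killing i\<close>.\<close>

lemma inflow_le:
  assumes "\<And>j. j \<in> {1..n} \<Longrightarrow> v j x \<le> k" "claim_slope v a x \<le> k"
  shows "inflow v a i x \<le> total i * k / killing i"
proof -
  have "(\<Sum>j\<in>{1..n} - {i}. lam i j * v j x) + lam i (n+1) * claim_slope v a x
     \<le> (\<Sum>j\<in>{1..n} - {i}. lam i j * k) + lam i (n+1) * k"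
    by (intro add_mono sum_mono mult_left_mono lam_nonneg'[OF i] assms) auto
  also have "\<dots> = total i * k" by (simp add: total_def sum_distrib_right distrib_right)
  finally show ?thesis using killing_pos[OF i] by (simp add: inflow_def divide_right_mono)
qed

lemma inflow_bound:
  assumes "0 \<le> x" shows "max 1 (inflow v a i x) \<le> max 1 (\<beta> * mix a)"
proof -
  have "inflow v a i x \<le> total i * max 1 (\<beta> * mix a) / killing i"
    using assms by (intro inflow_le adm_le claim_slope_bounds)
  also have "\<dots> \<le> max 1 (\<beta> * mix a)"
    using killing_pos[OF i] \<delta>_pos by (simp add: divide_le_eq killing_def mult_right_mono mult.commute)
  finally show ?thesis by simp
qed

lemma target_cont: "continuous_on {0..} (\<lambda>x. max 1 (inflow v a i x))"
  by (intro continuous_intros inflow_cont)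

lemma target_abs: "0 \<le> x \<Longrightarrow> \<bar>max 1 (inflow v a i x)\<bar> \<le> max 1 (\<beta> * mix a)"
  using inflow_bound[of x] by simp

lemma rate_pos: "killing i / c > 0" using killing_pos[OF i] c_pos by simp

lemma next_slope_deriv: "0 \<le> x \<Longrightarrow> (next_slope v a i has_real_derivative
   killing i / c * (next_slope v a i x - max 1 (inflow v a i x))) (at x within {0..})"
  unfolding next_slope_def by (rule resolvent_deriv[OF rate_pos target_cont target_abs])

lemma next_slope_cont: "continuous_on {0..} (next_slope v a i)"
  by (rule half_line_continuous[OF next_slope_deriv])

lemma next_slope_ge:
  assumes "0 \<le> x" "\<And>u. x \<le> u \<Longrightarrow> k \<le> max 1 (inflow v a i u)" shows "k \<le> next_slope v a i x"
proof -
  have "resolvent (killing i / c) (\<lambda>_. k) x \<le> next_slope v a i x"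
    unfolding next_slope_def
    by (rule resolvent_mono[OF rate_pos assms(1) _ _ target_cont target_abs, where K="\<bar>k\<bar>"])
       (use assms in \<open>auto simp del: max.bounded_iff\<close>)
  then show ?thesis by (simp add: resolvent_const[OF rate_pos])
qed

lemma next_slope_le:
  assumes "0 \<le> x" "\<And>u. x \<le> u \<Longrightarrow> max 1 (inflow v a i u) \<le> k" shows "next_slope v a i x \<le> k"
proof -
  have "next_slope v a i x \<le> resolvent (killing i / c) (\<lambda>_. k) x"
    unfolding next_slope_def
    by (rule resolvent_mono[OF rate_pos assms(1) target_cont target_abs, where K'="\<bar>k\<bar>"])
       (use assms in \<open>auto simp del: max.bounded_iff\<close>)
  then show ?thesis by (simp add: resolvent_const[OF rate_pos])
qed

lemma next_slope_ge1: "0 \<le> x \<Longrightarrow> 1 \<le> next_slope v a i x"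
  by (rule next_slope_ge) auto

lemma next_slope_bound: "0 \<le> x \<Longrightarrow> next_slope v a i x \<le> max 1 (\<beta> * mix a)"
  by (rule next_slope_le) (auto intro!: inflow_bound simp del: max.bounded_iff)

text \<open>The resolvent averages the target over points to the right, where it is no larger. In
  the differential equation this sign says that the new slope is nonincreasing, i.e. that concavity
  survives the step.\<close>

lemma next_slope_le_target: "0 \<le> x \<Longrightarrow> next_slope v a i x \<le> max 1 (inflow v a i x)"
  using inflow_anti by (intro next_slope_le max.mono) auto

lemma next_slope_anti: "0 \<le> x \<Longrightarrow> x \<le> y \<Longrightarrow> next_slope v a i y \<le> next_slope v a i x"
  by (rule half_line_antimono[OF next_slope_deriv])
     (use next_slope_le_target rate_pos in \<open>auto intro!: mult_nonneg_nonpos simp del: times_divide_eq_left\<close>)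

end

lemma val_deriv: "i \<in> {1..n} \<Longrightarrow> 0 \<le> x \<Longrightarrow> (val v a i has_real_derivative v i x) (at x within {0..})"
  unfolding val_def by (rule derivative_eq_intros half_line_antiderivative adm_cont | simp)+

text \<open>A nonincreasing slope satisfies \<open>x * v i x \<le> integral {0..x} (v i)\<close>,
  and the growth bound limits the integral.\<close>

lemma slope_decay:
  assumes "i \<in> {1..n}" "0 < x" shows "v i x \<le> 1 + c / (\<delta> * x)"
proof -
  have "integral {0..x} (\<lambda>_. v i x) \<le> integral {0..x} (v i)"
    by (intro integral_le integrable_continuous_interval continuous_on_subset[OF adm_cont] adm_anti)
       (use assms in auto)
  then have "x * v i x \<le> x + c / \<delta>"
    using adm_val[OF assms(1), of x] adm_base[OF assms(1)] assms(2) by (simp add: val_def)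
  then have "v i x \<le> (x + c / \<delta>) / x" using assms(2) by (simp add: field_simps)
  then show ?thesis using assms(2) \<delta>_pos by (simp add: field_simps)
qed

text \<open>\<open>claim_slope v a\<close> and \<open>\<beta> (F - \<integral> claim_slope v a)\<close>, with \<open>F\<close> the mixture of the candidate
  values, have the same derivative; in the nondegenerate case they agree at zero.\<close>

lemma integral_claim_slope_le:
  assumes "0 \<le> x" shows "integral {0..x} (claim_slope v a) \<le> x + c / \<delta>"
proof (cases "\<beta> * mix a \<le> 1")
  case True
  have "integral {0..x} (claim_slope v a) \<le> integral {0..x} (\<lambda>_. 1)"
    by (intro integral_le integrable_continuous_interval continuous_on_subset[OF claim_slope_cont])
       (use assms claim_slope_bounds True in \<open>auto simp: max_absorb1\<close>)
  then show ?thesis using assms c_pos \<delta>_pos by (simp add: add_increasing2)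
next
  case False
  let ?d = "\<lambda>x. claim_slope v a x - \<beta> * mix (\<lambda>j. val v a j x) + \<beta> * integral {0..x} (claim_slope v a)"
  have "?d x = ?d 0"
  proof (rule half_line_constant[of ?d "\<lambda>y. \<beta> * (mix (\<lambda>j. v j y) - claim_slope v a y)
        - \<beta> * mix (\<lambda>j. v j y) + \<beta> * claim_slope v a y"])
    fix y :: real assume y: "0 \<le> y"
    have *: "((\<lambda>x. mix (\<lambda>j. val v a j x)) has_real_derivative mix (\<lambda>j. v j y)) (at y within {0..})"
      unfolding mix_def by (intro DERIV_sum DERIV_cmult val_deriv y) auto
    show "(?d has_real_derivative \<beta> * (mix (\<lambda>j. v j y) - claim_slope v a y)
        - \<beta> * mix (\<lambda>j. v j y) + \<beta> * claim_slope v a y) (at y within {0..})"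
      by (rule derivative_eq_intros half_line_antiderivative claim_slope_cont val_deriv
          claim_slope_deriv y refl * | simp)+
  qed (use assms in \<open>auto simp: algebra_simps\<close>)
  then have "claim_slope v a x = \<beta> * (mix (\<lambda>j. val v a j x) - integral {0..x} (claim_slope v a))"
    using False by (simp add: claim_slope_def val_def algebra_simps)
  \<comment> \<open>Positivity of the slope alone bounds its own integral by the mixture of the
    values.\<close>
  then have "0 < \<beta> * (mix (\<lambda>j. val v a j x) - integral {0..x} (claim_slope v a))"
    using claim_slope_bounds(1)[OF assms] by linarith
  then have "0 \<le> mix (\<lambda>j. val v a j x) - integral {0..x} (claim_slope v a)"
    by (rule less_imp_le[OF zero_less_mult_pos[OF _ \<beta>_pos]])
  moreover have "mix (\<lambda>j. val v a j x) \<le> x + c / \<delta>"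
    by (intro mix_le adm_val assms)
  ultimately show ?thesis by simp
qed

lemma claim_slope_decay:
  assumes "0 < x" shows "claim_slope v a x \<le> 1 + c / (\<delta> * x)"
proof -
  have "integral {0..x} (\<lambda>_. claim_slope v a x) \<le> integral {0..x} (claim_slope v a)"
    by (intro integral_le integrable_continuous_interval continuous_on_subset[OF claim_slope_cont]
        claim_slope_anti) (use assms in auto)
  then have "x * claim_slope v a x \<le> x + c / \<delta>"
    using integral_claim_slope_le[of x] assms by simp
  then have "claim_slope v a x \<le> (x + c / \<delta>) / x" using assms by (simp add: field_simps)
  then show ?thesis using assms \<delta>_pos by (simp add: field_simps)
qed

context
  fixes i assumes i: "i \<in> {1..n}"
begin

lemma inflow_eventually_le: "\<exists>x\<ge>0. inflow v a i x \<le> 1"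
proof -
  \<comment> \<open>Chosen so that \<open>total i * c / (\<delta> * x) \<le> \<delta>\<close>: the
    excess of the slopes over one is then absorbed by discounting. The summand \<open>1\<close>
    keeps \<open>x\<close> positive.\<close>
  define x where "x = total i * c / \<delta>\<^sup>2 + 1"
  have x: "0 < x" using total_nonneg[OF i] c_pos by (simp add: x_def add_nonneg_pos)
  have "inflow v a i x \<le> total i * (1 + c / (\<delta> * x)) / killing i"
    using slope_decay claim_slope_decay x by (intro inflow_le[OF i]) auto
  also have "\<dots> \<le> 1"
  proof -
    have "total i * c \<le> \<delta> * (\<delta> * x)" using \<delta>_pos by (simp add: x_def field_simps power2_eq_square)
    then have "total i * c / (\<delta> * x) \<le> \<delta>" using x \<delta>_pos by (simp add: divide_le_eq)
    then show ?thesis using killing_pos[OF i] by (simp add: divide_le_eq killing_def distrib_left)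
  qed
  finally show ?thesis using x by (intro exI[of _ x]) auto
qed

lemma level_props: "0 \<le> level v a i" "inflow v a i (level v a i) \<le> 1"
  "0 \<le> x \<Longrightarrow> x < level v a i \<Longrightarrow> 1 < inflow v a i x"
proof -
  let ?S = "{x. 0 \<le> x \<and> inflow v a i x \<le> 1}"
  have ne: "?S \<noteq> {}" using inflow_eventually_le by auto
  have bdd: "bdd_below ?S" by (auto intro: bdd_belowI[of _ 0])
  have "closed ({0..} \<inter> inflow v a i -` {..1})"
    by (intro continuous_closed_preimage inflow_cont i) auto
  also have "{0..} \<inter> inflow v a i -` {..1} = ?S" by auto
  finally have "Inf ?S \<in> ?S" by (intro closed_contains_Inf ne bdd)
  then show "0 \<le> level v a i" "inflow v a i (level v a i) \<le> 1" by (auto simp: level_def)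
  show "1 < inflow v a i x" if "0 \<le> x" "x < level v a i"
    using cInf_lower[OF _ bdd, of x] that by (force simp: level_def not_le[symmetric])
qed

lemma inflow_le1: "level v a i \<le> x \<Longrightarrow> inflow v a i x \<le> 1"
  using inflow_anti[OF i level_props(1), of x] level_props(2) by simp

lemma next_slope_eq1: "level v a i \<le> x \<Longrightarrow> next_slope v a i x = 1"
  using level_props(1) inflow_le1
  by (intro antisym next_slope_le[OF i] next_slope_ge1[OF i]) (auto simp: max_def)

text \<open>A slope that had come down to one before the level would stay there by monotonicity; its
  derivative would vanish at a point where the target still exceeds one.\<close>

lemma next_slope_gt1:
  assumes "0 \<le> x" "x < level v a i" shows "1 < next_slope v a i x"
proof (rule ccontr)
  assume "\<not> 1 < next_slope v a i x"
  then have eq1: "next_slope v a i y = 1" if "x \<le> y" for y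
    using next_slope_anti[OF i assms(1) that] next_slope_ge1[OF i, of y] assms that by simp
  obtain z where z: "x < z" "z < level v a i"
    "next_slope v a i (level v a i) - next_slope v a i x =
     killing i / c * (next_slope v a i z - max 1 (inflow v a i z)) * (level v a i - x)"
    using mvt_half_line[OF assms next_slope_deriv[OF i]] by auto
  then have "max 1 (inflow v a i z) = 1"
    using eq1[of z] eq1[of "level v a i"] eq1[of x] rate_pos[OF i] assms by auto
  with level_props(3)[of z] z assms show False by simp
qed

text \<open>The Hamilton--Jacobi--Bellman expression for the updated candidate, with the continuation
  values taken from the old one.\<close>

definition surplus_drift :: "real \<Rightarrow> real" where
  "surplus_drift x = c * next_slope v a i x - killing i * (next_base v a i + integral {0..x} (next_slope v a i))
     + ((\<Sum>j\<in>{1..n} - {i}. lam i j * val v a j x) + lam i (n+1) * integral {0..x} (claim_slope v a))"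

lemma surplus_drift_0: "surplus_drift 0 = 0"
  using killing_pos[OF i] by (simp add: surplus_drift_def next_base_def val_def)

lemma surplus_drift_deriv:
  assumes x: "0 \<le> x"
  shows "(surplus_drift has_real_derivative killing i * (inflow v a i x - max 1 (inflow v a i x))) (at x within {0..})"
proof -
  have "(surplus_drift has_real_derivative
     c * (killing i / c * (next_slope v a i x - max 1 (inflow v a i x))) - killing i * next_slope v a i x
     + ((\<Sum>j\<in>{1..n} - {i}. lam i j * v j x) + lam i (n+1) * claim_slope v a x)) (at x within {0..})"
    unfolding surplus_drift_def
    by (rule derivative_eq_intros half_line_antiderivative claim_slope_cont next_slope_cont[OF i]
        next_slope_deriv[OF i x] val_deriv x refl DERIV_sum | force simp: mult.commute)+
  moreover have "(\<Sum>j\<in>{1..n} - {i}. lam i j * v j x) + lam i (n+1) * claim_slope v a x = killing i * inflow v a i x"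
    using killing_pos[OF i] by (simp add: inflow_def)
  ultimately show ?thesis using c_pos by (simp add: algebra_simps)
qed

text \<open>\<open>next_base\<close> makes the drift vanish at zero, and its derivative vanishes as
  long as the inflow exceeds one.\<close>

lemma surplus_drift_below: "0 \<le> x \<Longrightarrow> x \<le> level v a i \<Longrightarrow> surplus_drift x = 0"
  using half_line_constant[OF surplus_drift_deriv, of 0 x] level_props(3) surplus_drift_0
  by (auto simp: max_absorb2 less_imp_le)

text \<open>The difference between the value and \<open>x\<close> increases up to the level and is
  constant beyond, so the level is the worst point. There the slope is one and the drift zero, and
  the premium rate is \<open>c = \<delta> * (c / \<delta>)\<close>, exactly what discounting takes
  from \<open>c / \<delta>\<close>.\<close>

lemma next_val_le:
  assumes x: "0 \<le> x"
  shows "next_base v a i + integral {0..x} (next_slope v a i) \<le> x + c / \<delta>"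
proof -
  let ?V = "\<lambda>x. next_base v a i + integral {0..x} (next_slope v a i)"
  let ?b = "level v a i"
  have b: "0 \<le> ?b" by (rule level_props)
  have d: "((\<lambda>x. ?V x - x) has_real_derivative next_slope v a i x - 1) (at x within {0..})" if "0 \<le> x" for x
    by (rule derivative_eq_intros half_line_antiderivative next_slope_cont[OF i] that refl | simp)+
  have "killing i * ?V ?b = c + ((\<Sum>j\<in>{1..n} - {i}. lam i j * val v a j ?b)
      + lam i (n+1) * integral {0..?b} (claim_slope v a))"
    using surplus_drift_below[OF b order_refl] next_slope_eq1[OF order_refl]
    by (simp add: surplus_drift_def)
  also have "\<dots> \<le> c + ((\<Sum>j\<in>{1..n} - {i}. lam i j * (?b + c / \<delta>)) + lam i (n+1) * (?b + c / \<delta>))"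
    by (intro add_mono sum_mono mult_left_mono lam_nonneg'[OF i] adm_val integral_claim_slope_le b) auto
  also have "\<dots> = c + total i * (?b + c / \<delta>)"
    by (simp add: total_def sum_distrib_right distrib_right)
  also have "\<dots> \<le> killing i * (?b + c / \<delta>)"
    using \<delta>_pos b by (simp add: killing_def algebra_simps)
  finally have Vb: "?V ?b \<le> ?b + c / \<delta>" using killing_pos[OF i] by simp
  have "?V x - x \<le> ?V ?b - ?b"
  proof (cases "x \<le> ?b")
    case True
    show ?thesis by (rule half_line_mono[OF d x True]) (use x next_slope_ge1[OF i] in auto)
  next
    case False
    have "?V x - x = ?V ?b - ?b"
      by (rule half_line_constant[OF d b]) (use False next_slope_eq1 in auto)
    then show ?thesis by simp
  qed
  with Vb show ?thesis by simp
qed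

end

lemma next_base_nonneg: "i \<in> {1..n} \<Longrightarrow> 0 \<le> next_base v a i"
  unfolding next_base_def using killing_pos c_pos next_slope_ge1[of i 0]
  by (intro divide_nonneg_pos add_nonneg_nonneg sum_nonneg mult_nonneg_nonneg lam_nonneg' adm_base) auto

text \<open>The new slopes are bounded in terms of the old base; growth of the base turns this into
  the bound by the new one.\<close>

lemma admissible_next:
  assumes "\<And>i. i \<in> {1..n} \<Longrightarrow> a i \<le> next_base v a i"
  shows "admissible (next_slope v a) (next_base v a)"
  unfolding admissible_def
proof (intro ballI conjI allI impI)
  fix i x y assume i: "i \<in> {1..n}"
  show "continuous_on {0..} (next_slope v a i)" by (rule next_slope_cont[OF i])
  assume x: "0 \<le> (x::real)"
  show "1 \<le> next_slope v a i x" by (rule next_slope_ge1[OF i x])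
  have "\<beta> * mix a \<le> \<beta> * mix (next_base v a)" using \<beta>_pos assms by (intro mult_left_mono mix_mono) auto
  then show "next_slope v a i x \<le> max 1 (\<beta> * mix (next_base v a))"
    using next_slope_bound[OF i x] by linarith
  show "val (next_slope v a) (next_base v a) i x \<le> x + c / \<delta>"
    using next_val_le[OF i x] by (simp add: val_def)
  show "next_slope v a i y \<le> next_slope v a i x" if "x \<le> y" by (rule next_slope_anti[OF i x that])
qed (rule next_base_nonneg)

end

lemma claim_slope_mono:
  assumes "admissible v a" "admissible w e" "0 \<le> x"
    and "\<And>i x. i \<in> {1..n} \<Longrightarrow> 0 \<le> x \<Longrightarrow> v i x \<le> w i x" "\<And>i. i \<in> {1..n} \<Longrightarrow> a i \<le> e i"
  shows "claim_slope v a x \<le> claim_slope w e x"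
  unfolding claim_slope_def
  using \<beta>_pos assms
  by (intro claim_average_mono mix_slope_cont[OF assms(1)] mix_slope_cont[OF assms(2)] mix_mono max.mono mult_left_mono)
     auto

lemma next_mono:
  assumes "admissible v a" "admissible w e" "i \<in> {1..n}"
    and le: "\<And>i x. i \<in> {1..n} \<Longrightarrow> 0 \<le> x \<Longrightarrow> v i x \<le> w i x" "\<And>i. i \<in> {1..n} \<Longrightarrow> a i \<le> e i"
  shows "0 \<le> x \<Longrightarrow> next_slope v a i x \<le> next_slope w e i x" "next_base v a i \<le> next_base w e i"
proof -
  have "inflow v a i x \<le> inflow w e i x" if "0 \<le> x" for x
    unfolding inflow_def using killing_pos[OF assms(3)] lam_nonneg'[OF assms(3)] that
    by (intro divide_right_mono add_mono sum_mono mult_left_mono le claim_slope_mono assms(1,2)) auto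
  then show *: "next_slope v a i x \<le> next_slope w e i x" if "0 \<le> x" for x
    unfolding next_slope_def using that
    by (intro resolvent_mono[OF rate_pos[OF assms(1,3)] that target_cont[OF assms(1,3)] target_abs[OF assms(1,3)]
         target_cont[OF assms(2,3)] target_abs[OF assms(2,3)]] max.mono) auto
  show "next_base v a i \<le> next_base w e i"
    unfolding next_base_def using *[of 0] killing_pos[OF assms(3)] c_pos lam_nonneg'[OF assms(3)] le
    by (intro divide_right_mono add_mono sum_mono mult_left_mono) auto
qed

end

section \<open>Monotone iteration and its limit\<close>

context hjb_system begin

text \<open>The start is the smallest admissible pair, so the first step cannot decrease it, and
  monotonicity of the step carries this on.\<close>

fun iter :: "nat \<Rightarrow> (nat \<Rightarrow> real \<Rightarrow> real) \<times> (nat \<Rightarrow> real)" where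
  "iter 0 = (\<lambda>_ _. 1, \<lambda>_. 0)"
| "iter (Suc k) = (next_slope (fst (iter k)) (snd (iter k)), next_base (fst (iter k)) (snd (iter k)))"

abbreviation "slope k \<equiv> fst (iter k)"
abbreviation "base k \<equiv> snd (iter k)"

lemma iter_admissible:
  "admissible (slope k) (base k) \<and> (\<forall>i\<in>{1..n}. base k i \<le> base (Suc k) i \<and> (\<forall>x\<ge>0. slope k i x \<le> slope (Suc k) i x))"
proof (induction k)
  case 0
  have "admissible (\<lambda>_ _. 1) (\<lambda>_. 0)"
    using c_pos \<delta>_pos by (auto simp: admissible_def val_def)
  then show ?case by (auto intro: next_base_nonneg next_slope_ge1)
next
  case (Suc k)
  have "admissible (slope (Suc k)) (base (Suc k))"
    using Suc admissible_next[of "slope k" "base k"] by auto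
  then show ?case
    using next_mono[of "slope k" "base k" "slope (Suc k)" "base (Suc k)"] Suc by auto
qed

lemma iter_bounds:
  assumes "i \<in> {1..n}"
  shows "0 \<le> base k i" "base k i \<le> c / \<delta>" "0 \<le> x \<Longrightarrow> 1 \<le> slope k i x"
    "0 \<le> x \<Longrightarrow> slope k i x \<le> max 1 (\<beta> * (c / \<delta>))"
proof -
  have adm: "admissible (slope k) (base k)" using iter_admissible by blast
  have le: "base k j \<le> c / \<delta>" if "j \<in> {1..n}" for j
    using adm_val[OF adm that, of 0] by (simp add: val_def)
  show "0 \<le> base k i" "base k i \<le> c / \<delta>" "0 \<le> x \<Longrightarrow> 1 \<le> slope k i x"
    using adm_base[OF adm assms] adm_ge1[OF adm assms] le[OF assms] by auto
  have "\<beta> * mix (base k) \<le> \<beta> * (c / \<delta>)" using \<beta>_pos le by (intro mult_left_mono mix_le) auto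
  then show "0 \<le> x \<Longrightarrow> slope k i x \<le> max 1 (\<beta> * (c / \<delta>))"
    using adm_le[OF adm assms, of x] by linarith
qed

definition vlim :: "nat \<Rightarrow> real \<Rightarrow> real" where "vlim i x = lim (\<lambda>k. slope k i x)"
definition alim :: "nat \<Rightarrow> real" where "alim i = lim (\<lambda>k. base k i)"

lemma iter_incseq: "i \<in> {1..n} \<Longrightarrow> incseq (\<lambda>k. base k i)"
  "i \<in> {1..n} \<Longrightarrow> 0 \<le> x \<Longrightarrow> incseq (\<lambda>k. slope k i x)"
  using iter_admissible by (auto intro!: incseq_SucI)

lemma slope_tendsto: "i \<in> {1..n} \<Longrightarrow> 0 \<le> x \<Longrightarrow> (\<lambda>k. slope k i x) \<longlonglongrightarrow> vlim i x"
  unfolding vlim_def using iter_bounds(4)[of i x] iter_incseq(2)[of i x]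
  by (metis convergent_LIMSEQ_iff incseq_convergent convergentI)

lemma base_tendsto: "i \<in> {1..n} \<Longrightarrow> (\<lambda>k. base k i) \<longlonglongrightarrow> alim i"
  unfolding alim_def using iter_bounds(2)[of i] iter_incseq(1)[of i]
  by (metis convergent_LIMSEQ_iff incseq_convergent convergentI)

text \<open>After one step a slope solves its differential equation, whose right-hand side is
  bounded uniformly in \<open>k\<close> because slope and target both lie between one and a common
  bound. This makes the pointwise limit continuous.\<close>

lemma slope_lipschitz:
  assumes i: "i \<in> {1..n}" and xy: "0 \<le> x" "x \<le> y"
  shows "\<bar>slope (Suc k) i y - slope (Suc k) i x\<bar> \<le> killing i / c * max 1 (\<beta> * (c / \<delta>)) * (y - x)"
proof (cases "x < y")
  case True
  let ?K = "max 1 (\<beta> * (c / \<delta>))"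
  have adm: "admissible (slope k) (base k)" using iter_admissible by blast
  obtain z where z: "x < z" "slope (Suc k) i y - slope (Suc k) i x =
     killing i / c * (slope (Suc k) i z - max 1 (inflow (slope k) (base k) i z)) * (y - x)"
    using mvt_half_line[OF xy(1) True next_slope_deriv[OF adm i]] by auto
  have "1 \<le> slope (Suc k) i z" "slope (Suc k) i z \<le> ?K"
    using iter_bounds(3,4)[OF i, of z "Suc k"] z xy by (auto simp del: max.bounded_iff)
  moreover have "max 1 (inflow (slope k) (base k) i z) \<le> ?K"
  proof -
    have "\<beta> * mix (base k) \<le> \<beta> * (c / \<delta>)"
      using \<beta>_pos iter_bounds(2) by (intro mult_left_mono mix_le) auto
    then show ?thesis using inflow_bound[OF adm i, of z] z xy by linarith
  qed
  ultimately have "\<bar>slope (Suc k) i z - max 1 (inflow (slope k) (base k) i z)\<bar> \<le> ?K"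
    by linarith
  then show ?thesis
    using True rate_pos[OF adm i] unfolding z(2) abs_mult by (intro mult_mono mult_nonneg_nonneg) auto
qed (use xy in auto)

lemma vlim_cont: assumes i: "i \<in> {1..n}" shows "continuous_on {0..} (vlim i)"
proof -
  define L where "L = killing i / c * max 1 (\<beta> * (c / \<delta>))"
  have L: "0 \<le> L" using killing_pos[OF i] c_pos by (simp add: L_def)
  have *: "\<bar>vlim i y - vlim i x\<bar> \<le> L * (y - x)" if "0 \<le> x" "x \<le> y" for x y
  proof (rule LIMSEQ_le_const2)
    show "(\<lambda>k. \<bar>slope (Suc k) i y - slope (Suc k) i x\<bar>) \<longlonglongrightarrow> \<bar>vlim i y - vlim i x\<bar>"
      by (intro tendsto_intros LIMSEQ_Suc slope_tendsto i) (use that in auto)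
    show "\<exists>N. \<forall>k\<ge>N. \<bar>slope (Suc k) i y - slope (Suc k) i x\<bar> \<le> L * (y - x)"
      using slope_lipschitz[OF i that] by (auto simp: L_def)
  qed
  have "L-lipschitz_on {0..} (vlim i)"
  proof (rule lipschitz_onI[OF _ L])
    fix x y :: real assume xy: "x \<in> {0..}" "y \<in> {0..}"
    consider "x \<le> y" | "y \<le> x" by linarith
    then show "dist (vlim i x) (vlim i y) \<le> L * dist x y"
      using *[of x y] *[of y x] xy by cases (auto simp: dist_real_def abs_minus_commute)
  qed
  then show ?thesis by (rule lipschitz_on_continuous_on)
qed

lemma vlim_bounds:
  assumes "i \<in> {1..n}" "0 \<le> x" shows "1 \<le> vlim i x" "vlim i x \<le> max 1 (\<beta> * (c / \<delta>))"
  by (rule LIMSEQ_le_const[OF slope_tendsto[OF assms]], use iter_bounds(3)[OF assms(1)] assms(2) in blast)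
     (rule LIMSEQ_le_const2[OF slope_tendsto[OF assms]], use iter_bounds(4)[OF assms(1)] assms(2) in blast)

lemma mix_tendsto: "(\<And>i. i \<in> {1..n} \<Longrightarrow> (\<lambda>k. u k i) \<longlonglongrightarrow> w i) \<Longrightarrow> (\<lambda>k. mix (u k)) \<longlonglongrightarrow> mix w"
  unfolding mix_def by (intro tendsto_intros)

lemma integral_slope_tendsto:
  assumes "i \<in> {1..n}" "0 \<le> x"
  shows "(\<lambda>k. integral {0..x} (slope k i)) \<longlonglongrightarrow> integral {0..x} (vlim i)"
proof (rule dominated_convergence(2))
  show "slope k i integrable_on {0..x}" for k
    by (intro integrable_continuous_interval
        continuous_on_subset[OF adm_cont[OF conjunct1[OF iter_admissible] assms(1)]]) auto
  show "(\<lambda>_. max 1 (\<beta> * (c / \<delta>))) integrable_on {0..x}" by auto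
  show "norm (slope k i y) \<le> max 1 (\<beta> * (c / \<delta>))" if "y \<in> {0..x}" for k y
    using iter_bounds(3,4)[OF assms(1), of y k] that by (auto simp del: max.bounded_iff)
qed (use assms slope_tendsto in auto)

lemma lim_admissible: "admissible vlim alim"
  unfolding admissible_def
proof (intro ballI conjI allI impI)
  fix i x y assume i: "i \<in> {1..n}"
  show "continuous_on {0..} (vlim i)" by (rule vlim_cont[OF i])
  show "0 \<le> alim i"
    by (rule LIMSEQ_le_const[OF base_tendsto[OF i]]) (use iter_bounds(1)[OF i] in auto)
  assume x: "0 \<le> (x::real)"
  show "1 \<le> vlim i x" by (rule vlim_bounds[OF i x])
  show "vlim i x \<le> max 1 (\<beta> * mix alim)"
  proof (rule LIMSEQ_le[OF slope_tendsto[OF i x]])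
    show "(\<lambda>k. max 1 (\<beta> * mix (base k))) \<longlonglongrightarrow> max 1 (\<beta> * mix alim)"
      by (intro tendsto_intros mix_tendsto base_tendsto)
    show "\<exists>N. \<forall>k\<ge>N. slope k i x \<le> max 1 (\<beta> * mix (base k))"
      using iter_admissible adm_le i x by blast
  qed
  show "val vlim alim i x \<le> x + c / \<delta>"
  proof (rule LIMSEQ_le_const2)
    show "(\<lambda>k. val (slope k) (base k) i x) \<longlonglongrightarrow> val vlim alim i x"
      unfolding val_def by (intro tendsto_intros base_tendsto integral_slope_tendsto i x)
    show "\<exists>N. \<forall>k\<ge>N. val (slope k) (base k) i x \<le> x + c / \<delta>"
      using iter_admissible adm_val i x by blast
  qed
  show "vlim i y \<le> vlim i x" if "x \<le> y"
  proof (rule LIMSEQ_le[OF slope_tendsto[OF i] slope_tendsto[OF i]])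
    show "\<exists>N. \<forall>k\<ge>N. slope k i y \<le> slope k i x"
      using iter_admissible adm_anti i x that by blast
  qed (use x that in auto)
qed

lemma claim_slope_tendsto:
  assumes x: "0 \<le> x"
  shows "(\<lambda>k. claim_slope (slope k) (base k) x) \<longlonglongrightarrow> claim_slope vlim alim x"
proof -
  have "(\<lambda>k. integral {0..x} (\<lambda>u. \<beta> * exp (\<beta> * u) * mix (\<lambda>j. slope k j u)))
      \<longlonglongrightarrow> integral {0..x} (\<lambda>u. \<beta> * exp (\<beta> * u) * mix (\<lambda>j. vlim j u))"
  proof (rule dominated_convergence(2))
    show "(\<lambda>u. \<beta> * exp (\<beta> * u) * mix (\<lambda>j. slope k j u)) integrable_on {0..x}" for k
      by (intro integrable_continuous_interval continuous_intros
          continuous_on_subset[OF mix_slope_cont[OF conjunct1[OF iter_admissible]]]) auto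
    show "(\<lambda>u. \<beta> * exp (\<beta> * u) * max 1 (\<beta> * (c / \<delta>))) integrable_on {0..x}"
      by (intro integrable_continuous_interval continuous_intros)
    show "norm (\<beta> * exp (\<beta> * u) * mix (\<lambda>j. slope k j u)) \<le> \<beta> * exp (\<beta> * u) * max 1 (\<beta> * (c / \<delta>))"
      if u: "u \<in> {0..x}" for k u
    proof -
      have "1 \<le> mix (\<lambda>j. slope k j u)" "mix (\<lambda>j. slope k j u) \<le> max 1 (\<beta> * (c / \<delta>))"
        using iter_bounds(3,4) u by (auto intro!: mix_le mix_ge simp del: max.bounded_iff)
      then show ?thesis using \<beta>_pos by (auto simp: abs_mult intro!: mult_left_mono simp del: max.bounded_iff)
    qed
    show "(\<lambda>k. \<beta> * exp (\<beta> * u) * mix (\<lambda>j. slope k j u)) \<longlonglongrightarrow> \<beta> * exp (\<beta> * u) * mix (\<lambda>j. vlim j u)"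
      if "u \<in> {0..x}" for u
      by (intro tendsto_intros mix_tendsto slope_tendsto) (use that in auto)
  qed
  then show ?thesis unfolding claim_slope_def claim_average_def
    by (intro tendsto_intros mix_tendsto base_tendsto)
qed

lemma inflow_tendsto:
  assumes "i \<in> {1..n}" "0 \<le> x"
  shows "(\<lambda>k. inflow (slope k) (base k) i x) \<longlonglongrightarrow> inflow vlim alim i x"
  unfolding inflow_def using killing_pos[OF assms(1)] assms(2)
  by (intro tendsto_intros slope_tendsto claim_slope_tendsto) auto

text \<open>The targets converge pointwise below a common bound, so the resolvent integral passes to
  the limit by dominated convergence.\<close>

lemma vlim_fixpoint:
  assumes i: "i \<in> {1..n}" and x: "0 \<le> x"
  shows "next_slope vlim alim i x = vlim i x"
proof -
  let ?th = "killing i / c" let ?K = "max 1 (\<beta> * (c / \<delta>))"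
  have th: "?th > 0" using killing_pos[OF i] c_pos by simp
  have "(\<lambda>k. integral {x..} (\<lambda>u. exp (- ?th * u) * max 1 (inflow (slope k) (base k) i u)))
      \<longlonglongrightarrow> integral {x..} (\<lambda>u. exp (- ?th * u) * max 1 (inflow vlim alim i u))"
  proof (rule dominated_convergence(2))
    fix k
    have adm: "admissible (slope k) (base k)" using iter_admissible by blast
    show "(\<lambda>u. exp (- ?th * u) * max 1 (inflow (slope k) (base k) i u)) integrable_on {x..}"
      by (rule resolvent_integrable[OF th target_cont[OF adm i] target_abs[OF adm i] x])
    fix u assume u: "u \<in> {x..}"
    have "\<beta> * mix (base k) \<le> \<beta> * (c / \<delta>)"
      using \<beta>_pos iter_bounds(2) by (intro mult_left_mono mix_le) auto
    then have "\<bar>max 1 (inflow (slope k) (base k) i u)\<bar> \<le> ?K"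
      using target_abs[OF adm i, of u] u x by (smt (verit) atLeast_iff)
    then show "norm (exp (- ?th * u) * max 1 (inflow (slope k) (base k) i u)) \<le> exp (- ?th * u) * ?K"
      by (simp add: abs_mult del: max.bounded_iff)
  next
    show "(\<lambda>u. exp (- ?th * u) * ?K) integrable_on {x..}"
      using integrable_on_exp_minus_to_infinity[OF th] by (intro integrable_on_mult_left)
    show "(\<lambda>k. exp (- ?th * u) * max 1 (inflow (slope k) (base k) i u))
        \<longlonglongrightarrow> exp (- ?th * u) * max 1 (inflow vlim alim i u)" if "u \<in> {x..}" for u
      by (intro tendsto_intros inflow_tendsto i) (use that x in auto)
  qed
  then have "(\<lambda>k. next_slope (slope k) (base k) i x) \<longlonglongrightarrow> next_slope vlim alim i x"
    unfolding next_slope_def resolvent_def by (intro tendsto_intros)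
  moreover have "(\<lambda>k. next_slope (slope k) (base k) i x) \<longlonglongrightarrow> vlim i x"
    using LIMSEQ_Suc[OF slope_tendsto[OF i x]] by simp
  ultimately show ?thesis by (rule LIMSEQ_unique)
qed

lemma alim_fixpoint:
  assumes i: "i \<in> {1..n}" shows "killing i * alim i = c * vlim i 0 + (\<Sum>j\<in>{1..n} - {i}. lam i j * alim j)"
proof -
  have "(\<lambda>k. (c * slope (Suc k) i 0 + (\<Sum>j\<in>{1..n} - {i}. lam i j * base k j)) / killing i) \<longlonglongrightarrow>
     (c * vlim i 0 + (\<Sum>j\<in>{1..n} - {i}. lam i j * alim j)) / killing i"
    using killing_pos[OF i] by (intro tendsto_intros LIMSEQ_Suc slope_tendsto base_tendsto i) auto
  moreover have "(\<lambda>k. base (Suc k) i) \<longlonglongrightarrow> alim i"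
    by (rule LIMSEQ_Suc[OF base_tendsto[OF i]])
  ultimately have "alim i = (c * vlim i 0 + (\<Sum>j\<in>{1..n} - {i}. lam i j * alim j)) / killing i"
    by (intro LIMSEQ_unique) (auto simp: next_base_def)
  then show ?thesis using killing_pos[OF i] by (simp add: field_simps)
qed

lemma vlim_deriv:
  assumes "i \<in> {1..n}" "0 \<le> x"
  shows "(vlim i has_real_derivative killing i / c * (vlim i x - max 1 (inflow vlim alim i x))) (at x within {0..})"
  by (rule has_field_derivative_transform_within[OF next_slope_deriv[OF lim_admissible assms, unfolded vlim_fixpoint[OF assms]]
        zero_less_one])
     (use assms vlim_fixpoint in auto)

text \<open>
  If the inflow were equal to one on an interval, then all slopes contributing to it, directly or
  through further transitions, would be constant there, and the largest of these constants, which
  exceeds one, would contradict discounting.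
\<close>

lemma inflow_not_flat:
  assumes i: "i \<in> {1..n}" and pq: "0 \<le> p" "p < q"
    and eq1: "\<And>x. p < x \<Longrightarrow> x < q \<Longrightarrow> inflow vlim alim i x = 1"
  shows False
proof -
  note adm = lim_admissible
  let ?S = "claim_slope vlim alim"
  define flat where "flat f \<longleftrightarrow> (\<forall>x y. p < x \<longrightarrow> x < y \<longrightarrow> y < q \<longrightarrow> f x = f y)" for f :: "real \<Rightarrow> real"
  define mid where "mid = (p + q) / 2"
  have mid: "p < mid" "mid < q" using pq by (auto simp: mid_def field_simps)
  have flat_mid: "f x = f mid" if "flat f" "p < x" "x < q" for f x
    using that mid unfolding flat_def by (metis linorder_neqE_linordered_idom)
  have flat_deriv: "d = 0"
    if f: "flat f" and x: "p < x" "x < q" and d: "(f has_real_derivative d) (at x within {0..})" for f x d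
  proof -
    have "(f has_real_derivative d) (at x)"
      using d x pq by (subst (asm) at_within_interior) auto
    moreover have "\<forall>y. \<bar>x - y\<bar> < min (x - p) (q - x) \<longrightarrow> f x = f y"
    proof (intro allI impI)
      fix y assume "\<bar>x - y\<bar> < min (x - p) (q - x)"
      then have "p < y" "y < q" by auto
      then show "f x = f y" using flat_mid[OF f] x by metis
    qed
    ultimately show ?thesis using DERIV_local_const[of f d x "min (x - p) (q - x)"] x by auto
  qed
  \<comment> \<open>The inflow is a sum of nonincreasing terms, so it can be constant only if every
    term with positive weight is.\<close>
  have flat_inflow: "(\<forall>l\<in>{1..n} - {j}. lam j l > 0 \<longrightarrow> flat (vlim l)) \<and> (lam j (n+1) > 0 \<longrightarrow> flat ?S)"
    if j: "j \<in> {1..n}" and k: "\<And>x. p < x \<Longrightarrow> x < q \<Longrightarrow> inflow vlim alim j x = k" for j k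
  proof -
    have eq: "(\<forall>l\<in>{1..n} - {j}. lam j l * (vlim l x - vlim l y) = 0) \<and> lam j (n+1) * (?S x - ?S y) = 0"
      if xy: "p < x" "x < y" "y < q" for x y
    proof -
      have "inflow vlim alim j x = inflow vlim alim j y" using k xy by auto
      then have "(\<Sum>l\<in>{1..n} - {j}. lam j l * (vlim l x - vlim l y)) + lam j (n+1) * (?S x - ?S y) = 0"
        using killing_pos[OF j] by (simp add: inflow_def sum_subtractf right_diff_distrib)
      moreover have nn: "0 \<le> lam j l * (vlim l x - vlim l y)" if "l \<in> {1..n} - {j}" for l
        using lam_nonneg'(2)[OF j that] adm_anti[OF adm, of l x y] that xy pq by auto
      moreover have "0 \<le> lam j (n+1) * (?S x - ?S y)"
        using lam_nonneg'(1)[OF j] claim_slope_anti[OF adm, of x y] xy pq by auto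
      moreover have "0 \<le> (\<Sum>l\<in>{1..n} - {j}. lam j l * (vlim l x - vlim l y))" by (intro sum_nonneg nn)
      ultimately have "(\<Sum>l\<in>{1..n} - {j}. lam j l * (vlim l x - vlim l y)) = 0" "lam j (n+1) * (?S x - ?S y) = 0"
        by linarith+
      then show ?thesis using nn by (subst (asm) sum_nonneg_eq_0_iff) auto
    qed
    show ?thesis unfolding flat_def
    proof (intro conjI ballI impI allI)
      fix l x y assume "l \<in> {1..n} - {j}" "0 < lam j l" "p < x" "x < y" "y < q"
      then show "vlim l x = vlim l y" using eq[of x y] by force
    next
      fix x y assume "0 < lam j (n+1)" "p < x" "x < y" "y < q"
      then show "?S x = ?S y" using eq[of x y] by force
    qed
  qed
  \<comment> \<open>A flat slope has zero derivative and thus equals its target; being above one, it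
    equals the inflow itself.\<close>
  have flat_v: "inflow vlim alim j x = vlim j mid"
    if j: "j \<in> {1..n}" and f: "flat (vlim j)" and gt: "vlim j mid > 1" and x: "p < x" "x < q" for j x
  proof -
    have "killing j / c * (vlim j x - max 1 (inflow vlim alim j x)) = 0"
      by (rule flat_deriv[OF f x vlim_deriv[OF j]]) (use x pq in auto)
    then have "vlim j x = max 1 (inflow vlim alim j x)" using killing_pos[OF j] c_pos by auto
    then show ?thesis using flat_mid[OF f x] gt by (auto simp: max_def split: if_splits)
  qed
  \<comment> \<open>The constant values of all slopes, of phases and of the claim, that are flat on
    the interval; evaluation at \<open>mid\<close> represents the whole interval.\<close>
  define M where "M = {vlim j mid | j. j \<in> {1..n} \<and> flat (vlim j)} \<union> (if flat ?S then {?S mid} else {})"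
  have finM: "finite M" unfolding M_def by auto
  have le_total: "killing j * inflow vlim alim j mid \<le> total j * k"
    if j: "j \<in> {1..n}" and k: "\<And>u. u \<in> M \<Longrightarrow> u \<le> k"
      and kk: "\<And>x. p < x \<Longrightarrow> x < q \<Longrightarrow> inflow vlim alim j x = k'" for j k k'
  proof -
    note fl = flat_inflow[OF j kk]
    have "lam j l * vlim l mid \<le> lam j l * k" if l: "l \<in> {1..n} - {j}" for l
    proof (cases "lam j l = 0")
      case False
      then have "lam j l > 0" using lam_nonneg'(2)[OF j l] by simp
      then have "flat (vlim l)" using fl l by blast
      then have "vlim l mid \<in> M" using l by (auto simp: M_def)
      then show ?thesis using k lam_nonneg'(2)[OF j l] by (intro mult_left_mono)
    qed simp
    then have "(\<Sum>l\<in>{1..n} - {j}. lam j l * vlim l mid) \<le> (\<Sum>l\<in>{1..n} - {j}. lam j l * k)"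
      by (rule sum_mono)
    moreover have "lam j (n+1) * ?S mid \<le> lam j (n+1) * k"
    proof (cases "lam j (n+1) = 0")
      case False
      then have "lam j (n+1) > 0" using lam_nonneg'(1)[OF j] by simp
      then have "?S mid \<in> M" using fl by (auto simp: M_def)
      then show ?thesis using k lam_nonneg'(1)[OF j] by (intro mult_left_mono)
    qed simp
    ultimately show ?thesis
      using killing_pos[OF j] by (simp add: inflow_def total_def sum_distrib_right distrib_right)
  qed
  \<comment> \<open>Otherwise the inflow one would be a combination, of total weight
    \<open>total i / killing i < 1\<close>, of numbers at most one.\<close>
  have "\<exists>u\<in>M. 1 < u"
  proof (rule ccontr)
    assume "\<not> ?thesis"
    then have "killing i * inflow vlim alim i mid \<le> total i * 1"
      by (intro le_total[OF i _ eq1]) auto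
    then show False using eq1[OF mid] \<delta>_pos by (simp add: killing_def)
  qed
  then have Mne: "M \<noteq> {}" and M1: "1 < Max M"
    using finM by (auto intro: less_le_trans[OF _ Max_ge])
  \<comment> \<open>A phase cannot carry the maximum: its inflow would have to equal
    \<open>Max M\<close>, while all contributions are at most \<open>Max M\<close> and discounting
    removes a positive part.\<close>
  have no_v: False if j: "j \<in> {1..n}" and f: "flat (vlim j)" and m: "vlim j mid = Max M" for j
  proof -
    have "killing j * inflow vlim alim j mid \<le> total j * Max M"
      using flat_v[OF j f] M1 m by (intro le_total[OF j _, where k'="Max M"]) (auto simp: finM)
    moreover have "inflow vlim alim j mid = Max M" using flat_v[OF j f _ mid] M1 m by simp
    moreover have "0 < \<delta> * Max M" using \<delta>_pos M1 by simp
    ultimately show False by (simp add: killing_def distrib_right)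
  qed
  have "Max M \<in> M" using finM Mne by simp
  then consider j where "j \<in> {1..n}" "flat (vlim j)" "vlim j mid = Max M" | "flat ?S" "?S mid = Max M"
    unfolding M_def by (auto split: if_splits)
  then show False
  proof cases
    case 2
    \<comment> \<open>If the claim slope carries the maximum, its equation makes the mixture of the
      phase slopes equal to it; then some phase with positive restart probability is flat with the
      same value, the case already excluded.\<close>
    have mixS: "mix (\<lambda>j. vlim j x) = Max M" if x: "p < x" "x < q" for x
    proof -
      have "\<beta> * (mix (\<lambda>j. vlim j x) - ?S x) = 0"
        by (rule flat_deriv[OF 2(1) x claim_slope_deriv[OF adm]]) (use x pq in auto)
      then show ?thesis using \<beta>_pos flat_mid[OF 2(1) x] 2(2) by simp
    qed
    have fl: "flat (vlim j)" if j: "j \<in> {1..n}" "\<pi> j > 0" for j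
      unfolding flat_def
    proof (intro allI impI)
      fix x y assume xy: "p < x" "x < y" "y < q"
      have "(\<Sum>l=1..n. \<pi> l * (vlim l x - vlim l y)) = 0"
        using mixS[of x] mixS[of y] xy by (simp add: mix_def sum_subtractf right_diff_distrib)
      moreover have "0 \<le> \<pi> l * (vlim l x - vlim l y)" if "l \<in> {1..n}" for l
        using \<pi>_nonneg[OF that] adm_anti[OF adm that, of x y] xy pq by auto
      ultimately have "\<pi> j * (vlim j x - vlim j y) = 0"
        using j(1) by (subst (asm) sum_nonneg_eq_0_iff) auto
      then show "vlim j x = vlim j y" using j(2) by simp
    qed
    have "\<exists>j\<in>{1..n}. \<pi> j > 0 \<and> vlim j mid \<ge> Max M"
    proof (rule ccontr)
      assume neg: "\<not> ?thesis"
      have "(\<Sum>l=1..n. \<pi> l * (Max M - vlim l mid)) = 0"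
        using mixS[OF mid] \<pi>_sum by (simp add: mix_def sum_subtractf right_diff_distrib flip: sum_distrib_right)
      moreover have nn: "0 \<le> \<pi> l * (Max M - vlim l mid)" if "l \<in> {1..n}" for l
      proof (cases "\<pi> l = 0")
        case False
        then have "0 < \<pi> l" using \<pi>_nonneg[OF that] by simp
        then show ?thesis using neg that by (force simp: not_le intro!: mult_nonneg_nonneg less_imp_le)
      qed simp
      ultimately have "\<pi> l * (Max M - vlim l mid) = 0" if "l \<in> {1..n}" for l
        using that by (subst (asm) sum_nonneg_eq_0_iff) auto
      then have "\<pi> l = 0" if "l \<in> {1..n}" for l using neg \<pi>_nonneg[OF that] that by force
      then show False using \<pi>_sum by simp
    qed
    then obtain j where j: "j \<in> {1..n}" "\<pi> j > 0" "vlim j mid \<ge> Max M" by blast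
    have "vlim j mid \<in> M" using fl[OF j(1,2)] j(1) by (auto simp: M_def)
    then have "vlim j mid = Max M" using j(3) finM by (intro antisym) auto
    then show False using no_v[OF j(1) fl[OF j(1,2)]] by simp
  qed (use no_v in blast)
qed

end

text \<open>The infinitesimal generator of the discounted, undividended surplus within one interclaim
  period, applied to the values \<open>\<phi>\<close> (with slopes \<open>\<phi>'\<close>) and the value \<open>\<psi>\<close> at the claim.\<close>

definition generator ::
  "nat \<Rightarrow> real \<Rightarrow> real \<Rightarrow> (nat \<Rightarrow> nat \<Rightarrow> real) \<Rightarrow> (nat \<Rightarrow> real \<Rightarrow> real) \<Rightarrow> (nat \<Rightarrow> real \<Rightarrow> real) \<Rightarrow> (real \<Rightarrow> real)
    \<Rightarrow> nat \<Rightarrow> real \<Rightarrow> real" where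
  "generator n c d lam \<phi> \<phi>' \<psi> i x = c * \<phi>' i x + (\<Sum>j\<in>{1..n} - {i}. lam i j * (\<phi> j x - \<phi> i x))
     + lam i (n+1) * (\<psi> x - \<phi> i x) - d * \<phi> i x"

section \<open>The solution and the sign of its generator\<close>

context hjb_system begin

lemma generator_eq:
  "generator n c \<delta> lam \<phi> \<phi>' \<psi> i x = c * \<phi>' i x - killing i * \<phi> i x
     + ((\<Sum>j\<in>{1..n} - {i}. lam i j * \<phi> j x) + lam i (n+1) * \<psi> x)"
proof -
  have "(\<Sum>j\<in>{1..n} - {i}. lam i j * (\<phi> j x - \<phi> i x))
      = (\<Sum>j\<in>{1..n} - {i}. lam i j * \<phi> j x) - (\<Sum>j\<in>{1..n} - {i}. lam i j) * \<phi> i x"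
    by (simp add: right_diff_distrib sum_subtractf sum_distrib_right)
  then show ?thesis by (simp add: generator_def killing_def total_def algebra_simps)
qed

abbreviation "opt_value \<equiv> val vlim alim"
abbreviation "opt_level \<equiv> level vlim alim"

text \<open>Ruin is worth nothing, so the value before a claim vanishes at zero and starts with
  slope \<open>\<beta> * mix alim\<close>, without the cut at one made in
  \<open>claim_slope\<close>. The two slopes agree when
  \<open>1 \<le> \<beta> * mix alim\<close>.\<close>

definition claim_value :: "real \<Rightarrow> real" where
  "claim_value x = integral {0..x} (claim_average \<beta> (\<beta> * mix alim) (\<lambda>x. mix (\<lambda>j. vlim j x)))"

lemmas lim_cont = mix_slope_cont[OF lim_admissible]

lemma true_claim_slope:
  assumes "0 \<le> x"
  shows "claim_average \<beta> (\<beta> * mix alim) (\<lambda>x. mix (\<lambda>j. vlim j x)) x \<le> claim_slope vlim alim x"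
    and "1 \<le> \<beta> * mix alim \<Longrightarrow> claim_average \<beta> (\<beta> * mix alim) (\<lambda>x. mix (\<lambda>j. vlim j x)) x = claim_slope vlim alim x"
    and "0 \<le> claim_average \<beta> (\<beta> * mix alim) (\<lambda>x. mix (\<lambda>j. vlim j x)) x"
proof -
  show "claim_average \<beta> (\<beta> * mix alim) (\<lambda>x. mix (\<lambda>j. vlim j x)) x \<le> claim_slope vlim alim x"
    unfolding claim_slope_def using assms \<beta>_pos by (intro claim_average_mono lim_cont) auto
  have "0 \<le> mix alim" by (rule mix_ge) (rule adm_base[OF lim_admissible])
  then show "0 \<le> claim_average \<beta> (\<beta> * mix alim) (\<lambda>x. mix (\<lambda>j. vlim j x)) x"
    using mix_slope_bounds(1)[OF lim_admissible] \<beta>_pos assms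
    by (intro claim_average_ge lim_cont) (auto intro: order_trans[of 0 1])
qed (simp add: claim_slope_def max_absorb2)

lemma claim_value_0: "claim_value 0 = 0"
  by (simp add: claim_value_def)

lemma claim_value_deriv':
  "0 \<le> x \<Longrightarrow> (claim_value has_real_derivative
     claim_average \<beta> (\<beta> * mix alim) (\<lambda>x. mix (\<lambda>j. vlim j x)) x) (at x within {0..})"
  unfolding claim_value_def
  by (intro half_line_antiderivative half_line_continuous[OF claim_average_deriv] lim_cont)

lemma claim_value_nonneg: "0 \<le> x \<Longrightarrow> 0 \<le> claim_value x"
  using half_line_mono[OF claim_value_deriv', of 0 x] true_claim_slope(3) claim_value_0 by simp

lemma mix_value_deriv:
  "0 \<le> x \<Longrightarrow> ((\<lambda>x. mix (\<lambda>j. opt_value j x)) has_real_derivative mix (\<lambda>j. vlim j x)) (at x within {0..})"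
  unfolding mix_def by (intro DERIV_sum DERIV_cmult val_deriv[OF lim_admissible])

text \<open>Both expressions for the slope have the same derivative and agree at zero. In this form
  \<open>claim_value\<close> is recognisable as the convolution of the mixed value with the
  exponential claim density.\<close>

lemma claim_value_deriv:
  assumes "0 \<le> x"
  shows "(claim_value has_real_derivative \<beta> * (mix (\<lambda>j. opt_value j x) - claim_value x)) (at x within {0..})"
proof -
  let ?s = "claim_average \<beta> (\<beta> * mix alim) (\<lambda>x. mix (\<lambda>j. vlim j x))"
  let ?d = "\<lambda>x. ?s x - \<beta> * (mix (\<lambda>j. opt_value j x) - claim_value x)"
  have "?d x = ?d 0"
  proof (rule half_line_constant[of ?d "\<lambda>x. \<beta> * (mix (\<lambda>j. vlim j x) - ?s x) - \<beta> * (mix (\<lambda>j. vlim j x) - ?s x)"])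
    show "(?d has_real_derivative \<beta> * (mix (\<lambda>j. vlim j y) - ?s y) - \<beta> * (mix (\<lambda>j. vlim j y) - ?s y)) (at y within {0..})"
      if "0 \<le> y" for y
      by (intro DERIV_diff DERIV_cmult claim_average_deriv lim_cont mix_value_deriv claim_value_deriv' that)
  qed (use assms in auto)
  then show ?thesis
    using claim_value_deriv'[OF assms] by (simp add: claim_value_0 val_def)
qed

lemma value_nonneg: "i \<in> {1..n} \<Longrightarrow> 0 \<le> x \<Longrightarrow> 0 \<le> opt_value i x"
proof -
  assume i: "i \<in> {1..n}" and x: "0 \<le> x"
  have "0 \<le> alim i" by (rule adm_base[OF lim_admissible i])
  also have "\<dots> = opt_value i 0" by (simp add: val_def)
  also have "\<dots> \<le> opt_value i x"
  proof (rule half_line_mono[OF val_deriv[OF lim_admissible i] order_refl x])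
    show "0 \<le> vlim i y" if "0 < y" for y
      using adm_ge1[OF lim_admissible i, of y] that by simp
  qed
  finally show ?thesis .
qed

lemma vlim_above: "i \<in> {1..n} \<Longrightarrow> opt_level i \<le> x \<Longrightarrow> vlim i x = 1"
  using next_slope_eq1[OF lim_admissible, of i x] level_props(1)[OF lim_admissible, of i]
    vlim_fixpoint[of i x] by simp

lemma vlim_below: "i \<in> {1..n} \<Longrightarrow> 0 \<le> x \<Longrightarrow> x < opt_level i \<Longrightarrow> 1 < vlim i x"
  using next_slope_gt1[OF lim_admissible, of i x] vlim_fixpoint[of i x] by simp

lemma opt_level_nonneg: "i \<in> {1..n} \<Longrightarrow> 0 \<le> opt_level i"
  by (rule level_props(1)[OF lim_admissible])

lemma vlim_deriv_opt_level:
  assumes "i \<in> {1..n}" shows "(vlim i has_real_derivative 0) (at (opt_level i) within {0..})"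
  using vlim_deriv[OF assms opt_level_nonneg[OF assms]] vlim_above[OF assms order_refl]
    level_props(2)[OF lim_admissible assms] by (simp add: max_absorb1)

text \<open>Replacing the cut claim slope by the true one can only lower the derivative. Where the
  inflow exceeds one, \<open>inflow_bound\<close> gives \<open>1 < \<beta> * mix alim\<close>, so
  the two claim slopes coincide.\<close>

lemma value_generator_deriv:
  assumes i: "i \<in> {1..n}" and x: "0 \<le> x"
  shows "\<exists>s. (generator n c \<delta> lam opt_value vlim claim_value i has_real_derivative s) (at x within {0..}) \<and>
     s \<le> killing i * (inflow vlim alim i x - max 1 (inflow vlim alim i x)) \<and>
     (1 < inflow vlim alim i x \<longrightarrow> s = 0)"
proof -
  let ?s = "claim_average \<beta> (\<beta> * mix alim) (\<lambda>x. mix (\<lambda>j. vlim j x))"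
  let ?g = "inflow vlim alim i x"
  have "generator n c \<delta> lam opt_value vlim claim_value i = (\<lambda>x. c * vlim i x - killing i * opt_value i x
     + ((\<Sum>j\<in>{1..n} - {i}. lam i j * opt_value j x) + lam i (n+1) * claim_value x))"
    by (simp add: fun_eq_iff generator_eq)
  moreover have "((\<lambda>x. c * vlim i x - killing i * opt_value i x
     + ((\<Sum>j\<in>{1..n} - {i}. lam i j * opt_value j x) + lam i (n+1) * claim_value x)) has_real_derivative
     c * (killing i / c * (vlim i x - max 1 ?g)) - killing i * vlim i x
     + ((\<Sum>j\<in>{1..n} - {i}. lam i j * vlim j x) + lam i (n+1) * ?s x)) (at x within {0..})"
    by (intro DERIV_add DERIV_diff DERIV_sum DERIV_cmult vlim_deriv val_deriv[OF lim_admissible]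
        claim_value_deriv' i x) auto
  moreover have "c * (killing i / c * (vlim i x - max 1 ?g)) - killing i * vlim i x
     + ((\<Sum>j\<in>{1..n} - {i}. lam i j * vlim j x) + lam i (n+1) * ?s x)
     = killing i * (?g - max 1 ?g) + lam i (n+1) * (?s x - claim_slope vlim alim x)"
  proof -
    have "killing i * ?g = (\<Sum>j\<in>{1..n} - {i}. lam i j * vlim j x) + lam i (n+1) * claim_slope vlim alim x"
      using killing_pos[OF i] by (simp add: inflow_def)
    then show ?thesis using c_pos by (simp add: algebra_simps)
  qed
  ultimately have "(generator n c \<delta> lam opt_value vlim claim_value i has_real_derivative
     killing i * (?g - max 1 ?g) + lam i (n+1) * (?s x - claim_slope vlim alim x)) (at x within {0..})"
    by simp
  moreover have "lam i (n+1) * (?s x - claim_slope vlim alim x) \<le> 0"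
    using lam_nonneg'(1)[OF i] true_claim_slope(1)[OF x] by (simp add: mult_nonneg_nonpos)
  moreover have "?s x = claim_slope vlim alim x" if "1 < ?g"
  proof (rule true_claim_slope(2)[OF x])
    show "1 \<le> \<beta> * mix alim"
    proof (rule ccontr)
      assume "\<not> 1 \<le> \<beta> * mix alim"
      then show False using inflow_bound[OF lim_admissible i x] that by simp
    qed
  qed
  ultimately show ?thesis by (intro exI conjI) auto
qed

lemma value_generator_0:
  assumes i: "i \<in> {1..n}" shows "generator n c \<delta> lam opt_value vlim claim_value i 0 = 0"
  using alim_fixpoint[OF i] by (simp add: generator_eq val_def claim_value_0)

text \<open>The generator vanishes at zero; its derivative is zero below the level and nonpositive
  beyond. Strictness needs a point above the level and below \<open>x\<close> with inflow less than
  one, which \<open>inflow_not_flat\<close> supplies; by monotonicity the inflow stays below one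
  from there on.\<close>

lemma value_generator:
  assumes i: "i \<in> {1..n}" and x: "0 \<le> x"
  shows "x \<le> opt_level i \<Longrightarrow> generator n c \<delta> lam opt_value vlim claim_value i x = 0"
    and "opt_level i < x \<Longrightarrow> generator n c \<delta> lam opt_value vlim claim_value i x < 0"
proof -
  let ?E = "generator n c \<delta> lam opt_value vlim claim_value i" let ?g = "inflow vlim alim i"
  obtain s where s: "\<And>x. 0 \<le> x \<Longrightarrow> (?E has_real_derivative s x) (at x within {0..})"
      "\<And>x. 0 \<le> x \<Longrightarrow> s x \<le> killing i * (?g x - max 1 (?g x))"
      "\<And>x. 0 \<le> x \<Longrightarrow> 1 < ?g x \<Longrightarrow> s x = 0"
    using value_generator_deriv[OF i] by metis
  have s_le: "s x \<le> 0" if "0 \<le> x" for x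
    using s(2)[OF that] killing_pos[OF i] by (smt (verit) max.cobounded2 mult_nonneg_nonpos)
  note b = opt_level_nonneg[OF i]
  have below: "?E x = 0" if "0 \<le> x" "x \<le> opt_level i" for x
    using half_line_constant[OF s(1) order_refl that(1)] s(3) level_props(3)[OF lim_admissible i] that
      value_generator_0[OF i] by auto
  show "?E x = 0" if "x \<le> opt_level i" using below[OF x that] .
  show "?E x < 0" if lt: "opt_level i < x"
  proof -
    have "\<exists>y. opt_level i < y \<and> y < x \<and> ?g y < 1"
    proof (rule ccontr)
      assume "\<not> ?thesis"
      then have "?g y = 1" if "opt_level i < y" "y < x" for y
        using inflow_le1[OF lim_admissible i, of y] that by force
      then show False using inflow_not_flat[OF i b lt] by blast
    qed
    then obtain y where y: "opt_level i < y" "y < x" "?g y < 1" by blast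
    obtain z where z: "y < z" "z < x" "?E x - ?E y = s z * (x - y)"
      using mvt_half_line[OF _ y(2) s(1)] b y by auto
    have "?g z \<le> ?g y" using inflow_anti[OF lim_admissible i, of y z] z y b by auto
    then have "killing i * (?g z - max 1 (?g z)) < 0"
      using y killing_pos[OF i] by (simp add: mult_pos_neg)
    then have "s z < 0" using s(2)[of z] z y b by simp
    then have "s z * (x - y) < 0" using y by (simp add: mult_neg_pos)
    moreover have "?E y \<le> 0"
      using half_line_antimono[OF s(1) b, of y] s_le y(1) below[OF b order_refl] b by auto
    ultimately show ?thesis using z(3) by simp
  qed
qed

lemma value_generator_le: "i \<in> {1..n} \<Longrightarrow> 0 \<le> x \<Longrightarrow> generator n c \<delta> lam opt_value vlim claim_value i x \<le> 0"
  using value_generator by (metis less_imp_le linorder_not_less order_refl)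

text \<open>A wrong barrier in phase \<open>i\<close>, followed by optimal behaviour after the next phase change, is
  already strictly worse than the solution of the system.\<close>

lemma wrong_barrier_supersolution:
  assumes i: "i \<in> {1..n}" and b: "0 < b" "b \<noteq> opt_level i"
  obtains f f' where
    "\<And>x. 0 \<le> x \<Longrightarrow> (f has_real_derivative f' x) (at x within {0..})" "continuous_on {0..} f'"
    "\<And>x. 0 \<le> x \<Longrightarrow> 0 \<le> f x" "\<And>x. 0 \<le> x \<Longrightarrow> f x \<le> opt_value i x" "f b < opt_value i b"
    "\<And>x. b \<le> x \<Longrightarrow> f x = x - b + f b"
    "\<And>x. 0 \<le> x \<Longrightarrow> x \<le> b \<Longrightarrow> generator n c \<delta> lam (opt_value(i := f)) (vlim(i := f')) claim_value i x = 0"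
proof -
  define H where "H x = (\<Sum>j\<in>{1..n} - {i}. lam i j * opt_value j x) + lam i (n+1) * claim_value x" for x
  define th where "th = killing i / c"
  \<comment> \<open>The value at the barrier when all premiums are paid out there: the zero of the
    generator at \<open>b\<close> with slope one.\<close>
  define C where "C = (c + H b) / killing i"
  have th: "0 < th" "c * th = killing i" using killing_pos[OF i] c_pos by (auto simp: th_def)
  have H_cont: "continuous_on {0..} H"
    unfolding H_def by (intro continuous_intros half_line_continuous[OF val_deriv[OF lim_admissible]]
        half_line_continuous[OF claim_value_deriv]) auto
  have H_nonneg: "0 \<le> H x" if "0 \<le> x" for x
    unfolding H_def using that lam_nonneg'[OF i]
    by (intro add_nonneg_nonneg sum_nonneg mult_nonneg_nonneg claim_value_nonneg value_nonneg) auto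
  have gen: "generator n c \<delta> lam opt_value vlim claim_value i x = c * vlim i x - killing i * opt_value i x + H x" for x
    by (simp add: generator_eq H_def)
  \<comment> \<open>Below the level the optimal slope at \<open>b\<close> exceeds one while the
    generator is zero; above the level the slope is one while the generator is negative. Both give
    the strict inequality.\<close>
  have Cb: "C < opt_value i b"
  proof -
    have "c + H b < killing i * opt_value i b"
    proof (cases "b < opt_level i")
      case True
      then have "c * 1 < c * vlim i b" using c_pos b vlim_below[OF i, of b] by (intro mult_strict_left_mono) auto
      then show ?thesis using value_generator(1)[OF i, of b] True b gen[of b] by simp
    next
      case False
      then show ?thesis using value_generator(2)[OF i, of b] b vlim_above[OF i, of b] gen[of b] by simp
    qed
    then show ?thesis using killing_pos[OF i] by (simp add: C_def divide_less_eq mult.commute)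
  qed
  \<comment> \<open>Variation of constants for \<open>c * A' = killing i * A - H\<close> with end
    value \<open>C\<close> at \<open>b\<close>.\<close>
  define A where "A x = exp (th * x) * (exp (- th * b) * C + (integral {0..b} (\<lambda>u. exp (- th * u) * H u)
      - integral {0..x} (\<lambda>u. exp (- th * u) * H u)) / c)" for x
  have A_deriv: "(A has_real_derivative th * A x - H x / c) (at x within {0..})" if x: "0 \<le> x" for x
  proof -
    let ?I = "\<lambda>x. integral {0..x} (\<lambda>u. exp (- th * u) * H u)"
    have "(?I has_real_derivative exp (- th * x) * H x) (at x within {0..})"
      by (intro half_line_antiderivative continuous_intros H_cont x)
    then have "((\<lambda>x. exp (- th * b) * C + (?I b - ?I x) / c) has_real_derivative
       0 + (0 - exp (- th * x) * H x) / c) (at x within {0..})"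
      by (intro DERIV_add DERIV_cdivide DERIV_diff DERIV_const)
    moreover have "((\<lambda>x. exp (th * x)) has_real_derivative th * exp (th * x)) (at x within {0..})"
      by (auto intro!: derivative_eq_intros)
    ultimately have "(A has_real_derivative th * exp (th * x) * (exp (- th * b) * C + (?I b - ?I x) / c)
       + (0 + (0 - exp (- th * x) * H x) / c) * exp (th * x)) (at x within {0..})"
      unfolding A_def by (intro DERIV_mult)
    then show ?thesis by (rule DERIV_cong) (simp add: A_def flip: exp_add)
  qed
  have A_b: "A b = C" by (simp add: A_def mult.assoc[symmetric] flip: exp_add)
  define f' where "f' x = th * A (min x b) - H (min x b) / c" for x
  define f where "f x = A 0 + integral {0..x} f'" for x
  have cont_min: "continuous_on {0..} (\<lambda>x. g (min x b))" if g: "continuous_on {0..} g" for g :: "real \<Rightarrow> real"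
    by (rule continuous_on_compose2[OF g]) (use b in \<open>auto intro!: continuous_intros\<close>)
  have f'_cont: "continuous_on {0..} f'"
    unfolding f'_def using cont_min[OF half_line_continuous[OF A_deriv]] cont_min[OF H_cont] c_pos
    by (auto intro!: continuous_intros)
  have f_deriv: "(f has_real_derivative f' x) (at x within {0..})" if "0 \<le> x" for x
    unfolding f_def by (rule DERIV_cong[OF DERIV_add[OF DERIV_const half_line_antiderivative[OF f'_cont that]]]) simp
  have f_A: "f x = A x" if x: "0 \<le> x" "x \<le> b" for x
  proof -
    have "f x - A x = f 0 - A 0"
      by (rule half_line_constant[OF DERIV_diff[OF f_deriv A_deriv]]) (use x in \<open>auto simp: f'_def\<close>)
    then show ?thesis by (simp add: f_def)
  qed
  have f'_above: "f' x = 1" if "b \<le> x" for x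
    using that A_b killing_pos[OF i] c_pos by (simp add: f'_def C_def th_def field_simps)
  have f_b: "f b = C" using f_A[of b] A_b b by simp
  have f_above: "f x = x - b + f b" if x: "b \<le> x" for x
  proof -
    have "f x - x = f b - b"
      by (rule half_line_constant[OF DERIV_diff[OF f_deriv DERIV_ident]]) (use x b f'_above in auto)
    then show ?thesis by simp
  qed
  have C_pos: "0 \<le> C" unfolding C_def using H_nonneg[of b] b c_pos killing_pos[OF i] by simp
  have A_nonneg: "0 \<le> A x" if x: "0 \<le> x" "x \<le> b" for x
  proof -
    have "exp (- th * b) * A b \<le> exp (- th * x) * A x"
    proof (rule half_line_antimono[OF _ x])
      fix y :: real assume "0 \<le> y"
      show "((\<lambda>y. exp (- th * y) * A y) has_real_derivative - exp (- th * y) * (H y / c)) (at y within {0..})"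
        by (rule derivative_eq_intros A_deriv \<open>0 \<le> y\<close> refl | simp add: algebra_simps)+
    next
      fix y assume "x < y"
      then show "- exp (- th * y) * (H y / c) \<le> 0" using H_nonneg[of y] x c_pos by simp
    qed
    moreover have "0 \<le> exp (- th * b) * A b" using A_b C_pos by simp
    ultimately have "0 \<le> exp (- th * x) * A x" by linarith
    then show ?thesis by (simp add: zero_le_mult_iff)
  qed
  \<comment> \<open>With the factor \<open>exp (- th * x)\<close> the derivative of the difference
    is a positive multiple of the generator of the optimal value, hence nonpositive; the difference
    is controlled by its value at \<open>b\<close>.\<close>
  have A_le: "A x \<le> opt_value i x" if x: "0 \<le> x" "x \<le> b" for x
  proof -
    have "exp (- th * b) * (opt_value i b - A b) \<le> exp (- th * x) * (opt_value i x - A x)"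
    proof (rule half_line_antimono[OF _ x])
      fix y :: real assume y: "0 \<le> y"
      have "((\<lambda>y. exp (- th * y) * (opt_value i y - A y)) has_real_derivative
         (- th) * exp (- th * y) * (opt_value i y - A y) + exp (- th * y) * (vlim i y - (th * A y - H y / c))) (at y within {0..})"
        by (rule derivative_eq_intros A_deriv val_deriv[OF lim_admissible i] y refl | simp)+
      then show "((\<lambda>y. exp (- th * y) * (opt_value i y - A y)) has_real_derivative
          exp (- th * y) * (generator n c \<delta> lam opt_value vlim claim_value i y / c)) (at y within {0..})"
        by (rule DERIV_cong) (use c_pos in \<open>simp add: gen th_def field_simps\<close>)
    next
      fix y assume "x < y"
      then show "exp (- th * y) * (generator n c \<delta> lam opt_value vlim claim_value i y / c) \<le> 0"
        using value_generator_le[OF i, of y] x c_pos by (simp add: mult_nonneg_nonpos divide_nonpos_pos)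
    qed
    moreover have "0 \<le> exp (- th * b) * (opt_value i b - A b)" using A_b Cb by simp
    ultimately have "0 \<le> exp (- th * x) * (opt_value i x - A x)" by linarith
    then show ?thesis by (simp add: zero_le_mult_iff)
  qed
  show thesis
  proof (rule that[of f f', OF f_deriv f'_cont])
    fix x :: real assume x: "0 \<le> x"
    show "0 \<le> f x"
      using f_A[OF x] A_nonneg[OF x] f_above[of x] f_b C_pos by (cases "x \<le> b") auto
    show "f x \<le> opt_value i x"
    proof (cases "x \<le> b")
      case False
      have "opt_value i b - b \<le> opt_value i x - x"
        by (rule half_line_mono[OF DERIV_diff[OF val_deriv[OF lim_admissible i] DERIV_ident]])
           (use False b adm_ge1[OF lim_admissible i] in auto)
      then show ?thesis using f_above[of x] False f_b Cb by simp
    qed (use f_A[OF x] A_le[OF x] in auto)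
    assume "x \<le> b"
    then show "generator n c \<delta> lam (opt_value(i := f)) (vlim(i := f')) claim_value i x = 0"
      using f_A[OF x] c_pos th(2) by (simp add: generator_eq H_def f'_def right_diff_distrib mult.assoc[symmetric])
  next
    show "f b < opt_value i b" using f_b Cb by simp
  qed (assumption, rule f_above)
qed

end

section \<open>Discounted integrals\<close>

text \<open>The mean of \<open>g\<close> at an exponential time with rate \<open>d\<close>. Applied
  to cumulative dividends it equals their discounted integral, and limits can be taken in it from
  pointwise convergence of the dividends.\<close>

definition disc :: "real \<Rightarrow> (real \<Rightarrow> ennreal) \<Rightarrow> ennreal" where
  "disc d g = (\<integral>\<^sup>+ s. ennreal (d * exp (- d * s)) * indicator {0..} s * g s \<partial>lborel)"

lemma disc_const:
  assumes "d > 0" shows "disc d (\<lambda>_. k) = k"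
proof -
  interpret prob_space "density lborel (exponential_density d)"
    by (rule prob_space_exponential_density[OF assms])
  have "(\<integral>\<^sup>+ s. ennreal (d * exp (- d * s)) * indicator {0..} s \<partial>lborel) = (\<integral>\<^sup>+ s. exponential_density d s \<partial>lborel)"
    by (intro nn_integral_cong) (auto simp: exponential_density_def indicator_def mult_ac)
  also have "\<dots> = emeasure (density lborel (exponential_density d)) (space lborel)"
    by (simp add: emeasure_density)
  also have "\<dots> = 1" using emeasure_space_1 by simp
  finally show ?thesis by (simp add: disc_def nn_integral_multc)
qed

lemma disc_cong: "(\<And>s. 0 \<le> s \<Longrightarrow> g s = g' s) \<Longrightarrow> disc d g = disc d g'"
  unfolding disc_def by (intro nn_integral_cong) (auto simp: indicator_def)

lemma disc_mono: "(\<And>s. 0 \<le> s \<Longrightarrow> g s \<le> g' s) \<Longrightarrow> disc d g \<le> disc d g'"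
  unfolding disc_def by (intro nn_integral_mono) (auto simp: indicator_def intro!: mult_left_mono)

lemma disc_add:
  "g \<in> borel_measurable borel \<Longrightarrow> g' \<in> borel_measurable borel \<Longrightarrow>
   disc d (\<lambda>s. g s + g' s) = disc d g + disc d g'"
  unfolding disc_def by (simp add: distrib_left nn_integral_add)

lemma disc_suminf:
  "(\<And>k. g k \<in> borel_measurable borel) \<Longrightarrow> disc d (\<lambda>s. \<Sum>k. g k s) = (\<Sum>k. disc d (g k))"
  unfolding disc_def by (subst nn_integral_suminf[symmetric]) (auto simp: ennreal_suminf_cmult)

lemma disc_cmult: "g \<in> borel_measurable borel \<Longrightarrow> disc d (\<lambda>s. k * g s) = k * disc d g"
  unfolding disc_def by (simp add: nn_integral_cmult[symmetric] mult_ac)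

text \<open>Lack of memory of the exponential time: surviving until \<open>T\<close> costs the
  discount factor, and the clock restarts.\<close>

lemma disc_shift:
  assumes [measurable]: "g \<in> borel_measurable borel" and "0 \<le> T"
  shows "disc d (\<lambda>s. if s < T then 0 else g (s - T)) = ennreal (exp (- d * T)) * disc d g"
proof -
  have "disc d (\<lambda>s. if s < T then 0 else g (s - T)) =
      (\<integral>\<^sup>+ s. ennreal (d * exp (- d * (T + s))) * indicator {0..} (T + s) * (if T + s < T then 0 else g (T + s - T)) \<partial>lborel)"
    unfolding disc_def by (subst nn_integral_real_affine[where c=1 and t=T]) (auto intro!: nn_integral_cong)
  also have "\<dots> = (\<integral>\<^sup>+ s. ennreal (exp (- d * T)) * (ennreal (d * exp (- d * s)) * indicator {0..} s * g s) \<partial>lborel)"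
  proof (rule nn_integral_cong)
    fix s :: real
    have "ennreal (d * exp (- d * (T + s))) = ennreal (exp (- d * T) * (d * exp (- d * s)))"
      by (simp add: distrib_left exp_diff exp_minus field_simps)
    also have "\<dots> = ennreal (exp (- d * T)) * ennreal (d * exp (- d * s))" by (rule ennreal_mult') simp
    finally show "ennreal (d * exp (- d * (T + s))) * indicator {0..} (T + s) * (if T + s < T then 0 else g (T + s - T))
        = ennreal (exp (- d * T)) * (ennreal (d * exp (- d * s)) * indicator {0..} s * g s)"
      using assms(2) by (auto simp: indicator_def mult_ac)
  qed
  also have "\<dots> = ennreal (exp (- d * T)) * disc d g"
    unfolding disc_def by (rule nn_integral_cmult) measurable
  finally show ?thesis .
qed

lemma disc_linear:
  assumes "d > 0" "0 \<le> r" "0 \<le> c"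
  shows "disc d (\<lambda>s. ennreal (r + c * s)) = ennreal (r + c / d)"
proof -
  have "disc d (\<lambda>s. ennreal s) = (\<integral>\<^sup>+ s. ennreal (erlang_density 1 d s) * ennreal (1 / d) \<partial>lborel)"
    unfolding disc_def using assms
    by (intro nn_integral_cong)
       (auto simp: erlang_density_def indicator_def field_simps power2_eq_square simp flip: ennreal_mult)
  also have "\<dots> = ennreal (1 / d)"
  proof -
    interpret prob_space "density lborel (erlang_density 1 d)"
      by (rule prob_space_erlang_density[OF assms(1)])
    have "(\<integral>\<^sup>+ s. ennreal (erlang_density 1 d s) \<partial>lborel) = 1"
      using emeasure_space_1 by (simp add: emeasure_density)
    then show ?thesis by (simp add: nn_integral_multc)
  qed
  finally have *: "disc d (\<lambda>s. ennreal s) = ennreal (1 / d)" .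
  have "disc d (\<lambda>s. ennreal (r + c * s)) = disc d (\<lambda>s. ennreal r + ennreal c * ennreal s)"
    using assms by (intro disc_cong) (simp add: ennreal_mult)
  also have "\<dots> = ennreal r + ennreal c * ennreal (1 / d)"
    using * by (simp add: disc_add disc_cmult disc_const[OF assms(1)])
  finally show ?thesis using assms by (simp flip: ennreal_mult ennreal_plus)
qed

text \<open>Dividends never exceed capital plus premiums, so a linear majorant is the natural
  one.\<close>

lemma disc_dominated:
  assumes "d > 0" "\<And>k. g k \<in> borel_measurable borel" "g' \<in> borel_measurable borel"
    "\<And>s k. 0 \<le> s \<Longrightarrow> g k s \<le> ennreal (r + c * s)" "0 \<le> r" "0 \<le> c"
    "\<And>s. 0 \<le> s \<Longrightarrow> (\<lambda>k. g k s) \<longlonglongrightarrow> g' s"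
  shows "(\<lambda>k. disc d (g k)) \<longlonglongrightarrow> disc d g'"
  unfolding disc_def
proof (rule nn_integral_dominated_convergence)
  show "(\<integral>\<^sup>+ s. ennreal (d * exp (- d * s)) * indicator {0..} s * ennreal (r + c * s) \<partial>lborel) < \<infinity>"
    using disc_linear[OF assms(1,5,6)] unfolding disc_def by simp
  show "AE s in lborel. (\<lambda>k. ennreal (d * exp (- d * s)) * indicator {0..} s * g k s)
      \<longlonglongrightarrow> ennreal (d * exp (- d * s)) * indicator {0..} s * g' s"
  proof (rule AE_I2)
    fix s :: real
    show "(\<lambda>k. ennreal (d * exp (- d * s)) * indicator {0..} s * g k s)
      \<longlonglongrightarrow> ennreal (d * exp (- d * s)) * indicator {0..} s * g' s"
    proof (cases "0 \<le> s")
      case True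
      then show ?thesis using assms(7)[OF True] by (intro ennreal_tendsto_cmult) (auto simp: ennreal_mult_less_top)
    qed simp
  qed
  show "AE s in lborel. ennreal (d * exp (- d * s)) * indicator {0..} s * g k s
      \<le> ennreal (d * exp (- d * s)) * indicator {0..} s * ennreal (r + c * s)" for k
    using assms(4) by (intro AE_I2) (auto simp: indicator_def intro!: mult_left_mono)
qed (use assms in auto)

section \<open>One interclaim period: discretisation\<close>

text \<open>
  \<open>grid_div\<close> are the cumulative dividends paid along a discrete path \<open>z\<close> with step \<open>h\<close>,
  and \<open>grid_reward\<close> is \<open>\<alpha>\<close> times the discounted dividends of the first \<open>m\<close> steps together with
  the discounted payoff \<open>\<psi>\<close> of the surplus at the first visit to \<open>n + 1\<close>.
\<close>

locale cycle =
  fixes n :: nat and c \<alpha> d :: real and b :: "nat \<Rightarrow> real" and \<psi> :: "real \<Rightarrow> real" and C :: real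
  assumes c_pos: "c > 0" and d_pos: "d > 0" and \<alpha>_nonneg: "\<alpha> \<ge> 0"
    and b_nonneg: "\<And>i. i \<in> {1..n} \<Longrightarrow> 0 \<le> b i"
    and \<psi>_nonneg: "\<And>x. 0 \<le> x \<Longrightarrow> 0 \<le> \<psi> x" and \<psi>_cont: "continuous_on UNIV \<psi>"
    and \<psi>_growth: "\<And>x. 0 \<le> x \<Longrightarrow> \<psi> x \<le> C * (1 + x)"
begin

lemma C_nonneg: "0 \<le> C" using \<psi>_growth[of 0] \<psi>_nonneg[of 0] by simp

fun grid_reward :: "real \<Rightarrow> nat \<Rightarrow> real \<Rightarrow> (nat \<Rightarrow> nat) \<Rightarrow> real" where
  "grid_reward h 0 r z = (if z 0 = n + 1 then \<psi> r else \<alpha> * max 0 (r - b (z 0)))"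
| "grid_reward h (Suc m) r z = (if z 0 = n + 1 then \<psi> r else \<alpha> * max 0 (r - b (z 0))
     + exp (- d * h) * grid_reward h m (min r (b (z 0)) + c * h) (\<lambda>l. z (Suc l)))"

fun grid_div :: "real \<Rightarrow> nat \<Rightarrow> real \<Rightarrow> (nat \<Rightarrow> nat) \<Rightarrow> real" where
  "grid_div h 0 r z = (if z 0 = n + 1 then 0 else max 0 (r - b (z 0)))"
| "grid_div h (Suc l) r z = (if z 0 = n + 1 then 0 else max 0 (r - b (z 0))
     + grid_div h l (min r (b (z 0)) + c * h) (\<lambda>l. z (Suc l)))"

text \<open>The recursion is a discrete Skorokhod reflection: the total paid is the largest excess
  of the undividended surplus over the barrier met before \<open>n + 1\<close>. Stating it through
  upper bounds allows comparison with suprema over all times.\<close>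

lemma grid_div_le_iff:
  "grid_div h l r z \<le> u \<longleftrightarrow>
     0 \<le> u \<and> (\<forall>l'\<le>l. (\<forall>k\<le>l'. z k \<noteq> n + 1) \<longrightarrow> r + c * (real l' * h) - b (z l') \<le> u)"
proof (induction l arbitrary: r z u)
  case 0 then show ?case by auto
next
  case (Suc l)
  show ?case
  proof (cases "z 0 = n + 1")
    case False
    define D where "D = max 0 (r - b (z 0))"
    have D: "min r (b (z 0)) = r - D" "0 \<le> D" by (auto simp: D_def)
    have "grid_div h (Suc l) r z \<le> u \<longleftrightarrow> grid_div h l (r - D + c * h) (\<lambda>l. z (Suc l)) \<le> u - D"
      using False by (auto simp: D(1) simp flip: D_def)
    also have "\<dots> \<longleftrightarrow> D \<le> u \<and> (\<forall>l'\<le>l. (\<forall>k\<le>l'. z (Suc k) \<noteq> n + 1) \<longrightarrow>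
        r + c * (real (Suc l') * h) - b (z (Suc l')) \<le> u)"
      unfolding Suc.IH by (simp add: algebra_simps)
    also have "(\<forall>l'\<le>l. (\<forall>k\<le>l'. z (Suc k) \<noteq> n + 1) \<longrightarrow> r + c * (real (Suc l') * h) - b (z (Suc l')) \<le> u)
      \<longleftrightarrow> (\<forall>l'\<in>Suc ` {..l}. (\<forall>k\<le>l'. z k \<noteq> n + 1) \<longrightarrow> r + c * (real l' * h) - b (z l') \<le> u)"
    proof -
      have "(\<forall>k\<le>l'. z (Suc k) \<noteq> n + 1) \<longleftrightarrow> (\<forall>k\<le>Suc l'. z k \<noteq> n + 1)" for l'
        using False by (metis Suc_le_mono not0_implies_Suc)
      then show ?thesis by (auto simp del: of_nat_Suc)
    qed
    also have "D \<le> u \<and> \<dots> \<longleftrightarrow> 0 \<le> u \<and> (\<forall>l'\<in>insert 0 (Suc ` {..l}).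
        (\<forall>k\<le>l'. z k \<noteq> n + 1) \<longrightarrow> r + c * (real l' * h) - b (z l') \<le> u)"
      using False by (auto simp: D_def)
    also have "insert 0 (Suc ` {..l}) = {..Suc l}" by (simp add: atMost_Suc_eq_insert_0)
    finally show ?thesis by auto
  qed auto
qed

lemma grid_div_nonneg: "0 \<le> grid_div h l r z"
  using grid_div_le_iff[of h l r z "grid_div h l r z"] by simp

lemma grid_div_bound:
  assumes "0 \<le> r" "0 \<le> h" "\<And>k. z k \<in> {1..n+1}" "real l * h \<le> s"
  shows "grid_div h l r z \<le> r + c * s"
  unfolding grid_div_le_iff
proof (intro conjI allI impI)
  have "0 \<le> s" using assms(2,4) by (meson of_nat_0_le_iff mult_nonneg_nonneg order_trans)
  then show "0 \<le> r + c * s" using assms c_pos by simp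
  fix l' assume l: "l' \<le> l" "\<forall>k\<le>l'. z k \<noteq> n + 1"
  then have "z l' \<in> {1..n}" using assms(3)[of l'] by force
  moreover have "real l' * h \<le> s" using l(1) assms by (meson mult_right_mono of_nat_mono order_trans)
  then have "c * (real l' * h) \<le> c * s" using c_pos by simp
  ultimately show "r + c * (real l' * h) - b (z l') \<le> r + c * s" using b_nonneg by force
qed

text \<open>One recursion step pays a lump and delays everything else by \<open>h\<close>, which for
  an exponential time is a factor \<open>exp (- d * h)\<close> by \<open>disc_shift\<close>.\<close>

lemma grid_reward_eq:
  assumes "0 \<le> r" "0 < h" "\<And>k. z k \<in> {1..n+1}"
  shows "ennreal (grid_reward h m r z) =
     ennreal \<alpha> * disc d (\<lambda>s. ennreal (grid_div h (min m (nat \<lfloor>s / h\<rfloor>)) r z)) +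
     (if \<exists>l\<le>m. z l = n + 1 then let l = LEAST l. z l = n + 1 in
        ennreal (exp (- d * (real l * h)) * \<psi> (r + c * (real l * h) - grid_div h l r z)) else 0)"
    (is "_ = ennreal \<alpha> * ?R m r z + ?T m r z")
  using assms
proof (induction m arbitrary: r z)
  case 0
  have "?R 0 r z = ennreal (grid_div h 0 r z)" using disc_const[OF d_pos] by simp
  moreover have "?T 0 r z = (if z 0 = n + 1 then ennreal (\<psi> r) else 0)"
    by (auto simp: Let_def Least_equality)
  ultimately show ?case using \<alpha>_nonneg by (auto simp flip: ennreal_mult)
next
  case (Suc m)
  show ?case
  proof (cases "z 0 = n + 1")
    case True
    have "grid_div h l r z = 0" for l using True by (cases l) auto
    moreover have "(LEAST l. z l = n + 1) = 0" using True by (intro Least_equality) auto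
    moreover have "\<exists>l\<le>Suc m. z l = n + 1" using True by auto
    ultimately show ?thesis using True disc_const[OF d_pos] by (simp add: Let_def)
  next
    case False
    define D where "D = max 0 (r - b (z 0))"
    define r' where "r' = min r (b (z 0)) + c * h"
    define z' where "z' l = z (Suc l)" for l
    have z0: "z 0 \<in> {1..n}" using False Suc.prems(3)[of 0] by auto
    have D: "min r (b (z 0)) = r - D" "0 \<le> D" by (auto simp: D_def)
    have r': "0 \<le> r'" using b_nonneg[OF z0] Suc.prems c_pos by (auto simp: r'_def)
    have gdiv: "grid_div h (Suc l) r z = D + grid_div h l r' z'" for l
      using False by (simp add: D_def r'_def z'_def[abs_def])
    have "?R (Suc m) r z = disc d (\<lambda>s. ennreal D + (if s < h then 0 else
        ennreal (grid_div h (min m (nat \<lfloor>(s - h) / h\<rfloor>)) r' z')))"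
    proof (rule disc_cong)
      fix s :: real assume s: "0 \<le> s"
      show "ennreal (grid_div h (min (Suc m) (nat \<lfloor>s / h\<rfloor>)) r z) = ennreal D + (if s < h then 0 else
        ennreal (grid_div h (min m (nat \<lfloor>(s - h) / h\<rfloor>)) r' z'))"
      proof (cases "s < h")
        case True
        then have "\<lfloor>s / h\<rfloor> = 0" using s Suc.prems by (simp add: floor_eq_iff)
        then show ?thesis using True False by (simp add: D_def)
      next
        case h: False
        have eq: "(s - h) / h = s / h - 1" using Suc.prems by (simp add: field_simps)
        have "1 \<le> s / h" using h Suc.prems by simp
        then have "\<lfloor>s / h\<rfloor> \<ge> 1" by simp
        then have "nat \<lfloor>s / h\<rfloor> = Suc (nat \<lfloor>(s - h) / h\<rfloor>)" unfolding eq floor_diff_one by arith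
        then show ?thesis using h D grid_div_nonneg by (simp del: grid_div.simps add: gdiv ennreal_plus)
      qed
    qed
    also have "\<dots> = ennreal D + ennreal (exp (- d * h)) * ?R m r' z'"
    proof -
      have [measurable]: "(\<lambda>s. ennreal (grid_div h (min m (nat \<lfloor>s / h\<rfloor>)) r' z')) \<in> borel_measurable borel"
        by measurable
      have "disc d (\<lambda>s. if s < h then 0 else ennreal (grid_div h (min m (nat \<lfloor>(s - h) / h\<rfloor>)) r' z'))
          = ennreal (exp (- d * h)) * ?R m r' z'"
        by (rule disc_shift) (use Suc.prems in auto)
      then show ?thesis by (subst disc_add) (simp_all add: disc_const[OF d_pos])
    qed
    finally have R: "?R (Suc m) r z = ennreal D + ennreal (exp (- d * h)) * ?R m r' z'" .
    have T: "?T (Suc m) r z = ennreal (exp (- d * h)) * ?T m r' z'"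
    proof (cases "\<exists>l\<le>m. z' l = n + 1")
      case True
      then obtain l where l: "l \<le> m" "z' l = n + 1" by blast
      have ex: "\<exists>l\<le>Suc m. z l = n + 1" using l by (auto simp: z'_def intro!: exI[of _ "Suc l"])
      have least: "(LEAST l. z l = n + 1) = Suc (LEAST l. z' l = n + 1)"
        using Least_Suc[of "\<lambda>l. z l = n + 1" "Suc l"] l False by (simp add: z'_def)
      let ?l = "LEAST l. z' l = n + 1"
      have "r + c * (real (Suc ?l) * h) - grid_div h (Suc ?l) r z = r' + c * (real ?l * h) - grid_div h ?l r' z'"
        by (simp del: grid_div.simps add: gdiv r'_def D algebra_simps)
      moreover have "exp (- d * (real (Suc ?l) * h)) = exp (- d * h) * exp (- d * (real ?l * h))"
        by (simp add: algebra_simps flip: exp_add)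
      ultimately have "?T (Suc m) r z =
          ennreal (exp (- d * h) * (exp (- d * (real ?l * h)) * \<psi> (r' + c * (real ?l * h) - grid_div h ?l r' z')))"
        by (simp only: Let_def least if_P[OF ex] mult.assoc)
      also have "\<dots> = ennreal (exp (- d * h)) * ?T m r' z'"
        by (simp only: Let_def if_P[OF True]) (rule ennreal_mult', simp)
      finally show ?thesis .
    next
      case F: False
      then have F': "\<not> (\<exists>l\<le>Suc m. z l = n + 1)" using False by (auto simp: z'_def) (metis Suc_le_mono not0_implies_Suc)
      show ?thesis by (simp only: if_not_P[OF F] if_not_P[OF F'] mult_zero_right)
    qed
    have nn: "0 \<le> grid_reward h m r' z'"
    proof -
      have "0 \<le> grid_reward h m r z" if "0 \<le> r" "\<And>k. z k \<in> {1..n+1}" for m r z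
        using that
      proof (induction m arbitrary: r z)
        case 0 then show ?case using \<psi>_nonneg \<alpha>_nonneg by simp
      next
        case (Suc m)
        have "0 \<le> min r (b (z 0)) + c * h" if "z 0 \<noteq> n + 1"
          using that Suc.prems(1) Suc.prems(2)[of 0] b_nonneg[of "z 0"] c_pos \<open>0 < h\<close> by auto
        then show ?case using Suc.IH[of "min r (b (z 0)) + c * h" "\<lambda>l. z (Suc l)"] Suc.prems \<psi>_nonneg \<alpha>_nonneg by auto
      qed
      then show ?thesis using r' Suc.prems by (simp add: z'_def)
    qed
    have "ennreal (grid_reward h (Suc m) r z) = ennreal \<alpha> * ennreal D + ennreal (exp (- d * h)) * ennreal (grid_reward h m r' z')"
      using False D \<alpha>_nonneg nn by (simp add: D_def r'_def z'_def[abs_def] ennreal_plus ennreal_mult)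
    also have "ennreal (grid_reward h m r' z') = ennreal \<alpha> * ?R m r' z' + ?T m r' z'"
      by (rule Suc.IH) (use r' Suc.prems in \<open>auto simp: z'_def\<close>)
    finally show ?thesis unfolding R T by (simp add: distrib_left mult_ac add.assoc)
  qed
qed

lemma grid_reward_nonneg:
  assumes "0 \<le> r" "0 \<le> h" "\<And>k. z k \<in> {1..n+1}" shows "0 \<le> grid_reward h m r z"
  using assms
proof (induction m arbitrary: r z)
  case 0 then show ?case using \<psi>_nonneg \<alpha>_nonneg by simp
next
  case (Suc m)
  have "0 \<le> min r (b (z 0)) + c * h" if "z 0 \<noteq> n + 1"
    using that Suc.prems(1,2) Suc.prems(3)[of 0] b_nonneg[of "z 0"] c_pos by auto
  then show ?case using Suc.IH[of "min r (b (z 0)) + c * h" "\<lambda>l. z (Suc l)"] Suc.prems \<psi>_nonneg \<alpha>_nonneg by auto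
qed


text \<open>Free of \<open>h\<close> and \<open>m\<close>, hence a dominating constant for the
  passage to finer grids. Dividends are worth at most \<open>r + c / d\<close>, and discounting caps
  the linear growth of the payoff through \<open>exp (- d * t) * t \<le> 1 / d\<close>.\<close>

lemma grid_reward_bound:
  assumes "0 \<le> r" "0 < h" "\<And>k. z k \<in> {1..n+1}"
  shows "grid_reward h m r z \<le> \<alpha> * (r + c / d) + C * (1 + r + c / d)"
proof -
  have "disc d (\<lambda>s. ennreal (grid_div h (min m (nat \<lfloor>s / h\<rfloor>)) r z)) \<le> disc d (\<lambda>s. ennreal (r + c * s))"
  proof (intro disc_mono ennreal_leI grid_div_bound)
    fix s :: real assume s: "0 \<le> s"
    have "real (min m (nat \<lfloor>s / h\<rfloor>)) \<le> s / h" 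
      using of_nat_floor[of "s / h"] s assms(2) by (intro order_trans[OF of_nat_mono[OF min.cobounded2]]) auto
    then show "real (min m (nat \<lfloor>s / h\<rfloor>)) * h \<le> s" using assms(2) by (simp add: field_simps)
  qed (use assms in auto)
  also have "\<dots> = ennreal (r + c / d)" using c_pos assms by (intro disc_linear d_pos) auto
  finally have 1: "ennreal \<alpha> * disc d (\<lambda>s. ennreal (grid_div h (min m (nat \<lfloor>s / h\<rfloor>)) r z)) \<le> ennreal (\<alpha> * (r + c / d))"
    using \<alpha>_nonneg by (simp add: ennreal_mult' mult_left_mono)
  have 2: "exp (- d * (real l * h)) * \<psi> (r + c * (real l * h) - grid_div h l r z) \<le> C * (1 + r + c / d)" for l
  proof -
    define t where "t = real l * h"
    have t: "0 \<le> t" using assms by (simp add: t_def)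
    have "grid_div h l r z \<le> r + c * t" using assms by (intro grid_div_bound) (auto simp: t_def)
    then have "\<psi> (r + c * t - grid_div h l r z) \<le> C * (1 + (r + c * t - grid_div h l r z))" by (intro \<psi>_growth) simp
    also have "\<dots> \<le> C * (1 + r + c * t)" using C_nonneg grid_div_nonneg[of h l r z] by (intro mult_left_mono) auto
    finally have "exp (- d * t) * \<psi> (r + c * t - grid_div h l r z) \<le> exp (- d * t) * (C * (1 + r + c * t))"
      by (intro mult_left_mono) auto
    also have "\<dots> = C * (exp (- d * t) * (1 + r) + c * (exp (- d * t) * t))" by (simp add: algebra_simps)
    also have "\<dots> \<le> C * (1 * (1 + r) + c * (1 / d))"
    proof (intro mult_left_mono add_mono mult_right_mono)
      show "exp (- d * t) \<le> 1" using d_pos t by simp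
      have "d * t \<le> exp (d * t)" using exp_ge_add_one_self[of "d * t"] by linarith
      then show "exp (- d * t) * t \<le> 1 / d" using d_pos by (simp add: exp_minus field_simps)
    qed (use C_nonneg assms c_pos in auto)
    finally show ?thesis by (simp add: t_def algebra_simps)
  qed
  have "0 \<le> C * (1 + r + c / d)" "0 \<le> \<alpha> * (r + c / d)" using C_nonneg assms c_pos d_pos \<alpha>_nonneg by auto
  moreover from this have "ennreal (grid_reward h m r z) \<le> ennreal (\<alpha> * (r + c / d)) + ennreal (C * (1 + r + c / d))"
    unfolding grid_reward_eq[OF assms] using 1 2 by (intro add_mono) (auto simp: Let_def intro!: ennreal_leI)
  ultimately show ?thesis
    by (metis add_nonneg_nonneg ennreal_le_iff ennreal_plus)
qed

end

section \<open>One interclaim period: paths\<close>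

definition hits :: "nat \<Rightarrow> (real \<Rightarrow> nat) \<Rightarrow> bool" where "hits n z \<longleftrightarrow> (\<exists>t\<ge>0. z t = n + 1)"
definition hit_time :: "nat \<Rightarrow> (real \<Rightarrow> nat) \<Rightarrow> real" where "hit_time n z = Inf {t. 0 \<le> t \<and> z t = n + 1}"
definition before :: "nat \<Rightarrow> (real \<Rightarrow> nat) \<Rightarrow> real \<Rightarrow> bool" where
  "before n z v \<longleftrightarrow> (\<forall>u. 0 \<le> u \<longrightarrow> u \<le> v \<longrightarrow> z u \<noteq> n + 1)"
definition regular_path :: "nat \<Rightarrow> (real \<Rightarrow> nat) \<Rightarrow> bool" where
  "regular_path n z \<longleftrightarrow> (\<forall>t\<ge>0. z t \<in> {1..n+1} \<and> (\<forall>\<^sub>F s in at_right t. z s = z t))"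
text \<open>The union of the nested grids: each of its points lies on all sufficiently fine
  ones.\<close>

definition dyadics :: "real set" where "dyadics = (\<lambda>(l::nat, N::nat). real l * (1 / 2 ^ N)) ` UNIV"

lemma dyadic_nonneg: "v \<in> dyadics \<Longrightarrow> 0 \<le> v" by (auto simp: dyadics_def)

lemma dyadicI [simp]: "real l * (1 / 2 ^ N) \<in> dyadics" by (force simp: dyadics_def)

lemma dyadic_refine:
  assumes "v \<in> dyadics" shows "\<forall>\<^sub>F N in sequentially. \<exists>l. v = real l * (1 / 2 ^ N)"
proof -
  obtain l N where v: "v = real l * (1 / 2 ^ N)" using assms by (auto simp: dyadics_def)
  have "\<exists>l'. v = real l' * (1 / 2 ^ M)" if "N \<le> M" for M
  proof (intro exI)
    have "(2::real) ^ M = 2 ^ N * 2 ^ (M - N)" using that by (simp flip: power_add)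
    then show "v = real (l * 2 ^ (M - N)) * (1 / 2 ^ M)" using v by (simp add: field_simps)
  qed
  then show ?thesis by (auto simp: eventually_sequentially)
qed

lemma dyadics_dense:
  assumes "0 \<le> s" "s < t" shows "\<exists>v\<in>dyadics. s < v \<and> v < t"
proof -
  obtain N :: nat where "(1/2) ^ N < (t - s)"
    using real_arch_pow_inv[of "t - s" "1/2"] assms by auto
  then have N: "1 / 2 ^ N < t - s" by (simp add: power_one_over)
  define l where "l = nat (\<lfloor>s * 2 ^ N\<rfloor> + 1)"
  have l: "real l = real_of_int \<lfloor>s * 2 ^ N\<rfloor> + 1" using assms by (simp add: l_def)
  have "s * 2 ^ N < real l" "real l \<le> s * 2 ^ N + 1" unfolding l by linarith+
  then have "s < real l * (1 / 2 ^ N)" "real l * (1 / 2 ^ N) \<le> s + 1 / 2 ^ N" by (auto simp: field_simps)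
  then show ?thesis using N by (intro bexI[OF _ dyadicI[of l N]]) auto
qed

context
  fixes n :: nat and z :: "real \<Rightarrow> nat" assumes reg: "regular_path n z"
begin

lemma regular_phase: "0 \<le> t \<Longrightarrow> z t \<in> {1..n+1}"
  using reg by (auto simp: regular_path_def)

lemma regular_right:
  assumes "0 \<le> t" obtains e where "e > 0" "\<And>s. t \<le> s \<Longrightarrow> s < t + e \<Longrightarrow> z s = z t"
proof -
  have "\<forall>\<^sub>F s in at_right t. z s = z t" using reg assms by (auto simp: regular_path_def)
  then obtain u where u: "u > t" "\<And>s. t < s \<Longrightarrow> s < u \<Longrightarrow> z s = z t"
    by (auto simp: eventually_at_right_field)
  show thesis
  proof (rule that[of "u - t"])
    show "z s = z t" if "t \<le> s" "s < t + (u - t)" for s using u(2)[of s] that by (cases "s = t") auto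
  qed (use u in auto)
qed

lemma before_phase: "0 \<le> v \<Longrightarrow> before n z v \<Longrightarrow> z v \<in> {1..n}"
  using regular_phase[of v] by (force simp: before_def)

text \<open>Right-continuity makes the infimum attained: the phase is constant on an interval
  starting at \<open>hit_time\<close>, and that interval contains a visit to
  \<open>n + 1\<close>.\<close>

lemma hit_time_props:
  assumes "hits n z"
  shows "0 \<le> hit_time n z" "z (hit_time n z) = n + 1" "0 \<le> v \<Longrightarrow> before n z v \<longleftrightarrow> v < hit_time n z"
proof -
  let ?S = "{t. 0 \<le> t \<and> z t = n + 1}"
  have ne: "?S \<noteq> {}" using assms by (auto simp: hits_def)
  have bdd: "bdd_below ?S" by (auto intro: bdd_belowI[of _ 0])
  have ge: "hit_time n z \<le> t" if "t \<in> ?S" for t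
    unfolding hit_time_def by (rule cInf_lower[OF that bdd])
  show nn: "0 \<le> hit_time n z" unfolding hit_time_def by (rule cInf_greatest[OF ne]) auto
  show eq: "z (hit_time n z) = n + 1"
  proof (rule ccontr)
    assume neq: "z (hit_time n z) \<noteq> n + 1"
    obtain e where e: "e > 0" "\<And>s. hit_time n z \<le> s \<Longrightarrow> s < hit_time n z + e \<Longrightarrow> z s = z (hit_time n z)"
      using regular_right[OF nn] by blast
    have "Inf ?S < hit_time n z + e" using e(1) by (simp add: hit_time_def)
    then obtain t where t: "t \<in> ?S" "t < hit_time n z + e" using cInf_lessD[OF ne] by blast
    then show False using e(2)[OF ge[OF t(1)] t(2)] neq by auto
  qed
  show "before n z v \<longleftrightarrow> v < hit_time n z" if "0 \<le> v"
    using ge eq nn that unfolding before_def by (force simp: not_less[symmetric])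
qed

text \<open>A regular path may leave \<open>n + 1\<close> again, so a grid could miss the visit. It
  stays there for a positive time, however, and a mesh below that time catches it.\<close>

lemma grid_alive:
  "\<forall>\<^sub>F N in sequentially. \<forall>l. (\<forall>k\<le>l. z (real k * (1 / 2 ^ N)) \<noteq> n + 1) \<longleftrightarrow> before n z (real l * (1 / 2 ^ N))"
proof (cases "hits n z")
  case False
  then show ?thesis by (auto simp: hits_def before_def)
next
  case True
  let ?x = "hit_time n z"
  note x = hit_time_props[OF True]
  obtain e where e: "e > 0" "\<And>s. ?x \<le> s \<Longrightarrow> s < ?x + e \<Longrightarrow> z s = n + 1"
    using regular_right[OF x(1)] x(2) by metis
  obtain N0 :: nat where "(1/2) ^ N0 < e" using real_arch_pow_inv[OF e(1), of "1/2"] by auto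
  then have N0: "1 / 2 ^ N0 < e" by (simp add: power_one_over)
  have "(\<forall>k\<le>l. z (real k * (1 / 2 ^ N)) \<noteq> n + 1) \<longleftrightarrow> before n z (real l * (1 / 2 ^ N))" if N: "N0 \<le> N" for N l
  proof
    let ?h = "1 / 2 ^ N :: real"
    have "?h \<le> 1 / 2 ^ N0" using N by (intro divide_left_mono power_increasing) auto
    then have h: "0 < ?h" "?h < e" using N0 by auto
    show "before n z (real l * ?h)" if alive: "\<forall>k\<le>l. z (real k * ?h) \<noteq> n + 1"
    proof (rule ccontr)
      assume "\<not> ?thesis"
      then have le: "?x \<le> real l * ?h" using x(3)[of "real l * ?h"] by simp
      define k where "k = nat \<lceil>?x * 2 ^ N\<rceil>"
      have "0 \<le> ?x * 2 ^ N" using x(1) by simp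
      then have "0 \<le> \<lceil>?x * 2 ^ N\<rceil>" by linarith
      then have k: "real k = real_of_int \<lceil>?x * 2 ^ N\<rceil>" by (simp add: k_def)
      have "?x * 2 ^ N \<le> real k" "real k < ?x * 2 ^ N + 1" unfolding k by linarith+
      then have "?x \<le> real k * ?h" "real k * ?h < ?x + ?h" by (auto simp: field_simps)
      then have "z (real k * ?h) = n + 1" using h by (intro e(2)) auto
      moreover have "k \<le> l" using le by (simp add: k_def ceiling_le_iff nat_le_iff field_simps)
      ultimately show False using alive by blast
    qed
    show "\<forall>k\<le>l. z (real k * ?h) \<noteq> n + 1" if "before n z (real l * ?h)"
    proof (intro allI impI)
      fix k assume "k \<le> l"
      then have "real k * ?h \<le> real l * ?h" by (intro mult_right_mono) auto
      then show "z (real k * ?h) \<noteq> n + 1" using that unfolding before_def by simp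
    qed
  qed
  then show ?thesis by (auto simp: eventually_sequentially)
qed

end

context cycle begin

text \<open>The Skorokhod formula with the supremum over dyadic times, the form in which it is the
  limit of \<open>grid_div\<close>; the inserted \<open>0\<close> is the positive part.\<close>

definition path_div :: "real \<Rightarrow> (real \<Rightarrow> nat) \<Rightarrow> real \<Rightarrow> real" where
  "path_div r z s = Sup (insert 0 {r + c * v - b (z v) | v. v \<in> dyadics \<and> v \<le> s \<and> before n z v})"

definition period_reward :: "real \<Rightarrow> (real \<Rightarrow> nat) \<Rightarrow> ennreal" where
  "period_reward r z = ennreal \<alpha> * disc d (\<lambda>s. ennreal (path_div r z s)) +
     (if hits n z then ennreal (exp (- d * hit_time n z) *
        \<psi> (r + c * hit_time n z - path_div r z (hit_time n z))) else 0)"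

abbreviation step :: "nat \<Rightarrow> real" where "step N \<equiv> 1 / 2 ^ N"
abbreviation sample :: "nat \<Rightarrow> (real \<Rightarrow> nat) \<Rightarrow> nat \<Rightarrow> nat" where "sample N z \<equiv> \<lambda>l. z (real l * step N)"

context
  fixes z and r :: real assumes reg: "regular_path n z" and r: "0 \<le> r"
begin

lemma path_div_bdd: "0 \<le> s \<Longrightarrow> bdd_above (insert 0 {r + c * v - b (z v) | v. v \<in> dyadics \<and> v \<le> s \<and> before n z v})"
proof (rule bdd_aboveI[of _ "r + c * s"])
  fix x assume "0 \<le> s" "x \<in> insert 0 {r + c * v - b (z v) | v. v \<in> dyadics \<and> v \<le> s \<and> before n z v}"
  then consider "x = 0" | v where "x = r + c * v - b (z v)" "v \<in> dyadics" "v \<le> s" "before n z v" by auto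
  then show "x \<le> r + c * s"
  proof cases
    case 2
    then have "0 \<le> b (z v)" using before_phase[OF reg, of v] b_nonneg dyadic_nonneg by blast
    moreover have "c * v \<le> c * s" using 2 c_pos by simp
    ultimately show ?thesis using 2 by simp
  qed (use r c_pos \<open>0 \<le> s\<close> in auto)
qed

lemma path_div_le_iff:
  "0 \<le> s \<Longrightarrow> path_div r z s \<le> u \<longleftrightarrow>
     0 \<le> u \<and> (\<forall>v\<in>dyadics. v \<le> s \<longrightarrow> before n z v \<longrightarrow> r + c * v - b (z v) \<le> u)"
  unfolding path_div_def by (subst cSup_le_iff[OF _ path_div_bdd]) auto

lemma path_div_nonneg: "0 \<le> s \<Longrightarrow> 0 \<le> path_div r z s"
  using path_div_le_iff[of s "path_div r z s"] by simp

lemma path_div_ge: "v \<in> dyadics \<Longrightarrow> v \<le> s \<Longrightarrow> before n z v \<Longrightarrow> r + c * v - b (z v) \<le> path_div r z s"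
  using path_div_le_iff[of s "path_div r z s"] dyadic_nonneg[of v] by auto

lemma path_div_mono: "0 \<le> s \<Longrightarrow> s \<le> t \<Longrightarrow> path_div r z s \<le> path_div r z t"
  using path_div_le_iff[of t "path_div r z t"] by (intro path_div_le_iff[THEN iffD2]) auto

lemma path_div_bound: "0 \<le> s \<Longrightarrow> path_div r z s \<le> r + c * s"
proof -
  assume s: "0 \<le> s"
  have "r + c * v - b (z v) \<le> r + c * s" if "v \<in> dyadics" "v \<le> s" "before n z v" for v
  proof -
    have "0 \<le> b (z v)" using that before_phase[OF reg, of v] b_nonneg dyadic_nonneg by blast
    moreover have "c * v \<le> c * s" using that c_pos by simp
    ultimately show ?thesis by simp
  qed
  then show ?thesis using s r c_pos by (intro path_div_le_iff[THEN iffD2]) auto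
qed

lemma path_div_measurable: "(\<lambda>s. ennreal (path_div r z (max 0 s))) \<in> borel_measurable borel"
proof -
  have "(\<lambda>s. path_div r z (max 0 s)) \<in> borel_measurable borel"
    by (rule borel_measurable_mono) (auto intro!: monoI path_div_mono)
  then show ?thesis by simp
qed

text \<open>Grid points are dyadic, so the grid value eventually stays below the supremum; any
  smaller nonnegative number is exceeded at one dyadic time, which lies on all fine grids. With
  \<open>N * 2 ^ N\<close> steps of length \<open>1 / 2 ^ N\<close> the horizon is \<open>N\<close>,
  which eventually exceeds \<open>s\<close>.\<close>

lemma grid_div_tendsto:
  assumes s: "0 \<le> s"
  shows "(\<lambda>N. grid_div (step N) (min (N * 2 ^ N) (nat \<lfloor>s / step N\<rfloor>)) r (sample N z)) \<longlonglongrightarrow> path_div r z s"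
    (is "?f \<longlonglongrightarrow> _")
proof (rule order_tendstoI)
  have le: "\<forall>\<^sub>F N in sequentially. ?f N \<le> path_div r z s"
    using grid_alive[OF reg]
  proof eventually_elim
    case (elim N)
    show ?case
      unfolding grid_div_le_iff
    proof (intro conjI path_div_nonneg s allI impI)
      fix l assume l: "l \<le> min (N * 2 ^ N) (nat \<lfloor>s / step N\<rfloor>)" "\<forall>k\<le>l. sample N z k \<noteq> n + 1"
      have "real l \<le> s / step N" using l(1) of_nat_floor[of "s / step N"] s
        by (meson divide_nonneg_nonneg min.boundedE of_nat_mono order_trans zero_le_divide_1_iff zero_le_numeral zero_le_power)
      then have "real l * step N \<le> s" by (simp add: field_simps)
      moreover have "before n z (real l * step N)" using elim l(2) by blast
      ultimately show "r + c * (real l * step N) - b (sample N z l) \<le> path_div r z s"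
        by (intro path_div_ge dyadicI)
    qed
  qed
  fix u
  show "\<forall>\<^sub>F N in sequentially. ?f N < u" if "path_div r z s < u"
    using le by eventually_elim (use that in linarith)
  assume u: "u < path_div r z s"
  show "\<forall>\<^sub>F N in sequentially. u < ?f N"
  proof (cases "u < 0")
    case True
    then show ?thesis using grid_div_nonneg by (intro always_eventually allI) (rule less_le_trans)
  next
    case False
    then obtain v where v: "v \<in> dyadics" "v \<le> s" "before n z v" "u < r + c * v - b (z v)"
      using u path_div_le_iff[OF s, of u] by (auto simp: not_le[symmetric])
    have "\<forall>\<^sub>F N in sequentially. s \<le> real N"
      using eventually_ge_at_top[of "nat \<lceil>s\<rceil>"] by eventually_elim linarith
    with dyadic_refine[OF v(1)] grid_alive[OF reg] show ?thesis
    proof eventually_elim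
      case (elim N)
      then obtain l where l: "v = real l * step N" by blast
      have "real l \<le> s * 2 ^ N" using v(2) l by (simp add: field_simps)
      moreover have "s * 2 ^ N \<le> real (N * 2 ^ N)" using elim by simp
      ultimately have "real l \<le> real (N * 2 ^ N)" by (rule order_trans)
      then have "l \<le> N * 2 ^ N" by (rule of_nat_le_iff[THEN iffD1])
      moreover have "real l \<le> s / step N" using \<open>real l \<le> s * 2 ^ N\<close> by simp
      then have "l \<le> nat \<lfloor>s / step N\<rfloor>" by (rule le_nat_floor)
      ultimately have "l \<le> min (N * 2 ^ N) (nat \<lfloor>s / step N\<rfloor>)" by simp
      moreover have "\<forall>k\<le>l. sample N z k \<noteq> n + 1"
      proof -
        have "(\<forall>k\<le>l. sample N z k \<noteq> n + 1) \<longleftrightarrow> before n z (real l * step N)"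
          using elim(2) by (rule spec)
        then show ?thesis using v(3) unfolding l by (rule iffD2)
      qed
      ultimately have "r + c * (real l * step N) - b (sample N z l) \<le> ?f N"
        using grid_div_le_iff[of "step N" _ r "sample N z" "?f N", THEN iffD1, OF order_refl] by simp
      then show ?case using v(4) l by simp
    qed
  qed
qed

lemma grid_reward_tendsto:
  "(\<lambda>N. ennreal (grid_reward (step N) (N * 2 ^ N) r (sample N z))) \<longlonglongrightarrow> period_reward r z"
proof -
  have sample: "sample N z k \<in> {1..n+1}" for N k using regular_phase[OF reg] by simp
  have eq: "ennreal (grid_reward (step N) (N * 2 ^ N) r (sample N z)) =
     ennreal \<alpha> * disc d (\<lambda>s. ennreal (grid_div (step N) (min (N * 2 ^ N) (nat \<lfloor>s / step N\<rfloor>)) r (sample N z))) +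
     (if \<exists>l\<le>N * 2 ^ N. sample N z l = n + 1 then let l = LEAST l. sample N z l = n + 1 in
        ennreal (exp (- d * (real l * step N)) * \<psi> (r + c * (real l * step N) - grid_div (step N) l r (sample N z))) else 0)" for N
    by (rule grid_reward_eq[OF r _ sample]) simp
  have "(\<lambda>N. disc d (\<lambda>s. ennreal (grid_div (step N) (min (N * 2 ^ N) (nat \<lfloor>s / step N\<rfloor>)) r (sample N z))))
     \<longlonglongrightarrow> disc d (\<lambda>s. ennreal (path_div r z (max 0 s)))"
  proof (rule disc_dominated[OF d_pos _ path_div_measurable _ r, where c=c])
    fix s :: real and N assume s: "0 \<le> s"
    have "real (min (N * 2 ^ N) (nat \<lfloor>s / step N\<rfloor>)) \<le> s / step N"
      using of_nat_floor[of "s / step N"] s by (intro order_trans[OF of_nat_mono[OF min.cobounded2]]) auto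
    then have "real (min (N * 2 ^ N) (nat \<lfloor>s / step N\<rfloor>)) * step N \<le> s" by (simp add: field_simps)
    then show "ennreal (grid_div (step N) (min (N * 2 ^ N) (nat \<lfloor>s / step N\<rfloor>)) r (sample N z)) \<le> ennreal (r + c * s)"
      using r sample by (intro ennreal_leI grid_div_bound) auto
  next
    fix s :: real assume s: "0 \<le> s"
    show "(\<lambda>N. ennreal (grid_div (step N) (min (N * 2 ^ N) (nat \<lfloor>s / step N\<rfloor>)) r (sample N z))) \<longlonglongrightarrow> ennreal (path_div r z (max 0 s))"
      using grid_div_tendsto[OF s] s by (intro tendsto_ennrealI) (simp add: max_absorb2)
  qed (use c_pos in auto)
  also have "disc d (\<lambda>s. ennreal (path_div r z (max 0 s))) = disc d (\<lambda>s. ennreal (path_div r z s))"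
    by (rule disc_cong) (simp add: max_absorb2)
  finally have R: "(\<lambda>N. ennreal \<alpha> * disc d (\<lambda>s. ennreal (grid_div (step N) (min (N * 2 ^ N) (nat \<lfloor>s / step N\<rfloor>)) r (sample N z))))
     \<longlonglongrightarrow> ennreal \<alpha> * disc d (\<lambda>s. ennreal (path_div r z s))"
    by (intro ennreal_tendsto_cmult) auto
  have T: "(\<lambda>N. if \<exists>l\<le>N * 2 ^ N. sample N z l = n + 1 then let l = LEAST l. sample N z l = n + 1 in
        ennreal (exp (- d * (real l * step N)) * \<psi> (r + c * (real l * step N) - grid_div (step N) l r (sample N z))) else 0)
     \<longlonglongrightarrow> (if hits n z then ennreal (exp (- d * hit_time n z) *
        \<psi> (r + c * hit_time n z - path_div r z (hit_time n z))) else 0)" (is "?T \<longlonglongrightarrow> ?L")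
  proof (cases "hits n z")
    case False
    then have "sample N z l \<noteq> n + 1" for N l by (auto simp: hits_def)
    then show ?thesis using False by simp
  next
    case True
    let ?x = "hit_time n z"
    note x = hit_time_props[OF reg True]
    \<comment> \<open>The grid notices the claim at its first point at or after the hitting time, at
      most one step late.\<close>
    define L where "L N = (LEAST l. sample N z l = n + 1)" for N
    have "\<forall>\<^sub>F N in sequentially. ?x + 1 \<le> real N"
      using eventually_ge_at_top[of "nat \<lceil>?x + 1\<rceil>"] by eventually_elim linarith
    with grid_alive[OF reg]
    have L: "\<forall>\<^sub>F N in sequentially. L N \<le> N * 2 ^ N \<and> sample N z (L N) = n + 1 \<and> ?x \<le> real (L N) * step N \<and>
        real (L N) * step N \<le> ?x + step N \<and>
        grid_div (step N) (L N) r (sample N z) = grid_div (step N) (min (N * 2 ^ N) (nat \<lfloor>?x / step N\<rfloor>)) r (sample N z)"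
    proof eventually_elim
      case (elim N)
      define K where "K = nat \<lceil>?x * 2 ^ N\<rceil>"
      have "0 \<le> ?x * 2 ^ N" using x(1) by simp
      then have "0 \<le> \<lceil>?x * 2 ^ N\<rceil>" by linarith
      then have K: "real K = real_of_int \<lceil>?x * 2 ^ N\<rceil>" by (simp add: K_def)
      have K2: "?x * 2 ^ N \<le> real K" "real K < ?x * 2 ^ N + 1" unfolding K by linarith+
      have alive: "(\<forall>k\<le>l. sample N z k \<noteq> n + 1) \<longleftrightarrow> real l < ?x * 2 ^ N" for l
        using elim(1) x(3)[of "real l * step N"] by (simp add: field_simps)
      have "\<exists>l\<le>K. sample N z l = n + 1" using alive[of K] K2 by auto
      then obtain l0 where l0: "l0 \<le> K" "sample N z l0 = n + 1" by blast
      have LN: "sample N z (L N) = n + 1" unfolding L_def by (rule LeastI[of "\<lambda>l. sample N z l = n + 1", OF l0(2)])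
      have "L N \<le> l0" unfolding L_def by (rule Least_le[of "\<lambda>l. sample N z l = n + 1", OF l0(2)])
      then have LK: "L N \<le> K" using l0 by simp
      have L1: "?x * 2 ^ N \<le> real (L N)" using alive[of "L N"] LN by (auto simp: not_less[symmetric])
      have "real (L N) \<le> ?x * 2 ^ N + 1" using LK K2 by linarith
      then have L2: "real (L N) * step N \<le> ?x + step N" by (simp add: field_simps)
      have le: "?x * 2 ^ N + 1 \<le> real N * 2 ^ N"
      proof -
        have "(1::real) \<le> 2 ^ N" by simp
        then have "?x * 2 ^ N + 1 \<le> (?x + 1) * 2 ^ N" unfolding distrib_right by linarith
        also have "\<dots> \<le> real N * 2 ^ N" using elim(2) by (intro mult_right_mono) auto
        finally show ?thesis .
      qed
      then have LN2: "L N \<le> N * 2 ^ N"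
        using \<open>real (L N) \<le> ?x * 2 ^ N + 1\<close> by (intro of_nat_le_iff[where 'a=real, THEN iffD1]) simp
      \<comment> \<open>Only points before the hitting time contribute, and both index ranges
        contain all of these; the delay of at most one step adds no dividend.\<close>
      have same: "l \<le> L N \<and> real l < ?x * 2 ^ N \<longleftrightarrow> l \<le> min (N * 2 ^ N) (nat \<lfloor>?x / step N\<rfloor>) \<and> real l < ?x * 2 ^ N" for l
      proof (cases "real l < ?x * 2 ^ N")
        case True
        then have "real l \<le> real (L N)" "real l \<le> real N * 2 ^ N" using L1 le by linarith+
        then have "l \<le> L N" by simp
        moreover have "l \<le> N * 2 ^ N"
          using \<open>real l \<le> real N * 2 ^ N\<close> by (intro of_nat_le_iff[where 'a=real, THEN iffD1]) simp
        moreover have "l \<le> nat \<lfloor>?x / step N\<rfloor>" using True by (intro le_nat_floor) simp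
        ultimately show ?thesis by simp
      qed simp
      have "grid_div (step N) (L N) r (sample N z) \<le> u \<longleftrightarrow>
          grid_div (step N) (min (N * 2 ^ N) (nat \<lfloor>?x / step N\<rfloor>)) r (sample N z) \<le> u" for u
        unfolding grid_div_le_iff alive using same by blast
      then have "grid_div (step N) (L N) r (sample N z) = grid_div (step N) (min (N * 2 ^ N) (nat \<lfloor>?x / step N\<rfloor>)) r (sample N z)"
        by (meson antisym order_refl)
      then show ?case using LN LN2 L1 L2 by (simp add: field_simps)
    qed
    have step0: "(\<lambda>N. step N) \<longlonglongrightarrow> 0"
      using LIMSEQ_power_zero[of "1/2::real"] by (simp add: power_one_over)
    have Lx: "(\<lambda>N. real (L N) * step N) \<longlonglongrightarrow> ?x"
    proof (rule tendsto_sandwich[OF _ _ tendsto_const])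
      show "\<forall>\<^sub>F N in sequentially. ?x \<le> real (L N) * step N" using L by eventually_elim simp
      show "\<forall>\<^sub>F N in sequentially. real (L N) * step N \<le> ?x + step N" using L by eventually_elim simp
      show "(\<lambda>N. ?x + step N) \<longlonglongrightarrow> ?x" using tendsto_add[OF tendsto_const step0] by simp
    qed
    have gL: "(\<lambda>N. grid_div (step N) (L N) r (sample N z)) \<longlonglongrightarrow> path_div r z ?x"
      by (rule Lim_transform_eventually[OF grid_div_tendsto[OF x(1)]]) (use L in \<open>eventually_elim, simp\<close>)
    have "isCont \<psi> x" for x using \<psi>_cont by (simp add: continuous_on_eq_continuous_at)
    then have "(\<lambda>N. ennreal (exp (- d * (real (L N) * step N)) * \<psi> (r + c * (real (L N) * step N) - grid_div (step N) (L N) r (sample N z))))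
        \<longlonglongrightarrow> ennreal (exp (- d * ?x) * \<psi> (r + c * ?x - path_div r z ?x))"
      by (intro tendsto_ennrealI tendsto_mult tendsto_exp tendsto_diff tendsto_add tendsto_const Lx gL
          isCont_tendsto_compose[where g=\<psi>])
    moreover have "\<forall>\<^sub>F N in sequentially. ennreal (exp (- d * (real (L N) * step N)) * \<psi> (r + c * (real (L N) * step N) - grid_div (step N) (L N) r (sample N z))) = ?T N"
      using L
    proof eventually_elim
      case (elim N)
      then have ex: "\<exists>l\<le>N * 2 ^ N. sample N z l = n + 1" by blast
      show ?case by (simp only: if_P[OF ex] Let_def L_def)
    qed
    ultimately have "?T \<longlonglongrightarrow> ennreal (exp (- d * ?x) * \<psi> (r + c * ?x - path_div r z ?x))"
      by (rule Lim_transform_eventually)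
    then show ?thesis using True by simp
  qed
  show ?thesis unfolding eq period_reward_def by (intro tendsto_add R T)
qed

end
end

section \<open>One interclaim period: expectations\<close>

lemma path_events_algebra: "sigma_algebra (space M) (path_events M Z I)"
  unfolding path_events_def by (rule sigma_algebra_sigma_sets) auto

lemma path_events_mono: "I \<subseteq> J \<Longrightarrow> path_events M Z I \<subseteq> path_events M Z J"
  unfolding path_events_def by (rule sigma_sets_mono') auto

lemma path_events_phase: "s \<in> I \<Longrightarrow> {\<omega> \<in> space M. Z s \<omega> = k} \<in> path_events M Z I"
  unfolding path_events_def by (rule sigma_sets.Basic) (auto intro!: exI[of _ s] exI[of _ k])

lemma path_events_sets:
  assumes "\<And>s. s \<in> I \<Longrightarrow> Z s \<in> measurable M (count_space S)"
  shows "path_events M Z I \<subseteq> sets M"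
  unfolding path_events_def
proof (rule sets.sigma_sets_subset, safe)
  fix s k assume "s \<in> I"
  from assms[OF this] have "Z s \<in> measurable M (count_space UNIV)"
    by (rule measurable_compose) (auto simp: measurable_def)
  then show "Z s -` {k} \<inter> space M \<in> sets M" by (rule measurable_sets) simp
qed

section \<open>Small-time expansion of the one-step expectation\<close>

lemma shift_uniform_limit:
  fixes f :: "real \<Rightarrow> real"
  assumes f: "continuous_on {0..} f" and c: "0 < c"
  shows "uniform_limit {0..B} (\<lambda>h x. f (x + c * h)) f (at_right 0)"
proof (rule uniform_limitI)
  fix e :: real assume e: "e > 0"
  have "uniformly_continuous_on {0..B+1} f"
    by (intro compact_uniformly_continuous continuous_on_subset[OF f]) auto
  then obtain k where k: "k > 0" "\<And>x y. x \<in> {0..B+1} \<Longrightarrow> y \<in> {0..B+1} \<Longrightarrow> dist y x < k \<Longrightarrow> dist (f y) (f x) < e"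
    using e unfolding uniformly_continuous_on_def by metis
  have "\<forall>\<^sub>F h in at_right (0::real). h \<in> {0<..<min k 1 / c}"
    by (rule eventually_at_right_real) (use k c in auto)
  then show "\<forall>\<^sub>F h in at_right 0. \<forall>x\<in>{0..B}. dist (f (x + c * h)) (f x) < e"
  proof eventually_elim
    case (elim h)
    then have "0 < c * h" "c * h < min k 1" using c by (auto simp: field_simps)
    then show ?case by (intro ballI k(2)) (auto simp: dist_real_def)
  qed
qed

lemma difference_quotient_uniform_limit:
  fixes f :: "real \<Rightarrow> real"
  assumes d: "\<And>x. 0 \<le> x \<Longrightarrow> (f has_real_derivative f' x) (at x within {0..})"
    and f': "continuous_on {0..} f'" and c: "0 < c"
  shows "uniform_limit {0..B} (\<lambda>h x. (f (x + c * h) - f x) / h) (\<lambda>x. c * f' x) (at_right 0)"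
proof (rule uniform_limitI)
  fix e :: real assume e: "e > 0"
  have "uniformly_continuous_on {0..B+1} f'"
    by (intro compact_uniformly_continuous continuous_on_subset[OF f']) auto
  moreover have "0 < e / c" using e c by simp
  ultimately obtain k where k: "k > 0" "\<And>x y. x \<in> {0..B+1} \<Longrightarrow> y \<in> {0..B+1} \<Longrightarrow> dist y x < k \<Longrightarrow> dist (f' y) (f' x) < e / c"
    unfolding uniformly_continuous_on_def by metis
  have "\<forall>\<^sub>F h in at_right (0::real). h \<in> {0<..<min k 1 / c}"
    by (rule eventually_at_right_real) (use k c in auto)
  then show "\<forall>\<^sub>F h in at_right 0. \<forall>x\<in>{0..B}. dist ((f (x + c * h) - f x) / h) (c * f' x) < e"
  proof eventually_elim
    case (elim h)
    then have h: "0 < h" "0 < c * h" "c * h < min k 1" using c by (auto simp: field_simps)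
    show ?case
    proof
      fix x assume x: "x \<in> {0..B}"
      obtain y where y: "x < y" "y < x + c * h" "f (x + c * h) - f x = f' y * (x + c * h - x)"
        using mvt_half_line[of x "x + c * h" f f'] x h d by auto
      have "dist (f' y) (f' x) < e / c" by (rule k(2)) (use x y h in \<open>auto simp: dist_real_def\<close>)
      then have "c * \<bar>f' y - f' x\<bar> < e" using c by (simp add: dist_real_def field_simps)
      moreover have "(f (x + c * h) - f x) / h = c * f' y" using y(3) h by simp
      ultimately show "dist ((f (x + c * h) - f x) / h) (c * f' x) < e"
        using c by (simp add: dist_real_def abs_mult flip: right_diff_distrib)
    qed
  qed
qed

lemma uniform_limit_sum:
  fixes f :: "'i \<Rightarrow> 'b \<Rightarrow> 'a \<Rightarrow> real"
  assumes "\<And>i. i \<in> I \<Longrightarrow> uniform_limit S (f i) (l i) F"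
  shows "uniform_limit S (\<lambda>h x. \<Sum>i\<in>I. f i h x) (\<lambda>x. \<Sum>i\<in>I. l i x) F"
  using assms
proof (induction I rule: infinite_finite_induct)
  case (insert i I)
  then show ?case by (simp add: uniform_limit_add)
qed (auto intro: uniform_limit_const)

lemma uniform_limit_fixed:
  fixes k :: "'b \<Rightarrow> real"
  assumes "(k \<longlongrightarrow> l) F" shows "uniform_limit S (\<lambda>h x. k h) (\<lambda>x. l) F"
proof (rule uniform_limitI)
  fix e :: real assume "e > 0"
  from tendstoD[OF assms this] show "\<forall>\<^sub>F h in F. \<forall>x\<in>S. dist (k h) l < e"
    by (rule eventually_mono) auto
qed

text \<open>Of the transition matrix only row sums and off-diagonal rates are known, so the
  expectation is written with the differences \<open>f j - f i\<close>. Uniformity in the surplus is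
  what permits adding the errors along a whole grid.\<close>

lemma one_step_uniform_limit:
  fixes \<phi> \<phi>' :: "nat \<Rightarrow> real \<Rightarrow> real" and \<psi> :: "real \<Rightarrow> real" and p :: "real \<Rightarrow> nat \<Rightarrow> nat \<Rightarrow> real"
  assumes c: "0 < c"
    and rows: "\<And>h. 0 < h \<Longrightarrow> (\<Sum>j\<in>{1..n+1}. p h i j) = 1"
    and rates: "\<And>j. j \<in> {1..n+1} \<Longrightarrow> j \<noteq> i \<Longrightarrow> ((\<lambda>h. p h i j / h) \<longlongrightarrow> lam i j) (at_right 0)"
    and i: "i \<in> {1..n}"
    and \<phi>: "\<And>j x. j \<in> {1..n} \<Longrightarrow> 0 \<le> x \<Longrightarrow> (\<phi> j has_real_derivative \<phi>' j x) (at x within {0..})"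
    and \<phi>': "continuous_on {0..} (\<phi>' i)"
    and \<psi>: "continuous_on {0..} \<psi>"
  shows "uniform_limit {0..B} (\<lambda>h x. (exp (- d * h) * (\<Sum>j\<in>{1..n+1}. p h i j * (if j = n + 1 then \<psi> else \<phi> j) (x + c * h)) - \<phi> i x) / h)
     (generator n c d lam \<phi> \<phi>' \<psi> i) (at_right 0)"
proof -
  define f where "f j = (if j = n + 1 then \<psi> else \<phi> j)" for j
  let ?S = "{1..n+1} - {i}"
  have f_cont: "continuous_on {0..} (f j)" if "j \<in> {1..n+1}" for j
    using that \<psi> half_line_continuous[OF \<phi>] by (auto simp: f_def)
  have bdd: "bounded (g ` {0..B})" if "continuous_on {0..} g" for g :: "real \<Rightarrow> real"
    by (intro compact_imp_bounded compact_continuous_image continuous_on_subset[OF that]) auto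
  have fi: "f i = \<phi> i" using i by (auto simp: f_def)
  have i': "i \<in> {1..n+1}" using i by auto
  have diff_cont: "continuous_on {0..} (\<lambda>x. f j x - f i x)" if "j \<in> {1..n+1}" for j
    by (intro continuous_intros f_cont that i')
  have A: "uniform_limit {0..B} (\<lambda>h x. (f i (x + c * h) - f i x) / h) (\<lambda>x. c * \<phi>' i x) (at_right 0)"
    unfolding fi by (rule difference_quotient_uniform_limit[OF \<phi>[OF i] \<phi>' c])
  have B: "uniform_limit {0..B} (\<lambda>h x. \<Sum>j\<in>?S. p h i j / h * (f j (x + c * h) - f i (x + c * h)))
      (\<lambda>x. \<Sum>j\<in>?S. lam i j * (f j x - f i x)) (at_right 0)"
    by (intro uniform_limit_sum uniform_lim_mult uniform_limit_fixed rates shift_uniform_limit[OF diff_cont c] bdd diff_cont) auto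
  have C: "uniform_limit {0..B} (\<lambda>h x. exp (- d * h)) (\<lambda>x. 1) (at_right 0)"
    by (rule uniform_limit_fixed) (auto intro!: tendsto_eq_intros)
  have "((\<lambda>h. exp (- d * h)) has_real_derivative - d) (at 0)" by (auto intro!: derivative_eq_intros)
  then have "((\<lambda>h. (exp (- d * h) - 1) / h) \<longlongrightarrow> - d) (at 0)" by (simp add: DERIV_def)
  then have "((\<lambda>h. (exp (- d * h) - 1) / h) \<longlongrightarrow> - d) (at_right 0)"
    by (rule filterlim_mono[OF _ order_refl]) (simp add: at_le)
  then have D: "uniform_limit {0..B} (\<lambda>h x. (exp (- d * h) - 1) / h * f i x) (\<lambda>x. - d * f i x) (at_right 0)"
    by (intro uniform_lim_mult uniform_limit_fixed uniform_limit_const bdd f_cont i') auto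
  have "continuous_on {0..} (\<lambda>x. c * \<phi>' i x + (\<Sum>j\<in>?S. lam i j * (f j x - f i x)))"
    by (intro continuous_intros \<phi>' f_cont i') auto
  then have "uniform_limit {0..B} (\<lambda>h x. exp (- d * h) * ((f i (x + c * h) - f i x) / h
       + (\<Sum>j\<in>?S. p h i j / h * (f j (x + c * h) - f i (x + c * h)))) + (exp (- d * h) - 1) / h * f i x)
     (\<lambda>x. 1 * (c * \<phi>' i x + (\<Sum>j\<in>?S. lam i j * (f j x - f i x))) + - d * f i x) (at_right 0)"
    by (intro uniform_limit_add uniform_lim_mult A B C D bdd) auto
  moreover have "1 * (c * \<phi>' i x + (\<Sum>j\<in>?S. lam i j * (f j x - f i x))) + - d * f i x = generator n c d lam \<phi> \<phi>' \<psi> i x" for x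
  proof -
    have "?S = insert (n+1) ({1..n} - {i})" using i by auto
    then have "(\<Sum>j\<in>?S. lam i j * (f j x - f i x)) = lam i (n+1) * (f (n+1) x - f i x) + (\<Sum>j\<in>{1..n} - {i}. lam i j * (f j x - f i x))"
      by simp
    also have "(\<Sum>j\<in>{1..n} - {i}. lam i j * (f j x - f i x)) = (\<Sum>j\<in>{1..n} - {i}. lam i j * (\<phi> j x - \<phi> i x))"
      using fi by (intro sum.cong) (auto simp: f_def)
    finally show ?thesis by (simp add: generator_def fi) (simp add: f_def)
  qed
  ultimately have lim: "uniform_limit {0..B} (\<lambda>h x. exp (- d * h) * ((f i (x + c * h) - f i x) / h
       + (\<Sum>j\<in>?S. p h i j / h * (f j (x + c * h) - f i (x + c * h)))) + (exp (- d * h) - 1) / h * f i x)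
     (generator n c d lam \<phi> \<phi>' \<psi> i) (at_right 0)" by simp
  show ?thesis
  proof (rule uniform_limit_cong[THEN iffD1, OF _ _ lim])
    show "\<forall>\<^sub>F h in at_right 0. \<forall>x\<in>{0..B}. exp (- d * h) * ((f i (x + c * h) - f i x) / h
       + (\<Sum>j\<in>?S. p h i j / h * (f j (x + c * h) - f i (x + c * h)))) + (exp (- d * h) - 1) / h * f i x
      = (exp (- d * h) * (\<Sum>j\<in>{1..n+1}. p h i j * (if j = n + 1 then \<psi> else \<phi> j) (x + c * h)) - \<phi> i x) / h"
      unfolding f_def[symmetric] fi[symmetric] using eventually_at_right_less[of "0::real"]
    proof eventually_elim
      case (elim h)
      show ?case
      proof
        fix x
        let ?y = "x + c * h"
        \<comment> \<open>The diagonal entry enters only through the row sum: its difference term is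
          zero.\<close>
        have "(\<Sum>j\<in>?S. p h i j * (f j ?y - f i ?y)) = (\<Sum>j\<in>{1..n+1}. p h i j * (f j ?y - f i ?y))"
          by (subst sum.remove[OF _ i']) auto
        also have "\<dots> = (\<Sum>j\<in>{1..n+1}. p h i j * f j ?y) - f i ?y"
          using rows[OF elim] by (simp add: right_diff_distrib sum_subtractf flip: sum_distrib_right)
        finally have "(\<Sum>j\<in>?S. p h i j / h * (f j ?y - f i ?y)) = ((\<Sum>j\<in>{1..n+1}. p h i j * f j ?y) - f i ?y) / h"
          by (simp add: sum_divide_distrib[symmetric])
        then show "exp (- d * h) * ((f i ?y - f i x) / h + (\<Sum>j\<in>?S. p h i j / h * (f j ?y - f i ?y))) + (exp (- d * h) - 1) / h * f i x
           = (exp (- d * h) * (\<Sum>j\<in>{1..n+1}. p h i j * f j ?y) - f i x) / h"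
          using elim by (simp add: field_simps)
      qed
    qed
  qed auto
qed

section \<open>Expected rewards on a grid\<close>

context cycle begin

fun grid_mean :: "(nat \<Rightarrow> nat \<Rightarrow> real) \<Rightarrow> real \<Rightarrow> nat \<Rightarrow> nat \<Rightarrow> real \<Rightarrow> real" where
  "grid_mean p h 0 i r = (if i = n + 1 then \<psi> r else \<alpha> * max 0 (r - b i))"
| "grid_mean p h (Suc m) i r = (if i = n + 1 then \<psi> r else \<alpha> * max 0 (r - b i)
     + exp (- d * h) * (\<Sum>j\<in>{1..n+1}. p i j * grid_mean p h m j (min r (b i) + c * h)))"

lemma next_surplus_nonneg: "0 \<le> r \<Longrightarrow> 0 \<le> h \<Longrightarrow> i \<in> {1..n+1} \<Longrightarrow> i \<noteq> n + 1 \<Longrightarrow> 0 \<le> min r (b i) + c * h"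
  using b_nonneg[of i] c_pos by auto

lemma grid_mean_nonneg:
  assumes "\<And>i j. i \<in> {1..n+1} \<Longrightarrow> j \<in> {1..n+1} \<Longrightarrow> 0 \<le> p i j" "0 \<le> h"
  shows "0 \<le> r \<Longrightarrow> i \<in> {1..n+1} \<Longrightarrow> 0 \<le> grid_mean p h m i r"
proof (induction m arbitrary: i r)
  case (Suc m)
  then show ?case
    using \<alpha>_nonneg \<psi>_nonneg assms next_surplus_nonneg[of r h i]
    by (cases "i = n + 1") (simp_all del: sum.cl_ivl_Suc, intro add_nonneg_nonneg mult_nonneg_nonneg sum_nonneg, auto)
qed (use \<alpha>_nonneg \<psi>_nonneg in auto)

lemma grid_reward_measurable:
  assumes [measurable]: "\<psi> \<in> borel_measurable borel" "R \<in> borel_measurable N"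
    and "\<And>l. z l \<in> measurable N (count_space UNIV)"
  shows "(\<lambda>\<omega>. grid_reward h m (R \<omega>) (\<lambda>l. z l \<omega>)) \<in> borel_measurable N"
  using assms(2,3)
proof (induction m arbitrary: R z)
  case 0
  note [measurable] = 0
  show ?case by simp
next
  case (Suc m)
  note [measurable] = Suc.prems
  have [measurable]: "(\<lambda>\<omega>. grid_reward h m (min (R \<omega>) (b (z 0 \<omega>)) + c * h) (\<lambda>l. z (Suc l) \<omega>)) \<in> borel_measurable N"
    by (rule Suc.IH) measurable
  show ?case by simp
qed

text \<open>The past event \<open>A\<close> makes the induction work: the event that the path is in
  \<open>i\<close> at time \<open>t\<close> becomes part of the past of time \<open>t + h\<close>,
  where the Markov property applies again.\<close>

lemma grid_expectation:
  fixes M :: "'a measure" and Z :: "real \<Rightarrow> 'a \<Rightarrow> nat"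
  assumes fin: "finite_measure M"
    and meas: "\<And>t. 0 \<le> t \<Longrightarrow> Z t \<in> measurable M (count_space {1..n+1})"
    and markov: "\<And>t i j A. 0 \<le> t \<Longrightarrow> i \<in> {1..n+1} \<Longrightarrow> j \<in> {1..n+1} \<Longrightarrow> A \<in> path_events M Z {0..t} \<Longrightarrow>
       measure M (A \<inter> {\<omega>\<in>space M. Z t \<omega> = i \<and> Z (t + h) \<omega> = j}) = measure M (A \<inter> {\<omega>\<in>space M. Z t \<omega> = i}) * p i j"
    and p: "\<And>i j. i \<in> {1..n+1} \<Longrightarrow> j \<in> {1..n+1} \<Longrightarrow> 0 \<le> p i j" and h: "0 < h"
  shows "0 \<le> t \<Longrightarrow> i \<in> {1..n+1} \<Longrightarrow> A \<in> path_events M Z {0..t} \<Longrightarrow> 0 \<le> r \<Longrightarrow>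
     (\<integral>\<^sup>+\<omega>. indicator (A \<inter> {\<omega>\<in>space M. Z t \<omega> = i}) \<omega> * ennreal (grid_reward h m r (\<lambda>l. Z (t + real l * h) \<omega>)) \<partial>M)
      = ennreal (measure M (A \<inter> {\<omega>\<in>space M. Z t \<omega> = i}) * grid_mean p h m i r)"
proof (induction m arbitrary: t i A r)
  interpret finite_measure M by fact
  case (0 t i A r)
  have A: "A \<inter> {\<omega>\<in>space M. Z t \<omega> = i} \<in> sets M"
  proof -
    have "path_events M Z {0..t} \<subseteq> sets M"
      by (rule path_events_sets[where S="{1..n+1}"]) (use meas in auto)
    moreover have "{\<omega>\<in>space M. Z t \<omega> = i} \<in> path_events M Z {0..t}"
      using 0 by (intro path_events_phase) auto
    ultimately show ?thesis using 0(3) by (intro sets.Int) (blast intro: subsetD)+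
  qed
  have "(\<integral>\<^sup>+\<omega>. indicator (A \<inter> {\<omega>\<in>space M. Z t \<omega> = i}) \<omega> * ennreal (grid_reward h 0 r (\<lambda>l. Z (t + real l * h) \<omega>)) \<partial>M)
    = (\<integral>\<^sup>+\<omega>. ennreal (grid_mean p h 0 i r) * indicator (A \<inter> {\<omega>\<in>space M. Z t \<omega> = i}) \<omega> \<partial>M)"
    by (intro nn_integral_cong) (auto simp: indicator_def)
  also have "\<dots> = ennreal (measure M (A \<inter> {\<omega>\<in>space M. Z t \<omega> = i}) * grid_mean p h 0 i r)"
    using A 0 \<psi>_nonneg \<alpha>_nonneg by (simp add: nn_integral_cmult_indicator emeasure_eq_measure ennreal_mult mult.commute)
  finally show ?case .
next
  interpret finite_measure M by fact
  case (Suc m t i A r)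
  define A' where "A' = A \<inter> {\<omega>\<in>space M. Z t \<omega> = i}"
  have sub: "path_events M Z {0..s} \<subseteq> sets M" for s
    by (rule path_events_sets[where S="{1..n+1}"]) (use meas in auto)
  interpret E: sigma_algebra "space M" "path_events M Z {0..t+h}" by (rule path_events_algebra)
  have A'_ev: "A' \<in> path_events M Z {0..t+h}"
    unfolding A'_def using Suc.prems h path_events_mono[where I="{0..t}" and J="{0..t+h}" and M=M and Z=Z]
    by (intro E.Int path_events_phase) auto
  then have A'[measurable]: "A' \<in> sets M" using sub by blast
  show ?case
  proof (cases "i = n + 1")
    case True
    have "(\<integral>\<^sup>+\<omega>. indicator A' \<omega> * ennreal (grid_reward h (Suc m) r (\<lambda>l. Z (t + real l * h) \<omega>)) \<partial>M)
      = (\<integral>\<^sup>+\<omega>. ennreal (\<psi> r) * indicator A' \<omega> \<partial>M)"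
      using True by (intro nn_integral_cong) (auto simp: indicator_def A'_def)
    also have "\<dots> = ennreal (measure M A' * grid_mean p h (Suc m) i r)"
      using True Suc.prems \<psi>_nonneg
      by (simp add: nn_integral_cmult_indicator emeasure_eq_measure ennreal_mult mult.commute)
    finally show ?thesis by (simp only: A'_def)
  next
    case False
    define r' where "r' = min r (b i) + c * h"
    have r': "0 \<le> r'" using next_surplus_nonneg[OF Suc.prems(4) _ Suc.prems(2) False, of h] h by (simp add: r'_def)
    define G where "G \<omega> = grid_reward h m r' (\<lambda>l. Z (t + h + real l * h) \<omega>)" for \<omega>
    have meas': "Z s \<in> measurable M (count_space UNIV)" if "0 \<le> s" for s
      using meas[OF that] by (rule measurable_compose) (auto simp: measurable_def)
    have [measurable]: "G \<in> borel_measurable M"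
      unfolding G_def using Suc.prems h \<psi>_cont
      by (intro grid_reward_measurable meas') (auto intro: borel_measurable_continuous_onI)
    let ?B = "\<lambda>j. A' \<inter> {\<omega>\<in>space M. Z (t + h) \<omega> = j}"
    have [measurable]: "?B j \<in> sets M" for j
      using sub[of "t+h"] path_events_phase[where s="t+h" and I="{0..t+h}" and M=M and Z=Z and k=j] Suc.prems h
      by (intro sets.Int A') auto
    have "(\<integral>\<^sup>+\<omega>. indicator A' \<omega> * ennreal (grid_reward h (Suc m) r (\<lambda>l. Z (t + real l * h) \<omega>)) \<partial>M)
      = (\<integral>\<^sup>+\<omega>. ennreal (\<alpha> * max 0 (r - b i)) * indicator A' \<omega> + ennreal (exp (- d * h)) * (\<Sum>j\<in>{1..n+1}. indicator (?B j) \<omega> * ennreal (G \<omega>)) \<partial>M)"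
    proof (rule nn_integral_cong)
      fix \<omega> assume \<omega>: "\<omega> \<in> space M"
      show "indicator A' \<omega> * ennreal (grid_reward h (Suc m) r (\<lambda>l. Z (t + real l * h) \<omega>))
        = ennreal (\<alpha> * max 0 (r - b i)) * indicator A' \<omega> + ennreal (exp (- d * h)) * (\<Sum>j\<in>{1..n+1}. indicator (?B j) \<omega> * ennreal (G \<omega>))"
      proof (cases "\<omega> \<in> A'")
        case True
        have in_S: "Z s \<omega> \<in> {1..n+1}" if "0 \<le> s" for s using measurable_space[OF meas[OF that] \<omega>] by simp
        have "0 \<le> G \<omega>" unfolding G_def using r' h Suc.prems in_S by (intro grid_reward_nonneg) auto
        have "(\<Sum>j\<in>{1..n+1}. indicator (?B j) \<omega> * ennreal (G \<omega>)) = (\<Sum>j\<in>{1..n+1}. if Z (t + h) \<omega> = j then ennreal (G \<omega>) else 0)"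
          using True \<omega> by (intro sum.cong) (auto simp: indicator_def)
        also have "\<dots> = ennreal (G \<omega>)" using in_S[of "t + h"] Suc.prems h by simp
        finally have "(\<Sum>j\<in>{1..n+1}. indicator (?B j) \<omega> * ennreal (G \<omega>)) = ennreal (G \<omega>)" .
        moreover have "grid_reward h (Suc m) r (\<lambda>l. Z (t + real l * h) \<omega>) = \<alpha> * max 0 (r - b i) + exp (- d * h) * G \<omega>"
          using True False by (simp add: A'_def G_def r'_def algebra_simps)
        ultimately show ?thesis
          using True \<open>0 \<le> G \<omega>\<close> \<alpha>_nonneg by (simp add: ennreal_plus ennreal_mult)
      qed (auto simp: indicator_def)
    qed
    also have "\<dots> = ennreal (\<alpha> * max 0 (r - b i)) * ennreal (measure M A') + ennreal (exp (- d * h)) *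
        (\<Sum>j\<in>{1..n+1}. \<integral>\<^sup>+\<omega>. indicator (?B j) \<omega> * ennreal (G \<omega>) \<partial>M)"
      by (subst nn_integral_add, measurable)
         (subst nn_integral_cmult, measurable, subst nn_integral_cmult, measurable, subst nn_integral_sum, measurable,
          simp add: emeasure_eq_measure)
    also have "(\<Sum>j\<in>{1..n+1}. \<integral>\<^sup>+\<omega>. indicator (?B j) \<omega> * ennreal (G \<omega>) \<partial>M)
        = (\<Sum>j\<in>{1..n+1}. ennreal (measure M A' * p i j * grid_mean p h m j r'))"
    proof (rule sum.cong[OF refl])
      fix j assume j: "j \<in> {1..n+1}"
      have "?B j = A \<inter> {\<omega>\<in>space M. Z t \<omega> = i \<and> Z (t + h) \<omega> = j}" by (auto simp: A'_def)
      then have "measure M (?B j) = measure M A' * p i j"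
        using markov[OF Suc.prems(1,2) j Suc.prems(3)] by (simp add: A'_def)
      then show "(\<integral>\<^sup>+\<omega>. indicator (?B j) \<omega> * ennreal (G \<omega>) \<partial>M) = ennreal (measure M A' * p i j * grid_mean p h m j r')"
        unfolding G_def using Suc.IH[OF _ j A'_ev r'] Suc.prems h by simp
    qed
    also have "\<dots> = ennreal (\<Sum>j\<in>{1..n+1}. measure M A' * p i j * grid_mean p h m j r')"
      using p Suc.prems(2) h r' by (intro sum_ennreal mult_nonneg_nonneg grid_mean_nonneg) auto
    also have "\<dots> = ennreal (measure M A' * (\<Sum>j\<in>{1..n+1}. p i j * grid_mean p h m j r'))"
      by (simp only: sum_distrib_left mult.assoc)
    also have "ennreal (\<alpha> * max 0 (r - b i)) * ennreal (measure M A') + ennreal (exp (- d * h)) * \<dots>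
       = ennreal (measure M A' * grid_mean p h (Suc m) i r)"
    proof -
      have "0 \<le> (\<Sum>j\<in>{1..n+1}. p i j * grid_mean p h m j r')"
        using p Suc.prems(2) h r' by (intro sum_nonneg mult_nonneg_nonneg grid_mean_nonneg) auto
      then show ?thesis using False \<alpha>_nonneg
        by (simp add: r'_def ennreal_plus ennreal_mult'' algebra_simps flip: ennreal_mult'' ennreal_plus del: sum.cl_ivl_Suc)
    qed
    finally show ?thesis by (simp only: A'_def)
  qed
qed

end

context cycle begin

abbreviation "extend \<phi> j \<equiv> (if j = n + 1 then \<psi> else \<phi> j)"

text \<open>Each step may violate the supersolution inequality by \<open>h * e\<close>; discounting
  turns the accumulated errors into a geometric sum. A step first pays down to the barrier, so the
  one-step inequality is asked for on \<open>x \<le> b i\<close>, and \<open>lump\<close> covers the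
  payment.\<close>

lemma grid_mean_le:
  assumes p: "\<And>i j. i \<in> {1..n+1} \<Longrightarrow> j \<in> {1..n+1} \<Longrightarrow> 0 \<le> p i j" "\<And>i. i \<in> {1..n+1} \<Longrightarrow> (\<Sum>j\<in>{1..n+1}. p i j) = 1"
    and h: "0 < h" and e: "0 \<le> e"
    and step: "\<And>i x. i \<in> {1..n} \<Longrightarrow> 0 \<le> x \<Longrightarrow> x \<le> b i \<Longrightarrow>
       exp (- d * h) * (\<Sum>j\<in>{1..n+1}. p i j * extend \<phi> j (x + c * h)) \<le> \<phi> i x + h * e"
    and lump: "\<And>i r. i \<in> {1..n} \<Longrightarrow> 0 \<le> r \<Longrightarrow> \<alpha> * max 0 (r - b i) + \<phi> i (min r (b i)) \<le> \<phi> i r"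
    and nonneg: "\<And>i r. i \<in> {1..n} \<Longrightarrow> 0 \<le> r \<Longrightarrow> 0 \<le> \<phi> i r"
  shows "0 \<le> r \<Longrightarrow> i \<in> {1..n+1} \<Longrightarrow>
    grid_mean p h m i r \<le> extend \<phi> i r + h * e * (\<Sum>l<m. exp (- d * h) ^ l)"
proof (induction m arbitrary: i r)
  case 0
  show ?case
  proof (cases "i = n + 1")
    case False
    then have i: "i \<in> {1..n}" using 0 by auto
    have "0 \<le> \<phi> i (min r (b i))" using nonneg[OF i] 0 b_nonneg[OF i] by simp
    then show ?thesis using lump[OF i 0(1)] False by simp
  qed simp
next
  case (Suc m)
  let ?S = "\<Sum>l<m. exp (- d * h) ^ l"
  have S: "0 \<le> ?S" by (intro sum_nonneg) auto
  have S': "(\<Sum>l<Suc m. exp (- d * h) ^ l) = 1 + exp (- d * h) * ?S"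
    by (subst sum.lessThan_Suc_shift) (simp add: sum_distrib_left)
  show ?case
  proof (cases "i = n + 1")
    case True
    have "0 \<le> h * e * (\<Sum>l<Suc m. exp (- d * h) ^ l)" using h e S by (simp add: S')
    then show ?thesis using True by simp
  next
    case False
    then have i: "i \<in> {1..n}" using Suc.prems by auto
    let ?x = "min r (b i)"
    have x: "0 \<le> ?x" "?x \<le> b i" using Suc.prems b_nonneg[OF i] by auto
    have xh: "0 \<le> ?x + c * h" using x c_pos h by simp
    have "(\<Sum>j\<in>{1..n+1}. p i j * grid_mean p h m j (?x + c * h))
        \<le> (\<Sum>j\<in>{1..n+1}. p i j * (extend \<phi> j (?x + c * h) + h * e * ?S))"
      by (intro sum_mono mult_left_mono Suc.IH xh p Suc.prems)
    also have "\<dots> = (\<Sum>j\<in>{1..n+1}. p i j * extend \<phi> j (?x + c * h)) + h * e * ?S"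
      using p(2)[OF Suc.prems(2)] by (simp only: distrib_left sum.distrib sum_distrib_right[symmetric] mult_1_left)
    finally have "exp (- d * h) * (\<Sum>j\<in>{1..n+1}. p i j * grid_mean p h m j (?x + c * h))
       \<le> exp (- d * h) * (\<Sum>j\<in>{1..n+1}. p i j * extend \<phi> j (?x + c * h)) + exp (- d * h) * (h * e * ?S)"
      unfolding distrib_left[symmetric] by (rule mult_left_mono) simp
    also have "\<dots> \<le> \<phi> i ?x + h * e + exp (- d * h) * (h * e * ?S)"
      using step[OF i x] by simp
    also have "\<dots> = \<phi> i ?x + h * e * (1 + exp (- d * h) * ?S)" by (simp add: algebra_simps)
    finally show ?thesis using lump[OF i Suc.prems(1)] False unfolding S' by simp
  qed
qed

text \<open>The recursion stops after \<open>m\<close> steps and forfeits the remaining value; after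
  the last payment the surplus is at most at the barrier, so the loss is bounded by \<open>B\<close>
  and discounted \<open>m\<close> times.\<close>

lemma grid_mean_ge:
  assumes p: "\<And>i j. i \<in> {1..n+1} \<Longrightarrow> j \<in> {1..n+1} \<Longrightarrow> 0 \<le> p i j" "\<And>i. i \<in> {1..n+1} \<Longrightarrow> (\<Sum>j\<in>{1..n+1}. p i j) = 1"
    and h: "0 < h" and e: "0 \<le> e"
    and step: "\<And>i x. i \<in> {1..n} \<Longrightarrow> 0 \<le> x \<Longrightarrow> x \<le> b i \<Longrightarrow>
       \<phi> i x - h * e \<le> exp (- d * h) * (\<Sum>j\<in>{1..n+1}. p i j * extend \<phi> j (x + c * h))"
    and lump: "\<And>i r. i \<in> {1..n} \<Longrightarrow> 0 \<le> r \<Longrightarrow> \<phi> i r \<le> \<alpha> * max 0 (r - b i) + \<phi> i (min r (b i))"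
    and bound: "\<And>i r. i \<in> {1..n} \<Longrightarrow> 0 \<le> r \<Longrightarrow> r \<le> b i \<Longrightarrow> \<phi> i r \<le> B" and B: "0 \<le> B"
  shows "0 \<le> r \<Longrightarrow> i \<in> {1..n+1} \<Longrightarrow>
    extend \<phi> i r - h * e * (\<Sum>l<m. exp (- d * h) ^ l) - exp (- d * h) ^ m * B \<le> grid_mean p h m i r"
proof (induction m arbitrary: i r)
  case 0
  show ?case
  proof (cases "i = n + 1")
    case False
    then have i: "i \<in> {1..n}" using 0 by auto
    have "\<phi> i (min r (b i)) \<le> B" using bound[OF i] 0 b_nonneg[OF i] by simp
    then show ?thesis using lump[OF i 0(1)] False by simp
  qed (use B in simp)
next
  case (Suc m)
  let ?S = "\<Sum>l<m. exp (- d * h) ^ l"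
  have S: "0 \<le> ?S" by (intro sum_nonneg) auto
  have S': "(\<Sum>l<Suc m. exp (- d * h) ^ l) = 1 + exp (- d * h) * ?S"
    by (subst sum.lessThan_Suc_shift) (simp add: sum_distrib_left)
  show ?case
  proof (cases "i = n + 1")
    case True
    have "0 \<le> h * e * (\<Sum>l<Suc m. exp (- d * h) ^ l) + exp (- d * h) ^ Suc m * B" using h e S B by (simp add: S')
    then show ?thesis using True by simp
  next
    case False
    then have i: "i \<in> {1..n}" using Suc.prems by auto
    let ?x = "min r (b i)"
    have x: "0 \<le> ?x" "?x \<le> b i" using Suc.prems b_nonneg[OF i] by auto
    have xh: "0 \<le> ?x + c * h" using x c_pos h by simp
    have "(\<Sum>j\<in>{1..n+1}. p i j * extend \<phi> j (?x + c * h)) + (- (h * e * ?S) - exp (- d * h) ^ m * B)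
       = (\<Sum>j\<in>{1..n+1}. p i j * (extend \<phi> j (?x + c * h) + (- (h * e * ?S) - exp (- d * h) ^ m * B)))"
      using p(2)[OF Suc.prems(2)] by (simp only: distrib_left sum.distrib sum_distrib_right[symmetric] mult_1_left)
    also have "\<dots> \<le> (\<Sum>j\<in>{1..n+1}. p i j * grid_mean p h m j (?x + c * h))"
    proof (intro sum_mono mult_left_mono p Suc.prems)
      fix j assume "j \<in> {1..n+1}"
      from Suc.IH[OF xh this]
      show "extend \<phi> j (?x + c * h) + (- (h * e * ?S) - exp (- d * h) ^ m * B) \<le> grid_mean p h m j (?x + c * h)" by simp
    qed
    finally have "exp (- d * h) * (\<Sum>j\<in>{1..n+1}. p i j * extend \<phi> j (?x + c * h)) + exp (- d * h) * (- (h * e * ?S) - exp (- d * h) ^ m * B)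
       \<le> exp (- d * h) * (\<Sum>j\<in>{1..n+1}. p i j * grid_mean p h m j (?x + c * h))"
      unfolding distrib_left[symmetric] by (rule mult_left_mono) simp
    moreover have "\<phi> i ?x - h * e \<le> exp (- d * h) * (\<Sum>j\<in>{1..n+1}. p i j * extend \<phi> j (?x + c * h))"
      by (rule step[OF i x])
    moreover have "h * e * (\<Sum>l<Suc m. exp (- d * h) ^ l) = h * e + exp (- d * h) * (h * e * ?S)"
      unfolding S' by (simp add: algebra_simps)
    moreover have "exp (- d * h) * (- (h * e * ?S) - exp (- d * h) ^ m * B) = - (exp (- d * h) * (h * e * ?S)) - exp (- d * h) ^ Suc m * B"
      by (simp add: algebra_simps)
    ultimately have "\<phi> i ?x - h * e * (\<Sum>l<Suc m. exp (- d * h) ^ l) - exp (- d * h) ^ Suc m * B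
       \<le> exp (- d * h) * (\<Sum>j\<in>{1..n+1}. p i j * grid_mean p h m j (?x + c * h))"
      by linarith
    then show ?thesis using lump[OF i Suc.prems(1)] False by (simp del: power_Suc sum.lessThan_Suc sum.cl_ivl_Suc)
  qed
qed

text \<open>The sum is at most \<open>1 / (1 - exp (- d * h))\<close>, and
  \<open>exp (- d * h) * (1 + d * h) \<le> 1\<close> bounds \<open>h\<close> times this by
  \<open>(1 + d * h) / d\<close>; then \<open>h \<le> 1\<close> is used.\<close>

lemma geometric_bound:
  assumes "0 < h" "h \<le> 1" shows "h * (\<Sum>l<m. exp (- d * h) ^ l) \<le> (1 + d) / d"
proof -
  have dh: "0 < d * h" using d_pos assms by simp
  have "exp (- (d * h)) * (1 + d * h) \<le> exp (- (d * h)) * exp (d * h)"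
    by (intro mult_left_mono exp_ge_add_one_self_aux) (use dh in auto)
  then have "exp (- (d * h)) * (1 + d * h) \<le> 1" by (simp flip: exp_add)
  then have q: "d * h \<le> (1 - exp (- d * h)) * (1 + d * h)" by (simp add: algebra_simps)
  have lt: "exp (- d * h) < 1" using dh by simp
  have "(1 - exp (- d * h)) * (\<Sum>l<m. exp (- d * h) ^ l) = 1 - exp (- d * h) ^ m"
    by (rule one_diff_power_eq[symmetric])
  then have "(1 - exp (- d * h)) * (\<Sum>l<m. exp (- d * h) ^ l) \<le> 1" by simp
  then have "(1 - exp (- d * h)) * (\<Sum>l<m. exp (- d * h) ^ l) * (1 + d * h) \<le> 1 * (1 + d * h)"
    using dh by (intro mult_right_mono) auto
  moreover have "d * h * (\<Sum>l<m. exp (- d * h) ^ l) \<le> (1 - exp (- d * h)) * (1 + d * h) * (\<Sum>l<m. exp (- d * h) ^ l)"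
    by (intro mult_right_mono q sum_nonneg) auto
  ultimately have "d * h * (\<Sum>l<m. exp (- d * h) ^ l) \<le> 1 + d * h" by (simp add: mult_ac)
  also have "\<dots> \<le> 1 + d" using assms d_pos by simp
  finally show ?thesis using d_pos by (simp add: field_simps)
qed

end

section \<open>The Markov process of one interclaim period\<close>

locale cycle_process = cycle n c \<alpha> d b \<psi> C + prob_space M
  for n c \<alpha> d b \<psi> C and M :: "'a measure" +
  fixes lam :: "nat \<Rightarrow> nat \<Rightarrow> real" and Z :: "real \<Rightarrow> 'a \<Rightarrow> nat"
  assumes process: "markov_jump_process M {1..n+1} (\<lambda>l j. if l = n + 1 then 0 else lam l j) Z"
    and starts: "AE \<omega> in M. Z 0 \<omega> \<in> {1..n}"
begin

lemma Z_measurable: "0 \<le> t \<Longrightarrow> Z t \<in> measurable M (count_space {1..n+1})"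
  using process by (auto simp: markov_jump_process_def)

lemma Z_measurable': "0 \<le> t \<Longrightarrow> Z t \<in> measurable M (count_space UNIV)"
  by (rule measurable_compose[OF Z_measurable]) (auto simp: measurable_def)

lemma Z_regular: "\<omega> \<in> space M \<Longrightarrow> regular_path n (\<lambda>t. Z t \<omega>)"
  unfolding regular_path_def
proof (intro allI impI conjI)
  fix t :: real assume \<omega>: "\<omega> \<in> space M" and t: "0 \<le> t"
  show "Z t \<omega> \<in> {1..n+1}" using measurable_space[OF Z_measurable[OF t] \<omega>] by simp
  show "\<forall>\<^sub>F s in at_right t. Z s \<omega> = Z t \<omega>"
    using process \<omega> t by (auto simp: markov_jump_process_def)
qed

lemma transition_probabilities:
  obtains p where "\<And>h i j. 0 < h \<Longrightarrow> i \<in> {1..n+1} \<Longrightarrow> j \<in> {1..n+1} \<Longrightarrow> 0 \<le> p h i j"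
    "\<And>h i. 0 < h \<Longrightarrow> i \<in> {1..n+1} \<Longrightarrow> (\<Sum>j\<in>{1..n+1}. p h i j) = 1"
    "\<And>i j. i \<in> {1..n} \<Longrightarrow> j \<in> {1..n+1} \<Longrightarrow> j \<noteq> i \<Longrightarrow> ((\<lambda>h. p h i j / h) \<longlongrightarrow> lam i j) (at_right 0)"
    "\<And>t h i j A. 0 \<le> t \<Longrightarrow> 0 < h \<Longrightarrow> i \<in> {1..n+1} \<Longrightarrow> j \<in> {1..n+1} \<Longrightarrow> A \<in> path_events M Z {0..t} \<Longrightarrow>
       measure M (A \<inter> {\<omega>\<in>space M. Z t \<omega> = i \<and> Z (t + h) \<omega> = j}) = measure M (A \<inter> {\<omega>\<in>space M. Z t \<omega> = i}) * p h i j"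
proof -
  obtain p where *: "(\<forall>h>0. \<forall>i\<in>{1..n+1}. (\<forall>j\<in>{1..n+1}. 0 \<le> p h i j) \<and> (\<Sum>j\<in>{1..n+1}. p h i j) = 1) \<and>
    (\<forall>i\<in>{1..n+1}. \<forall>j\<in>{1..n+1}. j \<noteq> i \<longrightarrow> ((\<lambda>h. p h i j / h) \<longlongrightarrow> (if i = n + 1 then 0 else lam i j)) (at_right 0)) \<and>
    (\<forall>t\<ge>0. \<forall>h>0. \<forall>i\<in>{1..n+1}. \<forall>j\<in>{1..n+1}. \<forall>A\<in>path_events M Z {0..t}.
           measure M (A \<inter> {\<omega>\<in>space M. Z t \<omega> = i \<and> Z (t + h) \<omega> = j}) =
           measure M (A \<inter> {\<omega>\<in>space M. Z t \<omega> = i}) * p h i j)"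
    using process[unfolded markov_jump_process_def, THEN conjunct2, THEN conjunct2, THEN conjunct2] by (rule exE)
  note p = conjunct1[OF *] conjunct1[OF conjunct2[OF *]] conjunct2[OF conjunct2[OF *]]
  show thesis
  proof (rule that[of p])
    show "0 \<le> p h i j" if "0 < h" "i \<in> {1..n+1}" "j \<in> {1..n+1}" for h i j
      using p(1) that by blast
    show "(\<Sum>j\<in>{1..n+1}. p h i j) = 1" if "0 < h" "i \<in> {1..n+1}" for h i
      using p(1) that by blast
    show "measure M (A \<inter> {\<omega>\<in>space M. Z t \<omega> = i \<and> Z (t + h) \<omega> = j}) = measure M (A \<inter> {\<omega>\<in>space M. Z t \<omega> = i}) * p h i j"
      if "0 \<le> t" "0 < h" "i \<in> {1..n+1}" "j \<in> {1..n+1}" "A \<in> path_events M Z {0..t}" for t h i j A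
      by (rule p(3)[rule_format]) (rule that)+
    fix i j assume ij: "i \<in> {1..n}" "j \<in> {1..n+1}" "j \<noteq> i"
    then have "((\<lambda>h. p h i j / h) \<longlongrightarrow> (if i = n + 1 then 0 else lam i j)) (at_right 0)"
      by (intro p(2)[rule_format]) (use ij in auto)
    then show "((\<lambda>h. p h i j / h) \<longlongrightarrow> lam i j) (at_right 0)" using ij by auto
  qed
qed

lemma grid_limit:
  assumes r: "0 \<le> r"
  shows "(\<lambda>N. \<integral>\<^sup>+\<omega>. ennreal (grid_reward (step N) (N * 2 ^ N) r (sample N (\<lambda>t. Z t \<omega>))) \<partial>M)
     \<longlonglongrightarrow> (\<integral>\<^sup>+\<omega>. period_reward r (\<lambda>t. Z t \<omega>) \<partial>M)"
    and "(\<lambda>\<omega>. period_reward r (\<lambda>t. Z t \<omega>)) \<in> borel_measurable M"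
proof -
  have m: "(\<lambda>\<omega>. ennreal (grid_reward (step N) (N * 2 ^ N) r (sample N (\<lambda>t. Z t \<omega>)))) \<in> borel_measurable M" for N
    using \<psi>_cont by (intro measurable_compose[OF grid_reward_measurable measurable_ennreal] Z_measurable')
      (auto intro: borel_measurable_continuous_onI)
  have lim: "(\<lambda>N. ennreal (grid_reward (step N) (N * 2 ^ N) r (sample N (\<lambda>t. Z t \<omega>)))) \<longlonglongrightarrow> period_reward r (\<lambda>t. Z t \<omega>)"
    if "\<omega> \<in> space M" for \<omega> by (rule grid_reward_tendsto[OF Z_regular[OF that] r])
  show m': "(\<lambda>\<omega>. period_reward r (\<lambda>t. Z t \<omega>)) \<in> borel_measurable M"
    by (rule borel_measurable_LIMSEQ_order[OF lim m])
  show "(\<lambda>N. \<integral>\<^sup>+\<omega>. ennreal (grid_reward (step N) (N * 2 ^ N) r (sample N (\<lambda>t. Z t \<omega>))) \<partial>M)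
     \<longlonglongrightarrow> (\<integral>\<^sup>+\<omega>. period_reward r (\<lambda>t. Z t \<omega>) \<partial>M)"
  proof (rule nn_integral_dominated_convergence[where w="\<lambda>_. ennreal (\<alpha> * (r + c / d) + C * (1 + r + c / d))"])
    show "AE \<omega> in M. ennreal (grid_reward (step N) (N * 2 ^ N) r (sample N (\<lambda>t. Z t \<omega>))) \<le> ennreal (\<alpha> * (r + c / d) + C * (1 + r + c / d))" for N
      using regular_phase[OF Z_regular] r by (intro AE_I2 ennreal_leI grid_reward_bound) auto
  qed (use m m' lim in \<open>auto simp: emeasure_space_1\<close>)
qed

definition init_prob :: "nat \<Rightarrow> real" where "init_prob i = measure M {\<omega>\<in>space M. Z 0 \<omega> = i}"

lemma init_prob_sum: "(\<Sum>i\<in>{1..n}. init_prob i) = 1" and init_prob_absorbed: "init_prob (n+1) = 0"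
proof -
  have ev: "{\<omega>\<in>space M. Z 0 \<omega> = i} \<in> events" for i
    using measurable_sets[OF Z_measurable'[of 0], of "{i}"] by (simp add: vimage_def Int_def conj_commute)
  have "AE \<omega> in M. \<omega> \<notin> {\<omega>\<in>space M. Z 0 \<omega> = n+1}" using starts by eventually_elim auto
  then show "init_prob (n+1) = 0" unfolding init_prob_def using ev by (subst prob_eq_0) auto
  have "(\<Sum>i\<in>{1..n}. init_prob i) = prob (\<Union>i\<in>{1..n}. {\<omega>\<in>space M. Z 0 \<omega> = i})"
    unfolding init_prob_def using ev by (intro finite_measure_finite_Union[symmetric]) (auto simp: disjoint_family_on_def)
  also have "\<dots> = 1"
  proof (subst prob_eq_1)
    show "AE \<omega> in M. \<omega> \<in> (\<Union>i\<in>{1..n}. {\<omega>\<in>space M. Z 0 \<omega> = i})"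
      using starts AE_space by eventually_elim auto
  qed (use ev in auto)
  finally show "(\<Sum>i\<in>{1..n}. init_prob i) = 1" .
qed

lemma grid_total:
  assumes p: "\<And>i j. i \<in> {1..n+1} \<Longrightarrow> j \<in> {1..n+1} \<Longrightarrow> 0 \<le> p i j" and h: "0 < h" and r: "0 \<le> r"
    and markov: "\<And>t i j A. 0 \<le> t \<Longrightarrow> i \<in> {1..n+1} \<Longrightarrow> j \<in> {1..n+1} \<Longrightarrow> A \<in> path_events M Z {0..t} \<Longrightarrow>
       measure M (A \<inter> {\<omega>\<in>space M. Z t \<omega> = i \<and> Z (t + h) \<omega> = j}) = measure M (A \<inter> {\<omega>\<in>space M. Z t \<omega> = i}) * p i j"
  shows "(\<integral>\<^sup>+\<omega>. ennreal (grid_reward h m r (\<lambda>l. Z (real l * h) \<omega>)) \<partial>M)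
     = ennreal (\<Sum>i\<in>{1..n}. init_prob i * grid_mean p h m i r)"
proof -
  have m: "(\<lambda>\<omega>. ennreal (grid_reward h m r (\<lambda>l. Z (real l * h) \<omega>))) \<in> borel_measurable M"
    using h \<psi>_cont by (intro measurable_compose[OF grid_reward_measurable measurable_ennreal] Z_measurable')
      (auto intro: borel_measurable_continuous_onI)
  have ev: "{\<omega>\<in>space M. Z 0 \<omega> = i} \<in> events" for i
    using measurable_sets[OF Z_measurable'[of 0], of "{i}"] by (simp add: vimage_def Int_def conj_commute)
  have "(\<integral>\<^sup>+\<omega>. ennreal (grid_reward h m r (\<lambda>l. Z (real l * h) \<omega>)) \<partial>M)
     = (\<integral>\<^sup>+\<omega>. (\<Sum>i\<in>{1..n+1}. indicator {\<omega>\<in>space M. Z 0 \<omega> = i} \<omega> * ennreal (grid_reward h m r (\<lambda>l. Z (real l * h) \<omega>))) \<partial>M)"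
  proof (rule nn_integral_cong)
    fix \<omega> assume \<omega>: "\<omega> \<in> space M"
    let ?g = "ennreal (grid_reward h m r (\<lambda>l. Z (real l * h) \<omega>))"
    have "(\<Sum>i\<in>{1..n+1}. indicator {\<omega>\<in>space M. Z 0 \<omega> = i} \<omega> * ?g) = (\<Sum>i\<in>{1..n+1}. if Z 0 \<omega> = i then ?g else 0)"
      using \<omega> by (intro sum.cong) (auto simp: indicator_def)
    also have "\<dots> = ?g" using measurable_space[OF Z_measurable[of 0] \<omega>] by simp
    finally show "?g = (\<Sum>i\<in>{1..n+1}. indicator {\<omega>\<in>space M. Z 0 \<omega> = i} \<omega> * ?g)" by simp
  qed
  also have "\<dots> = (\<Sum>i\<in>{1..n+1}. \<integral>\<^sup>+\<omega>. indicator {\<omega>\<in>space M. Z 0 \<omega> = i} \<omega> * ennreal (grid_reward h m r (\<lambda>l. Z (real l * h) \<omega>)) \<partial>M)"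
    using ev m by (intro nn_integral_sum borel_measurable_times) auto
  also have "\<dots> = (\<Sum>i\<in>{1..n+1}. ennreal (init_prob i * grid_mean p h m i r))"
  proof (rule sum.cong[OF refl])
    fix i assume i: "i \<in> {1..n+1}"
    interpret E: sigma_algebra "space M" "path_events M Z {0..0}" by (rule path_events_algebra)
    have "space M \<inter> {\<omega>\<in>space M. Z 0 \<omega> = i} = {\<omega>\<in>space M. Z 0 \<omega> = i}" by auto
    then show "(\<integral>\<^sup>+\<omega>. indicator {\<omega>\<in>space M. Z 0 \<omega> = i} \<omega> * ennreal (grid_reward h m r (\<lambda>l. Z (real l * h) \<omega>)) \<partial>M)
        = ennreal (init_prob i * grid_mean p h m i r)"
      using grid_expectation[OF finite_measure_axioms Z_measurable markov p h order_refl i E.top r, of m]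
      by (simp add: init_prob_def)
  qed
  also have "\<dots> = ennreal (\<Sum>i\<in>{1..n+1}. init_prob i * grid_mean p h m i r)"
    using p h r by (intro sum_ennreal mult_nonneg_nonneg grid_mean_nonneg) (auto simp: init_prob_def)
  also have "(\<Sum>i\<in>{1..n+1}. init_prob i * grid_mean p h m i r) = (\<Sum>i\<in>{1..n}. init_prob i * grid_mean p h m i r)"
    using init_prob_absorbed by simp
  finally show ?thesis .
qed


lemma one_step:
  assumes \<phi>: "\<And>j x. j \<in> {1..n} \<Longrightarrow> 0 \<le> x \<Longrightarrow> (\<phi> j has_real_derivative \<phi>' j x) (at x within {0..})"
    and \<phi>': "\<And>j. j \<in> {1..n} \<Longrightarrow> continuous_on {0..} (\<phi>' j)"
    and p: "\<And>h i. 0 < h \<Longrightarrow> i \<in> {1..n+1} \<Longrightarrow> (\<Sum>j\<in>{1..n+1}. p h i j) = 1"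
      "\<And>i j. i \<in> {1..n} \<Longrightarrow> j \<in> {1..n+1} \<Longrightarrow> j \<noteq> i \<Longrightarrow> ((\<lambda>h. p h i j / h) \<longlongrightarrow> lam i j) (at_right 0)"
    and e: "0 < e"
  shows "\<forall>\<^sub>F N in sequentially. \<forall>i\<in>{1..n}. \<forall>x\<in>{0..b i}.
     \<bar>exp (- d * step N) * (\<Sum>j\<in>{1..n+1}. p (step N) i j * extend \<phi> j (x + c * step N)) - \<phi> i x
        - step N * generator n c d lam \<phi> \<phi>' \<psi> i x\<bar> \<le> step N * e"
proof -
  have "\<forall>\<^sub>F h in at_right 0. \<forall>x\<in>{0..b i}. dist ((exp (- d * h) * (\<Sum>j\<in>{1..n+1}. p h i j * extend \<phi> j (x + c * h)) - \<phi> i x) / h)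
       (generator n c d lam \<phi> \<phi>' \<psi> i x) < e" if i: "i \<in> {1..n}" for i
  proof (rule uniform_limitD[OF _ e])
    show "uniform_limit {0..b i} (\<lambda>h x. (exp (- d * h) * (\<Sum>j\<in>{1..n+1}. p h i j * extend \<phi> j (x + c * h)) - \<phi> i x) / h)
       (generator n c d lam \<phi> \<phi>' \<psi> i) (at_right 0)"
      by (rule one_step_uniform_limit[where p=p and lam=lam])
         (use c_pos p i \<phi> \<phi>' \<psi>_cont in \<open>auto intro: continuous_on_subset simp del: sum.cl_ivl_Suc\<close>)
  qed
  then have ev: "\<forall>\<^sub>F h in at_right 0. \<forall>i\<in>{1..n}. \<forall>x\<in>{0..b i}. dist ((exp (- d * h) * (\<Sum>j\<in>{1..n+1}. p h i j * extend \<phi> j (x + c * h)) - \<phi> i x) / h)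
       (generator n c d lam \<phi> \<phi>' \<psi> i x) < e"
    by (intro eventually_ball_finite) auto
  have "(\<lambda>N. step N) \<longlonglongrightarrow> 0" using LIMSEQ_power_zero[of "1/2::real"] by (simp add: power_one_over)
  then have "filterlim (\<lambda>N. step N) (at_right 0) sequentially"
    by (intro tendsto_imp_filterlim_at_right) auto
  from eventually_compose_filterlim[OF ev this] show ?thesis
  proof (rule eventually_mono, intro ballI)
    fix N i x
    let ?g = "generator n c d lam \<phi> \<phi>' \<psi> i x"
    let ?q = "exp (- d * step N) * (\<Sum>j\<in>{1..n+1}. p (step N) i j * extend \<phi> j (x + c * step N)) - \<phi> i x"
    assume "\<forall>i\<in>{1..n}. \<forall>x\<in>{0..b i}. dist ((exp (- d * step N) * (\<Sum>j\<in>{1..n+1}. p (step N) i j * extend \<phi> j (x + c * step N)) - \<phi> i x) / step N)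
       (generator n c d lam \<phi> \<phi>' \<psi> i x) < e" "i \<in> {1..n}" "x \<in> {0..b i}"
    then have "\<bar>?q / step N - ?g\<bar> \<le> e" unfolding dist_real_def by (meson less_imp_le)
    then have "step N * \<bar>?q / step N - ?g\<bar> \<le> step N * e" by (rule mult_left_mono) simp
    moreover have "step N * \<bar>?q / step N - ?g\<bar> = \<bar>step N * (?q / step N - ?g)\<bar>" by (simp only: abs_mult) simp
    moreover have "step N * (?q / step N - ?g) = ?q - step N * ?g" by (simp only: right_diff_distrib) simp
    ultimately show "\<bar>?q - step N * ?g\<bar> \<le> step N * e" by (simp only:)
  qed
qed

text \<open>Comparison on grids with vanishing error: \<open>one_step\<close> makes the error per
  unit of time as small as desired, the discounted number of steps times their length stays bounded,
  and the grid rewards converge to the period reward.\<close>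

lemma period_le:
  assumes \<phi>: "\<And>j x. j \<in> {1..n} \<Longrightarrow> 0 \<le> x \<Longrightarrow> (\<phi> j has_real_derivative \<phi>' j x) (at x within {0..})"
    and \<phi>': "\<And>j. j \<in> {1..n} \<Longrightarrow> continuous_on {0..} (\<phi>' j)"
    and lump: "\<And>i r. i \<in> {1..n} \<Longrightarrow> 0 \<le> r \<Longrightarrow> \<alpha> * max 0 (r - b i) + \<phi> i (min r (b i)) \<le> \<phi> i r"
    and nonneg: "\<And>i r. i \<in> {1..n} \<Longrightarrow> 0 \<le> r \<Longrightarrow> 0 \<le> \<phi> i r"
    and gen: "\<And>i x. i \<in> {1..n} \<Longrightarrow> 0 \<le> x \<Longrightarrow> x \<le> b i \<Longrightarrow> generator n c d lam \<phi> \<phi>' \<psi> i x \<le> 0"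
    and r: "0 \<le> r"
  shows "(\<integral>\<^sup>+\<omega>. period_reward r (\<lambda>t. Z t \<omega>) \<partial>M) \<le> ennreal (\<Sum>i\<in>{1..n}. init_prob i * \<phi> i r)"
proof (rule ennreal_le_epsilon)
  fix e :: real assume e: "0 < e"
  obtain p where p: "\<And>h i j. 0 < h \<Longrightarrow> i \<in> {1..n+1} \<Longrightarrow> j \<in> {1..n+1} \<Longrightarrow> 0 \<le> p h i j"
    "\<And>h i. 0 < h \<Longrightarrow> i \<in> {1..n+1} \<Longrightarrow> (\<Sum>j\<in>{1..n+1}. p h i j) = 1"
    "\<And>i j. i \<in> {1..n} \<Longrightarrow> j \<in> {1..n+1} \<Longrightarrow> j \<noteq> i \<Longrightarrow> ((\<lambda>h. p h i j / h) \<longlongrightarrow> lam i j) (at_right 0)"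
    "\<And>t h i j A. 0 \<le> t \<Longrightarrow> 0 < h \<Longrightarrow> i \<in> {1..n+1} \<Longrightarrow> j \<in> {1..n+1} \<Longrightarrow> A \<in> path_events M Z {0..t} \<Longrightarrow>
       measure M (A \<inter> {\<omega>\<in>space M. Z t \<omega> = i \<and> Z (t + h) \<omega> = j}) = measure M (A \<inter> {\<omega>\<in>space M. Z t \<omega> = i}) * p h i j"
    by (rule transition_probabilities) blast
  \<comment> \<open>Scaled so that \<open>e'\<close> times the bound of
    \<open>geometric_bound\<close> is \<open>e\<close>.\<close>
  define e' where "e' = e * (d / (1 + d))"
  have e': "0 < e'" using e d_pos by (simp add: e'_def)
  have os: "\<forall>\<^sub>F N in sequentially. \<forall>i\<in>{1..n}. \<forall>x\<in>{0..b i}.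
     \<bar>exp (- d * step N) * (\<Sum>j\<in>{1..n+1}. p (step N) i j * extend \<phi> j (x + c * step N)) - \<phi> i x
        - step N * generator n c d lam \<phi> \<phi>' \<psi> i x\<bar> \<le> step N * e'"
    by (rule one_step[where p=p and \<phi>=\<phi> and \<phi>'=\<phi>']) (fact \<phi> \<phi>' p(2,3) e')+
  show "(\<integral>\<^sup>+\<omega>. period_reward r (\<lambda>t. Z t \<omega>) \<partial>M) \<le> ennreal (\<Sum>i\<in>{1..n}. init_prob i * \<phi> i r) + ennreal e"
  proof (rule tendsto_upperbound[OF grid_limit(1)[OF r]])
    show "\<forall>\<^sub>F N in sequentially. (\<integral>\<^sup>+\<omega>. ennreal (grid_reward (step N) (N * 2 ^ N) r (sample N (\<lambda>t. Z t \<omega>))) \<partial>M)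
       \<le> ennreal (\<Sum>i\<in>{1..n}. init_prob i * \<phi> i r) + ennreal e"
      using os
    proof eventually_elim
      case (elim N)
      have h: "0 < step N" "step N \<le> 1" by auto
      have "grid_mean (p (step N)) (step N) (N * 2 ^ N) i r \<le> \<phi> i r + e" if i: "i \<in> {1..n}" for i
      proof -
        have "grid_mean (p (step N)) (step N) (N * 2 ^ N) i r \<le>
           extend \<phi> i r + step N * e' * (\<Sum>l<N * 2 ^ N. exp (- d * step N) ^ l)"
        proof (rule grid_mean_le[OF p(1)[OF h(1)] p(2)[OF h(1)] h(1) _ _ lump nonneg r])
          fix i x assume i: "i \<in> {1..n}" and x: "0 \<le> x" "x \<le> b i"
          have "step N * generator n c d lam \<phi> \<phi>' \<psi> i x \<le> 0"
            using gen[OF i x] h by (intro mult_nonneg_nonpos) auto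
          moreover have "\<bar>exp (- d * step N) * (\<Sum>j\<in>{1..n+1}. p (step N) i j * extend \<phi> j (x + c * step N)) - \<phi> i x
            - step N * generator n c d lam \<phi> \<phi>' \<psi> i x\<bar> \<le> step N * e'"
            by (rule elim[rule_format, OF i]) (use x in auto)
          ultimately show "exp (- d * step N) * (\<Sum>j\<in>{1..n+1}. p (step N) i j * extend \<phi> j (x + c * step N)) \<le> \<phi> i x + step N * e'"
            unfolding abs_le_iff by linarith
        qed (use e' i in auto)
        also have "step N * e' * (\<Sum>l<N * 2 ^ N. exp (- d * step N) ^ l) = e' * (step N * (\<Sum>l<N * 2 ^ N. exp (- d * step N) ^ l))"
          by (simp only: mult_ac)
        also have "\<dots> \<le> e' * ((1 + d) / d)" using e' h by (intro mult_left_mono geometric_bound) auto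
        also have "\<dots> = e" using d_pos by (simp add: e'_def)
        finally show ?thesis using i by simp
      qed
      then have "(\<Sum>i\<in>{1..n}. init_prob i * grid_mean (p (step N)) (step N) (N * 2 ^ N) i r)
          \<le> (\<Sum>i\<in>{1..n}. init_prob i * (\<phi> i r + e))"
        by (intro sum_mono mult_left_mono) (auto simp: init_prob_def)
      also have "\<dots> = (\<Sum>i\<in>{1..n}. init_prob i * \<phi> i r) + e"
        using init_prob_sum by (simp only: distrib_left sum.distrib sum_distrib_right[symmetric] mult_1_left)
      finally have "ennreal (\<Sum>i\<in>{1..n}. init_prob i * grid_mean (p (step N)) (step N) (N * 2 ^ N) i r)
          \<le> ennreal ((\<Sum>i\<in>{1..n}. init_prob i * \<phi> i r) + e)" by (rule ennreal_leI)
      also have "\<dots> = ennreal (\<Sum>i\<in>{1..n}. init_prob i * \<phi> i r) + ennreal e"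
        using e r nonneg by (intro ennreal_plus sum_nonneg mult_nonneg_nonneg) (auto simp: init_prob_def)
      finally show ?case using grid_total[OF p(1)[OF h(1)] h(1) r p(4)[OF _ h(1)]] by simp
    qed
  qed simp
qed

lemma period_ge:
  assumes \<phi>: "\<And>j x. j \<in> {1..n} \<Longrightarrow> 0 \<le> x \<Longrightarrow> (\<phi> j has_real_derivative \<phi>' j x) (at x within {0..})"
    and \<phi>': "\<And>j. j \<in> {1..n} \<Longrightarrow> continuous_on {0..} (\<phi>' j)"
    and lump: "\<And>i r. i \<in> {1..n} \<Longrightarrow> 0 \<le> r \<Longrightarrow> \<phi> i r \<le> \<alpha> * max 0 (r - b i) + \<phi> i (min r (b i))"
    and bound: "\<And>i r. i \<in> {1..n} \<Longrightarrow> 0 \<le> r \<Longrightarrow> r \<le> b i \<Longrightarrow> \<phi> i r \<le> B" and B: "0 \<le> B"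
    and gen: "\<And>i x. i \<in> {1..n} \<Longrightarrow> 0 \<le> x \<Longrightarrow> x \<le> b i \<Longrightarrow> 0 \<le> generator n c d lam \<phi> \<phi>' \<psi> i x"
    and r: "0 \<le> r"
  shows "ennreal (\<Sum>i\<in>{1..n}. init_prob i * \<phi> i r) \<le> (\<integral>\<^sup>+\<omega>. period_reward r (\<lambda>t. Z t \<omega>) \<partial>M)"
proof (rule ennreal_le_epsilon)
  fix e0 :: real assume e0: "0 < e0"
  \<comment> \<open>One half of the tolerance is spent on the generator error, the other on the
    value cut off at the horizon.\<close>
  define e where "e = e0 / 2"
  have e: "0 < e" using e0 by (simp add: e_def)
  let ?T = "\<Sum>i\<in>{1..n}. init_prob i * \<phi> i r"
  obtain p where p: "\<And>h i j. 0 < h \<Longrightarrow> i \<in> {1..n+1} \<Longrightarrow> j \<in> {1..n+1} \<Longrightarrow> 0 \<le> p h i j"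
    "\<And>h i. 0 < h \<Longrightarrow> i \<in> {1..n+1} \<Longrightarrow> (\<Sum>j\<in>{1..n+1}. p h i j) = 1"
    "\<And>i j. i \<in> {1..n} \<Longrightarrow> j \<in> {1..n+1} \<Longrightarrow> j \<noteq> i \<Longrightarrow> ((\<lambda>h. p h i j / h) \<longlongrightarrow> lam i j) (at_right 0)"
    "\<And>t h i j A. 0 \<le> t \<Longrightarrow> 0 < h \<Longrightarrow> i \<in> {1..n+1} \<Longrightarrow> j \<in> {1..n+1} \<Longrightarrow> A \<in> path_events M Z {0..t} \<Longrightarrow>
       measure M (A \<inter> {\<omega>\<in>space M. Z t \<omega> = i \<and> Z (t + h) \<omega> = j}) = measure M (A \<inter> {\<omega>\<in>space M. Z t \<omega> = i}) * p h i j"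
    by (rule transition_probabilities) blast
  define e' where "e' = e * (d / (1 + d))"
  have e': "0 < e'" using e d_pos by (simp add: e'_def)
  have os: "\<forall>\<^sub>F N in sequentially. \<forall>i\<in>{1..n}. \<forall>x\<in>{0..b i}.
     \<bar>exp (- d * step N) * (\<Sum>j\<in>{1..n+1}. p (step N) i j * extend \<phi> j (x + c * step N)) - \<phi> i x
        - step N * generator n c d lam \<phi> \<phi>' \<psi> i x\<bar> \<le> step N * e'"
    by (rule one_step[where p=p and \<phi>=\<phi> and \<phi>'=\<phi>']) (fact \<phi> \<phi>' p(2,3) e')+
  have "(\<lambda>N. exp (- d) ^ N * B) \<longlonglongrightarrow> 0 * B"
    using d_pos by (intro tendsto_mult tendsto_const LIMSEQ_power_zero) auto
  then have small: "\<forall>\<^sub>F N in sequentially. exp (- d) ^ N * B < e" using e by (intro order_tendstoD(2)) auto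
  have "ennreal (?T - e0) \<le> (\<integral>\<^sup>+\<omega>. period_reward r (\<lambda>t. Z t \<omega>) \<partial>M)"
  proof (rule tendsto_lowerbound[OF grid_limit(1)[OF r]])
    show "\<forall>\<^sub>F N in sequentially. ennreal (?T - e0) \<le> (\<integral>\<^sup>+\<omega>. ennreal (grid_reward (step N) (N * 2 ^ N) r (sample N (\<lambda>t. Z t \<omega>))) \<partial>M)"
      using os small
    proof eventually_elim
      case (elim N)
      have h: "0 < step N" "step N \<le> 1" by auto
      \<comment> \<open>\<open>N * 2 ^ N\<close> steps reach the time \<open>N\<close>, so the
        truncation error decays like \<open>exp (- d) ^ N\<close>.\<close>
      have expN: "exp (- d * step N) ^ (N * 2 ^ N) = exp (- d) ^ N"
        by (simp add: exp_of_nat_mult[symmetric])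
      have "\<phi> i r - e0 \<le> grid_mean (p (step N)) (step N) (N * 2 ^ N) i r" if i: "i \<in> {1..n}" for i
      proof -
        have "extend \<phi> i r - step N * e' * (\<Sum>l<N * 2 ^ N. exp (- d * step N) ^ l) - exp (- d * step N) ^ (N * 2 ^ N) * B
           \<le> grid_mean (p (step N)) (step N) (N * 2 ^ N) i r"
        proof (rule grid_mean_ge[OF p(1)[OF h(1)] p(2)[OF h(1)] h(1) _ _ lump bound B r])
          fix i x assume i: "i \<in> {1..n}" and x: "0 \<le> x" "x \<le> b i"
          have "0 \<le> step N * generator n c d lam \<phi> \<phi>' \<psi> i x"
            using gen[OF i x] h by (intro mult_nonneg_nonneg) auto
          moreover have "\<bar>exp (- d * step N) * (\<Sum>j\<in>{1..n+1}. p (step N) i j * extend \<phi> j (x + c * step N)) - \<phi> i x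
            - step N * generator n c d lam \<phi> \<phi>' \<psi> i x\<bar> \<le> step N * e'"
            by (rule elim(1)[rule_format, OF i]) (use x in auto)
          ultimately show "\<phi> i x - step N * e' \<le> exp (- d * step N) * (\<Sum>j\<in>{1..n+1}. p (step N) i j * extend \<phi> j (x + c * step N))"
            unfolding abs_le_iff by linarith
        qed (use e' i in auto)
        moreover have "step N * e' * (\<Sum>l<N * 2 ^ N. exp (- d * step N) ^ l) \<le> e"
        proof -
          have "step N * e' * (\<Sum>l<N * 2 ^ N. exp (- d * step N) ^ l) = e' * (step N * (\<Sum>l<N * 2 ^ N. exp (- d * step N) ^ l))"
            by (simp only: mult_ac)
          also have "\<dots> \<le> e' * ((1 + d) / d)" using e' h by (intro mult_left_mono geometric_bound) auto
          also have "\<dots> = e" using d_pos by (simp add: e'_def)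
          finally show ?thesis .
        qed
        moreover have "extend \<phi> i r = \<phi> i r" using i by auto
        moreover have "e0 = e + e" by (simp add: e_def)
        ultimately show ?thesis using elim(2) unfolding expN by linarith
      qed
      then have "(\<Sum>i\<in>{1..n}. init_prob i * (\<phi> i r - e0)) \<le> (\<Sum>i\<in>{1..n}. init_prob i * grid_mean (p (step N)) (step N) (N * 2 ^ N) i r)"
        by (intro sum_mono mult_left_mono) (auto simp: init_prob_def)
      also have "(\<Sum>i\<in>{1..n}. init_prob i * (\<phi> i r - e0)) = ?T - e0"
        using init_prob_sum by (simp only: right_diff_distrib sum_subtractf sum_distrib_right[symmetric] mult_1_left)
      finally show ?case using grid_total[OF p(1)[OF h(1)] h(1) r p(4)[OF _ h(1)]] by (simp add: ennreal_leI)
    qed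
  qed simp
  \<comment> \<open>\<open>?T - e0\<close> may be negative, where \<open>ennreal\<close> truncates
    to zero; the maximum makes the splitting of the sum valid.\<close>
  have "ennreal ?T \<le> ennreal (max 0 (?T - e0) + e0)" by (rule ennreal_leI) simp
  also have "\<dots> = ennreal (?T - e0) + ennreal e0" using e0 by (subst ennreal_plus) (auto simp: ennreal_max_0)
  also have "\<dots> \<le> (\<integral>\<^sup>+\<omega>. period_reward r (\<lambda>t. Z t \<omega>) \<partial>M) + ennreal e0"
    by (rule add_right_mono) fact
  finally show "ennreal ?T \<le> (\<integral>\<^sup>+\<omega>. period_reward r (\<lambda>t. Z t \<omega>) \<partial>M) + ennreal e0" .
qed

end

section \<open>Transience and absorption\<close>

context cycle_process begin

definition edges :: "(nat \<times> nat) set" where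
  "edges = {(j, l). j \<in> {1..n} \<and> l \<in> {1..n+1} \<and> l \<noteq> j \<and> 0 < lam j l}"

text \<open>A lower bound \<open>e\<close> for the probability of being in \<open>l\<close> after
  \<open>k\<close> steps, conditional on phase \<open>j\<close> and on an arbitrary past event;
  written as a product so that null events cause no division.\<close>

definition path_bound :: "real \<Rightarrow> nat \<Rightarrow> nat \<Rightarrow> nat \<Rightarrow> real \<Rightarrow> bool" where
  "path_bound h j l k e \<longleftrightarrow> 0 < e \<and> (\<forall>t\<ge>0. \<forall>A\<in>path_events M Z {0..t}.
     e * prob (A \<inter> {\<omega>\<in>space M. Z t \<omega> = j}) \<le> prob (A \<inter> {\<omega>\<in>space M. Z t \<omega> = j \<and> Z (t + real k * h) \<omega> = l}))"

lemma phase_event: "0 \<le> t \<Longrightarrow> {\<omega>\<in>space M. Z t \<omega> = j} \<in> events"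
  using measurable_sets[OF Z_measurable', of t "{j}"] by (simp add: vimage_def Int_def conj_commute)

lemma path_events_subset: "path_events M Z {0..t} \<subseteq> events"
  by (rule path_events_sets[OF Z_measurable]) auto

text \<open>For every edge \<open>p h j l / h\<close> tends to a positive rate; as there are
  finitely many edges, one small \<open>h\<close> makes all these entries positive, and the Markov
  property multiplies them along a path.\<close>

lemma path_prob:
  obtains h where "0 < h"
    "\<And>j l. (j, l) \<in> edges\<^sup>* \<Longrightarrow> j \<in> {1..n+1} \<Longrightarrow> \<exists>k e. path_bound h j l k e"
proof -
  obtain p where p: "\<And>h i j. 0 < h \<Longrightarrow> i \<in> {1..n+1} \<Longrightarrow> j \<in> {1..n+1} \<Longrightarrow> 0 \<le> p h i j"
    "\<And>h i. 0 < h \<Longrightarrow> i \<in> {1..n+1} \<Longrightarrow> (\<Sum>j\<in>{1..n+1}. p h i j) = 1"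
    "\<And>i j. i \<in> {1..n} \<Longrightarrow> j \<in> {1..n+1} \<Longrightarrow> j \<noteq> i \<Longrightarrow> ((\<lambda>h. p h i j / h) \<longlongrightarrow> lam i j) (at_right 0)"
    "\<And>t h i j A. 0 \<le> t \<Longrightarrow> 0 < h \<Longrightarrow> i \<in> {1..n+1} \<Longrightarrow> j \<in> {1..n+1} \<Longrightarrow> A \<in> path_events M Z {0..t} \<Longrightarrow>
       prob (A \<inter> {\<omega>\<in>space M. Z t \<omega> = i \<and> Z (t + h) \<omega> = j}) = prob (A \<inter> {\<omega>\<in>space M. Z t \<omega> = i}) * p h i j"
    by (rule transition_probabilities) blast
  have fin: "finite edges"
    by (rule finite_subset[of _ "{1..n} \<times> {1..n+1}"]) (auto simp: edges_def)
  have "\<forall>\<^sub>F h in at_right 0. \<forall>(i, j)\<in>edges. 0 < p h i j / h"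
  proof (rule eventually_ball_finite[OF fin], safe)
    fix i j assume "(i, j) \<in> edges"
    then show "\<forall>\<^sub>F h in at_right 0. 0 < p h i j / h"
      using p(3)[of i j] by (intro order_tendstoD(1)) (auto simp: edges_def)
  qed
  then have "\<forall>\<^sub>F h in at_right 0. 0 < h \<and> (\<forall>(i, j)\<in>edges. 0 < p h i j / h)"
    by (intro eventually_conj eventually_at_right_less)
  then obtain h where h: "0 < h" "\<And>i j. (i, j) \<in> edges \<Longrightarrow> 0 < p h i j / h"
    using eventually_happens'[of "at_right (0::real)"] by force
  have pos: "0 < p h i j" if "(i, j) \<in> edges" for i j using h(2)[OF that] h(1) by (simp add: zero_less_divide_iff)
  show thesis
  proof (rule that[OF h(1)])
    fix j l assume "(j, l) \<in> edges\<^sup>*" "j \<in> {1..n+1}"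
    then show "\<exists>k e. path_bound h j l k e"
    proof (induction rule: rtrancl_induct)
      case base
      show ?case by (intro exI[of _ 0] exI[of _ 1]) (simp add: path_bound_def)
    next
      case (step y z)
      then obtain k e where ke: "0 < e" "\<And>t A. 0 \<le> t \<Longrightarrow> A \<in> path_events M Z {0..t} \<Longrightarrow>
        e * prob (A \<inter> {\<omega>\<in>space M. Z t \<omega> = j}) \<le> prob (A \<inter> {\<omega>\<in>space M. Z t \<omega> = j \<and> Z (t + real k * h) \<omega> = y})"
        by (auto simp: path_bound_def)
      have yz: "y \<in> {1..n+1}" "z \<in> {1..n+1}" using step.hyps by (auto simp: edges_def)
      have "e * p h y z * prob (A \<inter> {\<omega>\<in>space M. Z t \<omega> = j})
         \<le> prob (A \<inter> {\<omega>\<in>space M. Z t \<omega> = j \<and> Z (t + real (Suc k) * h) \<omega> = z})"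
        if t: "0 \<le> t" and A: "A \<in> path_events M Z {0..t}" for t A
      proof -
        let ?s = "t + real k * h"
        let ?A = "A \<inter> {\<omega>\<in>space M. Z t \<omega> = j}"
        have s: "0 \<le> ?s" "t \<le> ?s" using t h by auto
        interpret E: sigma_algebra "space M" "path_events M Z {0..?s}" by (rule path_events_algebra)
        have A': "?A \<in> path_events M Z {0..?s}"
          using A s t path_events_mono[where I="{0..t}" and J="{0..?s}" and M=M and Z=Z]
          by (intro E.Int path_events_phase) auto
        have "e * prob ?A * p h y z \<le> prob (A \<inter> {\<omega>\<in>space M. Z t \<omega> = j \<and> Z ?s \<omega> = y}) * p h y z"
          by (intro mult_right_mono ke t A p h yz)
        also have "A \<inter> {\<omega>\<in>space M. Z t \<omega> = j \<and> Z ?s \<omega> = y} = ?A \<inter> {\<omega>\<in>space M. Z ?s \<omega> = y}" by auto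
        also have "prob (?A \<inter> {\<omega>\<in>space M. Z ?s \<omega> = y}) * p h y z = prob (?A \<inter> {\<omega>\<in>space M. Z ?s \<omega> = y \<and> Z (?s + h) \<omega> = z})"
          by (rule p(4)[symmetric, OF s(1) h(1) yz A'])
        also have "\<dots> \<le> prob (A \<inter> {\<omega>\<in>space M. Z t \<omega> = j \<and> Z (t + real (Suc k) * h) \<omega> = z})"
        proof (rule finite_measure_mono)
          show "?A \<inter> {\<omega>\<in>space M. Z ?s \<omega> = y \<and> Z (?s + h) \<omega> = z} \<subseteq> A \<inter> {\<omega>\<in>space M. Z t \<omega> = j \<and> Z (t + real (Suc k) * h) \<omega> = z}"
            by (auto simp: algebra_simps)
          have "A \<inter> {\<omega>\<in>space M. Z t \<omega> = j \<and> Z (t + real (Suc k) * h) \<omega> = z} = ?A \<inter> {\<omega>\<in>space M. Z (t + real (Suc k) * h) \<omega> = z}"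
            by auto
          also have "\<dots> \<in> events"
            using subsetD[OF path_events_subset A'] t h(1) by (intro sets.Int[of ?A] phase_event) auto
          finally show "A \<inter> {\<omega>\<in>space M. Z t \<omega> = j \<and> Z (t + real (Suc k) * h) \<omega> = z} \<in> events" .
        qed
        finally show ?thesis by (simp only: mult_ac)
      qed
      moreover have "0 < e * p h y z" using ke(1) pos[OF step.hyps(2)] by simp
      ultimately have "path_bound h j z (Suc k) (e * p h y z)" by (simp add: path_bound_def)
      then show ?case by blast
    qed
  qed
qed

text \<open>Zero rates only say that the leak out of \<open>Q\<close> in one step is of smaller
  order than \<open>h\<close>. Over the \<open>t / h\<close> steps up to time \<open>t\<close> the
  leaks add up to at most \<open>t * (leak h / h)\<close>, which tends to zero.\<close>

lemma closed_class:
  assumes Q: "Q \<subseteq> {1..n}" and closed: "\<And>j l. j \<in> Q \<Longrightarrow> l \<in> {1..n+1} - Q \<Longrightarrow> lam j l = 0"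
    and start: "AE \<omega> in M. Z 0 \<omega> \<in> Q" and t: "0 \<le> t"
  shows "prob {\<omega>\<in>space M. Z t \<omega> \<notin> Q} = 0"
proof -
  obtain p where p: "\<And>h i j. 0 < h \<Longrightarrow> i \<in> {1..n+1} \<Longrightarrow> j \<in> {1..n+1} \<Longrightarrow> 0 \<le> p h i j"
    "\<And>h i. 0 < h \<Longrightarrow> i \<in> {1..n+1} \<Longrightarrow> (\<Sum>j\<in>{1..n+1}. p h i j) = 1"
    "\<And>i j. i \<in> {1..n} \<Longrightarrow> j \<in> {1..n+1} \<Longrightarrow> j \<noteq> i \<Longrightarrow> ((\<lambda>h. p h i j / h) \<longlongrightarrow> lam i j) (at_right 0)"
    "\<And>t h i j A. 0 \<le> t \<Longrightarrow> 0 < h \<Longrightarrow> i \<in> {1..n+1} \<Longrightarrow> j \<in> {1..n+1} \<Longrightarrow> A \<in> path_events M Z {0..t} \<Longrightarrow>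
       prob (A \<inter> {\<omega>\<in>space M. Z t \<omega> = i \<and> Z (t + h) \<omega> = j}) = prob (A \<inter> {\<omega>\<in>space M. Z t \<omega> = i}) * p h i j"
    by (rule transition_probabilities) blast
  let ?O = "{1..n+1} - Q"
  have finQ: "finite Q" using Q finite_subset by blast
  define leak where "leak h = (\<Sum>(j, l)\<in>Q \<times> ?O. p h j l)" for h
  have ev: "{\<omega>\<in>space M. Z s \<omega> \<notin> Q} \<in> events" if "0 \<le> s" for s
    using measurable_sets[OF Z_measurable'[OF that], of "- Q"] by (simp add: vimage_def Int_def conj_commute)
  have step: "prob {\<omega>\<in>space M. Z (s + h) \<omega> \<notin> Q} \<le> prob {\<omega>\<in>space M. Z s \<omega> \<notin> Q} + leak h"
    if s: "0 \<le> s" and h: "0 < h" for s h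
  proof -
    interpret E: sigma_algebra "space M" "path_events M Z {0..s}" by (rule path_events_algebra)
    define B where "B x = {\<omega>\<in>space M. Z s \<omega> = fst x} \<inter> {\<omega>\<in>space M. Z (s + h) \<omega> = snd x}" for x
    have B: "B x \<in> events" for x unfolding B_def using s h by (intro sets.Int phase_event) auto
    have "{\<omega>\<in>space M. Z (s + h) \<omega> \<notin> Q} \<subseteq> {\<omega>\<in>space M. Z s \<omega> \<notin> Q} \<union> (\<Union>x\<in>Q \<times> ?O. B x)"
    proof
      fix \<omega> assume \<omega>: "\<omega> \<in> {\<omega>\<in>space M. Z (s + h) \<omega> \<notin> Q}"
      then have "Z (s + h) \<omega> \<in> ?O" using measurable_space[OF Z_measurable[of "s + h"]] s h by auto
      then show "\<omega> \<in> {\<omega>\<in>space M. Z s \<omega> \<notin> Q} \<union> (\<Union>x\<in>Q \<times> ?O. B x)"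
        using \<omega> by (cases "Z s \<omega> \<in> Q") (auto simp: B_def intro!: bexI[of _ "(Z s \<omega>, Z (s + h) \<omega>)"])
    qed
    then have "prob {\<omega>\<in>space M. Z (s + h) \<omega> \<notin> Q} \<le> prob ({\<omega>\<in>space M. Z s \<omega> \<notin> Q} \<union> (\<Union>x\<in>Q \<times> ?O. B x))"
      by (rule finite_measure_mono) (intro sets.Un ev[OF s] sets.finite_UN B finQ finite_cartesian_product finite_Diff finite_atLeastAtMost)
    also have "\<dots> \<le> prob {\<omega>\<in>space M. Z s \<omega> \<notin> Q} + prob (\<Union>x\<in>Q \<times> ?O. B x)"
      by (rule measure_Un_le) (intro ev[OF s] sets.finite_UN B finQ finite_cartesian_product finite_Diff finite_atLeastAtMost)+
    also have "prob (\<Union>x\<in>Q \<times> ?O. B x) \<le> (\<Sum>x\<in>Q \<times> ?O. prob (B x))"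
      by (rule measure_UNION_le) (use B finQ in blast)+
    also have "\<dots> \<le> leak h"
      unfolding leak_def
    proof (rule sum_mono, clarify)
      fix j l assume jl: "j \<in> Q" "l \<in> {1..n+1}" "l \<notin> Q"
      have "B (j, l) = space M \<inter> {\<omega>\<in>space M. Z s \<omega> = j \<and> Z (s + h) \<omega> = l}" by (auto simp: B_def)
      then have "prob (B (j, l)) = prob (space M \<inter> {\<omega>\<in>space M. Z s \<omega> = j}) * p h j l"
        using p(4)[OF s h _ _ E.top, of j l] jl Q by auto
      also have "\<dots> \<le> 1 * p h j l" using p(1)[OF h, of j l] jl Q by (intro mult_right_mono prob_le_1) auto
      finally show "prob (B (j, l)) \<le> p h j l" by simp
    qed
    finally show ?thesis by simp
  qed
  have grid: "prob {\<omega>\<in>space M. Z (real m * h) \<omega> \<notin> Q} \<le> real m * leak h" if h: "0 < h" for m h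
  proof (induction m)
    case 0
    have "prob {\<omega>\<in>space M. Z 0 \<omega> \<notin> Q} = 0"
      using start ev[of 0] by (subst prob_eq_0) (auto elim: eventually_mono)
    then show ?case by simp
  next
    case (Suc m)
    then show ?case using step[of "real m * h" h] h by (simp add: distrib_right add.commute)
  qed
  have "((\<lambda>h. leak h / h) \<longlongrightarrow> (\<Sum>(j, l)\<in>Q \<times> ?O. lam j l)) (at_right 0)"
    unfolding leak_def sum_divide_distrib using Q
    by (intro tendsto_sum) (auto intro!: p(3) split: prod.split)
  moreover have "(\<Sum>(j, l)\<in>Q \<times> ?O. lam j l) = 0" using closed by (intro sum.neutral) auto
  ultimately have leak: "((\<lambda>h. leak h / h) \<longlongrightarrow> 0) (at_right 0)" by simp
  show ?thesis
  proof (cases "t = 0")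
    case True
    then show ?thesis using grid[of 1 0] by (simp add: antisym)
  next
    case False
    have "(\<lambda>m. t / real (Suc m)) \<longlonglongrightarrow> 0" using lim_1_over_n by (intro LIMSEQ_Suc lim_const_over_n)
    then have "filterlim (\<lambda>m. t / real (Suc m)) (at_right 0) sequentially"
      using False t by (intro tendsto_imp_filterlim_at_right) (auto intro!: always_eventually)
    from filterlim_compose[OF leak this] have "(\<lambda>m. t * (leak (t / real (Suc m)) / (t / real (Suc m)))) \<longlonglongrightarrow> t * 0"
      by (intro tendsto_mult tendsto_const)
    moreover have "prob {\<omega>\<in>space M. Z t \<omega> \<notin> Q} \<le> t * (leak (t / real (Suc m)) / (t / real (Suc m)))" for m
      using grid[of "t / real (Suc m)" "Suc m"] False t by (simp add: field_simps del: of_nat_Suc)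
    ultimately have "prob {\<omega>\<in>space M. Z t \<omega> \<notin> Q} \<le> 0" by (intro LIMSEQ_le_const) auto
    then show ?thesis by (simp add: antisym)
  qed
qed

text \<open>In a closed class from which \<open>i\<close> is always reachable, the probabilities of
  being in \<open>i\<close> after finitely many fixed delays sum to at least \<open>e0\<close>,
  whatever the starting time. Bounded sets of visiting times make each of these probabilities tend
  to zero.\<close>

lemma transient_class_not_closed:
  assumes Q: "Q \<subseteq> {1..n}" and closed: "\<And>j l. j \<in> Q \<Longrightarrow> l \<in> {1..n+1} - Q \<Longrightarrow> lam j l = 0"
    and start: "AE \<omega> in M. Z 0 \<omega> = i" and i: "i \<in> Q"
    and reaches: "\<And>j. j \<in> Q \<Longrightarrow> (j, i) \<in> edges\<^sup>*"
    and transient: "AE \<omega> in M. bounded {t. 0 \<le> t \<and> Z t \<omega> = i}"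
  shows False
proof -
  obtain h where h: "0 < h"
    "\<And>j l. (j, l) \<in> edges\<^sup>* \<Longrightarrow> j \<in> {1..n+1} \<Longrightarrow> \<exists>k e. path_bound h j l k e"
    by (rule path_prob) blast
  have "\<forall>j\<in>Q. \<exists>k e. path_bound h j i k e"
    using h(2) reaches Q by auto
  then obtain k e where "\<And>j. j \<in> Q \<Longrightarrow> path_bound h j i (k j) (e j)" by metis
  then have ke: "\<And>j. j \<in> Q \<Longrightarrow> 0 < e j" "\<And>j t A. j \<in> Q \<Longrightarrow> 0 \<le> t \<Longrightarrow> A \<in> path_events M Z {0..t} \<Longrightarrow>
      e j * prob (A \<inter> {\<omega>\<in>space M. Z t \<omega> = j}) \<le> prob (A \<inter> {\<omega>\<in>space M. Z t \<omega> = j \<and> Z (t + real (k j) * h) \<omega> = i})"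
    by (auto simp: path_bound_def)
  have finQ: "finite Q" using Q finite_subset by blast
  define e0 where "e0 = Min (e ` Q)"
  have e0: "0 < e0" unfolding e0_def by (subst Min_gr_iff) (use finQ i ke(1) in auto)
  have e0_le: "e0 \<le> e j" if "j \<in> Q" for j using finQ that by (simp add: e0_def)
  have start': "AE \<omega> in M. Z 0 \<omega> \<in> Q" using start i by (auto elim: eventually_mono)
  have lower: "e0 \<le> (\<Sum>j\<in>Q. prob {\<omega>\<in>space M. Z (t + real (k j) * h) \<omega> = i})" if t: "0 \<le> t" for t
  proof -
    interpret E: sigma_algebra "space M" "path_events M Z {0..t}" by (rule path_events_algebra)
    have ev: "{\<omega>\<in>space M. Z t \<omega> \<notin> Q} \<in> events"
      using measurable_sets[OF Z_measurable'[OF t], of "- Q"] by (simp add: vimage_def Int_def conj_commute)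
    have "1 = prob (space M - {\<omega>\<in>space M. Z t \<omega> \<notin> Q})"
      using closed_class[OF Q closed start' t] ev by (simp add: prob_compl)
    also have "space M - {\<omega>\<in>space M. Z t \<omega> \<notin> Q} = (\<Union>j\<in>Q. {\<omega>\<in>space M. Z t \<omega> = j})" by auto
    also have "prob \<dots> \<le> (\<Sum>j\<in>Q. prob {\<omega>\<in>space M. Z t \<omega> = j})"
      by (rule measure_UNION_le) (use phase_event t finQ in auto)
    finally have "e0 * 1 \<le> e0 * (\<Sum>j\<in>Q. prob {\<omega>\<in>space M. Z t \<omega> = j})" using e0 by (intro mult_left_mono) auto
    also have "\<dots> \<le> (\<Sum>j\<in>Q. prob {\<omega>\<in>space M. Z (t + real (k j) * h) \<omega> = i})"
      unfolding sum_distrib_left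
    proof (rule sum_mono)
      fix j assume j: "j \<in> Q"
      have "e0 * prob {\<omega>\<in>space M. Z t \<omega> = j} \<le> e j * prob (space M \<inter> {\<omega>\<in>space M. Z t \<omega> = j})"
        using e0_le[OF j] by (intro mult_mono) (auto simp: Int_def intro: less_imp_le[OF ke(1)[OF j]])
      also have "\<dots> \<le> prob (space M \<inter> {\<omega>\<in>space M. Z t \<omega> = j \<and> Z (t + real (k j) * h) \<omega> = i})"
        by (rule ke(2)[OF j t E.top])
      also have "\<dots> \<le> prob {\<omega>\<in>space M. Z (t + real (k j) * h) \<omega> = i}"
        using t h by (intro finite_measure_mono phase_event) auto
      finally show "e0 * prob {\<omega>\<in>space M. Z t \<omega> = j} \<le> prob {\<omega>\<in>space M. Z (t + real (k j) * h) \<omega> = i}" .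
    qed
    finally show ?thesis by simp
  qed
  have vanish: "(\<lambda>N. prob {\<omega>\<in>space M. Z (real N + s) \<omega> = i}) \<longlonglongrightarrow> 0" if s: "0 \<le> s" for s
  proof -
    have "(\<lambda>N. \<integral>\<omega>. indicator {\<omega>\<in>space M. Z (real N + s) \<omega> = i} \<omega> \<partial>M) \<longlonglongrightarrow> (\<integral>\<omega>. 0 \<partial>M :: real)"
    proof (rule integral_dominated_convergence[where w="\<lambda>_. 1"])
      show "AE \<omega> in M. (\<lambda>N. indicator {\<omega>\<in>space M. Z (real N + s) \<omega> = i} \<omega>) \<longlonglongrightarrow> (0::real)"
        using transient
      proof eventually_elim
        case (elim \<omega>)
        then obtain B where B: "\<And>t. 0 \<le> t \<Longrightarrow> Z t \<omega> = i \<Longrightarrow> \<bar>t\<bar> \<le> B" by (auto simp: bounded_iff)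
        have "\<forall>\<^sub>F N in sequentially. B < real N" 
          using eventually_gt_at_top[of "nat \<lceil>B\<rceil>"] by eventually_elim linarith
        then have "\<forall>\<^sub>F N in sequentially. indicator {\<omega>\<in>space M. Z (real N + s) \<omega> = i} \<omega> = (0::real)"
        proof eventually_elim
          case (elim N)
          have "\<not> Z (real N + s) \<omega> = i" using B[of "real N + s"] elim s by auto
          then show ?case by (auto simp: indicator_def)
        qed
        then show ?case by (rule tendsto_eventually)
      qed
    qed (use phase_event s in auto)
    then show ?thesis using phase_event s by simp
  qed
  have "(\<lambda>N. \<Sum>j\<in>Q. prob {\<omega>\<in>space M. Z (real N + real (k j) * h) \<omega> = i}) \<longlonglongrightarrow> (\<Sum>j\<in>Q. 0)"
    by (intro tendsto_sum vanish) (use h in auto)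
  then have "e0 \<le> 0" using lower by (intro LIMSEQ_le_const) auto
  then show False using e0 by simp
qed

text \<open>From every phase a visit to \<open>n + 1\<close> within \<open>K\<close> grid steps has
  probability at least \<open>e0\<close>, so avoiding it on the grid has geometrically decaying
  probability. The events record the absence of a visit so far; thus a visit counts whatever the
  path does later.\<close>

lemma absorbed:
  assumes reach: "\<And>j. j \<in> {1..n} \<Longrightarrow> (j, n+1) \<in> edges\<^sup>*"
  shows "AE \<omega> in M. hits n (\<lambda>t. Z t \<omega>)"
proof -
  obtain h where h: "0 < h"
    "\<And>j l. (j, l) \<in> edges\<^sup>* \<Longrightarrow> j \<in> {1..n+1} \<Longrightarrow> \<exists>k e. path_bound h j l k e"
    by (rule path_prob) blast
  have "\<forall>j\<in>{1..n}. \<exists>k e. path_bound h j (n+1) k e"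
    using h(2) reach by auto
  then obtain k e where "\<And>j. j \<in> {1..n} \<Longrightarrow> path_bound h j (n+1) (k j) (e j)" by metis
  then have ke: "\<And>j. j \<in> {1..n} \<Longrightarrow> 0 < e j" "\<And>j t A. j \<in> {1..n} \<Longrightarrow> 0 \<le> t \<Longrightarrow> A \<in> path_events M Z {0..t} \<Longrightarrow>
      e j * prob (A \<inter> {\<omega>\<in>space M. Z t \<omega> = j}) \<le> prob (A \<inter> {\<omega>\<in>space M. Z t \<omega> = j \<and> Z (t + real (k j) * h) \<omega> = n+1})"
    by (auto simp: path_bound_def)
  \<comment> \<open>The inserted \<open>1\<close> makes \<open>1 - e0\<close> nonnegative.\<close>
  define e0 where "e0 = Min (insert 1 (e ` {1..n}))"
  have e0: "0 < e0" "e0 \<le> 1" using ke(1) by (auto simp: e0_def)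
  have e0_le: "e0 \<le> e j" if "j \<in> {1..n}" for j unfolding e0_def by (rule Min_le) (use that in auto)
  \<comment> \<open>A common number of steps that is at least each \<open>k j\<close>.\<close>
  define K where "K = (\<Sum>j\<in>{1..n}. k j)"
  have kK: "k j \<le> K" if "j \<in> {1..n}" for j unfolding K_def by (rule member_le_sum) (use that in auto)
  define A where "A m = {\<omega>\<in>space M. \<forall>l\<le>m. Z (real l * h) \<omega> \<noteq> n+1}" for m :: nat
  have A_ev: "A m \<in> path_events M Z {0..real m * h}" for m
  proof -
    interpret E: sigma_algebra "space M" "path_events M Z {0..real m * h}" by (rule path_events_algebra)
    have "A m = space M - (\<Union>l\<in>{..m}. {\<omega>\<in>space M. Z (real l * h) \<omega> = n+1})" by (auto simp: A_def)
    also have "\<dots> \<in> path_events M Z {0..real m * h}"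
      using h(1) by (intro E.compl_sets E.finite_UN path_events_phase) (auto intro!: mult_right_mono)
    finally show ?thesis .
  qed
  then have A_sets: "A m \<in> events" for m using path_events_subset by blast
  have decay: "prob (A (m + K)) \<le> (1 - e0) * prob (A m)" for m
  proof -
    let ?t = "real m * h"
    have t: "0 \<le> ?t" using h by simp
    let ?B = "\<lambda>j. A m \<inter> {\<omega>\<in>space M. Z ?t \<omega> = j}"
    have Bs: "?B j \<in> events" for j using A_sets phase_event[OF t] by auto
    have union: "A m = (\<Union>j\<in>{1..n}. ?B j)"
    proof -
      have "Z ?t \<omega> \<in> {1..n}" if "\<omega> \<in> A m" for \<omega>
      proof -
        have "\<omega> \<in> space M" "Z ?t \<omega> \<noteq> n + 1" using that by (auto simp: A_def)
        then show ?thesis using measurable_space[OF Z_measurable[OF t]] by force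
      qed
      then show ?thesis by (auto simp: A_def)
    qed
    have Am: "prob (A m) = (\<Sum>j\<in>{1..n}. prob (?B j))"
      by (subst union, rule finite_measure_finite_Union) (use Bs in \<open>auto simp: disjoint_family_on_def\<close>)
    have "A (m + K) \<subseteq> (\<Union>j\<in>{1..n}. A (m + K) \<inter> ?B j)" using union by (auto simp: A_def)
    then have "prob (A (m + K)) \<le> prob (\<Union>j\<in>{1..n}. A (m + K) \<inter> ?B j)"
      by (rule finite_measure_mono) (intro sets.finite_UN sets.Int[OF A_sets Bs] finite_atLeastAtMost)
    also have "\<dots> \<le> (\<Sum>j\<in>{1..n}. prob (A (m + K) \<inter> ?B j))"
      by (rule measure_UNION_le) (use A_sets Bs in auto)
    also have "\<dots> \<le> (\<Sum>j\<in>{1..n}. (1 - e0) * prob (?B j))"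
    proof (rule sum_mono)
      fix j assume j: "j \<in> {1..n}"
      let ?D = "A m \<inter> {\<omega>\<in>space M. Z ?t \<omega> = j \<and> Z (?t + real (k j) * h) \<omega> = n+1}"
      have D_eq: "?D = ?B j \<inter> {\<omega>\<in>space M. Z (?t + real (k j) * h) \<omega> = n+1}" by auto
      have D: "?D \<in> events" unfolding D_eq by (rule sets.Int[OF Bs phase_event]) (use t h(1) in auto)
      have "A (m + K) \<inter> ?B j \<subseteq> ?B j - ?D"
      proof
        fix \<omega> assume \<omega>: "\<omega> \<in> A (m + K) \<inter> ?B j"
        have "m + k j \<le> m + K" using kK[OF j] by simp
        then have "Z (real (m + k j) * h) \<omega> \<noteq> n+1" using \<omega> unfolding A_def by blast
        then have "Z (real m * h + real (k j) * h) \<omega> \<noteq> n+1" by (simp add: distrib_right)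
        then show "\<omega> \<in> ?B j - ?D" using \<omega> by blast
      qed
      then have "prob (A (m + K) \<inter> ?B j) \<le> prob (?B j - ?D)" by (rule finite_measure_mono) (use Bs D in auto)
      also have "\<dots> = prob (?B j) - prob ?D" by (rule finite_measure_Diff) (use Bs D in auto)
      also have "\<dots> \<le> prob (?B j) - e j * prob (?B j)" using ke(2)[OF j t A_ev] by simp
      also have "\<dots> \<le> (1 - e0) * prob (?B j)"
        using mult_right_mono[OF e0_le[OF j], of "prob (?B j)"] by (simp add: algebra_simps)
      finally show "prob (A (m + K) \<inter> ?B j) \<le> (1 - e0) * prob (?B j)" .
    qed
    also have "\<dots> = (1 - e0) * prob (A m)" unfolding Am by (simp add: sum_distrib_left)
    finally show ?thesis .
  qed
  have geo: "prob (A (m * K)) \<le> (1 - e0) ^ m" for m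
  proof (induction m)
    case (Suc m)
    have "prob (A (Suc m * K)) = prob (A (m * K + K))" by (simp add: add.commute)
    also have "\<dots> \<le> (1 - e0) * prob (A (m * K))" by (rule decay)
    also have "\<dots> \<le> (1 - e0) * (1 - e0) ^ m" using e0 by (intro mult_left_mono Suc.IH) auto
    finally show ?case by simp
  qed simp
  let ?N = "\<Inter>m. A (m * K)"
  have "prob ?N \<le> (1 - e0) ^ m" for m
  proof -
    have "prob ?N \<le> prob (A (m * K))" by (rule finite_measure_mono) (use A_sets in auto)
    then show ?thesis using geo[of m] by linarith
  qed
  moreover have "(\<lambda>m. (1 - e0) ^ m) \<longlonglongrightarrow> 0" using e0 by (intro LIMSEQ_power_zero) auto
  ultimately have "prob ?N \<le> 0" by (intro LIMSEQ_le_const) auto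
  then have "prob ?N = 0" by (simp add: antisym)
  moreover have "?N \<in> events" using A_sets by auto
  ultimately have "AE \<omega> in M. \<omega> \<notin> ?N" by (simp add: prob_eq_0)
  then show ?thesis
    using AE_space
  proof eventually_elim
    case (elim \<omega>)
    then obtain l where "Z (real l * h) \<omega> = n+1" by (auto simp: A_def)
    then show ?case using h(1) unfolding hits_def by (intro exI[of _ "real l * h"]) auto
  qed
qed

end

section \<open>The dividend process along a path\<close>

text \<open>Skorokhod reflection at a time-dependent upper barrier: the conditions on the dividend process
  determine it as the running maximum of the excess of the undividended surplus over the barrier.\<close>

lemma reflection_le_iff:
  fixes D U :: "real \<Rightarrow> real"
  assumes follows: "follows_phasewise_barriers b J U D" and t: "0 \<le> t"
  shows "D t \<le> u \<longleftrightarrow> 0 \<le> u \<and> (\<forall>s. 0 \<le> s \<longrightarrow> s \<le> t \<longrightarrow> U s - b (J s) \<le> u)"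
proof -
  have neg: "\<And>t. t < 0 \<Longrightarrow> D t = 0" and mono: "mono D" and rc: "\<And>t. continuous (at_right t) D"
    and below: "\<And>t. 0 \<le> t \<Longrightarrow> U t - D t \<le> b (J t)"
    and AE: "AE t in interval_measure D. 0 \<le> t \<longrightarrow> U t - D t = b (J t)"
    using follows by (auto simp: follows_phasewise_barriers_def)
  have D_mono: "D s \<le> D s'" if "s \<le> s'" for s s' using monoD[OF mono that] .
  have incr: "emeasure (interval_measure D) {a<..b} = ennreal (D b - D a)" if "a \<le> b" for a b
    by (rule emeasure_interval_measure_Ioc[OF that D_mono rc])
  show ?thesis
  proof
    assume le: "D t \<le> u"
    have "D (-1) \<le> D t" using t by (intro D_mono) simp
    moreover have "U s - b (J s) \<le> D t" if "0 \<le> s" "s \<le> t" for s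
      using below[OF that(1)] D_mono[OF that(2)] by simp
    ultimately show "0 \<le> u \<and> (\<forall>s. 0 \<le> s \<longrightarrow> s \<le> t \<longrightarrow> U s - b (J s) \<le> u)"
      using le neg[of "-1"] by fastforce
  next
    assume u: "0 \<le> u \<and> (\<forall>s. 0 \<le> s \<longrightarrow> s \<le> t \<longrightarrow> U s - b (J s) \<le> u)"
    show "D t \<le> u"
    proof (rule ccontr)
      assume "\<not> D t \<le> u"
      \<comment> \<open>Times at which more than \<open>u\<close> has been paid; as \<open>D\<close>
        is nondecreasing, this is an interval ending at \<open>t\<close>.\<close>
      define A where "A = {s. s \<le> t \<and> u < D s}"
      have tA: "t \<in> A" using \<open>\<not> D t \<le> u\<close> by (simp add: A_def)
      have A_nonneg: "0 \<le> s" if "s \<in> A" for s using neg[of s] that u by (force simp: A_def)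
      have bdd: "bdd_below A" by (rule bdd_belowI[of _ 0]) (rule A_nonneg)
      define a where "a = Inf A"
      have a: "0 \<le> a" "a \<le> t" "\<And>s. s \<in> A \<Longrightarrow> a \<le> s"
        using tA A_nonneg bdd unfolding a_def by (auto intro: cInf_greatest cInf_lower)
      have upper: "s \<in> A" if "a < s" "s \<le> t" for s
      proof -
        have "A \<noteq> {}" "Inf A < s" using tA that by (auto simp: a_def)
        then obtain s' where "s' \<in> A" "s' < s" using cInf_lessD by blast
        then show ?thesis using D_mono[of s' s] that by (auto simp: A_def)
      qed
      \<comment> \<open>On \<open>A\<close> one has \<open>U s - b (J s) \<le> u < D s\<close>, so
        the surplus is strictly below the barrier, where the dividend measure has no mass.\<close>
      have null: "emeasure (interval_measure D) B = 0" if B: "B \<subseteq> A" "B \<in> sets borel" for B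
      proof -
        have "AE s in interval_measure D. s \<notin> B"
          using AE
        proof eventually_elim
          case (elim s)
          show ?case
          proof
            assume "s \<in> B"
            then have s: "s \<in> A" using B by auto
            then have "U s - D s = b (J s)" using elim A_nonneg by auto
            then show False using s u A_nonneg[OF s] by (force simp: A_def)
          qed
        qed
        then show ?thesis using B by (subst (asm) AE_iff_measurable[where N=B]) auto
      qed
      have "{a<..t} \<subseteq> A" using upper by auto
      then have "D t = D a" using null[of "{a<..t}"] incr[OF a(2)] D_mono[OF a(2)] by simp
      then have aA: "a \<in> A" using tA a by (auto simp: A_def)
      have "emeasure (interval_measure D) {a} = 0" using null[of "{a}"] aA by simp
      have left: "D s \<le> u" if "s < a" for s using a(3)[of s] that a(2) by (force simp: A_def)
      \<comment> \<open>\<open>D\<close> stays at most \<open>u\<close> before \<open>a\<close>, so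
        exceeding \<open>u\<close> at \<open>a\<close> would need an atom there; shrinking intervals
        bound its mass from below by \<open>D a - u\<close>.\<close>
      have "ennreal (D a - u) \<le> emeasure (interval_measure D) {a - 1 / real (Suc k)<..a}" for k
        using left[of "a - 1 / real (Suc k)"] D_mono[of "a - 1 / real (Suc k)" a]
        by (subst incr) (auto intro!: ennreal_leI)
      moreover have "(\<lambda>k. emeasure (interval_measure D) {a - 1 / real (Suc k)<..a})
         \<longlonglongrightarrow> emeasure (interval_measure D) (\<Inter>k. {a - 1 / real (Suc k)<..a})"
      proof (rule Lim_emeasure_decseq)
        show "decseq (\<lambda>k. {a - 1 / real (Suc k)<..a})"
        proof (rule decseq_SucI)
          fix k
          have "1 / real (Suc (Suc k)) \<le> 1 / real (Suc k)" by (intro divide_left_mono) auto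
          then show "{a - 1 / real (Suc (Suc k))<..a} \<subseteq> {a - 1 / real (Suc k)<..a}" by auto
        qed
        show "emeasure (interval_measure D) {a - 1 / real (Suc k)<..a} \<noteq> \<infinity>" for k
          by (subst incr) auto
      qed auto
      moreover have "(\<Inter>k. {a - 1 / real (Suc k)<..a}) = {a}"
      proof
        show "(\<Inter>k. {a - 1 / real (Suc k)<..a}) \<subseteq> {a}"
        proof
          fix s assume s: "s \<in> (\<Inter>k. {a - 1 / real (Suc k)<..a})"
          then have "a \<le> s + 1 / real (Suc k)" for k by (auto dest!: spec[of _ k])
          moreover have "(\<lambda>k. s + 1 / real (Suc k)) \<longlonglongrightarrow> s + 0"
            by (intro tendsto_add tendsto_const LIMSEQ_Suc lim_1_over_n)
          ultimately have "a \<le> s + 0" by (intro LIMSEQ_le_const) auto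
          then show "s \<in> {a}" using s by auto
        qed
      qed auto
      ultimately have "ennreal (D a - u) \<le> emeasure (interval_measure D) {a}"
        by (intro LIMSEQ_le_const) auto
      then have "D a \<le> u" using \<open>emeasure (interval_measure D) {a} = 0\<close> by (simp add: ennreal_eq_0_iff)
      then show False using aA by (simp add: A_def)
    qed
  qed
qed

text \<open>Write \<open>exp (- \<delta> * t)\<close> as the integral of
  \<open>\<delta> * exp (- \<delta> * s)\<close> over \<open>s \<ge> t\<close> and exchange the
  integrals.\<close>

lemma discounted_measure:
  fixes D :: "real \<Rightarrow> real"
  assumes mono: "mono D" and rc: "\<And>t. continuous (at_right t) D" and \<delta>: "0 < \<delta>"
    and A: "A \<in> sets borel" "A \<subseteq> {0..}"
  shows "(\<integral>\<^sup>+ t. ennreal (exp (- \<delta> * t)) * indicator A t \<partial>interval_measure D)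
    = disc \<delta> (\<lambda>s. emeasure (interval_measure D) (A \<inter> {..s}))"
proof -
  interpret D: sigma_finite_measure "interval_measure D"
    by (rule sigma_finite_interval_measure[OF monoD[OF mono] rc])
  interpret pair_sigma_finite lborel "interval_measure D" ..
  note [measurable] = A(1)
  have exp_eq: "ennreal (exp (- \<delta> * t)) = (\<integral>\<^sup>+ s. ennreal (\<delta> * exp (- \<delta> * s)) * indicator {t..} s \<partial>lborel)" if "0 \<le> t" for t
  proof -
    have "disc \<delta> (\<lambda>s. if s < t then 0 else 1) = ennreal (exp (- \<delta> * t)) * disc \<delta> (\<lambda>_. 1)"
      by (rule disc_shift) (use that in auto)
    also have "disc \<delta> (\<lambda>_. 1) = 1" by (rule disc_const[OF \<delta>])
    also have "disc \<delta> (\<lambda>s. if s < t then 0 else 1) = (\<integral>\<^sup>+ s. ennreal (\<delta> * exp (- \<delta> * s)) * indicator {t..} s \<partial>lborel)"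
      unfolding disc_def using that by (intro nn_integral_cong) (auto simp: indicator_def)
    finally show ?thesis by simp
  qed
  have "(\<integral>\<^sup>+ t. ennreal (exp (- \<delta> * t)) * indicator A t \<partial>interval_measure D)
     = (\<integral>\<^sup>+ t. (\<integral>\<^sup>+ s. ennreal (\<delta> * exp (- \<delta> * s)) * indicator {0..} s * (indicator A t * (if t \<le> s then 1 else 0)) \<partial>lborel) \<partial>interval_measure D)"
  proof (rule nn_integral_cong)
    fix t
    show "ennreal (exp (- \<delta> * t)) * indicator A t = (\<integral>\<^sup>+ s. ennreal (\<delta> * exp (- \<delta> * s)) * indicator {0..} s * (indicator A t * (if t \<le> s then 1 else 0)) \<partial>lborel)"
    proof (cases "t \<in> A")
      case True
      then have t: "0 \<le> t" using A(2) by auto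
      show ?thesis using True t by (subst exp_eq[OF t]) (auto intro!: nn_integral_cong simp: indicator_def)
    qed simp
  qed
  also have "\<dots> = (\<integral>\<^sup>+ s. (\<integral>\<^sup>+ t. ennreal (\<delta> * exp (- \<delta> * s)) * indicator {0..} s * (indicator A t * (if t \<le> s then 1 else 0)) \<partial>interval_measure D) \<partial>lborel)"
    by (rule Fubini') measurable
  also have "\<dots> = disc \<delta> (\<lambda>s. emeasure (interval_measure D) (A \<inter> {..s}))"
    unfolding disc_def
  proof (rule nn_integral_cong)
    fix s
    have "(\<integral>\<^sup>+ t. indicator A t * (if t \<le> s then 1 else 0) \<partial>interval_measure D) = (\<integral>\<^sup>+ t. indicator (A \<inter> {..s}) t \<partial>interval_measure D)"
      by (intro nn_integral_cong) (auto simp: indicator_def)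
    also have "\<dots> = emeasure (interval_measure D) (A \<inter> {..s})" by (rule nn_integral_indicator) measurable
    finally have *: "(\<integral>\<^sup>+ t. indicator A t * (if t \<le> s then 1 else 0) \<partial>interval_measure D) = emeasure (interval_measure D) (A \<inter> {..s})" .
    show "(\<integral>\<^sup>+ t. ennreal (\<delta> * exp (- \<delta> * s)) * indicator {0..} s * (indicator A t * (if t \<le> s then 1 else 0)) \<partial>interval_measure D)
       = ennreal (\<delta> * exp (- \<delta> * s)) * indicator {0..} s * emeasure (interval_measure D) (A \<inter> {..s})"
      unfolding *[symmetric] by (rule nn_integral_cmult) measurable
  qed
  finally show ?thesis .
qed

context cycle begin

text \<open>The supremum over all times, as the reflection formula yields it for the actual
  strategy, whereas \<open>path_div\<close> is what the grids approximate.\<close>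

definition full_div :: "real \<Rightarrow> (real \<Rightarrow> nat) \<Rightarrow> real \<Rightarrow> real" where
  "full_div r z s = Sup (insert 0 {r + c * v - b (z v) | v. 0 \<le> v \<and> v \<le> s \<and> before n z v})"

context
  fixes z and r :: real assumes reg: "regular_path n z" and r: "0 \<le> r"
begin

lemma full_div_term: "0 \<le> v \<Longrightarrow> v \<le> s \<Longrightarrow> before n z v \<Longrightarrow> r + c * v - b (z v) \<le> r + c * s"
proof -
  assume v: "0 \<le> v" "v \<le> s" "before n z v"
  have "0 \<le> b (z v)" using v before_phase[OF reg, of v] b_nonneg by blast
  moreover have "c * v \<le> c * s" using v c_pos by simp
  ultimately show ?thesis by simp
qed

lemma full_div_le_iff:
  assumes "0 \<le> s"
  shows "full_div r z s \<le> u \<longleftrightarrow>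
     0 \<le> u \<and> (\<forall>v. 0 \<le> v \<longrightarrow> v \<le> s \<longrightarrow> before n z v \<longrightarrow> r + c * v - b (z v) \<le> u)"
proof -
  have "bdd_above (insert 0 {r + c * v - b (z v) | v. 0 \<le> v \<and> v \<le> s \<and> before n z v})"
    by (rule bdd_aboveI[of _ "r + c * s"]) (use full_div_term assms r c_pos in auto)
  then show ?thesis unfolding full_div_def by (subst cSup_le_iff) auto
qed

lemma full_div_bounds: "0 \<le> s \<Longrightarrow> 0 \<le> full_div r z s" "0 \<le> s \<Longrightarrow> full_div r z s \<le> r + c * s"
  using full_div_le_iff[of s "full_div r z s"] full_div_le_iff[of s "r + c * s"] full_div_term[of _ s] r c_pos by auto

lemma path_div_le_full_div: "0 \<le> s \<Longrightarrow> path_div r z s \<le> full_div r z s"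
  using full_div_le_iff[of s "full_div r z s"] dyadic_nonneg by (subst path_div_le_iff[OF reg r]) auto

text \<open>Right-continuity allows moving a time slightly to the right onto a dyadic in the same
  phase, and \<open>c * v\<close> only grows. The price is the strict inequality
  \<open>s < t\<close>.\<close>

lemma full_div_le_path_div:
  assumes "0 \<le> s" "s < t" shows "full_div r z s \<le> path_div r z t"
proof (subst full_div_le_iff[OF assms(1)], intro conjI allI impI)
  show "0 \<le> path_div r z t" using assms by (intro path_div_nonneg[OF reg r]) auto
  fix v assume v: "0 \<le> v" "v \<le> s" "before n z v"
  obtain e where e: "e > 0" "\<And>u. v \<le> u \<Longrightarrow> u < v + e \<Longrightarrow> z u = z v"
    by (rule regular_right[OF reg v(1)]) blast
  obtain v' where v': "v' \<in> dyadics" "v < v'" "v' < min (v + e) t"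
    using dyadics_dense[of v "min (v + e) t"] v e assms by auto
  have "before n z v'"
    unfolding before_def
  proof (intro allI impI)
    fix u assume u: "0 \<le> u" "u \<le> v'"
    show "z u \<noteq> n + 1"
    proof (cases "u \<le> v")
      case True then show ?thesis using v(3) u by (auto simp: before_def)
    next
      case False then show ?thesis using e(2)[of u] u v' v(1,3) by (auto simp: before_def)
    qed
  qed
  then have "r + c * v' - b (z v') \<le> path_div r z t" using v' by (intro path_div_ge[OF reg r]) auto
  moreover have "z v' = z v" using e(2)[of v'] v' by auto
  moreover have "c * v \<le> c * v'" using v' c_pos by simp
  ultimately show "r + c * v - b (z v) \<le> path_div r z t" by simp
qed

text \<open>The two versions agree at positive times where the monotone \<open>path_div\<close> is
  continuous, i.e. outside a countable set of times.\<close>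

lemma disc_full_div: "disc d (\<lambda>s. ennreal (full_div r z s)) = disc d (\<lambda>s. ennreal (path_div r z s))"
proof -
  let ?g = "\<lambda>s. path_div r z (max 0 s)"
  have mono: "mono ?g" by (auto intro!: monoI path_div_mono[OF reg r])
  have "AE s in lborel. s \<notin> {a. \<not> isCont ?g a}"
    using mono_ctble_discont[OF mono] by (intro AE_not_in countable_imp_null_set_lborel)
  moreover have "full_div r z s = path_div r z s" if "isCont ?g s" "0 < s" for s
  proof (rule antisym)
    have "((\<lambda>t. ?g t) \<longlongrightarrow> ?g s) (at_right s)"
      using that(1) by (auto simp: isCont_def intro: filterlim_mono at_le)
    moreover have "\<forall>\<^sub>F t in at_right s. full_div r z s \<le> ?g t"
      using eventually_at_right_less[of s]
      by eventually_elim (use that full_div_le_path_div in \<open>auto simp: max_absorb2\<close>)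
    ultimately have "full_div r z s \<le> ?g s" by (rule tendsto_lowerbound) simp
    then show "full_div r z s \<le> path_div r z s" using that by (simp add: max_absorb2)
  qed (use path_div_le_full_div that in auto)
  moreover have "AE s in lborel. s \<notin> {0::real}"
    by (intro AE_not_in countable_imp_null_set_lborel) auto
  ultimately show ?thesis
    unfolding disc_def by (intro nn_integral_cong_AE) (auto simp: indicator_def elim!: eventually_elim2)
qed

text \<open>The hitting time itself contributes no term, so only earlier times count, and each
  leaves room for a dyadic after it.\<close>

lemma path_div_hit_time_le_iff:
  assumes "hits n z"
  shows "path_div r z (hit_time n z) \<le> u \<longleftrightarrow> 0 \<le> u \<and> (\<forall>v. 0 \<le> v \<longrightarrow> v < hit_time n z \<longrightarrow> r + c * v - b (z v) \<le> u)"
proof -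
  note x = hit_time_props[OF reg assms]
  have "path_div r z (hit_time n z) = full_div r z (hit_time n z)"
  proof (rule antisym)
    show "full_div r z (hit_time n z) \<le> path_div r z (hit_time n z)"
    proof (subst full_div_le_iff[OF x(1)], intro conjI allI impI path_div_nonneg[OF reg r x(1)])
      fix v assume v: "0 \<le> v" "before n z v"
      then have "v < hit_time n z" using x(3) by blast
      then have "full_div r z v \<le> path_div r z (hit_time n z)" by (intro full_div_le_path_div v)
      then show "r + c * v - b (z v) \<le> path_div r z (hit_time n z)"
        using full_div_le_iff[OF v(1), of "full_div r z v"] v by force
    qed
  qed (rule path_div_le_full_div[OF x(1)])
  then show ?thesis using full_div_le_iff[OF x(1), of u] x(3) by (auto intro: less_imp_le)
qed

lemma full_div_after_hit:
  assumes "hits n z" "hit_time n z \<le> s" shows "full_div r z s = path_div r z (hit_time n z)"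
proof -
  note x = hit_time_props[OF reg assms(1)]
  have "0 \<le> s" using x(1) assms(2) by simp
  then have "full_div r z s \<le> u \<longleftrightarrow> path_div r z (hit_time n z) \<le> u" for u
    unfolding path_div_hit_time_le_iff[OF assms(1)] full_div_le_iff[OF \<open>0 \<le> s\<close>] using x(3) assms(2) by force
  then show ?thesis by (meson antisym order_refl)
qed

end
end

section \<open>Decomposition of a path into interclaim periods\<close>

context cycle begin

definition epoch :: "(nat \<Rightarrow> real \<Rightarrow> nat) \<Rightarrow> nat \<Rightarrow> real" where
  "epoch z k = (\<Sum>m<k. hit_time n (z m))"

text \<open>The surplus just after the \<open>k\<close>-th claim and before any payment at that time.\<close>

primrec claim_surplus :: "(nat \<Rightarrow> real \<Rightarrow> nat) \<Rightarrow> (nat \<Rightarrow> real) \<Rightarrow> real \<Rightarrow> nat \<Rightarrow> real" where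
  "claim_surplus z y x 0 = x"
| "claim_surplus z y x (Suc k) = claim_surplus z y x k + c * hit_time n (z k)
     - path_div (claim_surplus z y x k) (z k) (hit_time n (z k)) - y (Suc k)"

definition solvent :: "(nat \<Rightarrow> real \<Rightarrow> nat) \<Rightarrow> (nat \<Rightarrow> real) \<Rightarrow> real \<Rightarrow> nat \<Rightarrow> bool" where
  "solvent z y x k \<longleftrightarrow> (\<forall>l\<le>k. 0 \<le> claim_surplus z y x l)"

definition total_reward :: "(nat \<Rightarrow> real \<Rightarrow> nat) \<Rightarrow> (nat \<Rightarrow> real) \<Rightarrow> real \<Rightarrow> ennreal" where
  "total_reward z y x = (\<Sum>k. if solvent z y x k
     then ennreal (exp (- d * epoch z k)) * disc d (\<lambda>s. ennreal (path_div (claim_surplus z y x k) (z k) s)) else 0)"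

lemma solvent_nonneg: "solvent z y x k \<Longrightarrow> l \<le> k \<Longrightarrow> 0 \<le> claim_surplus z y x l"
  by (auto simp: solvent_def)

context
  fixes z :: "nat \<Rightarrow> real \<Rightarrow> nat" and y :: "nat \<Rightarrow> real" and x :: real
  assumes reg: "\<And>k. regular_path n (z k)" and hit: "\<And>k. hits n (z k)" and start: "\<And>k. z k 0 \<noteq> n + 1"
    and unbounded: "\<And>B. \<exists>k. B < epoch z k" and x: "0 \<le> x"
begin

abbreviation "dur k \<equiv> hit_time n (z k)"
abbreviation "res \<equiv> claim_surplus z y x"

lemma dur_pos: "0 < dur k"
  using hit_time_props(1,2)[OF reg hit, of k] start[of k] by (cases "dur k = 0") (auto simp: less_le)

lemma epoch_0 [simp]: "epoch z 0 = 0" and epoch_Suc: "epoch z (Suc k) = epoch z k + dur k"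
  by (simp_all add: epoch_def)

lemma epoch_less: "k < l \<Longrightarrow> epoch z k < epoch z l"
  by (rule lift_Suc_mono_less) (use dur_pos in \<open>auto simp: epoch_Suc\<close>)

lemma epoch_less_iff: "epoch z k < epoch z l \<longleftrightarrow> k < l"
  using epoch_less by (metis linorder_neqE_nat order_less_asym order_less_irrefl)

lemma epoch_le_iff: "epoch z k \<le> epoch z l \<longleftrightarrow> k \<le> l"
  using epoch_less_iff[of l k] by (simp add: not_less[symmetric])

lemma epoch_nonneg: "0 \<le> epoch z k"
  using epoch_le_iff[of 0 k] by simp

lemma epoch_cases:
  assumes "0 \<le> t" obtains k v where "t = epoch z k + v" "0 \<le> v" "v < dur k"
proof -
  define l where "l = (LEAST k. t < epoch z k)"
  have l: "t < epoch z l" unfolding l_def using unbounded[of t] by (rule LeastI_ex)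
  then have "l \<noteq> 0" using assms by (cases l) auto
  then obtain k where k: "l = Suc k" by (cases l) auto
  have "\<not> t < epoch z k" using not_less_Least[of k "\<lambda>k. t < epoch z k"] k by (simp add: l_def)
  then show thesis using that[of k "t - epoch z k"] l k by (simp add: epoch_Suc)
qed

definition paid :: "nat \<Rightarrow> real" where
  "paid k = (\<Sum>l<k. path_div (res l) (z l) (dur l))"

lemma paid_0 [simp]: "paid 0 = 0" and paid_Suc: "paid (Suc k) = paid k + path_div (res k) (z k) (dur k)"
  by (simp_all add: paid_def)

lemma res_eq: "res k = x + c * epoch z k - (\<Sum>j=1..k. y j) - paid k"
proof (induction k)
  case (Suc k)
  then show ?case by (simp add: epoch_Suc paid_Suc distrib_left)
qed simp

context
  fixes J :: "real \<Rightarrow> nat" and U D :: "real \<Rightarrow> real"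
  assumes J: "\<And>k v. 0 \<le> v \<Longrightarrow> v < dur k \<Longrightarrow> J (epoch z k + v) = z k v"
    and U: "\<And>k v. 0 \<le> v \<Longrightarrow> v < dur k \<Longrightarrow> U (epoch z k + v) = x + c * (epoch z k + v) - (\<Sum>j=1..k. y j)"
    and follows: "follows_phasewise_barriers b J U D"
begin

lemma U_res: "0 \<le> v \<Longrightarrow> v < dur k \<Longrightarrow> U (epoch z k + v) = res k + c * v + paid k"
  using U[of v k] res_eq[of k] by (simp add: distrib_left)

text \<open>Within period \<open>k\<close> the undividended surplus is
  \<open>res k + c * v + paid k\<close>, so earlier payments merely shift the bound of the
  single-period formula, and the running maxima of successive periods glue together.\<close>

lemma paid_le_iff:
  "(\<And>l. l < k \<Longrightarrow> 0 \<le> res l) \<Longrightarrow>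
   paid k \<le> u \<longleftrightarrow> 0 \<le> u \<and> (\<forall>s. 0 \<le> s \<longrightarrow> s < epoch z k \<longrightarrow> U s - b (J s) \<le> u)"
proof (induction k arbitrary: u)
  case (Suc k)
  have r: "0 \<le> res k" using Suc.prems by simp
  have IH: "paid k \<le> u \<longleftrightarrow> 0 \<le> u \<and> (\<forall>s. 0 \<le> s \<longrightarrow> s < epoch z k \<longrightarrow> U s - b (J s) \<le> u)" for u
    by (rule Suc.IH) (use Suc.prems in auto)
  have "paid (Suc k) \<le> u \<longleftrightarrow> path_div (res k) (z k) (dur k) \<le> u - paid k"
    by (auto simp: paid_Suc)
  also have "\<dots> \<longleftrightarrow> paid k \<le> u \<and> (\<forall>v. 0 \<le> v \<longrightarrow> v < dur k \<longrightarrow> res k + c * v - b (z k v) \<le> u - paid k)"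
    unfolding path_div_hit_time_le_iff[OF reg r hit] by auto
  also have "(\<forall>v. 0 \<le> v \<longrightarrow> v < dur k \<longrightarrow> res k + c * v - b (z k v) \<le> u - paid k)
     \<longleftrightarrow> (\<forall>v. 0 \<le> v \<longrightarrow> v < dur k \<longrightarrow> U (epoch z k + v) - b (J (epoch z k + v)) \<le> u)"
    using U_res J by (intro all_cong1 imp_cong refl) (simp add: algebra_simps)
  also have "\<dots> \<longleftrightarrow> (\<forall>s. epoch z k \<le> s \<longrightarrow> s < epoch z (Suc k) \<longrightarrow> U s - b (J s) \<le> u)"
  proof
    assume *: "\<forall>v. 0 \<le> v \<longrightarrow> v < dur k \<longrightarrow> U (epoch z k + v) - b (J (epoch z k + v)) \<le> u"
    show "\<forall>s. epoch z k \<le> s \<longrightarrow> s < epoch z (Suc k) \<longrightarrow> U s - b (J s) \<le> u"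
    proof (intro allI impI)
      fix s assume "epoch z k \<le> s" "s < epoch z (Suc k)"
      then show "U s - b (J s) \<le> u" using *[rule_format, of "s - epoch z k"] by (simp add: epoch_Suc)
    qed
  qed (auto simp: epoch_Suc)
  also have "paid k \<le> u \<and> \<dots> \<longleftrightarrow> 0 \<le> u \<and> (\<forall>s. 0 \<le> s \<longrightarrow> s < epoch z (Suc k) \<longrightarrow> U s - b (J s) \<le> u)"
    unfolding IH using epoch_nonneg[of k] epoch_less[of k "Suc k"] by (auto simp: not_less[symmetric])
  finally show ?case .
qed simp

lemma paid_nonneg: "(\<And>l. l < k \<Longrightarrow> 0 \<le> res l) \<Longrightarrow> 0 \<le> paid k"
  using paid_le_iff[of k "paid k"] by simp

lemma D_split:
  assumes "\<And>l. l < k \<Longrightarrow> 0 \<le> res l" "0 \<le> v" "v < dur k"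
  shows "D (epoch z k + v) \<le> u \<longleftrightarrow>
    paid k \<le> u \<and> (\<forall>v'. 0 \<le> v' \<longrightarrow> v' \<le> v \<longrightarrow> res k + c * v' - b (z k v') \<le> u - paid k)"
proof -
  have "0 \<le> epoch z k + v" using epoch_nonneg[of k] assms by simp
  then have "D (epoch z k + v) \<le> u \<longleftrightarrow> 0 \<le> u \<and> (\<forall>s. 0 \<le> s \<longrightarrow> s \<le> epoch z k + v \<longrightarrow> U s - b (J s) \<le> u)"
    by (rule reflection_le_iff[OF follows])
  also have "\<dots> \<longleftrightarrow> (0 \<le> u \<and> (\<forall>s. 0 \<le> s \<longrightarrow> s < epoch z k \<longrightarrow> U s - b (J s) \<le> u)) \<and>
      (\<forall>v'. 0 \<le> v' \<longrightarrow> v' \<le> v \<longrightarrow> U (epoch z k + v') - b (J (epoch z k + v')) \<le> u)" (is "?l \<longleftrightarrow> ?a \<and> ?b")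
  proof
    assume ?l then show "?a \<and> ?b" using epoch_nonneg[of k] assms by auto
  next
    assume ab: "?a \<and> ?b"
    have "U s - b (J s) \<le> u" if "0 \<le> s" "s \<le> epoch z k + v" for s
      using ab conjunct2[OF ab, rule_format, of "s - epoch z k"] that by (cases "s < epoch z k") auto
    then show ?l using ab by auto
  qed
  also have "?b \<longleftrightarrow> (\<forall>v'. 0 \<le> v' \<longrightarrow> v' \<le> v \<longrightarrow> res k + c * v' - b (z k v') \<le> u - paid k)"
    using U_res J assms by (intro all_cong1 imp_cong refl) (simp add: algebra_simps)
  finally show ?thesis using paid_le_iff[OF assms(1), of k u] by simp
qed

lemma D_eq:
  assumes "solvent z y x k" "0 \<le> v" "v < dur k"
  shows "D (epoch z k + v) = paid k + full_div (res k) (z k) v"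
proof -
  have r: "0 \<le> res l" if "l \<le> k" for l using solvent_nonneg[OF assms(1) that] .
  have "D (epoch z k + v) \<le> u \<longleftrightarrow> full_div (res k) (z k) v \<le> u - paid k" for u
  proof -
    have "before n (z k) v'" if "0 \<le> v'" "v' \<le> v" for v'
      using hit_time_props(3)[OF reg hit, of v' k] that assms by auto
    then show ?thesis
      using D_split[OF _ assms(2,3), where u=u] r by (subst full_div_le_iff[OF reg r assms(2)]) auto
  qed
  then have "D (epoch z k + v) \<le> u \<longleftrightarrow> paid k + full_div (res k) (z k) v \<le> u" for u by (auto simp: algebra_simps)
  then show ?thesis by (meson antisym order_refl)
qed

text \<open>A negative surplus lies below every barrier, so the fatal claim triggers no payment and
  the running maximum keeps its value.\<close>

lemma D_at_ruin:
  assumes "\<And>l. l < k \<Longrightarrow> 0 \<le> res l" "res k < 0"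
  shows "D (epoch z k) = paid k"
proof -
  have "z k 0 \<in> {1..n}" using regular_phase[OF reg, of 0 k] start[of k] by force
  then have "res k - b (z k 0) \<le> u - paid k" if "paid k \<le> u" for u using b_nonneg[of "z k 0"] assms(2) that by simp
  then have "D (epoch z k) \<le> u \<longleftrightarrow> paid k \<le> u" for u
    using D_split[OF assms(1) order_refl dur_pos, where u=u] by (auto simp: order.antisym[of _ "0::real"])
  then show ?thesis by (meson antisym order_refl)
qed

lemma surplus_solvent:
  assumes "solvent z y x k" "0 \<le> v" "v < dur k" shows "0 \<le> U (epoch z k + v) - D (epoch z k + v)"
  using U_res[OF assms(2,3)] D_eq[OF assms] full_div_bounds(2)[OF reg[of k] solvent_nonneg[OF assms(1) order_refl] assms(2)]
  by simp

abbreviation "period_div k s \<equiv> (if solvent z y x k then if s < epoch z k then 0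
  else ennreal (full_div (res k) (z k) (s - epoch z k)) else 0)"

lemma suminf_period_div:
  assumes "0 \<le> v" "v < dur k"
  shows "(\<Sum>l. period_div l (epoch z k + v)) = (\<Sum>l<k. if solvent z y x l then ennreal (path_div (res l) (z l) (dur l)) else 0)
     + (if solvent z y x k then ennreal (full_div (res k) (z k) v) else 0)"
proof -
  have "(\<Sum>l. period_div l (epoch z k + v)) = (\<Sum>l<Suc k. period_div l (epoch z k + v))"
  proof (rule suminf_finite)
    fix l assume "l \<notin> {..<Suc k}"
    then have "epoch z (Suc k) \<le> epoch z l" by (simp add: epoch_le_iff)
    then show "period_div l (epoch z k + v) = 0" using assms by (simp add: epoch_Suc)
  qed simp
  also have "\<dots> = (\<Sum>l<k. period_div l (epoch z k + v)) + period_div k (epoch z k + v)" by simp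
  also have "(\<Sum>l<k. period_div l (epoch z k + v)) = (\<Sum>l<k. if solvent z y x l then ennreal (path_div (res l) (z l) (dur l)) else 0)"
  proof (rule sum.cong[OF refl])
    fix l assume "l \<in> {..<k}"
    then have "epoch z (Suc l) \<le> epoch z k" by (simp add: epoch_le_iff)
    then have "dur l \<le> epoch z k + v - epoch z l" "\<not> epoch z k + v < epoch z l"
      using assms dur_pos[of l] by (auto simp: epoch_Suc)
    then show "period_div l (epoch z k + v) = (if solvent z y x l then ennreal (path_div (res l) (z l) (dur l)) else 0)"
      using full_div_after_hit[OF reg[of l] solvent_nonneg[OF _ order_refl] hit] by simp
  qed
  finally show ?thesis using assms by simp
qed

lemma ennreal_paid:
  assumes "\<And>l. l < k \<Longrightarrow> 0 \<le> res l"
  shows "ennreal (paid k) = (\<Sum>l<k. if solvent z y x l then ennreal (path_div (res l) (z l) (dur l)) else 0)"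
proof -
  have "(\<Sum>l<k. if solvent z y x l then ennreal (path_div (res l) (z l) (dur l)) else 0)
      = (\<Sum>l<k. ennreal (path_div (res l) (z l) (dur l)))"
    using assms by (intro sum.cong) (auto simp: solvent_def)
  also have "\<dots> = ennreal (paid k)"
    unfolding paid_def using assms dur_pos
    by (intro sum_ennreal path_div_nonneg[OF reg]) (auto intro: less_imp_le)
  finally show ?thesis by simp
qed

text \<open>The measure of \<open>{-1<..s}\<close> is \<open>D s\<close>, and the part on
  \<open>{-1<..<0}\<close> is null because \<open>D\<close> vanishes there; the atom of the lump sum
  at time zero is retained.\<close>

lemma interval_measure_D:
  assumes "0 \<le> s" shows "emeasure (interval_measure D) {0..s} = ennreal (D s)"
proof -
  have neg: "\<And>t. t < 0 \<Longrightarrow> D t = 0" and mono: "\<And>s t. s \<le> t \<Longrightarrow> D s \<le> D t" and rc: "\<And>t. continuous (at_right t) D"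
    using follows by (auto simp: follows_phasewise_barriers_def mono_def)
  have incr: "emeasure (interval_measure D) {a<..b} = ennreal (D b - D a)" if "a \<le> b" for a b
    by (rule emeasure_interval_measure_Ioc[OF that mono rc])
  have "(\<Union>k. {-1<..- 1 / real (Suc k)}) \<in> null_sets (interval_measure D)"
  proof (rule null_sets_UN)
    fix k
    have "-1 \<le> - 1 / real (Suc k)" "- 1 / real (Suc k) < 0" by (auto simp: field_simps)
    then show "{-1<..- 1 / real (Suc k)} \<in> null_sets (interval_measure D)"
      using incr[of "-1" "- 1 / real (Suc k)"] neg[of "-1"] neg[of "- 1 / real (Suc k)"] by (intro null_setsI) auto
  qed
  moreover have "(\<Union>k. {-1<..- 1 / real (Suc k)}) = {-1<..<0::real}"
  proof
    show "{-1<..<0::real} \<subseteq> (\<Union>k. {-1<..- 1 / real (Suc k)})"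
    proof
      fix t :: real assume t: "t \<in> {-1<..<0}"
      then obtain k where "inverse (real (Suc k)) < - t" using reals_Archimedean[of "- t"] by auto
      then have "t \<le> - 1 / real (Suc k)" by (simp add: inverse_eq_divide)
      then show "t \<in> (\<Union>k. {-1<..- 1 / real (Suc k)})" using t by auto
    qed
    show "(\<Union>k. {-1<..- 1 / real (Suc k)}) \<subseteq> {-1<..<0::real}"
    proof
      fix t :: real assume "t \<in> (\<Union>k. {-1<..- 1 / real (Suc k)})"
      then obtain k where "-1 < t" "t \<le> - 1 / real (Suc k)" by auto
      moreover have "- 1 / real (Suc k) < 0" by simp
      ultimately show "t \<in> {-1<..<0}" unfolding greaterThanLessThan_iff by linarith
    qed
  qed
  ultimately have "{-1<..<0} \<in> null_sets (interval_measure D)" by simp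
  then have "emeasure (interval_measure D) ({0..s} \<union> {-1<..<0}) = emeasure (interval_measure D) {0..s}"
    by (intro emeasure_Un_null_set) auto
  moreover have "{0..s} \<union> {-1<..<0} = {-1<..s}" using assms by auto
  ultimately show ?thesis using incr[of "-1" s] neg[of "-1"] assms by simp
qed

text \<open>Between claims a nonnegative surplus stays nonnegative, so ruin can occur only at a
  claim. The measure up to \<open>s\<close> is then the sum of the dividends of the solvent periods
  begun by \<open>s\<close>, and \<open>disc_shift\<close> moves each period to time zero.\<close>

theorem reward_eq:
  "(\<integral>\<^sup>+ t. ennreal (exp (- d * t)) * indicator {t. 0 \<le> t \<and> ereal t < ruin_time (\<lambda>s. U s - D s)} t \<partial>interval_measure D)
    = total_reward z y x"
proof -
  let ?A = "{t. 0 \<le> t \<and> ereal t < ruin_time (\<lambda>s. U s - D s)}"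
  have mono: "mono D" and rc: "\<And>t. continuous (at_right t) D"
    and AE: "AE t in interval_measure D. 0 \<le> t \<longrightarrow> U t - D t = b (J t)"
    using follows by (auto simp: follows_phasewise_barriers_def)
  have main: "?A \<in> sets borel \<and> (\<forall>s\<ge>0. emeasure (interval_measure D) (?A \<inter> {..s}) = (\<Sum>l. period_div l s))"
  proof (cases "\<forall>k. 0 \<le> res k")
    case True
    then have sol: "solvent z y x k" for k by (simp add: solvent_def)
    have "\<not> (U t - D t < 0)" if t: "0 \<le> t" for t
    proof -
      obtain k v where kv: "t = epoch z k + v" "0 \<le> v" "v < dur k" by (rule epoch_cases[OF t])
      show ?thesis using surplus_solvent[OF sol kv(2,3)] kv(1) by simp
    qed
    then have "{t. 0 \<le> t \<and> U t - D t < 0} = {}" by blast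
    then have "ruin_time (\<lambda>s. U s - D s) = \<infinity>"
      unfolding ruin_time_def by (simp only: image_empty Inf_empty top_ereal_def)
    then have A: "?A = {0..}" by auto
    have "emeasure (interval_measure D) (?A \<inter> {..s}) = (\<Sum>l. period_div l s)" if s: "0 \<le> s" for s
    proof -
      obtain k v where kv: "s = epoch z k + v" "0 \<le> v" "v < dur k" by (rule epoch_cases[OF s])
      have "?A \<inter> {..s} = {0..s}" unfolding A by auto
      then have "emeasure (interval_measure D) (?A \<inter> {..s}) = ennreal (D s)" using interval_measure_D[OF s] by simp
      also have "\<dots> = ennreal (paid k) + ennreal (full_div (res k) (z k) v)"
        unfolding kv(1) D_eq[OF sol kv(2,3)]
        using full_div_bounds(1)[OF reg[of k] _ kv(2), of "res k"] True paid_nonneg[of k]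
        by (intro ennreal_plus) auto
      also have "\<dots> = (\<Sum>l. period_div l s)"
        unfolding kv(1) suminf_period_div[OF kv(2,3)] using ennreal_paid[of k] True sol by simp
      finally show ?thesis .
    qed
    then show ?thesis using A by simp
  next
    case False
    define K where "K = (LEAST k. res k < 0)"
    have "\<exists>k. res k < 0" using False by (auto simp: not_le)
    then have K: "res K < 0" unfolding K_def by (rule LeastI_ex[of "\<lambda>k. res k < 0"])
    have Kmin: "0 \<le> res l" if "l < K" for l using not_less_Least[of l "\<lambda>k. res k < 0"] that by (simp add: K_def not_less)
    have sol_iff: "solvent z y x k \<longleftrightarrow> k < K" for k
    proof
      assume "solvent z y x k"
      then show "k < K" using solvent_nonneg[of z y x k K] K by (cases "k < K") auto
    next
      assume "k < K" then show "solvent z y x k" using Kmin by (auto simp: solvent_def)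
    qed
    have DK: "D (epoch z K) = paid K" by (rule D_at_ruin[OF Kmin K])
    have ruinK: "U (epoch z K) - D (epoch z K) < 0" using U_res[of 0 K] dur_pos[of K] DK K by simp
    have safe: "0 \<le> U t - D t" if t: "0 \<le> t" "t < epoch z K" for t
    proof -
      obtain k v where kv: "t = epoch z k + v" "0 \<le> v" "v < dur k" by (rule epoch_cases[OF t(1)])
      then have "epoch z k < epoch z K" using t by simp
      then have "solvent z y x k" by (simp add: epoch_less_iff sol_iff)
      then show ?thesis using surplus_solvent[OF _ kv(2,3)] kv(1) by simp
    qed
    have "ruin_time (\<lambda>s. U s - D s) = ereal (epoch z K)"
      unfolding ruin_time_def
    proof (rule antisym)
      show "Inf (ereal ` {t. 0 \<le> t \<and> U t - D t < 0}) \<le> ereal (epoch z K)"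
        using epoch_nonneg[of K] ruinK by (intro Inf_lower) auto
      show "ereal (epoch z K) \<le> Inf (ereal ` {t. 0 \<le> t \<and> U t - D t < 0})"
        using safe by (intro Inf_greatest) (force simp: not_less[symmetric])
    qed
    then have A: "?A = {0..<epoch z K}" by auto
    \<comment> \<open>The ruin time is excluded from the reward interval; it carries no mass, since
      the surplus there is negative and the barrier is not.\<close>
    have nullK: "emeasure (interval_measure D) {epoch z K} = 0"
    proof -
      have "z K 0 \<in> {1..n}" using regular_phase[OF reg, of 0 K] start[of K] by force
      then have "0 \<le> b (J (epoch z K))" using J[of 0 K] dur_pos[of K] b_nonneg by simp
      then have "AE t in interval_measure D. t \<notin> {epoch z K}"
        using AE ruinK epoch_nonneg[of K] by (auto elim!: eventually_mono)
      then show ?thesis by (subst (asm) AE_iff_measurable[where N="{epoch z K}"]) auto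
    qed
    have "emeasure (interval_measure D) (?A \<inter> {..s}) = (\<Sum>l. period_div l s)" if s: "0 \<le> s" for s
    proof -
      obtain k v where kv: "s = epoch z k + v" "0 \<le> v" "v < dur k" by (rule epoch_cases[OF s])
      show ?thesis
      proof (cases "k < K")
        case True
        then have "epoch z (Suc k) \<le> epoch z K" by (simp add: epoch_le_iff)
        then have "s < epoch z K" using kv by (simp add: epoch_Suc)
        then have "?A \<inter> {..s} = {0..s}" unfolding A by auto
        then have "emeasure (interval_measure D) (?A \<inter> {..s}) = ennreal (D s)" using interval_measure_D[OF s] by simp
        also have "\<dots> = ennreal (paid k) + ennreal (full_div (res k) (z k) v)"
          unfolding kv(1) D_eq[OF iffD2[OF sol_iff True] kv(2,3)]
          using full_div_bounds(1)[OF reg[of k] _ kv(2), of "res k"] Kmin True paid_nonneg[of k]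
          by (intro ennreal_plus) auto
        also have "\<dots> = (\<Sum>l. period_div l s)"
          unfolding kv(1) suminf_period_div[OF kv(2,3)] using ennreal_paid[of k] Kmin True by (simp add: sol_iff)
        finally show ?thesis .
      next
        case False
        then have "epoch z K \<le> epoch z k" by (simp add: epoch_le_iff)
        then have "epoch z K \<le> s" using kv by simp
        then have "?A \<inter> {..s} = {0..<epoch z K}" unfolding A by auto
        moreover have "emeasure (interval_measure D) ({0..<epoch z K} \<union> {epoch z K}) = emeasure (interval_measure D) {0..<epoch z K}"
          using nullK by (intro emeasure_Un_null_set) (auto intro: null_setsI)
        moreover have "{0..<epoch z K} \<union> {epoch z K} = {0..epoch z K}" using epoch_nonneg[of K] by auto
        ultimately have "emeasure (interval_measure D) (?A \<inter> {..s}) = ennreal (paid K)"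
          using interval_measure_D[OF epoch_nonneg, of K] DK by simp
        also have "\<dots> = (\<Sum>l<K. if solvent z y x l then ennreal (path_div (res l) (z l) (dur l)) else 0)"
          by (rule ennreal_paid[OF Kmin])
        also have "\<dots> = (\<Sum>l<k. if solvent z y x l then ennreal (path_div (res l) (z l) (dur l)) else 0)"
          using False by (intro sum.mono_neutral_left) (auto simp: sol_iff)
        also have "\<dots> = (\<Sum>l. period_div l s)"
          unfolding kv(1) suminf_period_div[OF kv(2,3)] using False by (simp add: sol_iff)
        finally show ?thesis .
      qed
    qed
    then show ?thesis using A by simp
  qed
  have m: "(\<lambda>s. ennreal (full_div (res l) (z l) (max 0 s))) \<in> borel_measurable borel" if "solvent z y x l" for l
  proof -
    have r: "0 \<le> res l" using solvent_nonneg[OF that order_refl] .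
    have "mono (\<lambda>s. full_div (res l) (z l) (max 0 s))"
    proof (rule monoI)
      fix s t :: real assume "s \<le> t"
      then show "full_div (res l) (z l) (max 0 s) \<le> full_div (res l) (z l) (max 0 t)"
        using full_div_le_iff[OF reg r, of "max 0 t" l "full_div (res l) (z l) (max 0 t)"]
        by (subst full_div_le_iff[OF reg r]) auto
    qed
    then show ?thesis by (intro measurable_compose[OF borel_measurable_mono measurable_ennreal])
  qed
  have disc_term: "disc d (\<lambda>s. if solvent z y x l then if s < epoch z l then 0
    else ennreal (full_div (res l) (z l) (max 0 (s - epoch z l))) else 0) = (if solvent z y x l
   then ennreal (exp (- d * epoch z l)) * disc d (\<lambda>s. ennreal (path_div (res l) (z l) s)) else 0)" for l
  proof (cases "solvent z y x l")
    case True
    have "disc d (\<lambda>s. if s < epoch z l then 0 else ennreal (full_div (res l) (z l) (max 0 (s - epoch z l))))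
      = ennreal (exp (- d * epoch z l)) * disc d (\<lambda>s. ennreal (full_div (res l) (z l) (max 0 s)))"
      by (rule disc_shift[OF m[OF True] epoch_nonneg])
    also have "disc d (\<lambda>s. ennreal (full_div (res l) (z l) (max 0 s))) = disc d (\<lambda>s. ennreal (full_div (res l) (z l) s))"
      by (rule disc_cong) (simp add: max_absorb2)
    also have "\<dots> = disc d (\<lambda>s. ennreal (path_div (res l) (z l) s))"
      by (rule disc_full_div[OF reg solvent_nonneg[OF True order_refl]])
    finally show ?thesis using True by simp
  qed (simp add: disc_const[OF d_pos])
  have disc_meas: "(\<lambda>s. if solvent z y x l then if s < epoch z l then 0
    else ennreal (full_div (res l) (z l) (max 0 (s - epoch z l))) else 0) \<in> borel_measurable borel" for l
  proof (cases "solvent z y x l")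
    case True
    then have "(\<lambda>s. ennreal (full_div (res l) (z l) (max 0 (s - epoch z l)))) \<in> borel_measurable borel"
      by (intro measurable_compose[OF _ m]) auto
    then show ?thesis using True by simp
  qed simp
  have "(\<integral>\<^sup>+ t. ennreal (exp (- d * t)) * indicator ?A t \<partial>interval_measure D)
     = disc d (\<lambda>s. emeasure (interval_measure D) (?A \<inter> {..s}))"
    by (rule discounted_measure[OF mono rc d_pos]) (use main in auto)
  also have "\<dots> = disc d (\<lambda>s. \<Sum>l. period_div l s)"
    by (rule disc_cong) (use main in blast)
  also have "\<dots> = disc d (\<lambda>s. \<Sum>l. if solvent z y x l then if s < epoch z l then 0
      else ennreal (full_div (res l) (z l) (max 0 (s - epoch z l))) else 0)"
    by (intro disc_cong suminf_cong) (simp add: max_absorb2)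
  also have "\<dots> = (\<Sum>l. disc d (\<lambda>s. if solvent z y x l then if s < epoch z l then 0
      else ennreal (full_div (res l) (z l) (max 0 (s - epoch z l))) else 0))"
    by (rule disc_suminf[OF disc_meas])
  also have "\<dots> = total_reward z y x"
    unfolding total_reward_def by (rule suminf_cong[OF disc_term])
  finally show ?thesis .
qed

end
end
end

section \<open>Independence of the interclaim periods\<close>

text \<open>The product rule on the two sub-\<sigma>-algebras says that the diagonal map is
  distributed as the product of the restricted laws; Fubini then separates the two copies of
  \<omega>.\<close>

lemma (in prob_space) nn_integral_indep_pair:
  assumes N1: "space N1 = space M" "sets N1 \<subseteq> events" and N2: "space N2 = space M" "sets N2 \<subseteq> events"
    and indep: "\<And>A B. A \<in> sets N1 \<Longrightarrow> B \<in> sets N2 \<Longrightarrow> prob (A \<inter> B) = prob A * prob B"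
    and f: "f \<in> borel_measurable (N1 \<Otimes>\<^sub>M N2)"
  shows "(\<integral>\<^sup>+\<omega>. f (\<omega>, \<omega>) \<partial>M) = (\<integral>\<^sup>+\<omega>1. (\<integral>\<^sup>+\<omega>2. f (\<omega>1, \<omega>2) \<partial>M) \<partial>M)"
proof -
  have id1: "(\<lambda>\<omega>. \<omega>) \<in> measurable M N1" and id2: "(\<lambda>\<omega>. \<omega>) \<in> measurable M N2"
    using N1 N2 sets.sets_into_space by (auto intro!: measurableI simp: subset_eq)
  let ?P1 = "distr M N1 (\<lambda>\<omega>. \<omega>)" and ?P2 = "distr M N2 (\<lambda>\<omega>. \<omega>)"
  interpret P1: prob_space ?P1 by (rule prob_space_distr[OF id1])
  interpret P2: prob_space ?P2 by (rule prob_space_distr[OF id2])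
  have diag: "(\<lambda>\<omega>. (\<omega>, \<omega>)) \<in> measurable M (N1 \<Otimes>\<^sub>M N2)" by (rule measurable_Pair[OF id1 id2])
  have sets_eq: "sets (?P1 \<Otimes>\<^sub>M ?P2) = sets (N1 \<Otimes>\<^sub>M N2)" by (intro sets_pair_measure_cong) auto
  have prod: "?P1 \<Otimes>\<^sub>M ?P2 = distr M (N1 \<Otimes>\<^sub>M N2) (\<lambda>\<omega>. (\<omega>, \<omega>))"
  proof (rule pair_measure_eqI)
    show "sigma_finite_measure ?P1" "sigma_finite_measure ?P2" by unfold_locales
    show "sets (?P1 \<Otimes>\<^sub>M ?P2) = sets (distr M (N1 \<Otimes>\<^sub>M N2) (\<lambda>\<omega>. (\<omega>, \<omega>)))" using sets_eq by simp
    fix A B assume "A \<in> sets ?P1" "B \<in> sets ?P2"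
    then have AB: "A \<in> sets N1" "B \<in> sets N2" "A \<in> events" "B \<in> events" using N1 N2 by auto
    then have "A \<subseteq> space M" "B \<subseteq> space M" by (auto dest: sets.sets_into_space)
    note AB = AB this
    have "(\<lambda>\<omega>. (\<omega>, \<omega>)) -` (A \<times> B) \<inter> space M = A \<inter> B" "(\<lambda>\<omega>. \<omega>) -` A \<inter> space M = A" "(\<lambda>\<omega>. \<omega>) -` B \<inter> space M = B"
      using AB by auto
    then show "emeasure ?P1 A * emeasure ?P2 B = emeasure (distr M (N1 \<Otimes>\<^sub>M N2) (\<lambda>\<omega>. (\<omega>, \<omega>))) (A \<times> B)"
      using AB indep[OF AB(1,2)] id1 id2 diag
      by (simp add: emeasure_distr emeasure_eq_measure flip: ennreal_mult)
  qed
  have f': "f \<in> borel_measurable (?P1 \<Otimes>\<^sub>M ?P2)" using f sets_eq measurable_cong_sets by blast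
  have "(\<integral>\<^sup>+\<omega>. f (\<omega>, \<omega>) \<partial>M) = (\<integral>\<^sup>+p. f p \<partial>distr M (N1 \<Otimes>\<^sub>M N2) (\<lambda>\<omega>. (\<omega>, \<omega>)))"
    by (subst nn_integral_distr[OF diag]) (use f in auto)
  also have "\<dots> = (\<integral>\<^sup>+x. (\<integral>\<^sup>+y. f (x, y) \<partial>?P2) \<partial>?P1)"
    unfolding prod[symmetric] by (rule P2.nn_integral_fst[symmetric, OF f'])
  also have "\<dots> = (\<integral>\<^sup>+\<omega>1. (\<integral>\<^sup>+y. f (\<omega>1, y) \<partial>?P2) \<partial>M)"
  proof (rule nn_integral_distr[OF id1])
    have "(\<lambda>x. \<integral>\<^sup>+y. f (x, y) \<partial>?P2) \<in> borel_measurable ?P1"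
      by (rule P2.borel_measurable_nn_integral_fst[OF f'])
    then show "(\<lambda>x. \<integral>\<^sup>+y. f (x, y) \<partial>?P2) \<in> borel_measurable (distr M N1 (\<lambda>\<omega>. \<omega>))" .
  qed
  also have "\<dots> = (\<integral>\<^sup>+\<omega>1. (\<integral>\<^sup>+\<omega>2. f (\<omega>1, \<omega>2) \<partial>M) \<partial>M)"
  proof (rule nn_integral_cong)
    fix \<omega> assume "\<omega> \<in> space M"
    then have "(\<lambda>y. f (\<omega>, y)) \<in> borel_measurable N2" using f N1 by (intro measurable_Pair2[of f N1 N2 borel]) auto
    then show "(\<integral>\<^sup>+y. f (\<omega>, y) \<partial>?P2) = (\<integral>\<^sup>+\<omega>2. f (\<omega>, \<omega>2) \<partial>M)"
      by (subst nn_integral_distr[OF id2]) simp_all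
  qed
  finally show ?thesis .
qed

context phase_type_risk_model begin

definition source :: "nat \<Rightarrow> nat + nat \<Rightarrow> 'a set set" where
  "source i = case_sum (\<lambda>k. path_events (P i) (Z k) {0..}) (\<lambda>k. {Y k -` B \<inter> space (P i) |B. B \<in> sets borel})"

text \<open>Packaging the generated \<sigma>-algebra as a measure lets \<open>measurable\<close>
  express that a quantity is determined by the sources in \<open>K\<close>.\<close>

definition info :: "nat \<Rightarrow> (nat + nat) set \<Rightarrow> 'a measure" where
  "info i K = sigma (space (P i)) (\<Union>j\<in>K. source i j)"

abbreviation sources :: "(nat + nat) set" where "sources \<equiv> UNIV <+> {1..}"

context
  fixes i assumes i: "i \<in> {1..n}"
begin

lemma prob_space_P: "prob_space (P i)" by (rule prob[OF i])

lemma source_subset: "source i j \<subseteq> Pow (space (P i))"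
proof (cases j)
  case (Inl k)
  interpret sigma_algebra "space (P i)" "path_events (P i) (Z k) {0..}" by (rule path_events_algebra)
  show ?thesis using Inl space_closed by (simp add: source_def)
qed (auto simp: source_def)

lemma space_info [simp]: "space (info i K) = space (P i)"
  unfolding info_def by (rule space_measure_of) (use source_subset in auto)

lemma sets_info: "sets (info i K) = sigma_sets (space (P i)) (\<Union>j\<in>K. source i j)"
  unfolding info_def by (rule sets_measure_of) (use source_subset in auto)

lemma sets_info_mono: "K \<subseteq> K' \<Longrightarrow> sets (info i K) \<subseteq> sets (info i K')"
  unfolding sets_info by (rule sigma_sets_mono') auto

lemma indep_sources: "prob_space.indep_sets (P i) (source i) sources"
  unfolding source_def by (rule independence[OF i])

lemma source_events: "j \<in> sources \<Longrightarrow> source i j \<subseteq> sets (P i)"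
  using prob_space.indep_sets_def[OF prob_space_P, of "source i" sources] indep_sources by blast

lemma sets_info_events: "K \<subseteq> sources \<Longrightarrow> sets (info i K) \<subseteq> sets (P i)"
  unfolding sets_info by (rule sets.sigma_sets_subset) (use source_events in blast)

lemma source_Int_stable: "Int_stable (source i j)"
proof (cases j)
  case (Inl k)
  interpret sigma_algebra "space (P i)" "path_events (P i) (Z k) {0..}" by (rule path_events_algebra)
  show ?thesis using Inl by (auto simp: source_def Int_stable_def)
next
  case (Inr k)
  show ?thesis
    unfolding Int_stable_def
  proof (intro ballI)
    fix A A' assume "A \<in> source i j" "A' \<in> source i j"
    then obtain B B' where "A = Y k -` B \<inter> space (P i)" "A' = Y k -` B' \<inter> space (P i)" "B \<in> sets borel" "B' \<in> sets borel"
      using Inr by (auto simp: source_def)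
    moreover from this have "A \<inter> A' = Y k -` (B \<inter> B') \<inter> space (P i)" by auto
    ultimately show "A \<inter> A' \<in> source i j" using Inr by (auto simp: source_def intro!: exI[of _ "B \<inter> B'"])
  qed
qed

lemma info_indep:
  assumes "K \<subseteq> sources" "K' \<subseteq> sources" "K \<inter> K' = {}" "A \<in> sets (info i K)" "B \<in> sets (info i K')"
  shows "measure (P i) (A \<inter> B) = measure (P i) A * measure (P i) B"
proof -
  interpret prob_space "P i" by (rule prob_space_P)
  let ?I = "case_bool K K'"
  have "indep_sets (\<lambda>j. sigma_sets (space (P i)) (\<Union>k\<in>?I j. source i k)) UNIV"
  proof (rule indep_sets_collect_sigma)
    show "indep_sets (source i) (\<Union>j\<in>UNIV. ?I j)"
      by (rule indep_sets_mono_index[OF _ indep_sources]) (use assms in \<open>auto simp: UNIV_bool\<close>)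
    show "disjoint_family_on ?I UNIV" using assms(3) by (auto simp: disjoint_family_on_def split: bool.split)
  qed (rule source_Int_stable)
  then have "prob (\<Inter>j\<in>UNIV. case_bool A B j) = (\<Prod>j\<in>UNIV. prob (case_bool A B j))"
    by (rule indep_setsD) (use assms(4,5) in \<open>auto simp: sets_info split: bool.split\<close>)
  then show ?thesis by (simp add: UNIV_bool ac_simps)
qed

lemma Z_info:
  assumes "Inl k \<in> K" "0 \<le> t" shows "Z k t \<in> measurable (info i K) (count_space UNIV)"
proof (rule measurableI)
  fix A
  have "{\<omega>\<in>space (P i). Z k t \<omega> = j} \<in> sets (info i K)" for j
    unfolding sets_info
    using assms path_events_phase[where s=t and I="{0..}" and M="P i" and Z="Z k" and k=j]
    by (intro sigma_sets.Basic) (force simp: source_def)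
  then have "(\<Union>j\<in>A. {\<omega>\<in>space (P i). Z k t \<omega> = j}) \<in> sets (info i K)" by (intro sets.countable_UN'') auto
  also have "(\<Union>j\<in>A. {\<omega>\<in>space (P i). Z k t \<omega> = j}) = Z k t -` A \<inter> space (info i K)" by auto
  finally show "Z k t -` A \<inter> space (info i K) \<in> sets (info i K)" .
qed simp

lemma Y_info:
  assumes "Inr k \<in> K" shows "Y k \<in> borel_measurable (info i K)"
proof (rule measurableI)
  fix B :: "real set" assume "B \<in> sets borel"
  then show "Y k -` B \<inter> space (info i K) \<in> sets (info i K)"
    unfolding sets_info using assms by (intro sigma_sets.Basic) (force simp: source_def)
qed simp

lemma info_integral:
  assumes "K \<subseteq> sources" "K' \<subseteq> sources" "K \<inter> K' = {}" "f \<in> borel_measurable (info i K \<Otimes>\<^sub>M info i K')"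
  shows "(\<integral>\<^sup>+\<omega>. f (\<omega>, \<omega>) \<partial>P i) = (\<integral>\<^sup>+\<omega>1. (\<integral>\<^sup>+\<omega>2. f (\<omega>1, \<omega>2) \<partial>P i) \<partial>P i)"
  by (rule prob_space.nn_integral_indep_pair[OF prob_space_P])
     (use assms sets_info_events info_indep in auto)

lemma info_measurable: "K \<subseteq> sources \<Longrightarrow> f \<in> measurable (info i K) N \<Longrightarrow> f \<in> measurable (P i) N"
  using sets_info_events[of K] by (intro measurable_mono[THEN subsetD, of N N "info i K" "P i"]) auto

lemma info_measurable_mono: "K \<subseteq> K' \<Longrightarrow> f \<in> measurable (info i K) N \<Longrightarrow> f \<in> measurable (info i K') N"
  using sets_info_mono[of K K'] by (intro measurable_mono[THEN subsetD, of N N "info i K" "info i K'"]) auto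

text \<open>For a restarted cycle the probabilities \<open>\<pi>\<close> of the phases already sum
  to one, which leaves no mass for \<open>n + 1\<close>.\<close>

lemma starts_transient: "AE \<omega> in P i. Z k 0 \<omega> \<in> {1..n}"
proof (cases "k = 0")
  case True
  then show ?thesis using initial_phase[OF i] i by (auto elim: eventually_mono)
next
  case False
  interpret prob_space "P i" by (rule prob_space_P)
  have meas: "Z k 0 \<in> measurable (P i) (count_space {1..n+1})" using cycles[OF i, of k] by (simp add: markov_jump_process_def)
  have ev: "{\<omega>\<in>space (P i). Z k 0 \<omega> = j} \<in> events" for j
  proof -
    have "Z k 0 \<in> measurable (P i) (count_space UNIV)"
      by (rule measurable_compose[OF meas]) (auto simp: measurable_def)
    from measurable_sets[OF this, of "{j}"] show ?thesis by (simp add: vimage_def Int_def conj_commute)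
  qed
  have "prob (\<Union>j\<in>{1..n}. {\<omega>\<in>space (P i). Z k 0 \<omega> = j}) = (\<Sum>j\<in>{1..n}. prob {\<omega>\<in>space (P i). Z k 0 \<omega> = j})"
    by (rule finite_measure_finite_Union) (use ev in \<open>auto simp: disjoint_family_on_def\<close>)
  also have "\<dots> = (\<Sum>j=1..n. \<pi> j)" by (intro sum.cong restart_phase i) (use False in auto)
  also have "\<dots> = 1" by (rule initial_sum)
  finally have "AE \<omega> in P i. \<omega> \<in> (\<Union>j\<in>{1..n}. {\<omega>\<in>space (P i). Z k 0 \<omega> = j})"
    using ev by (subst (asm) prob_eq_1) auto
  then show ?thesis by (auto elim: eventually_mono)
qed

lemma cycle_process_P: "cycle n c' \<alpha> d b \<psi> C \<Longrightarrow> cycle_process n c' \<alpha> d b \<psi> C (P i) lam (Z k)"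
  unfolding cycle_process_def cycle_process_axioms_def using prob_space_P cycles[OF i] starts_transient by blast

end

section \<open>Almost sure absorption of every cycle\<close>

abbreviation "jumps \<equiv> cycle_process.edges n lam"

text \<open>Zero reward and payoff, to give access to the facts of \<open>cycle_process\<close> that
  concern the process alone.\<close>

lemma trivial_cycle: "cycle n 1 0 1 (\<lambda>_. 0) (\<lambda>_. 0) 0"
  by unfold_locales auto

text \<open>Otherwise take a phase, among those reachable from \<open>i0\<close>, whose own
  reachable set is smallest. All phases in that set reach each other and none leads out, which
  contradicts transience under the law started there.\<close>

lemma absorbing_reachable:
  assumes i0: "i0 \<in> {1..n}" shows "(i0, n+1) \<in> jumps\<^sup>*"
proof (rule ccontr)
  assume neg: "(i0, n+1) \<notin> jumps\<^sup>*"
  interpret cp0: cycle_process n 1 0 1 "\<lambda>_. 0" "\<lambda>_. 0" 0 "P i0" lam "Z 0"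
    by (rule cycle_process_P[OF i0 trivial_cycle])
  define R where "R i = {j. (i, j) \<in> jumps\<^sup>*}" for i
  have R_sub: "R i \<subseteq> insert i {1..n+1}" for i
  proof
    fix j assume "j \<in> R i"
    then have "(i, j) \<in> jumps\<^sup>*" by (simp add: R_def)
    then show "j \<in> insert i {1..n+1}" by (induction rule: rtrancl_induct) (auto simp: cp0.edges_def)
  qed
  have R_fin: "finite (R i)" for i using R_sub finite_subset by blast
  have R_trans: "R j \<subseteq> R i" if "j \<in> R i" for i j using that by (auto simp: R_def)
  define i where "i = arg_min_on (\<lambda>i. card (R i)) (R i0)"
  have ne: "R i0 \<noteq> {}" by (auto simp: R_def)
  have iR: "i \<in> R i0" unfolding i_def by (rule arg_min_if_finite(1)[OF R_fin ne])
  have min: "card (R i) \<le> card (R j)" if "j \<in> R i0" for j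
    unfolding i_def using arg_min_if_finite(2)[OF R_fin ne, of "\<lambda>i. card (R i)"] that by force
  have Ri0: "R i0 \<subseteq> {1..n}" using R_sub[of i0] neg i0 by (auto simp: R_def le_Suc_eq)
  have i: "i \<in> {1..n}" using iR Ri0 by blast
  have Ri: "R i \<subseteq> {1..n}" using R_trans[OF iR] Ri0 by blast
  interpret cp: cycle_process n 1 0 1 "\<lambda>_. 0" "\<lambda>_. 0" 0 "P i" lam "Z 0"
    by (rule cycle_process_P[OF i trivial_cycle])
  show False
  proof (rule cp.transient_class_not_closed[OF Ri])
    fix j l assume j: "j \<in> R i" and l: "l \<in> {1..n+1} - R i"
    have jn: "j \<in> {1..n}" using j Ri by blast
    have "l \<noteq> j" using j l by auto
    then have nn: "0 \<le> lam j l" using intensity_nonneg[OF jn] l by auto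
    have "(j, l) \<notin> jumps" using j l by (auto simp: R_def intro: rtrancl.rtrancl_into_rtrancl)
    then show "lam j l = 0" using nn jn l \<open>l \<noteq> j\<close> by (auto simp: cp.edges_def)
  next
    fix j assume j: "j \<in> R i"
    have "R j \<subseteq> R i" by (rule R_trans[OF j])
    moreover have "card (R i) \<le> card (R j)" using min[of j] R_trans[OF iR] j by blast
    ultimately have "R j = R i" using card_seteq[OF R_fin] by blast
    then show "(j, i) \<in> jumps\<^sup>*" by (auto simp: R_def)
  qed (use initial_phase[OF i] transient[OF i] in \<open>auto simp: R_def\<close>)
qed

lemma cycles_absorbed:
  assumes i: "i \<in> {1..n}" shows "AE \<omega> in P i. hits n (\<lambda>t. Z k t \<omega>)"
proof -
  interpret cp: cycle_process n 1 0 1 "\<lambda>_. 0" "\<lambda>_. 0" 0 "P i" lam "Z k"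
    by (rule cycle_process_P[OF i trivial_cycle])
  show ?thesis by (rule cp.absorbed[OF absorbing_reachable])
qed

lemma cycles_regular:
  assumes i: "i \<in> {1..n}" and "\<omega> \<in> space (P i)" shows "regular_path n (\<lambda>t. Z k t \<omega>)"
proof -
  interpret cp: cycle_process n 1 0 1 "\<lambda>_. 0" "\<lambda>_. 0" 0 "P i" lam "Z k"
    by (rule cycle_process_P[OF i trivial_cycle])
  show ?thesis by (rule cp.Z_regular[OF assms(2)])
qed

end

text \<open>A limit of finite recursions along the grids. The starting surplus may be random, and
  \<open>max 0\<close> secures the nonnegativity that the convergence requires.\<close>

lemma (in cycle) period_reward_measurable:
  fixes z :: "real \<Rightarrow> 'b \<Rightarrow> nat"
  assumes R: "R \<in> borel_measurable N" and z: "\<And>t. 0 \<le> t \<Longrightarrow> z t \<in> measurable N (count_space UNIV)"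
    and reg: "\<And>\<omega>. \<omega> \<in> space N \<Longrightarrow> regular_path n (\<lambda>t. z t \<omega>)"
  shows "(\<lambda>\<omega>. period_reward (max 0 (R \<omega>)) (\<lambda>t. z t \<omega>)) \<in> borel_measurable N"
proof (rule borel_measurable_LIMSEQ_order)
  show "(\<lambda>k. ennreal (grid_reward (step k) (k * 2 ^ k) (max 0 (R \<omega>)) (sample k (\<lambda>t. z t \<omega>)))) \<longlonglongrightarrow>
      period_reward (max 0 (R \<omega>)) (\<lambda>t. z t \<omega>)" if "\<omega> \<in> space N" for \<omega>
    by (rule grid_reward_tendsto[OF reg[OF that]]) simp
  show "(\<lambda>\<omega>. ennreal (grid_reward (step k) (k * 2 ^ k) (max 0 (R \<omega>)) (sample k (\<lambda>t. z t \<omega>)))) \<in> borel_measurable N" for k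
    using \<psi>_cont R z
    by (intro measurable_compose[OF grid_reward_measurable measurable_ennreal] borel_measurable_max)
       (auto intro: borel_measurable_continuous_onI)
qed

section \<open>The model with a fixed barrier vector and initial capital\<close>

locale barrier_problem = phase_type_risk_model n c \<beta> \<pi> lam P Z Y
  for n c \<beta> \<pi> lam and P :: "nat \<Rightarrow> 'a measure" and Z Y +
  fixes \<delta> :: real and b :: "nat \<Rightarrow> real" and x :: real
  assumes \<delta>_pos: "0 < \<delta>" and b_nonneg: "\<And>i. i \<in> {1..n} \<Longrightarrow> 0 \<le> b i" and x_nonneg: "0 \<le> x"
begin

sublocale cy: cycle n c 1 \<delta> b "\<lambda>_. 0" 0
  by unfold_locales (use premium \<delta>_pos b_nonneg in auto)

text \<open>With \<alpha> zero a period reward contains only the payoff at the claim: payoff one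
  yields the discount factor of the period, and \<open>surplus_cycle\<close> yields the discounted
  surplus before the claim. Both inherit the measurability of period rewards.\<close>

lemma laplace_cycle: "0 < d \<Longrightarrow> cycle n c 0 d b (\<lambda>_. 1) 1"
  by unfold_locales (use premium b_nonneg in auto)

lemma surplus_cycle: "cycle n c 0 1 b (max 0) 1"
  by unfold_locales (use premium b_nonneg in \<open>auto intro!: continuous_intros\<close>)

abbreviation "reward d \<alpha> \<psi> \<equiv> cycle.period_reward n c \<alpha> d b \<psi>"

lemma reward_eq:
  assumes "cycle n c \<alpha> d b \<psi> C"
  shows "reward d \<alpha> \<psi> r z = ennreal \<alpha> * disc d (\<lambda>s. ennreal (cy.path_div r z s)) +
     (if hits n z then ennreal (exp (- d * hit_time n z) * \<psi> (r + c * hit_time n z - cy.path_div r z (hit_time n z))) else 0)"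
  by (rule cycle.period_reward_def[OF assms])

text \<open>The surplus just before the next claim; the junk value for an infinite period is irrelevant.\<close>

definition pre_claim :: "real \<Rightarrow> (real \<Rightarrow> nat) \<Rightarrow> real" where
  "pre_claim r z = (if hits n z then r + c * hit_time n z - cy.path_div r z (hit_time n z) else 0)"

definition factor :: "real \<Rightarrow> (real \<Rightarrow> nat) \<Rightarrow> real" where
  "factor d z = (if hits n z then exp (- d * hit_time n z) else 0)"

text \<open>Agrees with \<open>claim_surplus\<close> up to and including the first negative value;
  the cut at zero keeps later starting values in the range where period rewards are
  measurable.\<close>

primrec run :: "nat \<Rightarrow> 'a \<Rightarrow> real" where
  "run 0 \<omega> = x"
| "run (Suc k) \<omega> = pre_claim (max 0 (run k \<omega>)) (\<lambda>t. Z k t \<omega>) - Y (Suc k) \<omega>"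

definition weight :: "real \<Rightarrow> nat \<Rightarrow> 'a \<Rightarrow> real" where
  "weight d k \<omega> = (\<Prod>m<k. factor d (\<lambda>t. Z m t \<omega>))"

definition alive :: "nat \<Rightarrow> 'a \<Rightarrow> bool" where "alive k \<omega> \<longleftrightarrow> (\<forall>l\<le>k. 0 \<le> run l \<omega>)"

text \<open>What is known when cycle \<open>k\<close> starts: the earlier cycles and the claims
  \<open>1..k\<close>, the last of which falls at that moment. Cycle \<open>k\<close> is independent
  of it.\<close>

definition past :: "nat \<Rightarrow> (nat + nat) set" where "past k = Inl ` {..<k} \<union> Inr ` {1..k}"
definition past_cycle :: "nat \<Rightarrow> (nat + nat) set" where "past_cycle k = insert (Inl k) (past k)"

definition reward_sum :: "'a \<Rightarrow> ennreal" where
  "reward_sum \<omega> = (\<Sum>k. if alive k \<omega> then ennreal (weight \<delta> k \<omega>) * reward \<delta> 1 (\<lambda>_. 0) (max 0 (run k \<omega>)) (\<lambda>t. Z k t \<omega>) else 0)"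

lemma past_subsets: "past k \<subseteq> sources" "past_cycle k \<subseteq> sources" "past k \<subseteq> past_cycle k" "past_cycle k \<subseteq> past (Suc k)"
  "Inl k \<notin> past k" "Inr (Suc k) \<notin> past_cycle k"
  by (auto simp: past_def past_cycle_def)

lemma factor_nonneg: "0 \<le> factor d z" by (simp add: factor_def)
lemma weight_nonneg: "0 \<le> weight d k \<omega>" by (simp add: weight_def prod_nonneg factor_nonneg)
lemma weight_0 [simp]: "weight d 0 \<omega> = 1" and weight_Suc: "weight d (Suc k) \<omega> = weight d k \<omega> * factor d (\<lambda>t. Z k t \<omega>)"
  by (simp_all add: weight_def)

lemma laplace_reward: "0 < d \<Longrightarrow> reward d 0 (\<lambda>_. 1) r z = ennreal (factor d z)"
  by (simp add: reward_eq[OF laplace_cycle] factor_def)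

lemma pre_claim_nonneg: "regular_path n z \<Longrightarrow> 0 \<le> r \<Longrightarrow> 0 \<le> pre_claim r z"
  using cy.path_div_bound[of z r "hit_time n z"] hit_time_props(1)[of n z] by (auto simp: pre_claim_def)

lemma surplus_reward:
  "regular_path n z \<Longrightarrow> 0 \<le> r \<Longrightarrow> reward 1 0 (max 0) r z = ennreal (factor 1 z * pre_claim r z)"
  using pre_claim_nonneg[of z r]
  by (cases "hits n z") (simp_all add: reward_eq[OF surplus_cycle] factor_def pre_claim_def max_absorb2)

text \<open>Dividing out the discount factor exhibits the surplus as a function of two period
  rewards, hence as measurable. On paths that never reach \<open>n + 1\<close> the quotient is
  \<open>0 / 0 = 0\<close>, matching the default in \<open>pre_claim\<close>.\<close>

lemma pre_claim_eq:
  "regular_path n z \<Longrightarrow> 0 \<le> r \<Longrightarrow> pre_claim r z = enn2real (reward 1 0 (max 0) r z) / enn2real (reward 1 0 (\<lambda>_. 1) 0 z)"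
  using pre_claim_nonneg[of z r] factor_nonneg[of 1 z]
  by (simp add: surplus_reward laplace_reward) (simp add: factor_def pre_claim_def)

context
  fixes i assumes i: "i \<in> {1..n}"
begin

lemma Z_reg: "\<omega> \<in> space (P i) \<Longrightarrow> regular_path n (\<lambda>t. Z k t \<omega>)" by (rule cycles_regular[OF i])

lemma reward_info:
  assumes "cycle n c \<alpha> d b \<psi> C" "R \<in> borel_measurable (info i K)" "Inl k \<in> K"
  shows "(\<lambda>\<omega>. reward d \<alpha> \<psi> (max 0 (R \<omega>)) (\<lambda>t. Z k t \<omega>)) \<in> borel_measurable (info i K)"
  by (rule cycle.period_reward_measurable[OF assms(1,2)])
     (use Z_info[OF i assms(3)] Z_reg i in auto)

lemma factor_info: "0 < d \<Longrightarrow> Inl k \<in> K \<Longrightarrow> (\<lambda>\<omega>. factor d (\<lambda>t. Z k t \<omega>)) \<in> borel_measurable (info i K)"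
proof -
  assume d: "0 < d" and k: "Inl k \<in> K"
  have [measurable]: "(\<lambda>\<omega>. reward d 0 (\<lambda>_. 1) (max 0 0) (\<lambda>t. Z k t \<omega>)) \<in> borel_measurable (info i K)"
    using k by (intro reward_info[OF laplace_cycle[OF d]]) auto
  have "(\<lambda>\<omega>. enn2real (reward d 0 (\<lambda>_. 1) (max 0 0) (\<lambda>t. Z k t \<omega>))) \<in> borel_measurable (info i K)"
    by measurable
  then show ?thesis by (simp only: laplace_reward[OF d] enn2real_ennreal[OF factor_nonneg])
qed

lemma weight_info: "0 < d \<Longrightarrow> weight d k \<in> borel_measurable (info i (past k))"
  unfolding weight_def by (intro borel_measurable_prod factor_info) (auto simp: past_def)

lemma pre_claim_info:
  assumes "R \<in> borel_measurable (info i K)" "Inl k \<in> K"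
  shows "(\<lambda>\<omega>. pre_claim (max 0 (R \<omega>)) (\<lambda>t. Z k t \<omega>)) \<in> borel_measurable (info i K)"
proof -
  have [measurable]: "(\<lambda>\<omega>. reward 1 0 (max 0) (max 0 (R \<omega>)) (\<lambda>t. Z k t \<omega>)) \<in> borel_measurable (info i K)"
    "(\<lambda>\<omega>. reward 1 0 (\<lambda>_. 1) (max 0 0) (\<lambda>t. Z k t \<omega>)) \<in> borel_measurable (info i K)"
    using assms by (intro reward_info[OF surplus_cycle] reward_info[OF laplace_cycle[OF zero_less_one]]; simp)+
  have "(\<lambda>\<omega>. enn2real (reward 1 0 (max 0) (max 0 (R \<omega>)) (\<lambda>t. Z k t \<omega>)) /
      enn2real (reward 1 0 (\<lambda>_. 1) (max 0 0) (\<lambda>t. Z k t \<omega>))) \<in> borel_measurable (info i K)"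
    by measurable
  then show ?thesis
    by (rule measurable_cong[THEN iffD2, rotated]) (use Z_reg i in \<open>auto simp: pre_claim_eq\<close>)
qed

lemma run_info: "run k \<in> borel_measurable (info i (past k))"
proof (induction k)
  case (Suc k)
  have "run k \<in> borel_measurable (info i (past (Suc k)))"
    by (rule info_measurable_mono[OF i _ Suc]) (use past_subsets in blast)
  moreover have "Inl k \<in> past (Suc k)" "Inr (Suc k) \<in> past (Suc k)" by (auto simp: past_def)
  ultimately have "(\<lambda>\<omega>. run (Suc k) \<omega>) \<in> borel_measurable (info i (past (Suc k)))"
    unfolding run.simps by (intro borel_measurable_diff pre_claim_info Y_info[OF i])
  then show ?case .
qed simp

lemma alive_info: "Measurable.pred (info i (past k)) (alive k)"
proof -
  have "{\<omega> \<in> space (info i (past k)). 0 \<le> run l \<omega>} \<in> sets (info i (past k))" if "l \<le> k" for l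
  proof -
    have [measurable]: "run l \<in> borel_measurable (info i (past k))"
      by (rule info_measurable_mono[OF i _ run_info]) (use that in \<open>auto simp: past_def\<close>)
    show ?thesis by measurable
  qed
  then have "{\<omega> \<in> space (info i (past k)). \<forall>l\<in>{..k}. 0 \<le> run l \<omega>} \<in> sets (info i (past k))"
    by (intro sets.sets_Collect_finite_All) auto
  then have "{\<omega> \<in> space (info i (past k)). alive k \<omega>} \<in> sets (info i (past k))"
    by (simp only: alive_def Ball_def atMost_iff)
  then show ?thesis by (rule pred_def[THEN iffD2])
qed

text \<open>Cycle \<open>k\<close> is independent of the past that determines the weight and the
  starting surplus, so its reward may be integrated first with these frozen.\<close>

lemma cycle_integral:
  assumes cyc: "cycle n c \<alpha> d b \<psi> C"
    and w: "w \<in> borel_measurable (info i (past k))" and R: "R \<in> borel_measurable (info i (past k))"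
  shows "(\<integral>\<^sup>+\<omega>. w \<omega> * reward d \<alpha> \<psi> (max 0 (R \<omega>)) (\<lambda>t. Z k t \<omega>) \<partial>P i) =
    (\<integral>\<^sup>+\<omega>1. w \<omega>1 * (\<integral>\<^sup>+\<omega>2. reward d \<alpha> \<psi> (max 0 (R \<omega>1)) (\<lambda>t. Z k t \<omega>2) \<partial>P i) \<partial>P i)"
proof -
  interpret cp: cycle_process n c \<alpha> d b \<psi> C "P i" lam "Z k" by (rule cycle_process_P[OF i cyc])
  let ?f = "\<lambda>(\<omega>1, \<omega>2). w \<omega>1 * reward d \<alpha> \<psi> (max 0 (R \<omega>1)) (\<lambda>t. Z k t \<omega>2)"
  have "(\<lambda>p. reward d \<alpha> \<psi> (max 0 (R (fst p))) (\<lambda>t. Z k t (snd p))) \<in> borel_measurable (info i (past k) \<Otimes>\<^sub>M info i {Inl k})"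
  proof (rule cp.period_reward_measurable)
    show "(\<lambda>p. R (fst p)) \<in> borel_measurable (info i (past k) \<Otimes>\<^sub>M info i {Inl k})"
      by (rule measurable_compose[OF measurable_fst R])
    show "(\<lambda>p. Z k t (snd p)) \<in> measurable (info i (past k) \<Otimes>\<^sub>M info i {Inl k}) (count_space UNIV)" if "0 \<le> t" for t
      by (rule measurable_compose[OF measurable_snd Z_info[OF i _ that]]) simp
    show "regular_path n (\<lambda>t. Z k t (snd p))" if "p \<in> space (info i (past k) \<Otimes>\<^sub>M info i {Inl k})" for p
      using that Z_reg i by (auto simp: space_pair_measure)
  qed
  moreover have "(\<lambda>p. w (fst p)) \<in> borel_measurable (info i (past k) \<Otimes>\<^sub>M info i {Inl k})"
    by (rule measurable_compose[OF measurable_fst w])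
  ultimately have f: "?f \<in> borel_measurable (info i (past k) \<Otimes>\<^sub>M info i {Inl k})"
    by (simp add: case_prod_beta)
  have "(\<integral>\<^sup>+\<omega>. ?f (\<omega>, \<omega>) \<partial>P i) = (\<integral>\<^sup>+\<omega>1. (\<integral>\<^sup>+\<omega>2. ?f (\<omega>1, \<omega>2) \<partial>P i) \<partial>P i)"
    by (rule info_integral[OF i _ _ _ f]) (use past_subsets in auto)
  also have "\<dots> = (\<integral>\<^sup>+\<omega>1. w \<omega>1 * (\<integral>\<^sup>+\<omega>2. reward d \<alpha> \<psi> (max 0 (R \<omega>1)) (\<lambda>t. Z k t \<omega>2) \<partial>P i) \<partial>P i)"
    by (intro nn_integral_cong) (auto intro!: nn_integral_cmult cp.grid_limit(2))
  finally show ?thesis by simp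
qed

definition start_prob :: "nat \<Rightarrow> nat \<Rightarrow> real" where
  "start_prob k j = measure (P i) {\<omega>\<in>space (P i). Z k 0 \<omega> = j}"

lemma start_prob_Suc: "j \<in> {1..n} \<Longrightarrow> start_prob (Suc k) j = \<pi> j"
  unfolding start_prob_def by (rule restart_phase[OF i]) auto

lemma start_prob_sum: "(\<Sum>j\<in>{1..n}. start_prob k j) = 1"
proof -
  interpret cp: cycle_process n 1 0 1 "\<lambda>_. 0" "\<lambda>_. 0" 0 "P i" lam "Z k"
    by (rule cycle_process_P[OF i trivial_cycle])
  show ?thesis using cp.init_prob_sum by (simp add: cp.init_prob_def start_prob_def)
qed

lemma start_prob_0: "(\<Sum>j\<in>{1..n}. start_prob 0 j * f j) = f i"
proof -
  interpret prob_space "P i" by (rule prob[OF i])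
  interpret cp: cycle_process n 1 0 1 "\<lambda>_. 0" "\<lambda>_. 0" 0 "P i" lam "Z 0"
    by (rule cycle_process_P[OF i trivial_cycle])
  have "start_prob 0 i = 1"
    unfolding start_prob_def using cp.phase_event[of 0 i] initial_phase[OF i]
    by (subst prob_eq_1) (auto elim: eventually_mono)
  moreover have "start_prob 0 j = 0" if "j \<noteq> i" for j
    unfolding start_prob_def using cp.phase_event[of 0 j] initial_phase[OF i] that
    by (subst prob_eq_0) (auto elim: eventually_mono)
  ultimately have "(\<Sum>j\<in>{1..n}. start_prob 0 j * f j) = (\<Sum>j\<in>{1..n}. if j = i then f j else 0)"
    by (intro sum.cong) auto
  then show ?thesis using i by simp
qed

text \<open>Laplace transform at \<open>d\<close> of an exponential time whose rate dominates every
  claim intensity; the summand \<open>1\<close> keeps that rate positive.\<close>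

definition theta :: "real \<Rightarrow> real" where
  "theta d = (1 + (\<Sum>j\<in>{1..n}. lam j (n+1))) / (1 + (\<Sum>j\<in>{1..n}. lam j (n+1)) + d)"

lemma theta_bounds: assumes "0 < d" shows "0 < theta d" "theta d < 1"
proof -
  have "0 \<le> (\<Sum>j\<in>{1..n}. lam j (n+1))" by (intro sum_nonneg intensity_nonneg) auto
  then show "0 < theta d" "theta d < 1" using assms by (auto simp: theta_def)
qed

text \<open>Claims come no faster than at the dominating rate: the constant \<open>theta d\<close>
  is a supersolution for payoff one at the next claim, and independence multiplies the
  periods.\<close>

lemma laplace_le:
  assumes d: "0 < d" shows "(\<integral>\<^sup>+\<omega>. ennreal (weight d k \<omega>) \<partial>P i) \<le> ennreal (theta d ^ k)"
proof (induction k)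
  case 0
  interpret prob_space "P i" by (rule prob[OF i])
  show ?case by (simp add: emeasure_space_1)
next
  case (Suc k)
  interpret cp: cycle_process n c 0 d b "\<lambda>_. 1" 1 "P i" lam "Z k" by (rule cycle_process_P[OF i laplace_cycle[OF d]])
  note th = theta_bounds[OF d]
  define L where "L = 1 + (\<Sum>j\<in>{1..n}. lam j (n+1))"
  have L: "0 < L" "lam j (n+1) \<le> L" if "j \<in> {1..n}" for j
  proof -
    have nn: "0 \<le> lam j (n+1)" if "j \<in> {1..n}" for j using that by (intro intensity_nonneg) auto
    show "0 < L" using sum_nonneg[of "{1..n}" "\<lambda>j. lam j (n+1)"] nn by (simp add: L_def)
    have "lam j (n+1) \<le> (\<Sum>j\<in>{1..n}. lam j (n+1))" by (rule member_le_sum) (use that nn in auto)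
    then show "lam j (n+1) \<le> L" by (simp add: L_def)
  qed
  have one: "(\<integral>\<^sup>+\<omega>. reward d 0 (\<lambda>_. 1) (max 0 0) (\<lambda>t. Z k t \<omega>) \<partial>P i) \<le> ennreal (theta d)"
  proof -
    have "(\<integral>\<^sup>+\<omega>. reward d 0 (\<lambda>_. 1) (max 0 0) (\<lambda>t. Z k t \<omega>) \<partial>P i) \<le> ennreal (\<Sum>j\<in>{1..n}. cp.init_prob j * theta d)"
    proof (rule cp.period_le[where \<phi>="\<lambda>_ _. theta d" and \<phi>'="\<lambda>_ _. 0"])
      fix j and r :: real assume j: "j \<in> {1..n}"
      have "theta d = L / (L + d)" by (simp add: theta_def L_def)
      then have "1 - theta d = d / (L + d)" "theta d * d = L * d / (L + d)"
        using L(1)[OF j] d by (auto simp: field_simps)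
      then have "lam j (n+1) * (1 - theta d) \<le> d * theta d"
        using L[OF j] d by (simp add: divide_right_mono mult_right_mono mult.commute)
      then show "generator n c d lam (\<lambda>_ _. theta d) (\<lambda>_ _. 0) (\<lambda>_. 1) j r \<le> 0"
        by (simp add: generator_def)
    qed (use th in auto)
    also have "(\<Sum>j\<in>{1..n}. cp.init_prob j * theta d) = theta d"
      using cp.init_prob_sum by (simp flip: sum_distrib_right)
    finally show ?thesis .
  qed
  have "(\<integral>\<^sup>+\<omega>. ennreal (weight d (Suc k) \<omega>) \<partial>P i)
     = (\<integral>\<^sup>+\<omega>. ennreal (weight d k \<omega>) * reward d 0 (\<lambda>_. 1) (max 0 0) (\<lambda>t. Z k t \<omega>) \<partial>P i)"
    using d by (simp add: weight_Suc laplace_reward ennreal_mult weight_nonneg factor_nonneg)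
  also have "\<dots> = (\<integral>\<^sup>+\<omega>1. ennreal (weight d k \<omega>1) * (\<integral>\<^sup>+\<omega>2. reward d 0 (\<lambda>_. 1) (max 0 0) (\<lambda>t. Z k t \<omega>2) \<partial>P i) \<partial>P i)"
    using weight_info[OF d] by (intro cycle_integral[OF laplace_cycle[OF d]]) auto
  also have "\<dots> \<le> (\<integral>\<^sup>+\<omega>1. ennreal (weight d k \<omega>1) * ennreal (theta d) \<partial>P i)"
    by (intro nn_integral_mono mult_left_mono one) simp
  also have "\<dots> = (\<integral>\<^sup>+\<omega>1. ennreal (weight d k \<omega>1) \<partial>P i) * ennreal (theta d)"
    using info_measurable[OF i past_subsets(1) weight_info[OF d]] by (intro nn_integral_multc) auto
  also have "\<dots> \<le> ennreal (theta d ^ k) * ennreal (theta d)" by (intro mult_right_mono Suc.IH) simp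
  also have "\<dots> = ennreal (theta d ^ Suc k)" using th by (simp add: ennreal_mult mult.commute)
  finally show ?case .
qed

text \<open>The sum of the discount factors of all claim epochs has a finite mean by the geometric
  bounds, so it is almost surely finite; bounded epochs would make it infinite.\<close>

lemma claim_epochs_unbounded: "AE \<omega> in P i. \<forall>B. \<exists>k. B < cy.epoch (\<lambda>k t. Z k t \<omega>) k"
proof -
  note th = theta_bounds[OF zero_less_one]
  have m: "(\<lambda>\<omega>. ennreal (weight 1 k \<omega>)) \<in> borel_measurable (P i)" for k
    using info_measurable[OF i past_subsets(1) weight_info[of 1 k]] by simp
  have "(\<integral>\<^sup>+\<omega>. (\<Sum>k. ennreal (weight 1 k \<omega>)) \<partial>P i) = (\<Sum>k. \<integral>\<^sup>+\<omega>. ennreal (weight 1 k \<omega>) \<partial>P i)"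
    by (rule nn_integral_suminf[OF m])
  also have "\<dots> \<le> (\<Sum>k. ennreal (theta 1 ^ k))" by (intro suminf_le laplace_le) auto
  also have "\<dots> = ennreal (\<Sum>k. theta 1 ^ k)" using th by (intro suminf_ennreal2 summable_geometric) auto
  finally have "(\<integral>\<^sup>+\<omega>. (\<Sum>k. ennreal (weight 1 k \<omega>)) \<partial>P i) \<noteq> \<infinity>" by (auto simp: top_unique)
  then have "AE \<omega> in P i. (\<Sum>k. ennreal (weight 1 k \<omega>)) \<noteq> \<infinity>" using m by (intro nn_integral_PInf_AE) auto
  moreover have "AE \<omega> in P i. \<forall>k. hits n (\<lambda>t. Z k t \<omega>)" using cycles_absorbed[OF i] by (simp add: AE_all_countable)
  ultimately show ?thesis
  proof eventually_elim
    case (elim \<omega>)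
    have w: "weight 1 k \<omega> = exp (- cy.epoch (\<lambda>k t. Z k t \<omega>) k)" for k
      using elim(2) by (simp add: weight_def factor_def cy.epoch_def exp_sum sum_negf[symmetric])
    show ?case
    proof (rule ccontr)
      assume "\<not> ?case"
      then obtain B where B: "\<And>k. cy.epoch (\<lambda>k t. Z k t \<omega>) k \<le> B" by (auto simp: not_less)
      have "(\<Sum>k::nat. ennreal (exp (- B))) \<le> (\<Sum>k. ennreal (weight 1 k \<omega>))"
        using B by (intro suminf_le ennreal_leI) (auto simp: w)
      moreover have "(\<Sum>k::nat. ennreal (exp (- B))) = \<infinity>"
      proof (rule ccontr)
        assume "(\<Sum>k::nat. ennreal (exp (- B))) \<noteq> \<infinity>"
        then have "summable (\<lambda>k::nat. exp (- B))" by (intro summable_suminf_not_top) auto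
        then show False by (simp add: summable_const_iff)
      qed
      ultimately show False using elim(1) by (simp add: top_unique)
    qed
  qed
qed

end
end

section \<open>Verification\<close>

context barrier_problem begin

text \<open>Translates the claim times and claim counts of the model into epochs, and identifies
  \<open>run\<close> with \<open>claim_surplus\<close> as long as no earlier value is
  negative.\<close>

lemma path_decomposition:
  assumes reg: "\<And>k. regular_path n (\<lambda>t. Z k t \<omega>)" and hit: "\<And>k. hits n (\<lambda>t. Z k t \<omega>)"
    and start: "\<And>k. Z k 0 \<omega> \<noteq> n + 1" and unbounded: "\<And>B. \<exists>k. B < cy.epoch (\<lambda>k t. Z k t \<omega>) k"
    and follows: "follows_phasewise_barriers b (\<lambda>t. phase n Z t \<omega>) (\<lambda>t. free_surplus n c Z Y x t \<omega>) D"
  shows "(\<integral>\<^sup>+ t. ennreal (exp (- \<delta> * t)) * indicator {t. 0 \<le> t \<and>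
     ereal t < ruin_time (\<lambda>s. free_surplus n c Z Y x s \<omega> - D s)} t \<partial>interval_measure D) = reward_sum \<omega>"
proof -
  let ?z = "\<lambda>k t. Z k t \<omega>" and ?y = "\<lambda>k. Y k \<omega>"
  note good = reg hit start unbounded x_nonneg
  have ct: "claim_time n Z k \<omega> = cy.epoch ?z k" for k
    by (simp add: claim_time_def interclaim_time_def cy.epoch_def hit_time_def)
  have epoch_le: "cy.epoch ?z j \<le> cy.epoch ?z k \<longleftrightarrow> j \<le> k" for j k
    by (rule cy.epoch_le_iff[OF good])
  have number: "claim_number n Z (cy.epoch ?z k + v) \<omega> = k" if v: "0 \<le> v" "v < hit_time n (?z k)" for k v
  proof -
    have "cy.epoch ?z j \<le> cy.epoch ?z k + v \<longleftrightarrow> j \<le> k" for j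
    proof
      assume le: "cy.epoch ?z j \<le> cy.epoch ?z k + v"
      show "j \<le> k"
      proof (rule ccontr)
        assume "\<not> j \<le> k"
        then have "cy.epoch ?z (Suc k) \<le> cy.epoch ?z j"
          by (simp only: epoch_le not_le Suc_le_eq)
        then show False using le v by (simp add: cy.epoch_def)
      qed
    next
      assume "j \<le> k"
      then have "cy.epoch ?z j \<le> cy.epoch ?z k" by (simp only: epoch_le)
      then show "cy.epoch ?z j \<le> cy.epoch ?z k + v" using v by simp
    qed
    then have "{j. 1 \<le> j \<and> cy.epoch ?z j \<le> cy.epoch ?z k + v} = {1..k}"
      by (simp only: atLeastAtMost_def atLeast_def atMost_def Int_def mem_Collect_eq)
    then show ?thesis by (simp add: claim_number_def ct)
  qed
  have "(\<integral>\<^sup>+ t. ennreal (exp (- \<delta> * t)) * indicator {t. 0 \<le> t \<and>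
     ereal t < ruin_time (\<lambda>s. free_surplus n c Z Y x s \<omega> - D s)} t \<partial>interval_measure D) = cy.total_reward ?z ?y x"
  proof (rule cy.reward_eq[OF good _ _ follows])
    fix k v assume v: "0 \<le> v" "v < hit_time n (?z k)"
    show "phase n Z (cy.epoch ?z k + v) \<omega> = Z k v \<omega>"
      by (simp add: phase_def Let_def number[OF v] ct)
    show "free_surplus n c Z Y x (cy.epoch ?z k + v) \<omega> = x + c * (cy.epoch ?z k + v) - (\<Sum>j=1..k. Y j \<omega>)"
      by (simp add: free_surplus_def number[OF v])
  qed
  also have "\<dots> = reward_sum \<omega>"
  proof -
    have run_Suc: "run (Suc k) \<omega> = cy.claim_surplus ?z ?y x (Suc k)" if "0 \<le> run k \<omega>" "run k \<omega> = cy.claim_surplus ?z ?y x k" for k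
      using that hit[of k] by (simp add: pre_claim_def max_absorb2)
    have eq1: "run k \<omega> = cy.claim_surplus ?z ?y x k" if "\<forall>l<k. 0 \<le> run l \<omega>" for k
      using that
    proof (induction k)
      case (Suc k)
      then show ?case by (intro run_Suc) (blast intro: less_SucI)+
    qed simp
    have eq2: "run k \<omega> = cy.claim_surplus ?z ?y x k" if "\<forall>l<k. 0 \<le> cy.claim_surplus ?z ?y x l" for k
      using that
    proof (induction k)
      case (Suc k)
      then have "run k \<omega> = cy.claim_surplus ?z ?y x k" by (blast intro: less_SucI)
      moreover from this have "0 \<le> run k \<omega>" using Suc.prems by (simp only: lessI)
      ultimately show ?case by (intro run_Suc)
    qed simp
    have sol: "cy.solvent ?z ?y x k \<longleftrightarrow> alive k \<omega>" for k
    proof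
      assume s: "cy.solvent ?z ?y x k"
      then have "run l \<omega> = cy.claim_surplus ?z ?y x l" if "l \<le> k" for l
        using that by (intro eq2) (auto simp: cy.solvent_def)
      then show "alive k \<omega>" using s by (simp add: alive_def cy.solvent_def)
    next
      assume a: "alive k \<omega>"
      then have "run l \<omega> = cy.claim_surplus ?z ?y x l" if "l \<le> k" for l
        using that by (intro eq1) (auto simp: alive_def)
      then show "cy.solvent ?z ?y x k" using a by (simp add: alive_def cy.solvent_def)
    qed
    have w: "weight \<delta> k \<omega> = exp (- \<delta> * cy.epoch ?z k)" for k
      using hit by (simp add: weight_def factor_def cy.epoch_def exp_sum sum_distrib_left sum_negf[symmetric])
    have res: "max 0 (run k \<omega>) = cy.claim_surplus ?z ?y x k" if "alive k \<omega>" for k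
      using that eq1[of k] by (auto simp: alive_def max_absorb2)
    have "ennreal (exp (- \<delta> * cy.epoch ?z k)) * disc \<delta> (\<lambda>s. ennreal (cy.path_div (cy.claim_surplus ?z ?y x k) (?z k) s))
        = ennreal (weight \<delta> k \<omega>) * reward \<delta> 1 (\<lambda>_. 0) (max 0 (run k \<omega>)) (?z k)" if "alive k \<omega>" for k
      unfolding w res[OF that] by (simp add: reward_eq[OF cy.cycle_axioms])
    then show ?thesis unfolding cy.total_reward_def reward_sum_def sol by (intro suminf_cong) auto
  qed
  finally show ?thesis .
qed

context
  fixes i assumes i: "i \<in> {1..n}"
begin

lemma value_eq_integral:
  assumes "AE \<omega> in P i. follows_phasewise_barriers b (\<lambda>t. phase n Z t \<omega>) (\<lambda>t. free_surplus n c Z Y x t \<omega>) (\<lambda>t. D b x t \<omega>)"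
  shows "barrier_value n c \<delta> P Z Y D b i x = enn2real (\<integral>\<^sup>+\<omega>. reward_sum \<omega> \<partial>P i)"
  unfolding barrier_value_def
proof (rule arg_cong[where f=enn2real], rule nn_integral_cong_AE)
  have "AE \<omega> in P i. \<forall>k. hits n (\<lambda>t. Z k t \<omega>)" "AE \<omega> in P i. \<forall>k. Z k 0 \<omega> \<in> {1..n}"
    using cycles_absorbed[OF i] starts_transient[OF i] by (simp_all add: AE_all_countable)
  with assms claim_epochs_unbounded[OF i] AE_space
  show "AE \<omega> in P i. (\<integral>\<^sup>+ t. ennreal (exp (- \<delta> * t)) * indicator {t. 0 \<le> t \<and>
     ereal t < ruin_time (\<lambda>s. free_surplus n c Z Y x s \<omega> - D b x s \<omega>)} t \<partial>interval_measure (\<lambda>t. D b x t \<omega>)) = reward_sum \<omega>"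
  proof eventually_elim
    case (elim \<omega>)
    show ?case
    proof (rule path_decomposition)
      show "regular_path n (\<lambda>t. Z k t \<omega>)" for k by (rule cycles_regular[OF i elim(3)])
      show "hits n (\<lambda>t. Z k t \<omega>)" for k using elim(4) by blast
      show "Z k 0 \<omega> \<noteq> n + 1" for k using elim(5)[rule_format, of k] by auto
      show "\<exists>k. B < cy.epoch (\<lambda>k t. Z k t \<omega>) k" for B using elim(2) by blast
    qed (rule elim(1))
  qed
qed

definition live_weight :: "nat \<Rightarrow> 'a \<Rightarrow> ennreal" where
  "live_weight k \<omega> = (if alive k \<omega> then ennreal (weight \<delta> k \<omega>) else 0)"

lemma live_weight_info: "live_weight k \<in> borel_measurable (info i (past k))"
proof -
  note [measurable] = alive_info[OF i, of k] weight_info[OF i \<delta>_pos, of k]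
  show ?thesis unfolding live_weight_def by measurable
qed

lemma reward_term_measurable:
  "cycle n c \<alpha> d b' \<psi> C \<Longrightarrow> b' = b \<Longrightarrow> (\<lambda>\<omega>. live_weight k \<omega> * reward d \<alpha> \<psi> (max 0 (run k \<omega>)) (\<lambda>t. Z k t \<omega>)) \<in> borel_measurable (P i)"
proof -
  assume cyc: "cycle n c \<alpha> d b' \<psi> C" "b' = b"
  have "(\<lambda>\<omega>. live_weight k \<omega> * reward d \<alpha> \<psi> (max 0 (run k \<omega>)) (\<lambda>t. Z k t \<omega>)) \<in> borel_measurable (info i (past_cycle k))"
  proof (rule borel_measurable_times_ennreal)
    show "live_weight k \<in> borel_measurable (info i (past_cycle k))"
      by (rule info_measurable_mono[OF i past_subsets(3) live_weight_info])
    show "(\<lambda>\<omega>. reward d \<alpha> \<psi> (max 0 (run k \<omega>)) (\<lambda>t. Z k t \<omega>)) \<in> borel_measurable (info i (past_cycle k))"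
      by (rule reward_info[OF i cyc(1)[unfolded cyc(2)] info_measurable_mono[OF i past_subsets(3) run_info[OF i]]])
         (simp add: past_cycle_def)
  qed
  then show ?thesis by (rule info_measurable[OF i past_subsets(2)])
qed

lemma reward_sum_integral:
  "(\<integral>\<^sup>+\<omega>. reward_sum \<omega> \<partial>P i) = (\<Sum>k. \<integral>\<^sup>+\<omega>. live_weight k \<omega> * reward \<delta> 1 (\<lambda>_. 0) (max 0 (run k \<omega>)) (\<lambda>t. Z k t \<omega>) \<partial>P i)"
proof -
  have "reward_sum \<omega> = (\<Sum>k. live_weight k \<omega> * reward \<delta> 1 (\<lambda>_. 0) (max 0 (run k \<omega>)) (\<lambda>t. Z k t \<omega>))" for \<omega>
    unfolding reward_sum_def live_weight_def by (intro suminf_cong) auto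
  then show ?thesis
    by (simp only: nn_integral_suminf[OF reward_term_measurable[OF cy.cycle_axioms refl]])
qed

text \<open>Candidate values \<open>\<phi>\<close> with \<open>\<psi>\<close> the value just before a claim.\<close>

context
  fixes \<phi> \<phi>' :: "nat \<Rightarrow> real \<Rightarrow> real" and \<psi> :: "real \<Rightarrow> real" and C :: real
  assumes cyc: "cycle n c 1 \<delta> b \<psi> C"
    and \<phi>: "\<And>j x. j \<in> {1..n} \<Longrightarrow> 0 \<le> x \<Longrightarrow> (\<phi> j has_real_derivative \<phi>' j x) (at x within {0..})"
    and \<phi>': "\<And>j. j \<in> {1..n} \<Longrightarrow> continuous_on {0..} (\<phi>' j)"
    and \<phi>_nonneg: "\<And>j r. j \<in> {1..n} \<Longrightarrow> 0 \<le> r \<Longrightarrow> 0 \<le> \<phi> j r"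
begin

definition start_value :: "nat \<Rightarrow> ennreal" where
  "start_value k = (\<integral>\<^sup>+\<omega>. live_weight k \<omega> * ennreal (\<Sum>j\<in>{1..n}. start_prob i k j * \<phi> j (max 0 (run k \<omega>))) \<partial>P i)"

definition claim_integral :: "real \<Rightarrow> ennreal" where
  "claim_integral r = (\<integral>\<^sup>+ y. ennreal (exponential_density \<beta> y) *
     (if y \<le> r then ennreal (\<Sum>j\<in>{1..n}. \<pi> j * \<phi> j (max 0 (r - y))) else 0) \<partial>lborel)"

definition claim_payoff :: "nat \<Rightarrow> ennreal" where
  "claim_payoff k = (\<integral>\<^sup>+\<omega>. live_weight k \<omega> * ennreal (factor \<delta> (\<lambda>t. Z k t \<omega>) * \<psi> (pre_claim (max 0 (run k \<omega>)) (\<lambda>t. Z k t \<omega>))) \<partial>P i)"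

definition period_dividends :: "nat \<Rightarrow> ennreal" where
  "period_dividends k = (\<integral>\<^sup>+\<omega>. live_weight k \<omega> * reward \<delta> 1 (\<lambda>_. 0) (max 0 (run k \<omega>)) (\<lambda>t. Z k t \<omega>) \<partial>P i)"

lemma start_value_0: "start_value 0 = ennreal (\<phi> i x)"
proof -
  interpret prob_space "P i" by (rule prob[OF i])
  have "alive 0 \<omega>" for \<omega> using x_nonneg by (simp add: alive_def)
  then show ?thesis
    using start_prob_0[OF i, of "\<lambda>j. \<phi> j x"] x_nonneg
    by (simp add: start_value_def live_weight_def max_absorb2 emeasure_space_1)
qed

text \<open>Dividends and payoff at the claim are the two summands of one period reward, to which
  the single-period bounds apply once the past is frozen.\<close>

lemma period_split:
  "period_dividends k + claim_payoff k = (\<integral>\<^sup>+\<omega>. live_weight k \<omega> *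
     (\<integral>\<^sup>+\<omega>2. reward \<delta> 1 \<psi> (max 0 (run k \<omega>)) (\<lambda>t. Z k t \<omega>2) \<partial>P i) \<partial>P i)"
proof -
  have split: "reward \<delta> 1 \<psi> r z = reward \<delta> 1 (\<lambda>_. 0) r z + ennreal (factor \<delta> z * \<psi> (pre_claim r z))" for r z
    by (simp add: reward_eq[OF cyc] reward_eq[OF cy.cycle_axioms] factor_def pre_claim_def)
  have m: "(\<lambda>\<omega>. live_weight k \<omega> * ennreal (factor \<delta> (\<lambda>t. Z k t \<omega>) * \<psi> (pre_claim (max 0 (run k \<omega>)) (\<lambda>t. Z k t \<omega>)))) \<in> borel_measurable (P i)"
  proof -
    have [measurable]: "\<psi> \<in> borel_measurable borel"
      using cycle.\<psi>_cont[OF cyc] by (rule borel_measurable_continuous_onI)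
    have k: "Inl k \<in> past_cycle k" by (simp add: past_cycle_def)
    have [measurable]: "live_weight k \<in> borel_measurable (info i (past_cycle k))"
      by (rule info_measurable_mono[OF i past_subsets(3) live_weight_info])
    have [measurable]: "(\<lambda>\<omega>. factor \<delta> (\<lambda>t. Z k t \<omega>)) \<in> borel_measurable (info i (past_cycle k))"
      by (rule factor_info[OF i \<delta>_pos k])
    have [measurable]: "(\<lambda>\<omega>. pre_claim (max 0 (run k \<omega>)) (\<lambda>t. Z k t \<omega>)) \<in> borel_measurable (info i (past_cycle k))"
      by (rule pre_claim_info[OF i info_measurable_mono[OF i past_subsets(3) run_info[OF i]] k])
    show ?thesis by (rule info_measurable[OF i past_subsets(2)]) measurable
  qed
  have "period_dividends k + claim_payoff k = (\<integral>\<^sup>+\<omega>. live_weight k \<omega> * reward \<delta> 1 \<psi> (max 0 (run k \<omega>)) (\<lambda>t. Z k t \<omega>) \<partial>P i)"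
    unfolding period_dividends_def claim_payoff_def split distrib_left
    by (rule nn_integral_add[symmetric, OF reward_term_measurable[OF cy.cycle_axioms refl] m])
  also have "\<dots> = (\<integral>\<^sup>+\<omega>. live_weight k \<omega> *
     (\<integral>\<^sup>+\<omega>2. reward \<delta> 1 \<psi> (max 0 (run k \<omega>)) (\<lambda>t. Z k t \<omega>2) \<partial>P i) \<partial>P i)"
    by (rule cycle_integral[OF i cyc live_weight_info run_info[OF i]])
  finally show ?thesis .
qed

text \<open>The claim size is independent of everything before it, and integrating it out against
  its density yields \<open>claim_integral\<close>; surviving the claim is the condition
  \<open>y \<le> r\<close>.\<close>

lemma start_value_Suc:
  "start_value (Suc k) = (\<integral>\<^sup>+\<omega>. live_weight k \<omega> * ennreal (factor \<delta> (\<lambda>t. Z k t \<omega>)) *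
      claim_integral (pre_claim (max 0 (run k \<omega>)) (\<lambda>t. Z k t \<omega>)) \<partial>P i)"
proof -
  let ?pre = "\<lambda>\<omega>. pre_claim (max 0 (run k \<omega>)) (\<lambda>t. Z k t \<omega>)"
  let ?w = "\<lambda>\<omega>. live_weight k \<omega> * ennreal (factor \<delta> (\<lambda>t. Z k t \<omega>))"
  let ?h = "\<lambda>r y. if y \<le> r then ennreal (\<Sum>j\<in>{1..n}. \<pi> j * \<phi> j (max 0 (r - y))) else 0"
  have k: "Inl k \<in> past_cycle k" by (simp add: past_cycle_def)
  have \<phi>m: "(\<lambda>r. \<phi> j (max 0 r)) \<in> borel_measurable borel" if "j \<in> {1..n}" for j
  proof (rule borel_measurable_continuous_onI)
    have "continuous_on {0..} (\<phi> j)" by (rule half_line_continuous[OF \<phi>[OF that]]) auto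
    then show "continuous_on UNIV (\<lambda>r. \<phi> j (max 0 r))"
      by (rule continuous_on_compose2) (auto intro!: continuous_intros)
  qed
  have mixm: "(\<lambda>r. \<Sum>j\<in>{1..n}. \<pi> j * \<phi> j (max 0 r)) \<in> borel_measurable borel"
    by (intro borel_measurable_sum borel_measurable_times \<phi>m) auto
  have [measurable]: "?w \<in> borel_measurable (info i (past_cycle k))"
    using info_measurable_mono[OF i past_subsets(3) live_weight_info] factor_info[OF i \<delta>_pos k] by measurable
  have [measurable]: "?pre \<in> borel_measurable (info i (past_cycle k))"
    by (rule pre_claim_info[OF i info_measurable_mono[OF i past_subsets(3) run_info[OF i]] k])
  have [measurable]: "Y (Suc k) \<in> borel_measurable (info i {Inr (Suc k)})" by (rule Y_info[OF i]) simp
  let ?N = "info i (past_cycle k) \<Otimes>\<^sub>M info i {Inr (Suc k)}"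
  have [measurable]: "(\<lambda>p. ?pre (fst p)) \<in> borel_measurable ?N" "(\<lambda>p. Y (Suc k) (snd p)) \<in> borel_measurable ?N" "(\<lambda>p. ?w (fst p)) \<in> borel_measurable ?N"
    by measurable
  have [measurable]: "(\<lambda>p. \<Sum>j\<in>{1..n}. \<pi> j * \<phi> j (max 0 (?pre (fst p) - Y (Suc k) (snd p)))) \<in> borel_measurable ?N"
    by (rule measurable_compose[OF _ mixm]) measurable
  have "(\<lambda>p. ?w (fst p) * ?h (?pre (fst p)) (Y (Suc k) (snd p))) \<in> borel_measurable ?N" by measurable
  then have f: "(\<lambda>(\<omega>1, \<omega>2). ?w \<omega>1 * ?h (?pre \<omega>1) (Y (Suc k) \<omega>2)) \<in> borel_measurable ?N" by (simp add: case_prod_beta)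
  have "start_value (Suc k) = (\<integral>\<^sup>+\<omega>. ?w \<omega> * ?h (?pre \<omega>) (Y (Suc k) \<omega>) \<partial>P i)"
    unfolding start_value_def
  proof (rule nn_integral_cong)
    fix \<omega>
    have run: "run (Suc k) \<omega> = ?pre \<omega> - Y (Suc k) \<omega>" by simp
    have al: "alive (Suc k) \<omega> \<longleftrightarrow> alive k \<omega> \<and> Y (Suc k) \<omega> \<le> ?pre \<omega>"
      using run by (auto simp: alive_def le_Suc_eq simp del: run.simps)
    have sum: "(\<Sum>j\<in>{1..n}. start_prob i (Suc k) j * f j) = (\<Sum>j\<in>{1..n}. \<pi> j * f j)" for f
      using start_prob_Suc[OF i] by (intro sum.cong) auto
    show "live_weight (Suc k) \<omega> * ennreal (\<Sum>j\<in>{1..n}. start_prob i (Suc k) j * \<phi> j (max 0 (run (Suc k) \<omega>)))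
        = ?w \<omega> * ?h (?pre \<omega>) (Y (Suc k) \<omega>)"
      unfolding sum run using weight_nonneg factor_nonneg
      by (simp add: live_weight_def al weight_Suc ennreal_mult)
  qed
  also have "\<dots> = (\<integral>\<^sup>+\<omega>1. (\<integral>\<^sup>+\<omega>2. ?w \<omega>1 * ?h (?pre \<omega>1) (Y (Suc k) \<omega>2) \<partial>P i) \<partial>P i)"
    using info_integral[OF i past_subsets(2) _ _ f] past_subsets(6) by auto
  also have "\<dots> = (\<integral>\<^sup>+\<omega>1. ?w \<omega>1 * claim_integral (?pre \<omega>1) \<partial>P i)"
  proof (rule nn_integral_cong)
    fix \<omega>1
    have hm: "(\<lambda>y. ?h (?pre \<omega>1) y) \<in> borel_measurable borel"
    proof -
      have [measurable]: "(\<lambda>y. \<Sum>j\<in>{1..n}. \<pi> j * \<phi> j (max 0 (?pre \<omega>1 - y))) \<in> borel_measurable borel"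
        by (rule measurable_compose[OF _ mixm]) measurable
      show ?thesis by measurable
    qed
    have dist: "distributed (P i) lborel (Y (Suc k)) (exponential_density \<beta>)" by (rule claim_size[OF i]) simp
    have Ym: "Y (Suc k) \<in> borel_measurable (P i)" using distributed_measurable[OF dist] by simp
    have "(\<integral>\<^sup>+\<omega>2. ?w \<omega>1 * ?h (?pre \<omega>1) (Y (Suc k) \<omega>2) \<partial>P i) = ?w \<omega>1 * (\<integral>\<^sup>+\<omega>2. ?h (?pre \<omega>1) (Y (Suc k) \<omega>2) \<partial>P i)"
      by (rule nn_integral_cmult) (rule measurable_compose[OF Ym hm])
    also have "(\<integral>\<^sup>+\<omega>2. ?h (?pre \<omega>1) (Y (Suc k) \<omega>2) \<partial>P i) = claim_integral (?pre \<omega>1)"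
      unfolding claim_integral_def using hm by (subst distributed_nn_integral[OF dist, symmetric]) auto
    finally show "(\<integral>\<^sup>+\<omega>2. ?w \<omega>1 * ?h (?pre \<omega>1) (Y (Suc k) \<omega>2) \<partial>P i) = ?w \<omega>1 * claim_integral (?pre \<omega>1)" .
  qed
  finally show ?thesis .
qed

lemma pre_claim_run_nonneg: "\<omega> \<in> space (P i) \<Longrightarrow> 0 \<le> pre_claim (max 0 (run k \<omega>)) (\<lambda>t. Z k t \<omega>)"
  by (rule pre_claim_nonneg[OF Z_reg[OF i]]) auto

text \<open>Telescoping over the periods: the dividends of a period plus the candidate value at the
  start of the next are at most the candidate value at its own start. The value left after finitely
  many periods is nonnegative and is dropped.\<close>

theorem supersolution_bound:
  assumes lump: "\<And>j r. j \<in> {1..n} \<Longrightarrow> 0 \<le> r \<Longrightarrow> max 0 (r - b j) + \<phi> j (min r (b j)) \<le> \<phi> j r"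
    and gen: "\<And>j x. j \<in> {1..n} \<Longrightarrow> 0 \<le> x \<Longrightarrow> x \<le> b j \<Longrightarrow> generator n c \<delta> lam \<phi> \<phi>' \<psi> j x \<le> 0"
    and claim: "\<And>r. 0 \<le> r \<Longrightarrow> claim_integral r \<le> ennreal (\<psi> r)"
  shows "(\<integral>\<^sup>+\<omega>. reward_sum \<omega> \<partial>P i) \<le> ennreal (\<phi> i x)"
proof -
  have period: "period_dividends k + claim_payoff k \<le> start_value k" for k
    unfolding period_split start_value_def
  proof (intro nn_integral_mono mult_left_mono)
    fix \<omega>
    interpret cp: cycle_process n c 1 \<delta> b \<psi> C "P i" lam "Z k" by (rule cycle_process_P[OF i cyc])
    have "(\<integral>\<^sup>+\<omega>2. reward \<delta> 1 \<psi> (max 0 (run k \<omega>)) (\<lambda>t. Z k t \<omega>2) \<partial>P i) \<le> ennreal (\<Sum>j\<in>{1..n}. cp.init_prob j * \<phi> j (max 0 (run k \<omega>)))"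
      by (rule cp.period_le[OF \<phi> \<phi>' _ \<phi>_nonneg gen]) (use lump in auto)
    then show "(\<integral>\<^sup>+\<omega>2. reward \<delta> 1 \<psi> (max 0 (run k \<omega>)) (\<lambda>t. Z k t \<omega>2) \<partial>P i) \<le> ennreal (\<Sum>j\<in>{1..n}. start_prob i k j * \<phi> j (max 0 (run k \<omega>)))"
      by (simp add: cp.init_prob_def start_prob_def[OF i])
  qed simp
  have step: "start_value (Suc k) \<le> claim_payoff k" for k
    unfolding start_value_Suc claim_payoff_def
  proof (rule nn_integral_mono)
    fix \<omega> assume \<omega>: "\<omega> \<in> space (P i)"
    let ?pre = "pre_claim (max 0 (run k \<omega>)) (\<lambda>t. Z k t \<omega>)"
    have "live_weight k \<omega> * ennreal (factor \<delta> (\<lambda>t. Z k t \<omega>)) * claim_integral ?pre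
       \<le> live_weight k \<omega> * ennreal (factor \<delta> (\<lambda>t. Z k t \<omega>)) * ennreal (\<psi> ?pre)"
      by (intro mult_left_mono claim pre_claim_run_nonneg \<omega>) simp
    also have "\<dots> = live_weight k \<omega> * ennreal (factor \<delta> (\<lambda>t. Z k t \<omega>) * \<psi> ?pre)"
      by (simp add: ennreal_mult' factor_nonneg mult.assoc)
    finally show "live_weight k \<omega> * ennreal (factor \<delta> (\<lambda>t. Z k t \<omega>)) * claim_integral ?pre
       \<le> live_weight k \<omega> * ennreal (factor \<delta> (\<lambda>t. Z k t \<omega>) * \<psi> ?pre)" .
  qed
  have partial: "(\<Sum>k<m. period_dividends k) + start_value m \<le> start_value 0" for m
  proof (induction m)
    case (Suc m)
    have "(\<Sum>k<Suc m. period_dividends k) + start_value (Suc m) \<le> (\<Sum>k<m. period_dividends k) + (period_dividends m + claim_payoff m)"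
      using step[of m] by (simp add: add.assoc add_left_mono)
    also have "\<dots> \<le> (\<Sum>k<m. period_dividends k) + start_value m" by (intro add_left_mono period)
    also have "\<dots> \<le> start_value 0" by (rule Suc)
    finally show ?case .
  qed simp
  have "(\<Sum>k. period_dividends k) \<le> start_value 0"
  proof (rule suminf_le_const)
    show "(\<Sum>k<m. period_dividends k) \<le> start_value 0" for m
      using partial[of m] by (meson le_iff_add order_trans)
  qed simp
  then show ?thesis by (simp add: reward_sum_integral start_value_0 period_dividends_def)
qed

lemma claims_nonneg: "AE \<omega> in P i. \<forall>k\<ge>1. 0 \<le> Y k \<omega>"
proof -
  have "AE \<omega> in P i. 0 \<le> Y k \<omega>" if k: "1 \<le> k" for k
  proof -
    have dist: "distributed (P i) lborel (Y k) (exponential_density \<beta>)" by (rule claim_size[OF i k])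
    have "AE y in density lborel (\<lambda>y. ennreal (exponential_density \<beta> y)). 0 \<le> y"
      by (subst AE_density) (auto simp: exponential_density_def)
    then have "AE y in distr (P i) lborel (Y k). 0 \<le> y"
      by (simp only: distributed_distr_eq_density[OF dist])
    then show ?thesis using distributed_measurable[OF dist] by (subst (asm) AE_distr_iff) auto
  qed
  then show ?thesis by (simp add: AE_all_countable AE_ball_countable')
qed

text \<open>The surplus grows at most like \<open>x + c * T\<close>. Half of the discount exponent
  absorbs this growth, through \<open>T * exp (- (\<delta> / 2) * T) \<le> 2 / \<delta>\<close>; the
  other half remains as a weight whose mean decays geometrically.\<close>

lemma live_weight_bound:
  "AE \<omega> in P i. live_weight k \<omega> * ennreal (K + max 0 (run k \<omega>)) \<le> ennreal (\<bar>K\<bar> + x + 2 * c / \<delta>) * ennreal (weight (\<delta> / 2) k \<omega>)"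
proof -
  have "AE \<omega> in P i. \<forall>k. hits n (\<lambda>t. Z k t \<omega>)" using cycles_absorbed[OF i] by (simp add: AE_all_countable)
  with claims_nonneg AE_space show ?thesis
  proof eventually_elim
    case (elim \<omega>)
    let ?z = "\<lambda>k t. Z k t \<omega>"
    define T where "T = cy.epoch ?z k"
    have reg: "regular_path n (?z k)" for k by (rule Z_reg[OF i elim(2)])
    have ht: "0 \<le> hit_time n (?z k)" for k using hit_time_props(1)[OF reg] elim(3) by blast
    have T: "0 \<le> T" unfolding T_def cy.epoch_def by (intro sum_nonneg ht)
    have w: "weight d k \<omega> = exp (- d * T)" for d
      using elim(3) by (simp add: weight_def factor_def cy.epoch_def T_def exp_sum sum_distrib_left sum_negf[symmetric])
    have run: "run l \<omega> \<le> x + c * cy.epoch ?z l" if "alive l \<omega>" for l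
      using that
    proof (induction l)
      case (Suc l)
      have a: "alive l \<omega>" using Suc.prems by (simp add: alive_def)
      then have r: "0 \<le> run l \<omega>" by (simp add: alive_def)
      have "run (Suc l) \<omega> \<le> run l \<omega> + c * hit_time n (?z l)"
        using elim(1)[rule_format, of "Suc l"] elim(3)[rule_format, of l] r cy.path_div_nonneg[OF reg[of l] r ht[of l]]
        by (simp add: pre_claim_def max_absorb2)
      then show ?case using Suc.IH[OF a] by (simp add: cy.epoch_def distrib_left)
    qed (simp add: cy.epoch_def)
    show ?case
    proof (cases "alive k \<omega>")
      case True
      have "max 0 (run k \<omega>) \<le> x + c * T" using run[OF True] x_nonneg premium T by (simp add: T_def)
      then have "exp (- \<delta> * T) * (K + max 0 (run k \<omega>)) \<le> exp (- \<delta> * T) * (\<bar>K\<bar> + x + c * T)"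
        by (intro mult_left_mono) auto
      also have "\<dots> = exp (- (\<delta> / 2) * T) * ((\<bar>K\<bar> + x) * exp (- (\<delta> / 2) * T) + c * (T * exp (- (\<delta> / 2) * T)))"
      proof -
        have "exp (- \<delta> * T) = exp (- (\<delta> / 2) * T) * exp (- (\<delta> / 2) * T)" by (simp flip: exp_add)
        then show ?thesis by (simp add: algebra_simps)
      qed
      also have "\<dots> \<le> exp (- (\<delta> / 2) * T) * ((\<bar>K\<bar> + x) * 1 + c * (2 / \<delta>))"
      proof (intro mult_left_mono add_mono)
        show "exp (- (\<delta> / 2) * T) \<le> 1" using \<delta>_pos T by simp
        have "\<delta> / 2 * T \<le> exp (\<delta> / 2 * T)" using exp_ge_add_one_self[of "\<delta> / 2 * T"] by linarith
        then show "T * exp (- (\<delta> / 2) * T) \<le> 2 / \<delta>" using \<delta>_pos by (simp add: exp_minus field_simps)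
      qed (use x_nonneg premium in auto)
      finally have "ennreal (exp (- \<delta> * T) * (K + max 0 (run k \<omega>))) \<le> ennreal ((\<bar>K\<bar> + x + 2 * c / \<delta>) * exp (- (\<delta> / 2) * T))"
        by (intro ennreal_leI) (simp add: algebra_simps)
      then show ?thesis
        using True x_nonneg premium \<delta>_pos by (simp add: live_weight_def w ennreal_mult' ennreal_mult'')
    qed (simp add: live_weight_def)
  qed
qed

text \<open>The telescoping with reversed inequalities. Here the value left after \<open>m\<close>
  periods has to vanish in the limit, which follows from its linear growth,
  \<open>live_weight_bound\<close> and \<open>laplace_le\<close> at
  \<open>\<delta> / 2\<close>.\<close>

theorem subsolution_bound:
  assumes lump: "\<And>j r. j \<in> {1..n} \<Longrightarrow> 0 \<le> r \<Longrightarrow> \<phi> j r \<le> max 0 (r - b j) + \<phi> j (min r (b j))"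
    and gen: "\<And>j x. j \<in> {1..n} \<Longrightarrow> 0 \<le> x \<Longrightarrow> x \<le> b j \<Longrightarrow> 0 \<le> generator n c \<delta> lam \<phi> \<phi>' \<psi> j x"
    and claim: "\<And>r. 0 \<le> r \<Longrightarrow> ennreal (\<psi> r) \<le> claim_integral r"
    and growth: "\<And>j r. j \<in> {1..n} \<Longrightarrow> 0 \<le> r \<Longrightarrow> \<phi> j r \<le> K + r"
  shows "ennreal (\<phi> i x) \<le> (\<integral>\<^sup>+\<omega>. reward_sum \<omega> \<partial>P i)"
proof -
  have K: "0 \<le> K" using growth[OF i, of 0] \<phi>_nonneg[OF i, of 0] by simp
  define B where "B = K + (\<Sum>j\<in>{1..n}. b j)"
  have B: "0 \<le> B" unfolding B_def using K b_nonneg by (intro add_nonneg_nonneg sum_nonneg) auto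
  have bound: "\<phi> j r \<le> B" if j: "j \<in> {1..n}" and r: "0 \<le> r" "r \<le> b j" for j r
  proof -
    have "b j \<le> (\<Sum>j\<in>{1..n}. b j)" by (rule member_le_sum) (use j b_nonneg in auto)
    then show ?thesis using growth[OF j r(1)] r by (simp add: B_def)
  qed
  have period: "start_value k \<le> period_dividends k + claim_payoff k" for k
    unfolding period_split start_value_def
  proof (intro nn_integral_mono mult_left_mono)
    fix \<omega>
    interpret cp: cycle_process n c 1 \<delta> b \<psi> C "P i" lam "Z k" by (rule cycle_process_P[OF i cyc])
    have "ennreal (\<Sum>j\<in>{1..n}. cp.init_prob j * \<phi> j (max 0 (run k \<omega>))) \<le> (\<integral>\<^sup>+\<omega>2. reward \<delta> 1 \<psi> (max 0 (run k \<omega>)) (\<lambda>t. Z k t \<omega>2) \<partial>P i)"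
      by (rule cp.period_ge[OF \<phi> \<phi>' _ bound B gen]) (use lump in auto)
    then show "ennreal (\<Sum>j\<in>{1..n}. start_prob i k j * \<phi> j (max 0 (run k \<omega>))) \<le> (\<integral>\<^sup>+\<omega>2. reward \<delta> 1 \<psi> (max 0 (run k \<omega>)) (\<lambda>t. Z k t \<omega>2) \<partial>P i)"
      by (simp add: cp.init_prob_def start_prob_def[OF i])
  qed simp
  have step: "claim_payoff k \<le> start_value (Suc k)" for k
    unfolding start_value_Suc claim_payoff_def
  proof (rule nn_integral_mono)
    fix \<omega> assume \<omega>: "\<omega> \<in> space (P i)"
    let ?pre = "pre_claim (max 0 (run k \<omega>)) (\<lambda>t. Z k t \<omega>)"
    have "live_weight k \<omega> * ennreal (factor \<delta> (\<lambda>t. Z k t \<omega>) * \<psi> ?pre)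
       = live_weight k \<omega> * ennreal (factor \<delta> (\<lambda>t. Z k t \<omega>)) * ennreal (\<psi> ?pre)"
      by (simp add: ennreal_mult' factor_nonneg mult.assoc)
    also have "\<dots> \<le> live_weight k \<omega> * ennreal (factor \<delta> (\<lambda>t. Z k t \<omega>)) * claim_integral ?pre"
      by (intro mult_left_mono claim pre_claim_run_nonneg \<omega>) simp
    finally show "live_weight k \<omega> * ennreal (factor \<delta> (\<lambda>t. Z k t \<omega>) * \<psi> ?pre)
       \<le> live_weight k \<omega> * ennreal (factor \<delta> (\<lambda>t. Z k t \<omega>)) * claim_integral ?pre" .
  qed
  have partial: "start_value 0 \<le> (\<Sum>k<m. period_dividends k) + start_value m" for m
  proof (induction m)
    case (Suc m)
    note Suc
    also have "(\<Sum>k<m. period_dividends k) + start_value m \<le> (\<Sum>k<m. period_dividends k) + (period_dividends m + claim_payoff m)"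
      by (intro add_left_mono period)
    also have "\<dots> \<le> (\<Sum>k<Suc m. period_dividends k) + start_value (Suc m)"
      using step[of m] by (simp add: add.assoc add_left_mono)
    finally show ?case .
  qed simp
  let ?Q = "\<bar>K\<bar> + x + 2 * c / \<delta>"
  have d2: "0 < \<delta> / 2" using \<delta>_pos by simp
  have small: "start_value m \<le> ennreal (?Q * theta (\<delta> / 2) ^ m)" for m
  proof -
    have "start_value m \<le> (\<integral>\<^sup>+\<omega>. ennreal ?Q * ennreal (weight (\<delta> / 2) m \<omega>) \<partial>P i)"
      unfolding start_value_def
    proof (rule nn_integral_mono_AE)
      show "AE \<omega> in P i. live_weight m \<omega> * ennreal (\<Sum>j\<in>{1..n}. start_prob i m j * \<phi> j (max 0 (run m \<omega>)))
         \<le> ennreal ?Q * ennreal (weight (\<delta> / 2) m \<omega>)"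
        using live_weight_bound[of m K]
      proof eventually_elim
        case (elim \<omega>)
        have "(\<Sum>j\<in>{1..n}. start_prob i m j * \<phi> j (max 0 (run m \<omega>))) \<le> (\<Sum>j\<in>{1..n}. start_prob i m j * (K + max 0 (run m \<omega>)))"
          by (intro sum_mono mult_left_mono growth) (auto simp: start_prob_def[OF i])
        also have "\<dots> = K + max 0 (run m \<omega>)"
          using start_prob_sum[OF i, of m] by (simp flip: sum_distrib_right)
        finally have "live_weight m \<omega> * ennreal (\<Sum>j\<in>{1..n}. start_prob i m j * \<phi> j (max 0 (run m \<omega>)))
           \<le> live_weight m \<omega> * ennreal (K + max 0 (run m \<omega>))" by (intro mult_left_mono ennreal_leI) auto
        then show ?case using elim by (rule order_trans)
      qed
    qed
    also have "\<dots> = ennreal ?Q * (\<integral>\<^sup>+\<omega>. ennreal (weight (\<delta> / 2) m \<omega>) \<partial>P i)"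
      using info_measurable[OF i past_subsets(1) weight_info[OF i d2, of m]] by (intro nn_integral_cmult) simp
    also have "\<dots> \<le> ennreal ?Q * ennreal (theta (\<delta> / 2) ^ m)" by (intro mult_left_mono laplace_le i d2) simp
    also have "\<dots> = ennreal (?Q * theta (\<delta> / 2) ^ m)"
      using x_nonneg premium \<delta>_pos by (intro ennreal_mult'[symmetric]) auto
    finally show ?thesis .
  qed
  have "(\<lambda>m. ?Q * theta (\<delta> / 2) ^ m) \<longlonglongrightarrow> ?Q * 0"
    using theta_bounds[OF i d2] by (intro tendsto_mult tendsto_const LIMSEQ_power_zero) auto
  then have "(\<lambda>m. ennreal (?Q * theta (\<delta> / 2) ^ m)) \<longlonglongrightarrow> ennreal (?Q * 0)" by (rule tendsto_ennrealI)
  then have lim: "(\<lambda>m. (\<Sum>k. period_dividends k) + ennreal (?Q * theta (\<delta> / 2) ^ m)) \<longlonglongrightarrow> (\<Sum>k. period_dividends k) + ennreal (?Q * 0)"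
    by (intro tendsto_add tendsto_const)
  have "start_value 0 \<le> (\<Sum>k. period_dividends k) + ennreal (?Q * theta (\<delta> / 2) ^ m)" for m
    using partial[of m] small[of m] sum_le_suminf[of period_dividends "{..<m}"]
    by (meson add_mono finite_lessThan order_trans summableI zero_le)
  then have "start_value 0 \<le> (\<Sum>k. period_dividends k) + ennreal (?Q * 0)"
    by (intro LIMSEQ_le_const[OF lim]) auto
  then show ?thesis by (simp add: reward_sum_integral start_value_0 period_dividends_def)
qed

end
end
end

section \<open>Dependence on the initial capital\<close>

context cycle begin

text \<open>Raising the capital by \<open>r' - r\<close> raises each excess over the barrier by that
  amount. So the dividends grow, but by no more than the capital, and the surplus before the claim
  does not fall.\<close>

lemma path_div_start_mono:
  assumes reg: "regular_path n z" and r: "0 \<le> r" "r \<le> r'" and s: "0 \<le> s"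
  shows "path_div r z s \<le> path_div r' z s" "path_div r' z s \<le> path_div r z s + (r' - r)"
proof -
  have r': "0 \<le> r'" using r by simp
  note le_iff = path_div_le_iff[OF reg] and ge = path_div_ge[OF reg]
  show "path_div r z s \<le> path_div r' z s"
    unfolding le_iff[OF r(1) s]
  proof (intro conjI ballI impI path_div_nonneg[OF reg r' s])
    fix v assume v: "v \<in> dyadics" "v \<le> s" "before n z v"
    show "r + c * v - b (z v) \<le> path_div r' z s" using ge[OF r' v] r by simp
  qed
  show "path_div r' z s \<le> path_div r z s + (r' - r)"
    unfolding le_iff[OF r' s]
  proof (intro conjI ballI impI)
    show "0 \<le> path_div r z s + (r' - r)" using path_div_nonneg[OF reg r(1) s] r by simp
    fix v assume v: "v \<in> dyadics" "v \<le> s" "before n z v"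
    show "r' + c * v - b (z v) \<le> path_div r z s + (r' - r)" using ge[OF r(1) v] by simp
  qed
qed

text \<open>The excess over the barrier is paid at time zero, which is a dyadic time, and from then
  on the surplus paths coincide.\<close>

lemma path_div_start_shift:
  assumes reg: "regular_path n z" and z0: "z 0 \<in> {1..n}" and r: "b (z 0) \<le> r" and s: "0 \<le> s"
  shows "path_div r z s = r - b (z 0) + path_div (b (z 0)) z s"
proof (rule antisym)
  let ?b = "b (z 0)"
  have b0: "0 \<le> ?b" by (rule b_nonneg[OF z0])
  have r0: "0 \<le> r" using b0 r by simp
  show "path_div r z s \<le> r - ?b + path_div ?b z s"
    using path_div_start_mono(2)[OF reg b0 r s] by simp
  have "0 \<in> dyadics" using dyadicI[of 0 0] by simp
  moreover have "before n z 0" using z0 by (auto simp: before_def)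
  ultimately have "r - ?b \<le> path_div r z s" using path_div_ge[OF reg r0, of 0 s] s by simp
  then have "path_div ?b z s \<le> path_div r z s - (r - ?b)"
    unfolding path_div_le_iff[OF reg b0 s]
  proof (intro conjI ballI impI)
    fix v assume v: "v \<in> dyadics" "v \<le> s" "before n z v"
    show "?b + c * v - b (z v) \<le> path_div r z s - (r - ?b)" using path_div_ge[OF reg r0 v] by simp
  qed simp
  then show "r - ?b + path_div ?b z s \<le> path_div r z s" by simp
qed

lemma disc_path_div_add:
  assumes "regular_path n z" "0 \<le> r" "0 \<le> k"
  shows "disc d (\<lambda>s. ennreal (k + path_div r z s)) = ennreal k + disc d (\<lambda>s. ennreal (path_div r z s))"
proof -
  let ?g = "\<lambda>s. path_div r z (max 0 s)"
  have "mono ?g"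
    by (intro monoI path_div_mono[OF assms(1,2)]) auto
  then have m: "(\<lambda>s. ennreal (?g s)) \<in> borel_measurable borel"
    by (intro measurable_compose[OF borel_measurable_mono measurable_ennreal])
  have "disc d (\<lambda>s. ennreal (k + path_div r z s)) = disc d (\<lambda>s. ennreal k + ennreal (?g s))"
    using assms path_div_nonneg[OF assms(1,2)] by (intro disc_cong) (simp add: ennreal_plus max_absorb2)
  also have "\<dots> = ennreal k + disc d (\<lambda>s. ennreal (?g s))"
    using disc_add[OF _ m, of "\<lambda>_. ennreal k" d] disc_const[OF d_pos] by simp
  also have "disc d (\<lambda>s. ennreal (?g s)) = disc d (\<lambda>s. ennreal (path_div r z s))"
    by (intro disc_cong) (simp add: max_absorb2)
  finally show ?thesis .
qed

end

context barrier_problem begin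

context
  fixes i and x' :: real assumes i: "i \<in> {1..n}" and x': "x \<le> x'"
begin

interpretation other: barrier_problem n c \<beta> \<pi> lam P Z Y \<delta> b x'
  by unfold_locales (use x' x_nonneg \<delta>_pos b_nonneg in auto)

lemma pre_claim_mono:
  assumes reg: "regular_path n z" and r: "0 \<le> r" "r \<le> r'" shows "pre_claim r z \<le> pre_claim r' z"
proof (cases "hits n z")
  case True
  show ?thesis
    using cy.path_div_start_mono(2)[OF reg r hit_time_props(1)[OF reg True]] True by (simp add: pre_claim_def)
qed (simp add: pre_claim_def)

lemma period_dividends_mono:
  assumes reg: "regular_path n z" and r: "0 \<le> r" "r \<le> r'"
  shows "reward \<delta> 1 (\<lambda>_. 0) r z \<le> reward \<delta> 1 (\<lambda>_. 0) r' z"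
  using cy.path_div_start_mono(1)[OF reg r]
  by (simp add: reward_eq[OF cy.cycle_axioms] disc_mono ennreal_leI)

lemma run_mono: "\<omega> \<in> space (P i) \<Longrightarrow> run k \<omega> \<le> other.run k \<omega>"
proof (induction k)
  case (Suc k)
  then have "max 0 (run k \<omega>) \<le> max 0 (other.run k \<omega>)" by auto
  then show ?case using pre_claim_mono[OF Z_reg[OF i Suc.prems]] by simp
qed (simp add: x')

text \<open>Coupling on the same path: more capital means no earlier ruin and no smaller dividends
  in any period.\<close>

lemma reward_sum_mono:
  assumes "\<omega> \<in> space (P i)" shows "reward_sum \<omega> \<le> other.reward_sum \<omega>"
  unfolding reward_sum_def other.reward_sum_def
proof (rule suminf_le)
  fix k
  have a: "other.alive k \<omega>" if "alive k \<omega>"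
    using that by (auto simp: alive_def other.alive_def intro: order_trans[OF _ run_mono[OF assms]])
  have "max 0 (run k \<omega>) \<le> max 0 (other.run k \<omega>)" using run_mono[OF assms, of k] by auto
  then have "reward \<delta> 1 (\<lambda>_. 0) (max 0 (run k \<omega>)) (\<lambda>t. Z k t \<omega>) \<le> reward \<delta> 1 (\<lambda>_. 0) (max 0 (other.run k \<omega>)) (\<lambda>t. Z k t \<omega>)"
    by (intro period_dividends_mono Z_reg[OF i assms]) simp
  then show "(if alive k \<omega> then ennreal (weight \<delta> k \<omega>) * reward \<delta> 1 (\<lambda>_. 0) (max 0 (run k \<omega>)) (\<lambda>t. Z k t \<omega>) else 0)
     \<le> (if other.alive k \<omega> then ennreal (weight \<delta> k \<omega>) * reward \<delta> 1 (\<lambda>_. 0) (max 0 (other.run k \<omega>)) (\<lambda>t. Z k t \<omega>) else 0)"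
    using a by (auto intro: mult_left_mono)
qed auto

text \<open>The lump sum at time zero is the only difference; from the first claim on both runs are
  equal.\<close>

lemma reward_sum_shift:
  assumes xb: "x = b i" and \<omega>: "\<omega> \<in> space (P i)" and start: "Z 0 0 \<omega> = i"
  shows "other.reward_sum \<omega> = ennreal (x' - x) + reward_sum \<omega>"
proof -
  note reg = Z_reg[OF i \<omega>]
  let ?z = "\<lambda>t. Z 0 t \<omega>"
  have x'0: "0 \<le> x'" using x' x_nonneg by simp
  have shift: "cy.path_div x' ?z s = x' - x + cy.path_div x ?z s" if "0 \<le> s" for s
    using cy.path_div_start_shift[OF reg[of 0] _ _ that, of x'] start i x' by (simp add: xb)
  have "pre_claim x' ?z = pre_claim x ?z"
    using shift[OF hit_time_props(1)[OF reg[of 0]]] by (auto simp: pre_claim_def)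
  then have run1: "other.run (Suc k) \<omega> = run (Suc k) \<omega>" for k
    by (induction k) (use x_nonneg x'0 in \<open>simp_all add: max_absorb2\<close>)
  have alive: "other.alive k \<omega> \<longleftrightarrow> alive k \<omega>" for k
  proof -
    have "0 \<le> other.run l \<omega> \<longleftrightarrow> 0 \<le> run l \<omega>" for l
      by (cases l) (use x_nonneg x'0 in \<open>simp_all add: run1 del: run.simps(2) other.run.simps(2)\<close>)
    then show ?thesis by (simp add: alive_def other.alive_def)
  qed
  have disc: "disc \<delta> (\<lambda>s. ennreal (cy.path_div x' ?z s)) = ennreal (x' - x) + disc \<delta> (\<lambda>s. ennreal (cy.path_div x ?z s))"
    using cy.disc_path_div_add[OF reg[of 0] x_nonneg, of "x' - x"] x' disc_cong[of "\<lambda>s. ennreal (cy.path_div x' ?z s)"]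
    by (simp add: shift)
  have first: "reward \<delta> 1 (\<lambda>_. 0) x' ?z = ennreal (x' - x) + reward \<delta> 1 (\<lambda>_. 0) x ?z"
    by (simp add: reward_eq[OF cy.cycle_axioms] disc)
  have "alive 0 \<omega>" using x_nonneg by (simp add: alive_def)
  then show ?thesis
    unfolding reward_sum_def other.reward_sum_def alive
    by (subst (1 2) suminf_offset[of _ 1])
       (use x_nonneg x'0 in \<open>simp_all add: run1 first max_absorb2 add.assoc del: run.simps(2) other.run.simps(2) cong: if_cong\<close>)
qed

lemma reward_sum_measurable: "reward_sum \<in> borel_measurable (P i)"
proof -
  have "reward_sum = (\<lambda>\<omega>. \<Sum>k. live_weight k \<omega> * reward \<delta> 1 (\<lambda>_. 0) (max 0 (run k \<omega>)) (\<lambda>t. Z k t \<omega>))"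
    unfolding reward_sum_def live_weight_def[OF i] by (intro ext suminf_cong) auto
  also have "\<dots> \<in> borel_measurable (P i)"
    by (intro borel_measurable_suminf_order reward_term_measurable[OF i cy.cycle_axioms refl])
  finally show ?thesis .
qed

lemma reward_integral_mono: "(\<integral>\<^sup>+\<omega>. reward_sum \<omega> \<partial>P i) \<le> (\<integral>\<^sup>+\<omega>. other.reward_sum \<omega> \<partial>P i)"
  by (intro nn_integral_mono reward_sum_mono)

lemma reward_integral_shift:
  assumes "x = b i"
  shows "(\<integral>\<^sup>+\<omega>. other.reward_sum \<omega> \<partial>P i) = ennreal (x' - x) + (\<integral>\<^sup>+\<omega>. reward_sum \<omega> \<partial>P i)"
proof -
  interpret prob_space "P i" by (rule prob[OF i])
  have "AE \<omega> in P i. other.reward_sum \<omega> = ennreal (x' - x) + reward_sum \<omega>"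
    using initial_phase[OF i] AE_space by eventually_elim (rule reward_sum_shift[OF assms])
  then have "(\<integral>\<^sup>+\<omega>. other.reward_sum \<omega> \<partial>P i) = (\<integral>\<^sup>+\<omega>. ennreal (x' - x) + reward_sum \<omega> \<partial>P i)"
    by (rule nn_integral_cong_AE)
  then show ?thesis by (simp add: nn_integral_add reward_sum_measurable emeasure_space_1)
qed

end
end

section \<open>Identification of the optimal barriers\<close>

context hjb_system begin

text \<open>By \<open>claim_value_deriv\<close>,
  \<open>- exp (- \<beta> * y) * claim_value (r - y)\<close> is an antiderivative of the claim
  density times the mixed value at \<open>r - y\<close>; at \<open>y = r\<close> it
  vanishes.\<close>

lemma claim_value_integral:
  assumes r: "0 \<le> r"
  shows "(\<integral>\<^sup>+ y. ennreal (exponential_density \<beta> y) *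
     (if y \<le> r then ennreal (\<Sum>j\<in>{1..n}. \<pi> j * opt_value j (max 0 (r - y))) else 0) \<partial>lborel) = ennreal (claim_value r)"
proof -
  let ?m = "\<lambda>x. mix (\<lambda>j. opt_value j x)"
  let ?g = "\<lambda>y. \<beta> * exp (- \<beta> * y) * ?m (max 0 (r - y))"
  have m_nonneg: "0 \<le> ?m x" if "0 \<le> x" for x
    using that by (intro mix_ge value_nonneg)
  have "((\<lambda>y. - exp (- \<beta> * y) * claim_value (r - y)) has_real_derivative ?g y) (at y within {0..r})"
    if y: "y \<in> {0..r}" for y
  proof -
    have "(claim_value has_real_derivative \<beta> * (?m (r - y) - claim_value (r - y))) (at (r - y) within (\<lambda>y. r - y) ` {0..r})"
      by (rule DERIV_subset[OF claim_value_deriv]) (use y in auto)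
    then have "((claim_value \<circ> (\<lambda>y. r - y)) has_real_derivative \<beta> * (?m (r - y) - claim_value (r - y)) * (0 - 1)) (at y within {0..r})"
      by (rule DERIV_image_chain) (auto intro!: derivative_eq_intros)
    then have "((\<lambda>y. claim_value (r - y)) has_real_derivative - (\<beta> * (?m (r - y) - claim_value (r - y)))) (at y within {0..r})"
      by (simp add: o_def)
    moreover have "((\<lambda>y. - exp (- \<beta> * y)) has_real_derivative \<beta> * exp (- \<beta> * y)) (at y within {0..r})"
      by (auto intro!: derivative_eq_intros)
    ultimately have "((\<lambda>y. - exp (- \<beta> * y) * claim_value (r - y)) has_real_derivative
       \<beta> * exp (- \<beta> * y) * claim_value (r - y) + - (\<beta> * (?m (r - y) - claim_value (r - y))) * - exp (- \<beta> * y)) (at y within {0..r})"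
      by (intro DERIV_mult)
    then show ?thesis using y by (simp add: max_absorb2 algebra_simps)
  qed
  then have "(?g has_integral (- exp (- \<beta> * r) * claim_value (r - r) - - exp (- \<beta> * 0) * claim_value (r - 0))) {0..r}"
    by (intro fundamental_theorem_of_calculus[OF r]) (simp add: has_real_derivative_iff_has_vector_derivative)
  then have "(?g has_integral claim_value r) {0..r}" by (simp add: claim_value_0)
  then have I: "((\<lambda>y. if y \<in> {0..r} then ?g y else 0) has_integral claim_value r) UNIV"
    by (simp only: has_integral_restrict_UNIV)
  have "(\<lambda>y. ?m (max 0 (r - y))) \<in> borel_measurable borel"
  proof (rule borel_measurable_continuous_onI)
    have "continuous_on {0..} ?m" by (rule half_line_continuous[OF mix_value_deriv])
    then show "continuous_on UNIV (\<lambda>y. ?m (max 0 (r - y)))"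
      by (rule continuous_on_compose2) (auto intro!: continuous_intros)
  qed
  note [measurable] = this
  have "(\<integral>\<^sup>+ y. ennreal (if y \<in> {0..r} then ?g y else 0) \<partial>lborel) = ennreal (claim_value r)"
    by (rule nn_integral_has_integral_lborel[OF _ _ I]) (use m_nonneg \<beta>_pos in auto)
  moreover have "ennreal (exponential_density \<beta> y) *
     (if y \<le> r then ennreal (\<Sum>j\<in>{1..n}. \<pi> j * opt_value j (max 0 (r - y))) else 0) = ennreal (if y \<in> {0..r} then ?g y else 0)" for y
    using \<beta>_pos by (auto simp: exponential_density_def mix_def ac_simps simp flip: ennreal_mult')
  ultimately show ?thesis by simp
qed

lemma claim_value_growth: "0 \<le> x \<Longrightarrow> claim_value x \<le> max 1 (\<beta> * mix alim) * (1 + x)"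
proof -
  assume x: "0 \<le> x"
  let ?M = "max 1 (\<beta> * mix alim)"
  have "?M * 0 - claim_value 0 \<le> ?M * x - claim_value x"
  proof (rule half_line_mono[OF _ order_refl x])
    show "((\<lambda>x. ?M * x - claim_value x) has_real_derivative
       ?M - claim_average \<beta> (\<beta> * mix alim) (\<lambda>x. mix (\<lambda>j. vlim j x)) y) (at y within {0..})" if "0 \<le> y" for y
      by (rule derivative_eq_intros claim_value_deriv'[OF that] | simp)+
    show "0 \<le> ?M - claim_average \<beta> (\<beta> * mix alim) (\<lambda>x. mix (\<lambda>j. vlim j x)) y" if "0 < y" for y
      using order_trans[OF true_claim_slope(1) claim_slope_bounds(2)[OF lim_admissible]] that
      by (simp del: max.bounded_iff)
  qed
  then show ?thesis using claim_value_0 by (simp add: distrib_left del: max.bounded_iff)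
qed

lemma claim_value_extension_continuous: "continuous_on UNIV (\<lambda>x. claim_value (max 0 x))"
proof -
  have "continuous_on {0..} claim_value" by (rule half_line_continuous[OF claim_value_deriv])
  then show ?thesis by (rule continuous_on_compose2) (auto intro!: continuous_intros)
qed

text \<open>\<open>cycle\<close> asks for a payoff that is continuous on the whole line, hence the
  extension by \<open>max 0\<close>.\<close>

lemma claim_cycle:
  "(\<And>i. i \<in> {1..n} \<Longrightarrow> 0 \<le> b i) \<Longrightarrow> cycle n c 1 \<delta> b (\<lambda>x. claim_value (max 0 x)) (max 1 (\<beta> * mix alim))"
  by unfold_locales
     (use c_pos \<delta>_pos claim_value_nonneg claim_value_extension_continuous claim_value_growth in \<open>auto simp: max_absorb2\<close>)

lemma generator_extension:
  "0 \<le> x \<Longrightarrow> generator n c d lam \<phi> \<phi>' (\<lambda>x. claim_value (max 0 x)) j x = generator n c d lam \<phi> \<phi>' claim_value j x"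
  by (simp add: generator_def max_absorb2)

text \<open>Slopes of at least one make a lump payment neutral at best; it is neutral above the
  level, where the slope is one.\<close>

lemma value_lump:
  assumes j: "j \<in> {1..n}" and r: "0 \<le> r" and b: "0 \<le> b"
  shows "max 0 (r - b) + opt_value j (min r b) \<le> opt_value j r"
    and "opt_level j \<le> b \<Longrightarrow> opt_value j r = max 0 (r - b) + opt_value j (min r b)"
proof -
  have deriv: "((\<lambda>x. opt_value j x - x) has_real_derivative vlim j x - 1) (at x within {0..})" if "0 \<le> x" for x
    by (rule derivative_eq_intros val_deriv[OF lim_admissible j that] | simp)+
  have slack: "0 \<le> vlim j x - 1" if "0 \<le> x" for x using adm_ge1[OF lim_admissible j that] by simp
  show "max 0 (r - b) + opt_value j (min r b) \<le> opt_value j r"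
  proof (cases "b \<le> r")
    case True
    have "opt_value j b - b \<le> opt_value j r - r"
      by (rule half_line_mono[OF deriv b True]) (use slack b in auto)
    then show ?thesis using True by simp
  qed simp
  show "opt_value j r = max 0 (r - b) + opt_value j (min r b)" if "opt_level j \<le> b"
  proof (cases "b \<le> r")
    case True
    have "opt_value j b - b \<le> opt_value j r - r"
      by (rule half_line_mono[OF deriv b True]) (use slack b in auto)
    moreover have "opt_value j r - r \<le> opt_value j b - b"
      by (rule half_line_antimono[OF deriv b True]) (use vlim_above[OF j] that in auto)
    ultimately show ?thesis using True by simp
  qed simp
qed

end

section \<open>Strategy values compared with the solution of the system\<close>

locale barrier_model = phase_type_risk_model n c \<beta> \<pi> lam P Z Y
  for n c \<beta> \<pi> lam and P :: "nat \<Rightarrow> 'a measure" and Z Y +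
  fixes \<delta> :: real and D :: "(nat \<Rightarrow> real) \<Rightarrow> real \<Rightarrow> real \<Rightarrow> 'a \<Rightarrow> real"
  assumes \<delta>_pos: "0 < \<delta>"
    and dividends: "\<And>b x l. b \<in> barrier_vectors n \<Longrightarrow> x \<ge> 0 \<Longrightarrow> l \<in> {1..n} \<Longrightarrow>
      AE \<omega> in P l. follows_phasewise_barriers b
        (\<lambda>t. phase n Z t \<omega>) (\<lambda>t. free_surplus n c Z Y x t \<omega>) (\<lambda>t. D b x t \<omega>)"
begin

sublocale hjb: hjb_system n c \<beta> \<delta> \<pi> lam
  by unfold_locales (use premium claim_parameter \<delta>_pos initial_nonneg initial_sum intensity_nonneg in auto)

abbreviation "strategy_value \<equiv> barrier_value n c \<delta> P Z Y D"
abbreviation "expected_reward b i x \<equiv> integral\<^sup>N (P i) (barrier_problem.reward_sum n c Z Y \<delta> b x)"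

lemma barrier_nonneg: "b \<in> barrier_vectors n \<Longrightarrow> i \<in> {1..n} \<Longrightarrow> 0 \<le> b i"
  by (auto simp: barrier_vectors_def)

lemma problem: "b \<in> barrier_vectors n \<Longrightarrow> 0 \<le> x \<Longrightarrow> barrier_problem n c \<beta> \<pi> lam P Z Y \<delta> b x"
  by unfold_locales (use \<delta>_pos barrier_nonneg in auto)

lemma strategy_value_eq:
  assumes "b \<in> barrier_vectors n" "0 \<le> x" "i \<in> {1..n}"
  shows "strategy_value b i x = enn2real (expected_reward b i x)"
  by (rule barrier_problem.value_eq_integral[where D = D, OF problem[OF assms(1,2)] assms(3) dividends[OF assms]])

context
  fixes b assumes b: "b \<in> barrier_vectors n"
begin

text \<open>The payoff at claims stays the optimal \<open>claim_value\<close> even if the candidate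
  is smaller; \<open>\<phi> \<le> opt_value\<close> then supplies the claim inequality. This admits
  candidates that deviate from the solution in one phase.\<close>

lemma expected_reward_le:
  assumes \<phi>: "\<And>j x. j \<in> {1..n} \<Longrightarrow> 0 \<le> x \<Longrightarrow> (\<phi> j has_real_derivative \<phi>' j x) (at x within {0..})"
      "\<And>j. j \<in> {1..n} \<Longrightarrow> continuous_on {0..} (\<phi>' j)"
      "\<And>j r. j \<in> {1..n} \<Longrightarrow> 0 \<le> r \<Longrightarrow> 0 \<le> \<phi> j r"
    and le: "\<And>j r. j \<in> {1..n} \<Longrightarrow> 0 \<le> r \<Longrightarrow> \<phi> j r \<le> hjb.opt_value j r"
    and lump: "\<And>j r. j \<in> {1..n} \<Longrightarrow> 0 \<le> r \<Longrightarrow> max 0 (r - b j) + \<phi> j (min r (b j)) \<le> \<phi> j r"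
    and gen: "\<And>j x. j \<in> {1..n} \<Longrightarrow> 0 \<le> x \<Longrightarrow> x \<le> b j \<Longrightarrow> generator n c \<delta> lam \<phi> \<phi>' hjb.claim_value j x \<le> 0"
    and i: "i \<in> {1..n}" and x: "0 \<le> x"
  shows "expected_reward b i x \<le> ennreal (\<phi> i x)"
proof -
  interpret barrier_problem n c \<beta> \<pi> lam P Z Y \<delta> b x by (rule problem[OF b x])
  note cyc = hjb.claim_cycle[of b, OF barrier_nonneg[OF b]]
  show ?thesis
  proof (rule supersolution_bound[OF i cyc \<phi> lump])
    show "generator n c \<delta> lam \<phi> \<phi>' (\<lambda>x. hjb.claim_value (max 0 x)) j r \<le> 0" if "j \<in> {1..n}" "0 \<le> r" "r \<le> b j" for j r
      using gen[OF that] by (simp only: hjb.generator_extension[OF that(2)])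
    fix r :: real assume r: "0 \<le> r"
    have eq: "claim_integral \<phi> r = (\<integral>\<^sup>+ y. ennreal (exponential_density \<beta> y) *
       (if y \<le> r then ennreal (\<Sum>j\<in>{1..n}. \<pi> j * \<phi> j (max 0 (r - y))) else 0) \<partial>lborel)"
      by (rule claim_integral_def[OF i cyc \<phi>])
    have "claim_integral \<phi> r \<le> (\<integral>\<^sup>+ y. ennreal (exponential_density \<beta> y) *
       (if y \<le> r then ennreal (\<Sum>j\<in>{1..n}. \<pi> j * hjb.opt_value j (max 0 (r - y))) else 0) \<partial>lborel)"
      unfolding eq
      by (intro nn_integral_mono mult_left_mono) (auto intro!: ennreal_leI sum_mono mult_left_mono le initial_nonneg)
    also have "\<dots> = ennreal (hjb.claim_value (max 0 r))" using r by (simp add: hjb.claim_value_integral max_absorb2)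
    finally show "claim_integral \<phi> r \<le> ennreal (hjb.claim_value (max 0 r))" .
  qed
qed

lemma expected_reward_le_opt:
  assumes i: "i \<in> {1..n}" and x: "0 \<le> x"
  shows "expected_reward b i x \<le> ennreal (hjb.opt_value i x)"
  by (rule expected_reward_le[where \<phi>' = hjb.vlim])
     (use i x hjb.val_deriv[OF hjb.lim_admissible] hjb.vlim_cont hjb.value_nonneg hjb.value_lump(1)
       hjb.value_generator_le barrier_nonneg[OF b] in auto)

text \<open>The expectation is finite because it is bounded by the solution, so
  \<open>enn2real\<close> loses nothing.\<close>

lemma strategy_value_ennreal:
  assumes i: "i \<in> {1..n}" and x: "0 \<le> x"
  shows "ennreal (strategy_value b i x) = expected_reward b i x"
  using le_less_trans[OF expected_reward_le_opt[OF i x] ennreal_less_top]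
  by (simp add: strategy_value_eq[OF b x i])

lemma strategy_value_nonneg: "0 \<le> strategy_value b i x"
  by (simp add: barrier_value_def)

lemma strategy_value_le:
  "i \<in> {1..n} \<Longrightarrow> 0 \<le> x \<Longrightarrow> 0 \<le> k \<Longrightarrow> expected_reward b i x \<le> ennreal k \<Longrightarrow> strategy_value b i x \<le> k"
  by (simp flip: strategy_value_ennreal)

lemma strategy_value_le_opt: "i \<in> {1..n} \<Longrightarrow> 0 \<le> x \<Longrightarrow> strategy_value b i x \<le> hjb.opt_value i x"
  by (intro strategy_value_le expected_reward_le_opt hjb.value_nonneg)

lemma strategy_value_mono:
  assumes i: "i \<in> {1..n}" and x: "0 \<le> x" "x \<le> y"
  shows "strategy_value b i x \<le> strategy_value b i y"
proof -
  interpret barrier_problem n c \<beta> \<pi> lam P Z Y \<delta> b x by (rule problem[OF b x(1)])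
  have "ennreal (strategy_value b i x) \<le> ennreal (strategy_value b i y)"
    using reward_integral_mono[OF i x(2)] x i by (simp add: strategy_value_ennreal)
  then show ?thesis by (simp add: strategy_value_nonneg)
qed

lemma strategy_value_above:
  assumes i: "i \<in> {1..n}" and y: "b i \<le> y"
  shows "strategy_value b i y = y - b i + strategy_value b i (b i)"
proof -
  note b0 = barrier_nonneg[OF b i]
  interpret barrier_problem n c \<beta> \<pi> lam P Z Y \<delta> b "b i" by (rule problem[OF b b0])
  have "ennreal (strategy_value b i y) = ennreal (y - b i) + ennreal (strategy_value b i (b i))"
    using reward_integral_shift[OF i y refl] y b0 i by (simp add: strategy_value_ennreal)
  also have "\<dots> = ennreal (y - b i + strategy_value b i (b i))"
    using y by (simp add: ennreal_plus strategy_value_nonneg)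
  finally show ?thesis using y strategy_value_nonneg by (subst (asm) ennreal_inj) (auto intro: add_nonneg_nonneg)
qed

end

definition opt_barrier :: "nat \<Rightarrow> real" where "opt_barrier = restrict hjb.opt_level {1..n}"

lemma opt_barrier: "opt_barrier \<in> barrier_vectors n" and opt_barrier_eq: "j \<in> {1..n} \<Longrightarrow> opt_barrier j = hjb.opt_level j"
  using hjb.opt_level_nonneg by (auto simp: opt_barrier_def barrier_vectors_def)

text \<open>With barriers at the levels every inequality is an equality: the generator vanishes up
  to the barrier, lump payments above it are neutral, and the claim integral is exact.\<close>

lemma strategy_value_opt_barrier:
  assumes i: "i \<in> {1..n}" and x: "0 \<le> x"
  shows "strategy_value opt_barrier i x = hjb.opt_value i x"
proof (rule antisym[OF strategy_value_le_opt[OF opt_barrier i x]])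
  interpret barrier_problem n c \<beta> \<pi> lam P Z Y \<delta> opt_barrier x by (rule problem[OF opt_barrier x])
  note cyc = hjb.claim_cycle[of opt_barrier, OF barrier_nonneg[OF opt_barrier]]
  note val = hjb.val_deriv[OF hjb.lim_admissible] hjb.vlim_cont hjb.value_nonneg
  have "ennreal (hjb.opt_value i x) \<le> expected_reward opt_barrier i x"
  proof (rule subsolution_bound[OF i cyc val, where K = "c / \<delta>"])
    fix j and r :: real assume j: "j \<in> {1..n}" and r: "0 \<le> r"
    show "hjb.opt_value j r \<le> max 0 (r - opt_barrier j) + hjb.opt_value j (min r (opt_barrier j))"
      using hjb.value_lump(2)[OF j r hjb.opt_level_nonneg[OF j] order_refl] by (simp add: opt_barrier_eq[OF j])
    show "0 \<le> generator n c \<delta> lam hjb.opt_value hjb.vlim (\<lambda>x. hjb.claim_value (max 0 x)) j r" if "r \<le> opt_barrier j"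
      using hjb.value_generator(1)[OF j r] that by (simp add: hjb.generator_extension[OF r] opt_barrier_eq[OF j])
    show "hjb.opt_value j r \<le> c / \<delta> + r" using hjb.adm_val[OF hjb.lim_admissible j r] by simp
  next
    fix r :: real assume r: "0 \<le> r"
    have "claim_integral hjb.opt_value r = (\<integral>\<^sup>+ y. ennreal (exponential_density \<beta> y) *
       (if y \<le> r then ennreal (\<Sum>j\<in>{1..n}. \<pi> j * hjb.opt_value j (max 0 (r - y))) else 0) \<partial>lborel)"
      by (rule claim_integral_def[OF i cyc val])
    then show "ennreal (hjb.claim_value (max 0 r)) \<le> claim_integral hjb.opt_value r"
      using r by (simp add: hjb.claim_value_integral max_absorb2)
  qed
  then have "ennreal (hjb.opt_value i x) \<le> ennreal (strategy_value opt_barrier i x)"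
    by (simp add: strategy_value_ennreal[OF opt_barrier i x])
  then show "hjb.opt_value i x \<le> strategy_value opt_barrier i x"
    by (simp add: strategy_value_nonneg[OF opt_barrier])
qed

section \<open>Recovering a given vector of optimal barriers\<close>

context
  fixes bs i assumes bs: "optimal_phasewise_barriers n strategy_value bs" and i: "i \<in> {1..n}"
begin

lemma bs_barrier: "bs \<in> barrier_vectors n" using bs by (simp add: optimal_phasewise_barriers_def)

lemma bs_nonneg: "0 \<le> bs i" by (rule barrier_nonneg[OF bs_barrier i])

text \<open>The supremum of reals is meaningful because the solution bounds every strategy value,
  and the barriers at the levels attain this bound.\<close>

lemma value_below_barrier:
  assumes x: "0 \<le> x" "x < bs i" shows "strategy_value bs i x = hjb.opt_value i x"
proof -
  have "strategy_value bs i x = (SUP b\<in>barrier_vectors n. strategy_value b i x)"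
    using bs i x by (simp add: optimal_phasewise_barriers_def)
  moreover have "strategy_value opt_barrier i x \<le> (SUP b\<in>barrier_vectors n. strategy_value b i x)"
    by (rule cSUP_upper[OF opt_barrier]) (rule bdd_aboveI2[OF strategy_value_le_opt[OF _ i x(1)]])
  ultimately show ?thesis
    using strategy_value_opt_barrier[OF i x(1)] strategy_value_le_opt[OF bs_barrier i x(1)] by simp
qed

lemma opt_value_tendsto: "0 < bs i \<Longrightarrow> (hjb.opt_value i \<longlongrightarrow> hjb.opt_value i (bs i)) (at_left (bs i))"
proof -
  assume "0 < bs i"
  have "isCont (hjb.opt_value i) (bs i)"
    using half_line_continuous[OF hjb.val_deriv[OF hjb.lim_admissible i]] \<open>0 < bs i\<close>
    by (simp add: continuous_on_interior)
  then show ?thesis unfolding isCont_def by (rule filterlim_mono) (simp_all add: at_le)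
qed

lemma eventually_below: "0 < bs i \<Longrightarrow> \<forall>\<^sub>F x in at_left (bs i). 0 \<le> x \<and> x < bs i"
  using eventually_at_left_real[of 0 "bs i"] by (auto elim: eventually_mono)

text \<open>Optimality says nothing at the barrier itself. Values below it equal the continuous
  solution, and the strategy value is nondecreasing in the capital, which leaves no room for a
  drop.\<close>

lemma value_at_barrier: "0 < bs i \<Longrightarrow> strategy_value bs i (bs i) = hjb.opt_value i (bs i)"
proof (rule antisym[OF strategy_value_le_opt[OF bs_barrier i bs_nonneg]])
  assume pos: "0 < bs i"
  show "hjb.opt_value i (bs i) \<le> strategy_value bs i (bs i)"
  proof (rule tendsto_upperbound[OF opt_value_tendsto[OF pos]])
    show "\<forall>\<^sub>F x in at_left (bs i). hjb.opt_value i x \<le> strategy_value bs i (bs i)"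
      using eventually_below[OF pos]
    proof eventually_elim
      case (elim x)
      then show ?case using value_below_barrier[of x] strategy_value_mono[OF bs_barrier i, of x "bs i"] by simp
    qed
  qed simp
qed

text \<open>With a barrier away from the level the supersolution would bound the strategy value
  strictly below the solution at \<open>bs i\<close>, against \<open>value_at_barrier\<close>. The
  barriers of the other phases may be arbitrary.\<close>

lemma barrier_eq_opt_level:
  assumes pos: "0 < bs i" shows "bs i = hjb.opt_level i"
proof (rule ccontr)
  assume ne: "bs i \<noteq> hjb.opt_level i"
  obtain f f' where f: "\<And>x. 0 \<le> x \<Longrightarrow> (f has_real_derivative f' x) (at x within {0..})" "continuous_on {0..} f'"
    "\<And>x. 0 \<le> x \<Longrightarrow> 0 \<le> f x" "\<And>x. 0 \<le> x \<Longrightarrow> f x \<le> hjb.opt_value i x" "f (bs i) < hjb.opt_value i (bs i)"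
    "\<And>x. bs i \<le> x \<Longrightarrow> f x = x - bs i + f (bs i)"
    "\<And>x. 0 \<le> x \<Longrightarrow> x \<le> bs i \<Longrightarrow>
       generator n c \<delta> lam (hjb.opt_value(i := f)) (hjb.vlim(i := f')) hjb.claim_value i x = 0"
    by (rule hjb.wrong_barrier_supersolution[OF i pos ne]) blast
  let ?\<phi> = "hjb.opt_value(i := f)" and ?\<phi>' = "hjb.vlim(i := f')"
  have gen: "generator n c \<delta> lam ?\<phi> ?\<phi>' hjb.claim_value j x \<le> 0" if j: "j \<in> {1..n}" and x: "0 \<le> x" "x \<le> bs j" for j x
  proof (cases "j = i")
    case False
    \<comment> \<open>Lowering the candidate in phase \<open>i\<close> can only lower the generators
      of the other phases, whose own candidates are unchanged.\<close>
    have "(\<Sum>l\<in>{1..n} - {j}. lam j l * (?\<phi> l x - ?\<phi> j x)) \<le> (\<Sum>l\<in>{1..n} - {j}. lam j l * (hjb.opt_value l x - hjb.opt_value j x))"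
      using False f(4)[OF x(1)] j by (intro sum_mono mult_left_mono intensity_nonneg) auto
    then have "generator n c \<delta> lam ?\<phi> ?\<phi>' hjb.claim_value j x \<le> generator n c \<delta> lam hjb.opt_value hjb.vlim hjb.claim_value j x"
      using False by (simp add: generator_def)
    also have "\<dots> \<le> 0" by (rule hjb.value_generator_le[OF j x(1)])
    finally show ?thesis .
  qed (use f(7) x in simp)
  have le_f: "strategy_value bs i x \<le> f x" if x: "0 \<le> x" for x
  proof -
    have "expected_reward bs i x \<le> ennreal (?\<phi> i x)"
    proof (rule expected_reward_le[OF bs_barrier _ _ _ _ _ gen i x])
      fix j and r :: real assume j: "j \<in> {1..n}"
      show "continuous_on {0..} (?\<phi>' j)" using f(2) hjb.vlim_cont[OF j] by simp
      assume r: "0 \<le> r"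
      show "(?\<phi> j has_real_derivative ?\<phi>' j r) (at r within {0..})"
        using f(1)[OF r] hjb.val_deriv[OF hjb.lim_admissible j r] by simp
      show "0 \<le> ?\<phi> j r" using f(3)[OF r] hjb.value_nonneg[OF j r] by simp
      show "?\<phi> j r \<le> hjb.opt_value j r" using f(4)[OF r] by simp
      show "max 0 (r - bs j) + ?\<phi> j (min r (bs j)) \<le> ?\<phi> j r"
        using f(6)[of r] hjb.value_lump(1)[OF j r barrier_nonneg[OF bs_barrier j]] by (auto simp: min_def max_def)
    qed auto
    then show ?thesis using strategy_value_le[OF bs_barrier i x f(3)[OF x]] by simp
  qed
  show False using le_f[OF bs_nonneg] value_at_barrier[OF pos] f(5) by simp
qed

text \<open>Above the barrier, which is the level, both functions continue with slope one from a
  common value.\<close>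

lemma value_eq_opt_value:
  assumes pos: "0 < bs i" and x: "0 \<le> x"
  shows "strategy_value bs i x = hjb.opt_value i x"
proof (cases "x < bs i")
  case False
  then show ?thesis
    using strategy_value_above[OF bs_barrier i, of x] value_at_barrier[OF pos]
      hjb.value_lump(2)[OF i x bs_nonneg] barrier_eq_opt_level[OF pos] by simp
qed (rule value_below_barrier[OF x])

lemma slope_below_barrier:
  assumes x: "0 < x" "x < bs i"
  shows "\<exists>d>1. (strategy_value bs i has_real_derivative d) (at x)"
proof (intro exI conjI)
  have pos: "0 < bs i" using x by simp
  show "1 < hjb.vlim i x" using hjb.vlim_below[OF i] x barrier_eq_opt_level[OF pos] by simp
  have d: "(hjb.opt_value i has_real_derivative hjb.vlim i x) (at x within {0..})"
    using x by (intro hjb.val_deriv[OF hjb.lim_admissible i]) simp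
  have "(strategy_value bs i has_real_derivative hjb.vlim i x) (at x within {0..})"
    by (rule has_field_derivative_transform_within[OF d zero_less_one])
       (use x value_eq_opt_value[OF pos] in auto)
  moreover have "at x within {0..} = at x"
    by (rule at_within_open_subset[of x "{0<..}"]) (use x in auto)
  ultimately show "(strategy_value bs i has_real_derivative hjb.vlim i x) (at x)" by simp
qed

lemma curvature_at_barrier: "has_second_derivative_within (strategy_value bs i) 0 (bs i) {0..}"
proof (cases "bs i = 0")
  case True
  have d: "(strategy_value bs i has_real_derivative 1) (at x within {0..})" if x: "0 \<le> x" for x
  proof -
    have d: "((\<lambda>x. x - bs i + strategy_value bs i (bs i)) has_real_derivative 1) (at x within {0..})"
      by (rule derivative_eq_intros | simp)+
    show ?thesis
    proof (rule has_field_derivative_transform_within[OF d zero_less_one])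
      show "y - bs i + strategy_value bs i (bs i) = strategy_value bs i y" if "y \<in> {0..}" for y
        by (rule strategy_value_above[OF bs_barrier i, symmetric]) (use True that in simp)
    qed (use x in simp)
  qed
  show ?thesis
    unfolding has_second_derivative_within_def
    by (rule exI[of _ "\<lambda>_. 1"], intro conjI always_eventually allI impI d DERIV_const) simp
next
  case False
  then have pos: "0 < bs i" using bs_nonneg by simp
  have d: "(strategy_value bs i has_real_derivative hjb.vlim i x) (at x within {0..})" if x: "0 \<le> x" for x
    by (rule has_field_derivative_transform_within[OF hjb.val_deriv[OF hjb.lim_admissible i x] zero_less_one])
       (use x value_eq_opt_value[OF pos] in auto)
  have d2: "(hjb.vlim i has_real_derivative 0) (at (bs i) within {0..})"
    using hjb.vlim_deriv_opt_level[OF i] barrier_eq_opt_level[OF pos] by simp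
  show ?thesis
    unfolding has_second_derivative_within_def
    by (rule exI[of _ "hjb.vlim i"], intro conjI always_eventually allI impI d d2) simp
qed

end
end

theorem mainTheorem1:
  fixes n :: nat and c \<beta> \<delta> :: real and \<pi> :: "nat \<Rightarrow> real" and lam :: "nat \<Rightarrow> nat \<Rightarrow> real"
    and P :: "nat \<Rightarrow> 'a measure"
    and Z :: "nat \<Rightarrow> real \<Rightarrow> 'a \<Rightarrow> nat"
    and Y :: "nat \<Rightarrow> 'a \<Rightarrow> real"
    and D :: "(nat \<Rightarrow> real) \<Rightarrow> real \<Rightarrow> real \<Rightarrow> 'a \<Rightarrow> real"
    and bs :: "nat \<Rightarrow> real" and i :: nat
  assumes "n \<ge> 2"
    and "phase_type_risk_model n c \<beta> \<pi> lam P Z Y"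
    and "\<delta> > 0"
    and "\<And>b x l. b \<in> barrier_vectors n \<Longrightarrow> x \<ge> 0 \<Longrightarrow> l \<in> {1..n} \<Longrightarrow>
      AE \<omega> in P l. follows_phasewise_barriers b
        (\<lambda>t. phase n Z t \<omega>) (\<lambda>t. free_surplus n c Z Y x t \<omega>) (\<lambda>t. D b x t \<omega>)"
    and "optimal_phasewise_barriers n (barrier_value n c \<delta> P Z Y D) bs"
    and "i \<in> {1..n}"
  shows "(\<forall>x\<in>{0<..<bs i}. \<exists>d>1. (barrier_value n c \<delta> P Z Y D bs i has_real_derivative d) (at x))
    \<and> has_second_derivative_within (barrier_value n c \<delta> P Z Y D bs i) 0 (bs i) {0..}"
proof -
  interpret phase_type_risk_model n c \<beta> \<pi> lam P Z Y by (rule assms(2))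
  interpret barrier_model n c \<beta> \<pi> lam P Z Y \<delta> D by unfold_locales (use assms(3,4) in auto)
  show ?thesis using slope_below_barrier[OF assms(5,6)] curvature_at_barrier[OF assms(5,6)] by auto
qed

end
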